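(* For every integer $n\ge 2$ and every real $K\ge 1$ there exists a finite number $q_0=q_0(n,K)$, depending only on $n$ and $K$, such that every $K$-quasiregular map $f\colon \mathbb{R}^n\to \mathbb{S}^n$ omits at most $q_0$ points of $\mathbb{S}^n$, i.e., the set $\mathbb{S}^n\setminus f(\mathbb{R}^n)$ has at most $q_0$ elements.
   Context: $\mathbb{R}^n$ is Euclidean $n$-space and $\mathbb{S}^n$ is the unit sphere in $\mathbb{R}^{n+1}$ equipped with the induced Riemannian metric; both are oriented. A map $f\colon M\to N$ between connected oriented Riemannian $n$-manifolds ($n\ge 2$) is called $K$-quasiregular, $K\ge 1$, if $f$ has distributional first-order derivatives that are locally $L^n$-integrable (i.e. $f\in W^{1,n}_{loc}$) and the formal differential $Df(p)\colon T_pM\to T_{f(p)}N$ satisfies $\|Df(p)\|^n\le K\det(Df(p))$ for almost every $p\in M$, where $\|Df(p)\|$ is the operator norm with respect to the norms on the tangent spaces induced by the Riemannian structures, and $\det$ is taken with respect to the Riemannian structures and orientations. By convention, quasiregular maps are always assumed to be continuous and non-constant. *)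

theory Defs
  imports "HOL-Analysis.Analysis" "HOL-Combinatorics.Permutations"
begin

section \<open>Test functions and weak derivatives on Euclidean space\<close>

definition partial_deriv :: "'n::finite \<Rightarrow> (real^'n \<Rightarrow> real) \<Rightarrow> real^'n \<Rightarrow> real" where
  "partial_deriv j \<phi> x = frechet_derivative \<phi> (at x) (axis j 1)"

fun times_cont_diff :: "nat \<Rightarrow> (real^'n::finite \<Rightarrow> real) \<Rightarrow> bool" where
  "times_cont_diff 0 \<phi> \<longleftrightarrow> continuous_on UNIV \<phi>"
| "times_cont_diff (Suc k) \<phi> \<longleftrightarrow>
     \<phi> differentiable_on UNIV \<and> (\<forall>j. times_cont_diff k (partial_deriv j \<phi>))"

definition test_function :: "(real^'n::finite \<Rightarrow> real) \<Rightarrow> bool" where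
  "test_function \<phi> \<longleftrightarrow>
     (\<forall>k. times_cont_diff k \<phi>) \<and> compact (closure {x. \<phi> x \<noteq> 0})"

definition loc_Lp :: "nat \<Rightarrow> (real^'n::finite \<Rightarrow> real) \<Rightarrow> bool" where
  "loc_Lp p u \<longleftrightarrow>
     u \<in> borel_measurable lebesgue \<and>
     (\<forall>C. compact C \<longrightarrow> set_integrable lebesgue C (\<lambda>x. \<bar>u x\<bar> ^ p))"

text \<open>Only meaningful for locally integrable \<open>u\<close> and \<open>g\<close>, since a Bochner integral
  that does not exist is \<open>0\<close>; below it is used together with \<^const>\<open>loc_Lp\<close>.\<close>

definition has_weak_partial ::
  "'n::finite \<Rightarrow> (real^'n \<Rightarrow> real) \<Rightarrow> (real^'n \<Rightarrow> real) \<Rightarrow> bool" where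
  "has_weak_partial j u g \<longleftrightarrow>
     (\<forall>\<phi>. test_function \<phi> \<longrightarrow>
        (LINT x|lebesgue. u x * partial_deriv j \<phi> x) = - (LINT x|lebesgue. g x * \<phi> x))"

text \<open>\<open>has_W1p_loc_differential p f Df\<close>: all components of \<open>f\<close> lie in
  \<open>W\<^sup>1\<^sup>,\<^sup>p\<close> locally, and \<open>Df x\<close> is the Jacobian matrix of weak partial derivatives
  (row = component of \<open>f\<close>, column = direction); \<open>Df\<close> is determined by \<open>f\<close> almost everywhere.\<close>

definition has_W1p_loc_differential ::
  "nat \<Rightarrow> (real^'n::finite \<Rightarrow> real^'m::finite) \<Rightarrow> (real^'n \<Rightarrow> real^'n^'m) \<Rightarrow> bool" where
  "has_W1p_loc_differential p f Df \<longleftrightarrow>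
     (\<forall>k. loc_Lp p (\<lambda>x. f x $ k)) \<and>
     (\<forall>k j. loc_Lp p (\<lambda>x. Df x $ k $ j) \<and>
            has_weak_partial j (\<lambda>x. f x $ k) (\<lambda>x. Df x $ k $ j))"


section \<open>The oriented sphere\<close>

text \<open>Euclidean \<open>(n+1)\<close>-space is \<open>real^('n option)\<close>, with \<open>None\<close> the additional coordinate
  (counted first).  The unit sphere carries the orientation given by the outward normal:
  a basis \<open>v\<close> of the tangent space at \<open>y\<close> (the orthogonal complement of \<open>y\<close>) is positive iff
  \<open>det (y, v) > 0\<close>.  As rows and columns have the same index type, these determinants do not
  depend on an ordering of \<open>'n\<close>.\<close>

definition sphere_volume_form :: "real^('n::finite option) \<Rightarrow> ('n \<Rightarrow> real^('n option)) \<Rightarrow> real" where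
  "sphere_volume_form y v = det (\<chi> a. case a of None \<Rightarrow> y | Some j \<Rightarrow> v j)"

definition positive_orthonormal_frame ::
  "real^('n::finite option) \<Rightarrow> ('n \<Rightarrow> real^('n option)) \<Rightarrow> bool" where
  "positive_orthonormal_frame y b \<longleftrightarrow>
     (\<forall>i. b i \<bullet> y = 0) \<and> (\<forall>i j. b i \<bullet> b j = (if i = j then 1 else 0)) \<and>
     sphere_volume_form y b > 0"

text \<open>The determinant of a linear map \<open>A\<close> from Euclidean \<open>n\<close>-space to the tangent space at \<open>y\<close>,
  with respect to the Riemannian structures and orientations: the factor by which \<open>A\<close> pulls
  the Riemannian volume form of the sphere back to that of Euclidean space.\<close>

definition sphere_det :: "real^('n::finite option) \<Rightarrow> real^'n^('n option) \<Rightarrow> real" where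
  "sphere_det y A = sphere_volume_form y (\<lambda>j. A *v axis j 1)"

text \<open>Equivalently, it is the determinant of the matrix of \<open>A\<close> with respect to positively
  oriented orthonormal bases.\<close>

lemma det_option_block:
  fixes M :: "real^('n::finite option)^('n option)"
  assumes 1: "M $ None $ None = 1" and 0: "\<And>i. M $ None $ Some i = 0"
  shows "det M = det (\<chi> i j. M $ Some i $ Some j)"
proof -
  let ?S = "range (Some :: 'n \<Rightarrow> 'n option)"
  let ?F = "\<lambda>p. of_int (sign p) * (\<Prod>i\<in>UNIV. M $ i $ p i)"
  have U: "(UNIV :: 'n option set) = insert None ?S" by (auto simp: UNIV_option_conv)
  have "det M = sum ?F {p. p permutes UNIV}" by (simp add: det_def)
  also have "\<dots> = sum ?F {p. p permutes ?S}"
  proof (rule sum.mono_neutral_right)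
    show "finite {p. p permutes (UNIV :: 'n option set)}" by (simp add: finite_permutations)
    show "{p. p permutes ?S} \<subseteq> {p. p permutes UNIV}"
      using permutes_subset by blast
    show "\<forall>p\<in>{p. p permutes UNIV} - {p. p permutes ?S}. ?F p = 0"
    proof
      fix p assume p: "p \<in> {p. p permutes UNIV} - {p. p permutes ?S}"
      have "p None \<noteq> None"
      proof
        assume "p None = None"
        then have "\<And>x. x \<notin> ?S \<Longrightarrow> p x = x" using U by auto
        then have "p permutes ?S" using p unfolding permutes_def by auto
        then show False using p by auto
      qed
      then have "M $ None $ p None = 0" using 0 by auto
      then have "(\<Prod>i\<in>UNIV. M $ i $ p i) = 0"
        by (intro prod_zero) auto
      then show "?F p = 0" by simp
    qed
  qed
  also have "\<dots> = (\<Sum>q\<in>{q. q permutes (UNIV :: 'n set)}.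
                     of_int (sign q) * (\<Prod>i\<in>UNIV. M $ Some i $ Some (q i)))"
  proof (rule sum.reindex_bij_witness[where
        i = "map_permutation UNIV Some" and j = "map_permutation ?S the"])
    fix p assume "p \<in> {p. p permutes ?S}"
    then have p: "p permutes ?S" by simp
    show "map_permutation UNIV Some (map_permutation ?S the p) = p"
      by (rule map_permutation_compose_inv[OF _ p]) (auto simp: bij_betw_def inj_on_def)
    show q: "map_permutation ?S the p \<in> {q. q permutes UNIV}"
      using map_permutation_permutes[OF _ p, of the UNIV]
      by (auto simp: bij_betw_def inj_on_def image_iff)
    have inj: "inj_on the ?S" by (auto simp: inj_on_def)
    have s: "sign (map_permutation ?S the p) = sign p"
      by (rule sign_map_permutation) (use inj p in auto)
    have ap: "Some (map_permutation ?S the p i) = p (Some i)" for i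
    proof -
      have "map_permutation ?S the p (the (Some i)) = the (p (Some i))"
        by (rule map_permutation_apply[OF inj]) auto
      moreover have "p (Some i) \<in> ?S" using permutes_in_image[OF p, of "Some i"] by auto
      ultimately show ?thesis by auto
    qed
    have pn: "p None = None" using p by (auto simp: permutes_def)
    have "(\<Prod>i\<in>UNIV. M $ i $ p i) = M $ None $ p None * (\<Prod>i\<in>?S. M $ i $ p i)"
      unfolding U by (subst prod.insert) auto
    also have "\<dots> = (\<Prod>i\<in>UNIV. M $ Some i $ p (Some i))"
      by (simp add: pn 1 prod.reindex o_def)
    finally show "of_int (sign (map_permutation ?S the p)) *
        (\<Prod>i\<in>UNIV. M $ Some i $ Some (map_permutation ?S the p i)) = ?F p"
      by (simp add: s ap)
  next
    fix q assume "q \<in> {q. q permutes (UNIV :: 'n set)}"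
    then have q: "q permutes (UNIV :: 'n set)" by simp
    show "map_permutation ?S the (map_permutation UNIV Some q) = q"
      by (rule map_permutation_compose_inv[OF _ q]) (auto simp: bij_betw_def)
    show "map_permutation UNIV Some q \<in> {p. p permutes ?S}"
      using map_permutation_permutes[OF _ q, of Some ?S] by (auto simp: bij_betw_def)
  qed
  also have "\<dots> = det (\<chi> i j. M $ Some i $ Some j)" by (simp add: det_def)
  finally show ?thesis .
qed

lemma sphere_det_eq_det_in_frame:
  fixes A :: "real^'n::finite^('n option)"
  assumes y: "norm y = 1" and tangent: "\<And>v. (A *v v) \<bullet> y = 0"
    and b: "positive_orthonormal_frame y b"
  shows "sphere_det y A = det (\<chi> i j. b i \<bullet> (A *v axis j 1))"
proof -
  define Q where "Q = (\<chi> a. case a of None \<Rightarrow> y | Some j \<Rightarrow> b j)"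
  define M where "M = (\<chi> a. case a of None \<Rightarrow> y | Some j \<Rightarrow> A *v axis j 1)"
  have ent: "(X ** transpose Y) $ i $ j = X $ i \<bullet> Y $ j" for X Y :: "real^('n option)^('n option)" and i j
    by (simp add: matrix_matrix_mult_def transpose_def inner_vec_def)
  have yy: "y \<bullet> y = 1" using y by (simp add: dot_square_norm)
  have yb: "y \<bullet> b i = 0" "b i \<bullet> y = 0" for i
    using b by (auto simp: positive_orthonormal_frame_def inner_commute)
  have "Q ** transpose Q = mat 1"
    using b by (simp add: vec_eq_iff ent mat_def Q_def yy yb positive_orthonormal_frame_def
        split: option.splits)
  then have "orthogonal_matrix Q"
    by (metis matrix_left_right_inverse orthogonal_matrix_def)
  moreover have "det Q > 0"
    using b by (simp add: positive_orthonormal_frame_def sphere_volume_form_def Q_def)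
  ultimately have dQ: "det Q = 1" using det_orthogonal_matrix[of Q] by auto
  have "sphere_det y A = det (M ** transpose Q)"
    by (simp add: det_mul dQ sphere_det_def sphere_volume_form_def M_def)
  also have "\<dots> = det (\<chi> i j. (M ** transpose Q) $ Some i $ Some j)"
    by (rule det_option_block) (auto simp: ent M_def Q_def yy yb)
  also have "(\<chi> i j. (M ** transpose Q) $ Some i $ Some j)
               = transpose (\<chi> i j. b i \<bullet> (A *v axis j 1))"
    unfolding vec_eq_iff ent by (simp add: transpose_def M_def Q_def inner_commute)
  also have "det \<dots> = det (\<chi> i j. b i \<bullet> (A *v axis j 1))" by (rule det_transpose)
  finally show ?thesis .
qed


section \<open>Quasiregular maps into the sphere\<close>

text \<open>Since \<open>f\<close> takes values in the unit sphere, \<open>Df x\<close> maps into the tangent space at \<open>f x\<close>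
  for almost every \<open>x\<close>; the norm of that space is the restricted Euclidean one, so the
  operator norm can be taken in the ambient space.\<close>

definition quasiregular_to_sphere ::
  "real \<Rightarrow> (real^'n::finite \<Rightarrow> real^('n option)) \<Rightarrow> bool" where
  "quasiregular_to_sphere K f \<longleftrightarrow>
     range f \<subseteq> sphere 0 1 \<and> continuous_on UNIV f \<and> \<not> f constant_on UNIV \<and>
     (\<exists>Df. has_W1p_loc_differential CARD('n) f Df \<and>
           (AE x in lebesgue.
              onorm ((*v) (Df x)) ^ CARD('n) \<le> K * sphere_det (f x) (Df x)))"

end

theory Submission
  imports Defs "HOL-Computational_Algebra.Polynomial"
begin

text \<open>
  Let \<open>f\<close> be quasiregular with Jacobian \<open>J\<close>.  Project stereographically from an omitted point \<open>a\<close> to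
  get \<open>g : \<real>\<^sup>n \<rightarrow> \<real>\<^sup>n\<close> and put \<open>u = ln (1 + |g|\<^sup>n)\<close>, \<open>Y\<^sup>n = |Dg|\<^sup>n / (1 + |g|\<^sup>n)\<close>.  Integrating
  the null Lagrangian \<open>div (\<kappa>(|g|\<^sup>n) cof(Dg) g)\<close> by parts bounds \<open>\<integral>\<eta> J\<close> by \<open>C \<integral>|\<nabla>\<eta>| Y\<^sup>n\<^sup>-\<^sup>1\<close>, and
  bounds the \<open>n\<close>-energy of \<open>ln (L + u)\<close> by the mass of \<open>J\<close> times \<open>L\<^sup>1\<^sup>-\<^sup>n\<close>.

  With many omitted points the sets \<open>{u > b}\<close> are disjoint, so on any ball one of them has small density.
  Choose a ball \<open>B\<close> of large mass \<open>M\<close> on which the measure \<open>J dx\<close> is doubling and take \<open>L\<^sup>n\<^sup>-\<^sup>1\<close>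
  comparable to \<open>M\<close>.  Then \<open>ln (L + u)\<close> has small energy near \<open>B\<close> and \<open>u > L\<close> holds only on a small
  set; a De Giorgi type iteration over the levels \<open>2\<^sup>k L\<close> gives the decay of \<open>{u > 2\<^sup>k L}\<close> and hence
  moments of \<open>u\<close>, which by Young's inequality make \<open>\<integral>|\<nabla>\<eta>| Y\<^sup>n\<^sup>-\<^sup>1\<close> much smaller than \<open>M\<close>, a contradiction.
  If the total mass is finite, the same estimate on large balls shows that it vanishes, so \<open>f\<close> is constant.
\<close>

section \<open>Doubling balls and cutoff functions\<close>

text \<open>The level \<open>b\<close> above which the superlevel sets are disjoint depends on the
  distances between the omitted points, hence on the map, while their number must not. So
  \<open>b\<close> may enter only through the mass demanded of the ball. This dictates the order of
  choice: the doubling constant; then \<Lambda> with L^(n-1) = \<Lambda> M, large, so that the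
  energy, of order 1/\<Lambda>, falls below the threshold of the iteration; then the Young parameter
  \<epsilon>, small, to beat \<Lambda>; then the scale \<sigma> and from it the number of sets; only
  then \<open>b\<close>, and last the mass. Outside the superlevel set Y^n is at most C exp(b) J.
  Inside, the factor exp u is unbounded, so there Y is written as L X V with X = Y / (L + u) and V =
  (L + u) / L; X has small energy, and the moments of V gain from the small scale \<sigma>. If the
  total mass is finite, M cannot be made large, but then the energy outside large balls tends to 0
  and the level L = b can be kept.\<close>

lemma ball_covering:
  obtains P :: "'a::euclidean_space set" and c :: nat where "finite P" "P \<subseteq> cball 0 1"
    "cball 0 1 \<subseteq> (\<Union>p\<in>P. ball p (1/16))" "card P \<le> c" "2 \<le> c"
proof -
  have "compact (cball (0::'a) 1)" by simp
  moreover have "cball (0::'a) 1 \<subseteq> (\<Union>p\<in>cball 0 1. ball p (1/16))" by force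
  ultimately obtain P where P: "P \<subseteq> cball (0::'a) 1" "finite P" "cball (0::'a) 1 \<subseteq> (\<Union>p\<in>P. ball p (1/16))"
    using compactE_image[of "cball (0::'a) 1" "cball 0 1" "\<lambda>p. ball p (1/16)"] by (metis open_ball)
  with that[of P "card P + 2"] show ?thesis by auto
qed

text \<open>Otherwise, passing to the heaviest of the covering balls of radius \<open>r/16\<close> and enlarging it eightfold would
  multiply the mass by \<open>c\<close> while halving the radius, again and again inside a bounded region.\<close>

lemma exists_doubling_ball:
  fixes \<mu> :: "'a::euclidean_space measure" and P :: "'a set" and c :: nat and m :: real
  assumes P: "finite P" "P \<subseteq> cball 0 1" "cball 0 1 \<subseteq> (\<Union>p\<in>P. ball p (1/16))" "card P \<le> c" "2 \<le> c"
    and sets: "sets \<mu> = sets borel"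
    and fin: "\<And>x r. emeasure \<mu> (ball x r) < \<infinity>"
    and m: "0 < m" "0 < r\<^sub>0" "c * m \<le> measure \<mu> (ball x\<^sub>0 r\<^sub>0)"
  shows "\<exists>x r. 0 < r \<and> m \<le> measure \<mu> (ball x r) \<and> measure \<mu> (ball x (8 * r)) \<le> real c^2 * measure \<mu> (ball x r)"
proof (rule ccontr)
  assume neg: "\<not> ?thesis"
  have fmb: "ball x r \<in> fmeasurable \<mu>" for x r
    using fin[of x r] sets by (auto simp: fmeasurable_def)
  have ex: "\<exists>x. dist x\<^sub>0 x \<le> 2 * r\<^sub>0 * (1 - (1/2)^k) \<and> real c ^ (k+1) * m \<le> measure \<mu> (ball x (r\<^sub>0 / 2^k))" for k
  proof (induction k)
    case 0
    show ?case using m by (intro exI[of _ x\<^sub>0]) auto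
  next
    case (Suc k)
    then obtain x where x: "dist x\<^sub>0 x \<le> 2 * r\<^sub>0 * (1 - (1/2)^k)"
      "real c ^ (k+1) * m \<le> measure \<mu> (ball x (r\<^sub>0 / 2^k))" by auto
    define \<rho> where "\<rho> = r\<^sub>0 / 2^k"
    have \<rho>: "\<rho> > 0" using m by (simp add: \<rho>_def)
    have sub: "ball x \<rho> \<subseteq> (\<Union>p\<in>P. ball (x + \<rho> *\<^sub>R p) (\<rho>/16))"
    proof
      fix y assume y: "y \<in> ball x \<rho>"
      define z where "z = (1/\<rho>) *\<^sub>R (y - x)"
      have yz: "y = x + \<rho> *\<^sub>R z" using \<rho> by (simp add: z_def)
      have "norm z = dist x y / \<rho>" using \<rho> by (simp add: z_def dist_norm norm_minus_commute)
      then have "norm z \<le> 1" using y \<rho> by simp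
      then obtain p where p: "p \<in> P" "dist p z < 1/16" using P(3) by (force simp: subset_iff)
      have "dist (x + \<rho> *\<^sub>R p) y = \<rho> * dist p z"
        using \<rho> unfolding yz by (simp add: dist_norm flip: scaleR_diff_right)
      also have "\<dots> < \<rho> * (1/16)" using p \<rho> by (intro mult_strict_left_mono) auto
      finally show "y \<in> (\<Union>p\<in>P. ball (x + \<rho> *\<^sub>R p) (\<rho>/16))" using p(1) by (intro UN_I[of p]) auto
    qed
    have "\<exists>p\<in>P. real c ^ k * m \<le> measure \<mu> (ball (x + \<rho> *\<^sub>R p) (\<rho>/16))"
    proof (rule ccontr)
      assume "\<not> ?thesis"
      then have lt: "\<And>p. p \<in> P \<Longrightarrow> measure \<mu> (ball (x + \<rho> *\<^sub>R p) (\<rho>/16)) < real c ^ k * m" by force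
      have ne: "P \<noteq> {}" using P(3) by fastforce
      have "measure \<mu> (ball x \<rho>) \<le> measure \<mu> (\<Union>p\<in>P. ball (x + \<rho> *\<^sub>R p) (\<rho>/16))"
        using sub fmb P(1) by (intro measure_mono_fmeasurable fmeasurable.finite_UN) (auto simp: sets)
      also have "\<dots> \<le> (\<Sum>p\<in>P. measure \<mu> (ball (x + \<rho> *\<^sub>R p) (\<rho>/16)))"
        using fmb P(1) by (intro measure_UNION_le) (auto simp: sets)
      also have "\<dots> < (\<Sum>p\<in>P. real c ^ k * m)" using lt ne P(1) by (intro sum_strict_mono) auto
      also have "\<dots> \<le> real c * (real c ^ k * m)" using m P(4) by (simp add: mult_right_mono)
      finally show False using x(2) by (simp add: \<rho>_def)
    qed
    then obtain p where p: "p \<in> P" "real c ^ k * m \<le> measure \<mu> (ball (x + \<rho> *\<^sub>R p) (\<rho>/16))" by blast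
    have "1 * m \<le> real c ^ k * m" using m P(5) by (intro mult_right_mono one_le_power) auto
    with p(2) have "m \<le> measure \<mu> (ball (x + \<rho> *\<^sub>R p) (\<rho>/16))" by linarith
    have "real c^2 * measure \<mu> (ball (x + \<rho> *\<^sub>R p) (\<rho>/16)) < measure \<mu> (ball (x + \<rho> *\<^sub>R p) (8 * (\<rho>/16)))"
    proof -
      have "\<not> (0 < \<rho>/16 \<and> m \<le> measure \<mu> (ball (x + \<rho> *\<^sub>R p) (\<rho>/16)) \<and>
          measure \<mu> (ball (x + \<rho> *\<^sub>R p) (8 * (\<rho>/16))) \<le> (real c)^2 * measure \<mu> (ball (x + \<rho> *\<^sub>R p) (\<rho>/16)))"
        by (rule notI, rule notE[OF neg], intro exI)
      then have "\<not> measure \<mu> (ball (x + \<rho> *\<^sub>R p) (8 * (\<rho>/16))) \<le> (real c)^2 * measure \<mu> (ball (x + \<rho> *\<^sub>R p) (\<rho>/16))"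
        using \<rho> \<open>m \<le> measure \<mu> (ball (x + \<rho> *\<^sub>R p) (\<rho>/16))\<close> by simp
      then show ?thesis by simp
    qed
    \<comment> \<open>The pigeonhole costs a factor c and the failure of the doubling inequality
      gains c^2, so each halving of the radius multiplies the mass by c, which is at least
      2.\<close>
    moreover have "real c^2 * (real c ^ k * m) \<le> real c^2 * measure \<mu> (ball (x + \<rho> *\<^sub>R p) (\<rho>/16))"
      by (rule mult_left_mono[OF p(2)]) simp
    moreover have "real c^2 * (real c ^ k * m) = real c ^ (Suc k + 1) * m"
      by (simp add: power2_eq_square)
    moreover have e8: "r\<^sub>0 / 2 ^ Suc k = 8 * (\<rho>/16)" by (simp add: \<rho>_def)
    ultimately have 1: "real c ^ (Suc k + 1) * m \<le> measure \<mu> (ball (x + \<rho> *\<^sub>R p) (r\<^sub>0 / 2 ^ Suc k))"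
      unfolding e8 by linarith
    have "dist x\<^sub>0 (x + \<rho> *\<^sub>R p) \<le> dist x\<^sub>0 x + dist x (x + \<rho> *\<^sub>R p)" by (rule dist_triangle)
    moreover have "dist x (x + \<rho> *\<^sub>R p) \<le> \<rho>"
    proof -
      have "norm p \<le> 1" using subsetD[OF P(2) p(1)] by simp
      then have "\<rho> * norm p \<le> \<rho> * 1" using \<rho> by (intro mult_left_mono) auto
      then show ?thesis using \<rho> by (simp add: dist_norm)
    qed
    moreover have "dist x\<^sub>0 x + \<rho> \<le> 2 * r\<^sub>0 * (1 - (1/2)^Suc k)"
    proof -
      define e where "e = (1/2::real)^k"
      have "\<rho> = r\<^sub>0 * e" by (simp add: \<rho>_def e_def power_divide)
      moreover have "2 * r\<^sub>0 * (1 - (1/2)^Suc k) = 2 * r\<^sub>0 - r\<^sub>0 * e"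
        by (simp add: e_def right_diff_distrib)
      moreover have "dist x\<^sub>0 x \<le> 2 * r\<^sub>0 - 2 * (r\<^sub>0 * e)"
        using x(1) by (simp add: e_def right_diff_distrib)
      ultimately show ?thesis by linarith
    qed
    ultimately have "dist x\<^sub>0 (x + \<rho> *\<^sub>R p) \<le> 2 * r\<^sub>0 * (1 - (1/2)^Suc k)" by linarith
    with 1 show ?case by (intro exI[of _ "x + \<rho> *\<^sub>R p"] conjI)
  qed
  have bd: "real c ^ (k+1) * m \<le> measure \<mu> (ball x\<^sub>0 (3 * r\<^sub>0))" for k
  proof -
    obtain x where x: "dist x\<^sub>0 x \<le> 2 * r\<^sub>0 * (1 - (1/2)^k)" "real c ^ (k+1) * m \<le> measure \<mu> (ball x (r\<^sub>0 / 2^k))"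
      using ex by blast
    have "2 * r\<^sub>0 * (1 - (1/2)^k) + r\<^sub>0 / 2^k \<le> 3 * r\<^sub>0" using m by (simp add: field_simps)
    with x(1) have "dist x\<^sub>0 x + r\<^sub>0 / 2^k \<le> 3 * r\<^sub>0" by simp
    then have "ball x (r\<^sub>0 / 2^k) \<subseteq> ball x\<^sub>0 (3 * r\<^sub>0)"
      by (simp add: ball_subset_ball_iff dist_commute)
    then have "measure \<mu> (ball x (r\<^sub>0 / 2^k)) \<le> measure \<mu> (ball x\<^sub>0 (3 * r\<^sub>0))"
      by (intro measure_mono_fmeasurable fmb) (auto simp: sets)
    with x(2) show ?thesis by simp
  qed
  obtain k where "measure \<mu> (ball x\<^sub>0 (3 * r\<^sub>0)) / m < 2 ^ k"
    using real_arch_pow[of 2] by auto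
  also have "(2::real)^k \<le> real c ^ k" using P(5) by (intro power_mono) auto
  also have "\<dots> \<le> real c ^ (k+1)" using P(5) by (intro power_increasing) auto
  finally show False using bd[of k] m(1) by (simp add: field_simps)
qed

text \<open>A quadratic spline rising from 0 to 1 on [0,1], with the tent function of height 2 as
  derivative: C^1 regularity is what \<open>C1_cutoff\<close> asks for, and the bounds on the
  derivative can be read off.\<close>

definition smooth_step :: "real \<Rightarrow> real" where
  "smooth_step t = 2 * (max 0 t)^2 - 4 * (max 0 (t - 1/2))^2 + 2 * (max 0 (t - 1))^2"

definition smooth_step' :: "real \<Rightarrow> real" where
  "smooth_step' t = 4 * max 0 t - 8 * max 0 (t - 1/2) + 4 * max 0 (t - 1)"

lemma has_real_derivative_max_0_squared:
  "((\<lambda>t::real. (max 0 t)^2) has_real_derivative 2 * max 0 t) (at t)"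
proof -
  consider "t < 0" | "t > 0" | "t = 0" by linarith
  then show ?thesis
  proof cases
    case 1
    then have "((\<lambda>t::real. 0) has_real_derivative 2 * max 0 t) (at t)" by simp
    then show ?thesis
      by (rule DERIV_cong_ev[THEN iffD1, rotated -1, OF _ refl _ refl])
         (use 1 eventually_nhds_in_open[of "{..<0}" t] in \<open>auto elim!: eventually_mono\<close>)
  next
    case 2
    then have "((\<lambda>t::real. t^2) has_real_derivative 2 * max 0 t) (at t)"
      by (auto intro!: derivative_eq_intros)
    then show ?thesis
      by (rule DERIV_cong_ev[THEN iffD1, rotated -1, OF _ refl _ refl])
         (use 2 eventually_nhds_in_open[of "{0<..}" t] in \<open>auto elim!: eventually_mono\<close>)
  next
    case 3
    have "((\<lambda>h::real. (max 0 h)^2 / h) \<longlongrightarrow> 0) (at 0)"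
    proof (rule tendsto_sandwich[where f="\<lambda>h. -\<bar>h\<bar>" and h="\<lambda>h. \<bar>h\<bar>"])
      show "((\<lambda>h::real. -\<bar>h\<bar>) \<longlongrightarrow> 0) (at 0)" "((\<lambda>h::real. \<bar>h\<bar>) \<longlongrightarrow> 0) (at 0)"
        by (auto intro!: tendsto_eq_intros)
    qed (auto simp: max_def power2_eq_square intro!: always_eventually)
    then show ?thesis using 3 by (simp add: DERIV_def)
  qed
qed

lemma has_real_derivative_smooth_step: "(smooth_step has_real_derivative smooth_step' t) (at t)"
proof -
  have sh: "((\<lambda>t::real. (max 0 (t - a))^2) has_real_derivative 2 * max 0 (t - a)) (at t)" for a
    using DERIV_shift[of "\<lambda>t. (max 0 t)^2" "2 * max 0 (t - a)" t "-a"] has_real_derivative_max_0_squared[of "t - a"]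
    by simp
  show ?thesis unfolding smooth_step_def[abs_def] smooth_step'_def
    by (rule derivative_eq_intros has_real_derivative_max_0_squared sh refl | simp)+
qed

lemma continuous_on_smooth_step': "continuous_on A smooth_step'"
  unfolding smooth_step'_def[abs_def] by (intro continuous_intros)

lemma smooth_step_eq: "t \<le> 0 \<Longrightarrow> smooth_step t = 0" "1 \<le> t \<Longrightarrow> smooth_step t = 1"
  "t \<le> 0 \<Longrightarrow> smooth_step' t = 0" "1 \<le> t \<Longrightarrow> smooth_step' t = 0"
  by (auto simp: smooth_step_def smooth_step'_def max_def power2_eq_square algebra_simps)

lemma smooth_step'_bounds: "0 \<le> smooth_step' t" "smooth_step' t \<le> 2"
  by (auto simp: smooth_step'_def max_def)

lemma smooth_step_bounds: "0 \<le> smooth_step t" "smooth_step t \<le> 1"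
proof -
  have mono: "smooth_step s \<le> smooth_step t" if "s \<le> t" for s t
    by (rule DERIV_nonneg_imp_nondecreasing[OF that])
       (use has_real_derivative_smooth_step smooth_step'_bounds in blast)
  show "0 \<le> smooth_step t" using mono[of "min 0 t" t] smooth_step_eq(1)[of "min 0 t"] by simp
  show "smooth_step t \<le> 1" using mono[of t "max 1 t"] smooth_step_eq(2)[of "max 1 t"] by simp
qed

text \<open>Young's inequality with a parameter, by comparing Z with \<epsilon> X: in either case
  one of the two summands alone dominates. The weights are plain powers of \<epsilon>, which keeps
  the later choice of constants explicit.\<close>

lemma pow_mult_le_young:
  fixes X Z \<epsilon> :: real
  assumes "0 \<le> X" "0 \<le> Z" "0 < \<epsilon>" "1 \<le> n"
  shows "X ^ (n-1) * Z \<le> \<epsilon> * X ^ n + Z ^ n / \<epsilon> ^ (n-1)"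
proof (cases "Z \<le> \<epsilon> * X")
  case True
  then have "X ^ (n-1) * Z \<le> X ^ (n-1) * (\<epsilon> * X)" using assms by (intro mult_left_mono) auto
  also have "\<dots> = \<epsilon> * X ^ n" using assms(4) by (cases n) auto
  also have "\<dots> \<le> \<epsilon> * X ^ n + Z ^ n / \<epsilon> ^ (n-1)" using assms by simp
  finally show ?thesis .
next
  case False
  then have "X \<le> Z / \<epsilon>" using assms by (simp add: field_simps)
  then have "X ^ (n-1) * Z \<le> (Z / \<epsilon>) ^ (n-1) * Z"
    using assms by (intro mult_right_mono power_mono) auto
  also have "\<dots> = Z ^ n / \<epsilon> ^ (n-1)" using assms(4) by (cases n) (auto simp: power_divide)
  also have "\<dots> \<le> \<epsilon> * X ^ n + Z ^ n / \<epsilon> ^ (n-1)" using assms by simp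
  finally show ?thesis .
qed

text \<open>No sign is imposed, because products of a cutoff with components of a map must qualify
  as well; nonnegativity is added where a cutoff weights a mass or an energy.\<close>

definition C1_cutoff :: "('a::euclidean_space \<Rightarrow> real) \<Rightarrow> ('a \<Rightarrow> 'a) \<Rightarrow> bool" where
  "C1_cutoff \<eta> D\<eta> \<longleftrightarrow> (\<forall>x. (\<eta> has_derivative (\<lambda>h. D\<eta> x \<bullet> h)) (at x)) \<and> continuous_on UNIV D\<eta> \<and>
     (\<exists>R. \<forall>x. R < norm x \<longrightarrow> \<eta> x = 0 \<and> D\<eta> x = 0)"

lemma radial_cutoff:
  fixes x\<^sub>0 :: "'a::euclidean_space"
  assumes r: "0 < r"
  obtains \<eta> D\<eta> where "C1_cutoff \<eta> D\<eta>" "\<And>x. 0 \<le> \<eta> x" "\<And>x. \<eta> x \<le> 1"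
    "\<And>x. dist x\<^sub>0 x \<le> r \<Longrightarrow> \<eta> x = 1" "\<And>x. 2 * r \<le> dist x\<^sub>0 x \<Longrightarrow> \<eta> x = 0"
    "\<And>x. dist x\<^sub>0 x \<le> r \<Longrightarrow> D\<eta> x = 0" "\<And>x. 2 * r \<le> dist x\<^sub>0 x \<Longrightarrow> D\<eta> x = 0"
    "\<And>x. norm (D\<eta> x) \<le> 3 / r"
proof
  \<comment> \<open>Affine in the squared distance, hence smooth also at the centre; it is at least
    1 up to distance r and at most 0 from 2r on.\<close>
  define q where "q x = (4 * r^2 - (x - x\<^sub>0) \<bullet> (x - x\<^sub>0)) / (3 * r^2)" for x
  define \<eta> where "\<eta> x = smooth_step (q x)" for x
  define D\<eta> where "D\<eta> x = (smooth_step' (q x) * (- 2 / (3 * r^2))) *\<^sub>R (x - x\<^sub>0)" for x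
  have dd: "(x - x\<^sub>0) \<bullet> (x - x\<^sub>0) = (dist x\<^sub>0 x)^2" for x
    by (simp add: dist_norm norm_minus_commute[of x\<^sub>0] flip: power2_norm_eq_inner)
  have q1: "1 \<le> q x" if "dist x\<^sub>0 x \<le> r" for x
  proof -
    have "(dist x\<^sub>0 x)^2 \<le> r^2" using that by (intro power_mono) auto
    then show ?thesis using r by (simp add: q_def dd field_simps)
  qed
  have q0: "q x \<le> 0" if "2 * r \<le> dist x\<^sub>0 x" for x
  proof -
    have "(2*r)^2 \<le> (dist x\<^sub>0 x)^2" using that r by (intro power_mono) auto
    then show ?thesis using r by (simp add: q_def dd field_simps)
  qed
  show "dist x\<^sub>0 x \<le> r \<Longrightarrow> \<eta> x = 1" "dist x\<^sub>0 x \<le> r \<Longrightarrow> D\<eta> x = 0" for x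
    using smooth_step_eq q1[of x] by (auto simp: \<eta>_def D\<eta>_def)
  show s0: "2 * r \<le> dist x\<^sub>0 x \<Longrightarrow> \<eta> x = 0" "2 * r \<le> dist x\<^sub>0 x \<Longrightarrow> D\<eta> x = 0" for x
    using smooth_step_eq q0[of x] by (auto simp: \<eta>_def D\<eta>_def)
  show "0 \<le> \<eta> x" "\<eta> x \<le> 1" for x using smooth_step_bounds by (auto simp: \<eta>_def)
  show "norm (D\<eta> x) \<le> 3 / r" for x
  proof (cases "2 * r \<le> dist x\<^sub>0 x")
    case True then show ?thesis using s0 r by simp
  next
    case False
    have "norm (D\<eta> x) = smooth_step' (q x) * (2 / (3 * r^2)) * dist x\<^sub>0 x"
      using smooth_step'_bounds[of "q x"] by (simp add: D\<eta>_def dist_norm norm_minus_commute abs_mult)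
    also have "\<dots> \<le> 2 * (2 / (3 * r^2)) * (2 * r)"
      using smooth_step'_bounds[of "q x"] False r by (intro mult_mono) auto
    also have "\<dots> \<le> 3 / r" using r by (simp add: field_simps power2_eq_square)
    finally show ?thesis .
  qed
  show "C1_cutoff \<eta> D\<eta>"
    unfolding C1_cutoff_def
  proof (intro conjI allI)
    show "(\<eta> has_derivative (\<lambda>h. D\<eta> x \<bullet> h)) (at x)" for x
    proof -
      have "(q has_derivative (\<lambda>h. (- 2 / (3 * r^2)) * ((x - x\<^sub>0) \<bullet> h))) (at x)"
        unfolding q_def[abs_def] using r
        by (auto intro!: derivative_eq_intros simp: inner_commute field_simps)
      then have "((\<lambda>x. smooth_step (q x)) has_derivative (\<lambda>h. smooth_step' (q x) * ((- 2 / (3 * r^2)) * ((x - x\<^sub>0) \<bullet> h)))) (at x)"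
        using has_derivative_compose[OF _ has_real_derivative_smooth_step[unfolded has_field_derivative_def]] by blast
      then show ?thesis by (simp add: \<eta>_def[abs_def] D\<eta>_def mult.assoc)
    qed
    show "continuous_on UNIV D\<eta>" unfolding D\<eta>_def[abs_def] q_def
      using r by (intro continuous_intros continuous_on_compose2[OF continuous_on_smooth_step'[of UNIV]]) auto
    show "\<exists>R. \<forall>x. R < norm x \<longrightarrow> \<eta> x = 0 \<and> D\<eta> x = 0"
    proof (intro exI[of _ "2 * r + norm x\<^sub>0"] allI impI)
      fix x :: 'a assume "2 * r + norm x\<^sub>0 < norm x"
      moreover have "norm x \<le> dist x\<^sub>0 x + norm x\<^sub>0"
        using norm_triangle_sub[of x x\<^sub>0] by (simp add: dist_norm norm_minus_commute)
      ultimately show "\<eta> x = 0 \<and> D\<eta> x = 0" using s0 by auto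
    qed
  qed
qed

section \<open>Growth estimates for many disjoint superlevel sets\<close>

text \<open>In the application \<open>J\<close> is the Jacobian of a quasiregular map into the sphere, \<open>exp u = 1 + |g|\<^sup>n\<close> for
  the stereographic projection \<open>g\<close> of the map from an omitted point, and \<open>Y\<^sup>n = |Dg|\<^sup>n / (1 + |g|\<^sup>n)\<close>;
  \<open>C\<close> depends only on the dimension and the distortion.\<close>

locale growth_data =
  fixes C :: real and J u Y :: "'a::euclidean_space \<Rightarrow> real"
  assumes C: "1 \<le> C" and dim: "2 \<le> DIM('a)"
    and J: "J \<in> borel_measurable borel" "\<And>x. 0 \<le> J x" "\<And>R. set_integrable lborel (cball 0 R) J"
    and u: "continuous_on UNIV u" "\<And>x. 0 \<le> u x"
    and Y: "Y \<in> borel_measurable borel" "\<And>x. 0 \<le> Y x" "\<And>R. set_integrable lborel (cball 0 R) (\<lambda>x. Y x ^ DIM('a))"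
    and mass: "\<And>\<eta> D\<eta>. C1_cutoff \<eta> D\<eta> \<Longrightarrow> (\<And>x. 0 \<le> \<eta> x) \<Longrightarrow>
      (LINT x|lborel. \<eta> x * J x) \<le> C * (LINT x|lborel. norm (D\<eta> x) * Y x ^ (DIM('a) - 1))"
    and log_energy: "\<And>\<eta> D\<eta> L. C1_cutoff \<eta> D\<eta> \<Longrightarrow> (\<And>x. 0 \<le> \<eta> x) \<Longrightarrow> 1 \<le> L \<Longrightarrow>
      (LINT x|lborel. (\<eta> x * (Y x / (L + u x))) ^ DIM('a))
        \<le> C / L ^ (DIM('a) - 1) * (LINT x|lborel. \<eta> x ^ DIM('a) * J x)
          + C * (LINT x|lborel. (\<eta> x * (Y x / (L + u x))) ^ (DIM('a) - 1) * norm (D\<eta> x))"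
    and variation: "\<And>F F' A A' z. (\<And>t. (F has_real_derivative F' t) (at t)) \<Longrightarrow> continuous_on UNIV F' \<Longrightarrow> (\<And>t. 0 \<le> F' t) \<Longrightarrow>
      A \<in> sets borel \<Longrightarrow> A' \<in> sets borel \<Longrightarrow> bounded A' \<Longrightarrow> (\<And>x t. x \<in> A \<Longrightarrow> 0 \<le> t \<Longrightarrow> t \<le> 1 \<Longrightarrow> x + t *\<^sub>R z \<in> A') \<Longrightarrow>
      (\<integral>\<^sup>+x\<in>A. ennreal \<bar>F (u (x + z)) - F (u x)\<bar> \<partial>lborel) \<le> ennreal (norm z * C) * (\<integral>\<^sup>+x\<in>A'. ennreal (F' (u x) * Y x) \<partial>lborel)"
    and upper: "AE x in lborel. Y x ^ DIM('a) \<le> C * exp (u x) * J x"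
begin

text \<open>The region where the gradient of a cutoff from radius r to 2r lives, thickened by s; the
  thickening makes room for the translations in the level iteration.\<close>

definition annulus :: "'a \<Rightarrow> real \<Rightarrow> real \<Rightarrow> 'a set" where
  "annulus x\<^sub>0 r s = {x. r - s \<le> dist x\<^sub>0 x \<and> dist x\<^sub>0 x \<le> 2 * r + s}"

lemma annulus_borel [measurable, simp]: "annulus x\<^sub>0 r s \<in> sets borel"
proof -
  have "closed (annulus x\<^sub>0 r s)"
    unfolding annulus_def by (intro closed_Collect_conj closed_Collect_le continuous_intros)
  then show ?thesis by (rule borel_closed)
qed

lemma bounded_annulus [simp]: "bounded (annulus x\<^sub>0 r s)"
  by (rule bounded_subset[of "cball x\<^sub>0 (2 * r + s)"]) (auto simp: annulus_def)

lemma u_borel [measurable]: "u \<in> borel_measurable borel"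
  using u(1) by (rule borel_measurable_continuous_onI)

lemmas [measurable] = Y(1) J(1)

lemma emeasure_ball_pow: "0 \<le> r \<Longrightarrow> emeasure lborel (ball (x::'a) r) = ennreal (unit_ball_vol (real DIM('a)) * r ^ DIM('a))"
  by (simp add: emeasure_ball)

text \<open>On \<open>{u > 2\<l>}\<close> a cutoff of \<open>u\<close> between \<open>\<l>\<close> and \<open>2\<l>\<close> equals \<open>1\<close>, but it vanishes on at least half of
  every ball of radius \<open>\<rho>\<close>; comparing it with its translates bounds the measure by the energy.\<close>

lemma level_step:
  assumes \<rho>: "0 < \<rho>" and L: "0 < L" "L \<le> \<l>" and e: "0 < e"
    and small: "emeasure lborel ({x. \<l> < u x} \<inter> annulus x\<^sub>0 r (s + \<rho>)) \<le> ennreal (unit_ball_vol (real DIM('a)) * \<rho> ^ DIM('a) / 2)"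
    and E: "(\<integral>\<^sup>+x\<in>annulus x\<^sub>0 r (s + \<rho>). ennreal ((Y x / (L + u x)) ^ DIM('a)) \<partial>lborel) \<le> ennreal (e ^ DIM('a))"
  shows "emeasure lborel ({x. 2 * \<l> < u x} \<inter> annulus x\<^sub>0 r s) \<le> ennreal (6 * C * (unit_ball_vol (real DIM('a)) + 2) * e * \<rho> ^ DIM('a))"
proof -
  let ?N = "DIM('a)" and ?A = "annulus x\<^sub>0 r s" and ?A' = "annulus x\<^sub>0 r (s + \<rho>)" and ?B = "ball (0::'a) \<rho>"
  define \<U> where "\<U> = {x. 2 * \<l> < u x} \<inter> ?A"
  have \<l>: "0 < \<l>" using L by simp
  define F where "F t = smooth_step ((t - \<l>) / \<l>)" for t
  define F' where "F' t = smooth_step' ((t - \<l>) / \<l>) / \<l>" for t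
  have dF: "(F has_real_derivative F' t) (at t)" for t
  proof -
    have "((\<lambda>t. (t - \<l>) / \<l>) has_real_derivative 1 / \<l>) (at t)"
      using \<l> by (auto intro!: derivative_eq_intros)
    from DERIV_chain2[OF has_real_derivative_smooth_step this] show ?thesis
      by (simp add: F_def[abs_def] F'_def)
  qed
  have cF': "continuous_on UNIV F'" unfolding F'_def[abs_def]
    using \<l> by (intro continuous_intros continuous_on_compose2[OF continuous_on_smooth_step'[of UNIV]]) auto
  have F'0: "0 \<le> F' t" for t using smooth_step'_bounds \<l> by (simp add: F'_def)
  have cF: "continuous_on UNIV F" using dF DERIV_continuous_on has_field_derivative_at_within by blast
  have [measurable]: "F \<in> borel_measurable borel" "F' \<in> borel_measurable borel"
    using cF cF' borel_measurable_continuous_onI by blast+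
  have \<U>_borel [measurable]: "\<U> \<in> sets borel" unfolding \<U>_def by measurable
  define X where "X x = Y x / (L + u x)" for x
  have X0: "0 \<le> X x" for x using Y(2)[of x] u(2)[of x] L by (simp add: X_def)
  have [measurable]: "X \<in> borel_measurable borel" unfolding X_def[abs_def] by measurable
  define I where "I = (\<integral>\<^sup>+x\<in>?A'. ennreal (F' (u x) * Y x) \<partial>lborel)"
  have step: "x + t *\<^sub>R z \<in> ?A'" if "x \<in> ?A" "norm z < \<rho>" "0 \<le> t" "t \<le> 1" for x z t
  proof -
    have "norm (t *\<^sub>R z) \<le> \<rho>" using that mult_left_le_one_le[of "norm z" t] by simp
    moreover have "\<bar>dist x\<^sub>0 (x + t *\<^sub>R z) - dist x\<^sub>0 x\<bar> \<le> norm (t *\<^sub>R z)"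
    proof -
      have "dist x (x + t *\<^sub>R z) = norm (t *\<^sub>R z)" by (simp add: dist_norm)
      then show ?thesis
        using dist_triangle[of x\<^sub>0 "x + t *\<^sub>R z" x] dist_triangle[of x\<^sub>0 x "x + t *\<^sub>R z"]
          dist_commute[of x "x + t *\<^sub>R z"] by linarith
    qed
    ultimately show ?thesis using that(1) by (auto simp: annulus_def)
  qed
  have [measurable]: "?B \<in> sets borel" by simp
  have inner: "ennreal (unit_ball_vol (real DIM('a)) * \<rho> ^ ?N / 2) \<le> (\<integral>\<^sup>+z\<in>?B. ennreal \<bar>F (u (x + z)) - F (u x)\<bar> \<partial>lborel)" if x: "x \<in> \<U>" for x
  proof -
    define G where "G = {z \<in> ?B. u (x + z) \<le> \<l>}"
    define H where "H = {z \<in> ?B. \<l> < u (x + z)}"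
    have [measurable]: "G \<in> sets borel" "H \<in> sets borel" unfolding G_def H_def by measurable
    have "emeasure lborel H = emeasure (distr lborel borel (\<lambda>z. x + z)) ((\<lambda>z. - x + z) -` H)"
      by (subst emeasure_distr) (auto simp: vimage_def)
    also have "\<dots> = emeasure lborel ((\<lambda>z. - x + z) -` H)"
      by (simp add: lborel_distr_plus)
    also have "\<dots> \<le> emeasure lborel ({x. \<l> < u x} \<inter> ?A')"
    proof (rule emeasure_mono)
      show "(\<lambda>z. - x + z) -` H \<subseteq> {x. \<l> < u x} \<inter> ?A'"
      proof
        fix y assume "y \<in> (\<lambda>z. - x + z) -` H"
        then have "norm (y - x) < \<rho>" "\<l> < u y" by (auto simp: H_def)
        then show "y \<in> {x. \<l> < u x} \<inter> ?A'" using step[of x "y - x" 1] x by (auto simp: \<U>_def)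
      qed
    qed measurable
    also have "\<dots> \<le> ennreal (unit_ball_vol (real DIM('a)) * \<rho> ^ ?N / 2)" by (rule small)
    finally have H: "emeasure lborel H \<le> ennreal (unit_ball_vol (real DIM('a)) * \<rho> ^ ?N / 2)" .
    have "emeasure lborel ?B = emeasure lborel G + emeasure lborel H"
      by (subst plus_emeasure) (auto simp: G_def H_def intro!: arg_cong[where f="emeasure lborel"])
    then have "ennreal (unit_ball_vol (real DIM('a)) * \<rho> ^ ?N) \<le> emeasure lborel G + ennreal (unit_ball_vol (real DIM('a)) * \<rho> ^ ?N / 2)"
      using H \<rho> by (simp add: emeasure_ball_pow add_left_mono)
    moreover have "ennreal (unit_ball_vol (real DIM('a)) * \<rho> ^ ?N) = ennreal (unit_ball_vol (real DIM('a)) * \<rho> ^ ?N / 2) + ennreal (unit_ball_vol (real DIM('a)) * \<rho> ^ ?N / 2)"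
      using \<rho> by (subst ennreal_plus[symmetric]) auto
    ultimately have "ennreal (unit_ball_vol (real DIM('a)) * \<rho> ^ ?N / 2) \<le> emeasure lborel G"
      by (simp add: add.commute[of "emeasure lborel G"] ennreal_add_left_cancel_le)
    also have "\<dots> = (\<integral>\<^sup>+z. indicator G z \<partial>lborel)" by simp
    also have "\<dots> \<le> (\<integral>\<^sup>+z\<in>?B. ennreal \<bar>F (u (x + z)) - F (u x)\<bar> \<partial>lborel)"
    proof (rule nn_integral_mono)
      fix z
      have "F (u x) = 1" using x \<l> by (auto simp: \<U>_def F_def field_simps intro!: smooth_step_eq)
      moreover have "F (u (x + z)) = 0" if "z \<in> G"
        using that \<l> by (auto simp: G_def F_def field_simps intro!: smooth_step_eq)
      ultimately show "indicator G z \<le> ennreal \<bar>F (u (x + z)) - F (u x)\<bar> * indicator ?B z"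
        by (auto simp: indicator_def G_def)
    qed
    finally show ?thesis .
  qed
  have "ennreal (unit_ball_vol (real DIM('a)) * \<rho> ^ ?N / 2) * emeasure lborel \<U> = (\<integral>\<^sup>+x\<in>\<U>. ennreal (unit_ball_vol (real DIM('a)) * \<rho> ^ ?N / 2) \<partial>lborel)"
    by (simp add: nn_integral_cmult_indicator)
  also have "\<dots> \<le> (\<integral>\<^sup>+x\<in>?A. (\<integral>\<^sup>+z\<in>?B. ennreal \<bar>F (u (x + z)) - F (u x)\<bar> \<partial>lborel) \<partial>lborel)"
    using inner by (intro nn_integral_mono) (auto simp: indicator_def \<U>_def)
  also have "\<dots> = (\<integral>\<^sup>+x. (\<integral>\<^sup>+z. ennreal \<bar>F (u (x + z)) - F (u x)\<bar> * indicator ?B z * indicator ?A x \<partial>lborel) \<partial>lborel)"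
    by (intro nn_integral_cong nn_integral_multc[symmetric]) measurable
  also have "\<dots> = (\<integral>\<^sup>+z. (\<integral>\<^sup>+x. ennreal \<bar>F (u (x + z)) - F (u x)\<bar> * indicator ?B z * indicator ?A x \<partial>lborel) \<partial>lborel)"
    by (rule lborel_pair.Fubini') measurable
  also have "\<dots> \<le> (\<integral>\<^sup>+z. (ennreal (\<rho> * C) * I) * indicator ?B z \<partial>lborel)"
  proof (rule nn_integral_mono)
    fix z :: 'a
    show "(\<integral>\<^sup>+x. ennreal \<bar>F (u (x + z)) - F (u x)\<bar> * indicator ?B z * indicator ?A x \<partial>lborel) \<le> (ennreal (\<rho> * C) * I) * indicator ?B z"
    proof (cases "z \<in> ?B")
      case True
      then have "(\<integral>\<^sup>+x\<in>?A. ennreal \<bar>F (u (x + z)) - F (u x)\<bar> \<partial>lborel) \<le> ennreal (norm z * C) * I"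
        unfolding I_def using step[of _ z] by (intro variation dF cF' F'0) auto
      also have "\<dots> \<le> ennreal (\<rho> * C) * I"
        using True C by (intro mult_right_mono ennreal_leI) auto
      finally show ?thesis using True by simp
    qed simp
  qed
  also have "\<dots> = (ennreal (\<rho> * C) * I) * ennreal (unit_ball_vol (real DIM('a)) * \<rho> ^ ?N)"
    using \<rho> by (simp add: nn_integral_cmult_indicator emeasure_ball_pow)
  finally have 1: "ennreal (unit_ball_vol (real DIM('a)) * \<rho> ^ ?N / 2) * emeasure lborel \<U> \<le> (ennreal (\<rho> * C) * I) * ennreal (unit_ball_vol (real DIM('a)) * \<rho> ^ ?N)" .
  \<comment> \<open>This value balances the two Young terms: \<epsilon> times a volume of order
    \<rho>^n and e^n / \<epsilon>^(n-1) are both of order e \<rho>^(n-1).\<close>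
  define \<epsilon> where "\<epsilon> = e / \<rho>"
  have \<epsilon>: "0 < \<epsilon>" using e \<rho> by (simp add: \<epsilon>_def)
  have "I \<le> (\<integral>\<^sup>+x. ennreal (6 * \<epsilon>) * indicator ({x. \<l> < u x} \<inter> ?A') x + ennreal (6 / \<epsilon> ^ (?N - 1)) * (ennreal (X x ^ ?N) * indicator ?A' x) \<partial>lborel)"
    unfolding I_def
  proof (rule nn_integral_mono)
    fix x
    show "ennreal (F' (u x) * Y x) * indicator ?A' x \<le> ennreal (6 * \<epsilon>) * indicator ({x. \<l> < u x} \<inter> ?A') x + ennreal (6 / \<epsilon> ^ (?N - 1)) * (ennreal (X x ^ ?N) * indicator ?A' x)"
    proof (cases "\<l> < u x \<and> u x < 2 * \<l>")
      case True
      \<comment> \<open>In the transition layer L + u is less than 3\<l>, because L is at most \<l>.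
        This brings in the logarithmic quotient Y / (L + u), with a constant independent of the
        level.\<close>
      have "F' (u x) \<le> 2 / \<l>" using smooth_step'_bounds(2) \<l> by (simp add: F'_def divide_right_mono)
      also have "\<dots> \<le> 6 / (L + u x)" using True L by (simp add: field_simps)
      finally have "F' (u x) * Y x \<le> 6 / (L + u x) * Y x" using Y(2) by (intro mult_right_mono) auto
      also have "\<dots> = 6 * X x" by (simp add: X_def)
      also have "X x \<le> \<epsilon> + X x ^ ?N / \<epsilon> ^ (?N - 1)"
      proof (cases "X x \<le> \<epsilon>")
        case True then show ?thesis using X0[of x] \<epsilon> by (simp add: add_increasing2)
      next
        case False
        then have "X x * \<epsilon> ^ (?N - 1) \<le> X x * X x ^ (?N - 1)"
          using \<epsilon> X0[of x] by (intro mult_left_mono power_mono) auto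
        also have "\<dots> = X x ^ ?N" using dim by (cases "?N") auto
        finally have "X x \<le> X x ^ ?N / \<epsilon> ^ (?N - 1)" using \<epsilon> by (simp add: field_simps)
        then show ?thesis using \<epsilon> by simp
      qed
      finally have "F' (u x) * Y x \<le> 6 * \<epsilon> + 6 / \<epsilon> ^ (?N - 1) * X x ^ ?N" by simp
      then have "ennreal (F' (u x) * Y x) \<le> ennreal (6 * \<epsilon>) + ennreal (6 / \<epsilon> ^ (?N - 1)) * ennreal (X x ^ ?N)"
        using \<epsilon> X0[of x] by (subst ennreal_mult'[symmetric]) (auto simp flip: ennreal_plus intro: ennreal_leI)
      then show ?thesis using True by (auto simp: indicator_def)
    next
      case False
      then have "F' (u x) = 0" using \<l> smooth_step_eq(3,4)[of "(u x - \<l>) / \<l>"]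
        by (cases "u x \<le> \<l>") (auto simp: F'_def field_simps)
      then show ?thesis by simp
    qed
  qed
  also have "\<dots> = ennreal (6 * \<epsilon>) * emeasure lborel ({x. \<l> < u x} \<inter> ?A') + ennreal (6 / \<epsilon> ^ (?N - 1)) * (\<integral>\<^sup>+x\<in>?A'. ennreal (X x ^ ?N) \<partial>lborel)"
    by (subst nn_integral_add) (auto simp: nn_integral_cmult nn_integral_cmult_indicator)
  also have "\<dots> \<le> ennreal (6 * \<epsilon>) * ennreal (unit_ball_vol (real DIM('a)) * \<rho> ^ ?N / 2) + ennreal (6 / \<epsilon> ^ (?N - 1)) * ennreal (e ^ ?N)"
    using small E unfolding X_def by (intro add_mono mult_left_mono) auto
  also have "\<dots> = ennreal (6 * \<epsilon> * (unit_ball_vol (real DIM('a)) * \<rho> ^ ?N / 2) + 6 / \<epsilon> ^ (?N - 1) * e ^ ?N)"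
    using \<epsilon> \<rho> e by (simp flip: ennreal_mult ennreal_plus)
  also have "6 * \<epsilon> * (unit_ball_vol (real DIM('a)) * \<rho> ^ ?N / 2) + 6 / \<epsilon> ^ (?N - 1) * e ^ ?N = 3 * (unit_ball_vol (real DIM('a)) + 2) * e * \<rho> ^ (?N - 1)"
    using dim e \<rho> by (cases "?N") (auto simp: \<epsilon>_def power_divide field_simps)
  finally have I: "I \<le> ennreal (3 * (unit_ball_vol (real DIM('a)) + 2) * e * \<rho> ^ (?N - 1))" .
  have "ennreal (unit_ball_vol (real DIM('a)) * \<rho> ^ ?N / 2) * emeasure lborel \<U> \<le> (ennreal (\<rho> * C) * ennreal (3 * (unit_ball_vol (real DIM('a)) + 2) * e * \<rho> ^ (?N - 1))) * ennreal (unit_ball_vol (real DIM('a)) * \<rho> ^ ?N)"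
    by (rule order_trans[OF 1]) (intro mult_right_mono mult_left_mono I zero_le)
  also have "\<dots> = ennreal (unit_ball_vol (real DIM('a)) * \<rho> ^ ?N / 2) * ennreal (6 * C * (unit_ball_vol (real DIM('a)) + 2) * e * \<rho> ^ ?N)"
  proof -
    define w where "w = unit_ball_vol (real DIM('a))"
    have w: "0 < w" by (simp add: w_def)
    have p: "\<rho> ^ ?N = \<rho> * \<rho> ^ (?N - 1)" using dim by (cases "?N") auto
    have "ennreal (\<rho> * C) * ennreal (3 * (w + 2) * e * \<rho> ^ (?N - 1)) * ennreal (w * \<rho> ^ ?N)
        = ennreal (\<rho> * C * (3 * (w + 2) * e * \<rho> ^ (?N - 1)) * (w * \<rho> ^ ?N))"
      using \<rho> C e w by (simp add: ennreal_mult)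
    also have "\<rho> * C * (3 * (w + 2) * e * \<rho> ^ (?N - 1)) * (w * \<rho> ^ ?N) = w * \<rho> ^ ?N / 2 * (6 * C * (w + 2) * e * \<rho> ^ ?N)"
      unfolding p by (simp add: algebra_simps)
    also have "ennreal \<dots> = ennreal (w * \<rho> ^ ?N / 2) * ennreal (6 * C * (w + 2) * e * \<rho> ^ ?N)"
      using \<rho> C e w by (intro ennreal_mult) auto
    finally show ?thesis by (simp add: w_def)
  qed
  finally have "emeasure lborel \<U> \<le> ennreal (6 * C * (unit_ball_vol (real DIM('a)) + 2) * e * \<rho> ^ ?N)"
    using less_imp_neq[OF unit_ball_vol_pos[of "real DIM('a)"]] \<rho> by (subst (asm) ennreal_mult_le_mult_iff) auto
  then show ?thesis by (simp add: \<U>_def)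
qed

end

section \<open>Decay over dyadic levels and moments of the growth function\<close>

lemma ennreal_integral_le_nn_integral:
  fixes f :: "'a \<Rightarrow> real"
  assumes "f \<in> borel_measurable M" "\<And>x. 0 \<le> f x"
  shows "ennreal (integral\<^sup>L M f) \<le> (\<integral>\<^sup>+x. ennreal (f x) \<partial>M)"
proof (cases "integrable M f")
  case True
  then show ?thesis using assms(2) by (simp add: nn_integral_eq_integral)
next
  \<comment> \<open>By convention the Bochner integral is then 0.\<close>
  case False
  then show ?thesis by (simp add: not_integrable_integral_eq)
qed

context growth_data begin

text \<open>Threshold for the n-th root e of the energy. With w the volume of the unit ball, e below
  it makes the bound 6 C (w + 2) e \<rho>^n of \<open>level_step\<close> at most w (\<rho> / 2^n)^n
  / 2, which is the volume hypothesis of the same lemma at the scale \<rho> / 2^n.\<close>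

definition small_exponent :: real where
  "small_exponent = (1 / 2 ^ DIM('a)) ^ DIM('a) * unit_ball_vol (real DIM('a)) / (12 * C * (unit_ball_vol (real DIM('a)) + 2))"

text \<open>Origin of the two summands, with p = n (n - 1): where u \<le> L the integrand is at most
  2^p; the dyadic layers above contribute at most 2^(2p) times the geometric series with sum 2. Both
  multiply the volume w \<rho>^n / 2.\<close>

definition moment_const :: real where
  "moment_const = unit_ball_vol (real DIM('a)) / 2 * (2 ^ (DIM('a) * (DIM('a) - 1)) + 2 ^ (2 * (DIM('a) * (DIM('a) - 1)) + 1))"

lemma annulus_mono: "s \<le> s' \<Longrightarrow> annulus x\<^sub>0 r s \<subseteq> annulus x\<^sub>0 r s'"
  by (auto simp: annulus_def)

text \<open>Iteration of \<open>level_step\<close>: doubling the level lets the scale drop by the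
  factor 2^n. The measure thus decays like 2^(-k n^2), faster than the growth 2^(k n (n - 1)) of the
  moment to be summed.\<close>

lemma level_decay:
  assumes r: "0 < r" and \<rho>: "0 < \<rho>" "\<rho> \<le> r / 4" and L: "0 < L" and e: "0 < e" "e \<le> small_exponent"
    and small: "emeasure lborel ({x. L < u x} \<inter> annulus x\<^sub>0 r (r / 2)) \<le> ennreal (unit_ball_vol (real DIM('a)) * \<rho> ^ DIM('a) / 2)"
    and E: "(\<integral>\<^sup>+x\<in>annulus x\<^sub>0 r (r / 2). ennreal ((Y x / (L + u x)) ^ DIM('a)) \<partial>lborel) \<le> ennreal (e ^ DIM('a))"
  shows "emeasure lborel ({x. 2 ^ k * L < u x} \<inter> annulus x\<^sub>0 r 0)
    \<le> ennreal (unit_ball_vol (real DIM('a)) * (\<rho> * (1 / 2 ^ DIM('a)) ^ k) ^ DIM('a) / 2)"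
proof -
  let ?N = "DIM('a)"
  define w where "w = unit_ball_vol (real DIM('a))"
  have w: "0 < w" by (simp add: w_def)
  define \<kappa> where "\<kappa> = (1::real) / 2 ^ ?N"
  have \<kappa>: "0 < \<kappa>" "\<kappa> \<le> 1/2"
    using power_increasing[of 1 ?N "2::real"] dim by (auto simp: \<kappa>_def field_simps)
  \<comment> \<open>Step k uses up a thickening of at most \<rho> / 2^k; the total loss stays below
    2\<rho>, which is at most r / 2, so every thickened annulus still contains the unthickened
    one.\<close>
  define s where "s k = r / 2 - 2 * \<rho> * (1 - (1/2)^k)" for k :: nat
  have ind: "emeasure lborel ({x. 2 ^ k * L < u x} \<inter> annulus x\<^sub>0 r (s k)) \<le> ennreal (w * (\<rho> * \<kappa> ^ k) ^ ?N / 2)" for k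
  proof (induction k)
    case 0
    then show ?case using small by (simp add: s_def w_def)
  next
    case (Suc k)
    define \<rho>' where "\<rho>' = \<rho> * \<kappa> ^ k"
    have \<rho>': "0 < \<rho>'" using \<rho> \<kappa> by (simp add: \<rho>'_def)
    have "\<kappa> ^ k \<le> (1/2) ^ k" using \<kappa> by (intro power_mono) auto
    then have "\<rho>' \<le> \<rho> * (1/2)^k" using \<rho> by (simp add: \<rho>'_def)
    moreover have "s (Suc k) = s k - \<rho> * (1/2)^k" by (simp add: s_def algebra_simps)
    ultimately have sk: "s (Suc k) + \<rho>' \<le> s k" by simp
    have "(1/2::real)^k \<le> 1" by (simp add: power_le_one)
    then have "0 \<le> 2 * \<rho> * (1 - (1/2)^k)" using \<rho> by (intro mult_nonneg_nonneg) auto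
    then have "s k \<le> r / 2" by (simp add: s_def)
    with sk have sub: "annulus x\<^sub>0 r (s (Suc k) + \<rho>') \<subseteq> annulus x\<^sub>0 r (s k)" "annulus x\<^sub>0 r (s (Suc k) + \<rho>') \<subseteq> annulus x\<^sub>0 r (r / 2)"
      by (auto intro!: annulus_mono)
    have "emeasure lborel ({x. 2 * (2 ^ k * L) < u x} \<inter> annulus x\<^sub>0 r (s (Suc k))) \<le> ennreal (6 * C * (w + 2) * e * \<rho>' ^ ?N)"
      unfolding w_def
    proof (rule level_step[OF \<rho>' L _ e(1)])
      show "L \<le> 2 ^ k * L" using L by simp
      show "emeasure lborel ({x. 2 ^ k * L < u x} \<inter> annulus x\<^sub>0 r (s (Suc k) + \<rho>')) \<le> ennreal (unit_ball_vol (real DIM('a)) * \<rho>' ^ ?N / 2)"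
        using sub(1) by (intro order_trans[OF emeasure_mono Suc[unfolded w_def \<rho>'_def[symmetric]]]) auto
      show "(\<integral>\<^sup>+x\<in>annulus x\<^sub>0 r (s (Suc k) + \<rho>'). ennreal ((Y x / (L + u x)) ^ ?N) \<partial>lborel) \<le> ennreal (e ^ ?N)"
        using sub(2) by (intro order_trans[OF nn_integral_mono E]) (auto simp: indicator_def)
    qed
    also have "\<dots> \<le> ennreal (w * (\<rho> * \<kappa> ^ Suc k) ^ ?N / 2)"
    proof (rule ennreal_leI)
      have "6 * C * (w + 2) * e * \<rho>' ^ ?N \<le> 6 * C * (w + 2) * (\<kappa> ^ ?N * w / (12 * C * (w + 2))) * \<rho>' ^ ?N"
        using C w \<rho>' e(2) by (intro mult_right_mono mult_left_mono) (auto simp: small_exponent_def w_def \<kappa>_def)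
      also have "\<dots> = w * \<kappa> ^ ?N * \<rho>' ^ ?N / 2"
      proof -
        define c where "c = 12 * C * (w + 2)"
        have c0: "c \<noteq> 0" and c6: "6 * C * (w + 2) = c / 2" using C w by (auto simp: c_def)
        show ?thesis unfolding c_def[symmetric] c6 using c0 by simp
      qed
      also have "\<dots> = w * (\<rho> * \<kappa> ^ Suc k) ^ ?N / 2"
        by (simp add: \<rho>'_def power_mult_distrib)
      finally show "6 * C * (w + 2) * e * \<rho>' ^ ?N \<le> w * (\<rho> * \<kappa> ^ Suc k) ^ ?N / 2" .
    qed
    finally show ?case by (simp add: mult.assoc)
  qed
  have sub: "annulus x\<^sub>0 r 0 \<subseteq> annulus x\<^sub>0 r (s k)"
  proof (rule annulus_mono)
    have "\<rho> * (1 - (1/2)^k) \<le> \<rho> * 1" using \<rho> by (intro mult_left_mono) auto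
    then show "0 \<le> s k" using \<rho> unfolding s_def by linarith
  qed
  have "emeasure lborel ({x. 2 ^ k * L < u x} \<inter> annulus x\<^sub>0 r 0) \<le> emeasure lborel ({x. 2 ^ k * L < u x} \<inter> annulus x\<^sub>0 r (s k))"
    using sub by (intro emeasure_mono) auto
  also note ind
  finally have "emeasure lborel ({x. 2 ^ k * L < u x} \<inter> annulus x\<^sub>0 r 0) \<le> ennreal (w * (\<rho> * \<kappa> ^ k) ^ ?N / 2)" .
  then show ?thesis by (simp add: w_def \<kappa>_def)
qed

text \<open>On the layer where u lies between 2^k L and 2^(k+1) L the integrand is at most 2^((k+2)
  p) with p = n (n - 1), while \<open>level_decay\<close> gives a measure of order 2^(-k n^2). As
  n^2 = p + n, the sum over k is geometric. In the application \<open>D\<close> is the superlevel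
  set at the level b \<le> L; on its part with u \<le> L the integrand is bounded and the small
  measure of \<open>D\<close> suffices.\<close>

lemma moment_bound:
  assumes r: "0 < r" and \<rho>: "0 < \<rho>" "\<rho> \<le> r / 4" and L: "0 < L" and e: "0 < e" "e \<le> small_exponent"
    and D: "D \<in> sets borel" "{x. L < u x} \<subseteq> D"
    and small: "emeasure lborel (D \<inter> annulus x\<^sub>0 r (r / 2)) \<le> ennreal (unit_ball_vol (real DIM('a)) * \<rho> ^ DIM('a) / 2)"
    and E: "(\<integral>\<^sup>+x\<in>annulus x\<^sub>0 r (r / 2). ennreal ((Y x / (L + u x)) ^ DIM('a)) \<partial>lborel) \<le> ennreal (e ^ DIM('a))"
  shows "(\<integral>\<^sup>+x\<in>D \<inter> annulus x\<^sub>0 r 0. ennreal (((L + u x) / L) ^ (DIM('a) * (DIM('a) - 1))) \<partial>lborel)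
    \<le> ennreal (moment_const * \<rho> ^ DIM('a))"
proof -
  let ?N = "DIM('a)" and ?A = "annulus x\<^sub>0 r 0"
  define p where "p = ?N * (?N - 1)"
  define w where "w = unit_ball_vol (real DIM('a))"
  have w: "0 < w" by (simp add: w_def)
  note [measurable] = D(1)
  have small': "emeasure lborel ({x. L < u x} \<inter> annulus x\<^sub>0 r (r / 2)) \<le> ennreal (unit_ball_vol (real DIM('a)) * \<rho> ^ DIM('a) / 2)"
    using D by (intro order_trans[OF emeasure_mono small]) auto
  have decay: "emeasure lborel ({x. 2 ^ k * L < u x} \<inter> ?A) \<le> ennreal (w * (\<rho> * (1 / 2 ^ ?N) ^ k) ^ ?N / 2)" for k
    unfolding w_def by (rule level_decay[OF r \<rho> L e small' E])
  have "emeasure lborel (D \<inter> ?A) \<le> emeasure lborel (D \<inter> annulus x\<^sub>0 r (r / 2))"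
    using r annulus_mono[of 0 "r / 2"] by (intro emeasure_mono) auto
  also note small
  finally have D0: "emeasure lborel (D \<inter> ?A) \<le> ennreal (w * \<rho> ^ ?N / 2)" by (simp add: w_def)
  have pw: "ennreal (((L + u x) / L) ^ p) * indicator (D \<inter> ?A) x
      \<le> ennreal (2 ^ p) * indicator (D \<inter> ?A) x + (\<Sum>k. ennreal (2 ^ ((k + 2) * p)) * indicator ({x. 2 ^ k * L < u x} \<inter> ?A) x)" for x
  proof (cases "x \<in> D \<inter> ?A \<and> L < u x")
    case True
    obtain m0 where "u x / L < 2 ^ m0" using real_arch_pow[of 2] by auto
    then have m0: "u x \<le> 2 ^ m0 * L" using L by (simp add: field_simps)
    \<comment> \<open>The dyadic layer of x; m is positive because L < u x, so its predecessor k
      satisfies 2^k L < u x.\<close>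
    define m where "m = (LEAST m. u x \<le> 2 ^ m * L)"
    have m: "u x \<le> 2 ^ m * L" unfolding m_def by (rule LeastI[of "\<lambda>m. u x \<le> 2 ^ m * L", OF m0])
    have "m \<noteq> 0" using m True by (intro notI) simp
    then obtain k where k: "m = Suc k" by (cases m) auto
    then have "\<not> u x \<le> 2 ^ k * L" using not_less_Least[of k "\<lambda>m. u x \<le> 2 ^ m * L"] by (simp add: m_def)
    then have kk: "2 ^ k * L < u x" by simp
    have "(L + u x) / L \<le> 1 + 2 ^ Suc k" using m k L by (simp add: field_simps)
    also have "\<dots> \<le> 2 ^ (k + 2)"
    proof -
      have "(1::real) \<le> 2 ^ k" by simp
      moreover have "(2::real) ^ Suc k = 2 * 2 ^ k" "(2::real) ^ (k + 2) = 4 * 2 ^ k" by (simp_all add: power_add)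
      ultimately show ?thesis by linarith
    qed
    finally have "((L + u x) / L) ^ p \<le> (2 ^ (k + 2)) ^ p" using L u(2)[of x] by (intro power_mono) auto
    also have "(2 ^ (k + 2)) ^ p = (2::real) ^ ((k + 2) * p)" by (simp only: power_mult)
    finally have "ennreal (((L + u x) / L) ^ p) * indicator (D \<inter> ?A) x \<le> ennreal (2 ^ ((k + 2) * p)) * indicator ({x. 2 ^ k * L < u x} \<inter> ?A) x"
      using True kk by (auto intro: ennreal_leI)
    also have "\<dots> \<le> (\<Sum>k. ennreal (2 ^ ((k + 2) * p)) * indicator ({x. 2 ^ k * L < u x} \<inter> ?A) x)"
    proof -
      define t where "t k = ennreal (2 ^ ((k + 2) * p)) * indicator ({x. 2 ^ k * L < u x} \<inter> ?A) x" for k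
      have "t k \<le> (\<Sum>k. t k)" using sum_le_suminf[of t "{k}"] by simp
      then show ?thesis unfolding t_def .
    qed
    finally show ?thesis by (rule order_trans) (simp add: add_increasing)
  next
    case False
    show ?thesis
    proof (cases "x \<in> D \<inter> ?A")
      case True
      then have "((L + u x) / L) ^ p \<le> 2 ^ p" using False L u(2)[of x] by (intro power_mono) (auto simp: field_simps)
      then show ?thesis using True by (auto intro!: ennreal_leI add_increasing2)
    qed simp
  qed
  have "(\<integral>\<^sup>+x\<in>D \<inter> ?A. ennreal (((L + u x) / L) ^ p) \<partial>lborel)
      \<le> (\<integral>\<^sup>+x. ennreal (2 ^ p) * indicator (D \<inter> ?A) x + (\<Sum>k. ennreal (2 ^ ((k + 2) * p)) * indicator ({x. 2 ^ k * L < u x} \<inter> ?A) x) \<partial>lborel)"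
    by (intro nn_integral_mono pw)
  also have "\<dots> = ennreal (2 ^ p) * emeasure lborel (D \<inter> ?A) + (\<Sum>k. ennreal (2 ^ ((k + 2) * p)) * emeasure lborel ({x. 2 ^ k * L < u x} \<inter> ?A))"
    by (subst nn_integral_add) (auto simp: nn_integral_cmult_indicator nn_integral_suminf)
  also have "\<dots> \<le> ennreal (2 ^ p) * ennreal (w * \<rho> ^ ?N / 2) + (\<Sum>k. ennreal (w * \<rho> ^ ?N / 2 * 2 ^ (2 * p) * (1/2) ^ k))"
  proof (intro add_mono mult_left_mono D0 suminf_le summableI zero_le)
    fix k
    have "ennreal (2 ^ ((k + 2) * p)) * emeasure lborel ({x. 2 ^ k * L < u x} \<inter> ?A)
        \<le> ennreal (2 ^ ((k + 2) * p)) * ennreal (w * (\<rho> * (1 / 2 ^ ?N) ^ k) ^ ?N / 2)"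
      by (intro mult_left_mono decay) auto
    also have "\<dots> = ennreal (2 ^ ((k + 2) * p) * (w * (\<rho> * (1 / 2 ^ ?N) ^ k) ^ ?N / 2))"
      using w \<rho> by (intro ennreal_mult[symmetric]) auto
    also have "\<dots> \<le> ennreal (w * \<rho> ^ ?N / 2 * 2 ^ (2 * p) * (1/2) ^ k)"
    proof (rule ennreal_leI)
      have "?N * ?N = p + ?N" using dim by (cases ?N) (auto simp: p_def)
      then have "k * (?N * ?N) = k * p + k * ?N" by (simp add: algebra_simps)
      then have "(2::real) ^ (k * (?N * ?N)) = 2 ^ (k * p) * 2 ^ (k * ?N)" by (simp add: power_add)
      then have "(2::real) ^ (k * p) * ((1 / 2 ^ ?N) ^ k) ^ ?N = 1 / 2 ^ (k * ?N)"
        by (simp add: power_one_over power_divide flip: power_mult) (simp add: mult.commute mult.left_commute field_simps)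
      also have "\<dots> \<le> (1/2) ^ k"
        using dim power_increasing[of k "k * ?N" "2::real"] by (simp add: power_one_over field_simps)
      finally have "(2::real) ^ (k * p) * ((1 / 2 ^ ?N) ^ k) ^ ?N \<le> (1/2) ^ k" .
      then have "w * \<rho> ^ ?N / 2 * 2 ^ (2 * p) * ((2::real) ^ (k * p) * ((1 / 2 ^ ?N) ^ k) ^ ?N) \<le> w * \<rho> ^ ?N / 2 * 2 ^ (2 * p) * (1/2) ^ k"
        using w \<rho> by (intro mult_left_mono) auto
      moreover have "2 ^ ((k + 2) * p) * (w * (\<rho> * (1 / 2 ^ ?N) ^ k) ^ ?N / 2) = w * \<rho> ^ ?N / 2 * 2 ^ (2 * p) * ((2::real) ^ (k * p) * ((1 / 2 ^ ?N) ^ k) ^ ?N)"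
        by (simp add: add_mult_distrib power_add power_mult_distrib mult_2)
      ultimately show "2 ^ ((k + 2) * p) * (w * (\<rho> * (1 / 2 ^ ?N) ^ k) ^ ?N / 2) \<le> w * \<rho> ^ ?N / 2 * 2 ^ (2 * p) * (1/2) ^ k" by linarith
    qed
    finally show "ennreal (2 ^ ((k + 2) * p)) * emeasure lborel ({x. 2 ^ k * L < u x} \<inter> ?A) \<le> ennreal (w * \<rho> ^ ?N / 2 * 2 ^ (2 * p) * (1/2) ^ k)" .
  qed
  also have "(\<Sum>k. ennreal (w * \<rho> ^ ?N / 2 * 2 ^ (2 * p) * (1/2) ^ k)) = ennreal (w * \<rho> ^ ?N / 2 * 2 ^ (2 * p) * 2)"
  proof (rule suminf_ennreal_eq)
    show "(\<lambda>k. w * \<rho> ^ ?N / 2 * 2 ^ (2 * p) * (1/2) ^ k) sums (w * \<rho> ^ ?N / 2 * 2 ^ (2 * p) * 2)"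
      using geometric_sums[of "1/2::real"] by (intro sums_mult) simp
  qed (use w \<rho> in auto)
  also have "ennreal (2 ^ p) * ennreal (w * \<rho> ^ ?N / 2) + ennreal (w * \<rho> ^ ?N / 2 * 2 ^ (2 * p) * 2) = ennreal (moment_const * \<rho> ^ ?N)"
    using w \<rho> by (simp flip: ennreal_mult ennreal_plus) (simp add: moment_const_def w_def p_def algebra_simps)
  finally show ?thesis by (simp add: p_def)
qed

end

section \<open>Mass and energy estimates on one ball\<close>

lemma C1_cutoff_continuous:
  assumes "C1_cutoff \<eta> D\<eta>" shows "continuous_on UNIV \<eta>" "continuous_on UNIV D\<eta>"
  using assms
  by (auto simp: C1_cutoff_def intro!: continuous_at_imp_continuous_on has_derivative_continuous)

context growth_data begin

text \<open>The locale provides local integrability of J and Y^n; the integrands below vanish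
  outside a ball and are bounded by these two functions and a constant.\<close>

lemma integrable_of_bound:
  assumes f: "f \<in> borel_measurable borel" "\<And>x. \<bar>f x\<bar> \<le> c * (1 + Y x ^ DIM('a) + J x)" "\<And>x. R < norm x \<Longrightarrow> f x = (0::real)"
  shows "integrable lborel f"
proof (rule Bochner_Integration.integrable_bound)
  have "integrable lborel (\<lambda>x::'a. indicator (cball 0 R) x *\<^sub>R (1::real))"
    using integrable_real_indicator[OF _ emeasure_lborel_cball_finite[of "0::'a" R]] by simp
  moreover have "integrable lborel (\<lambda>x. indicator (cball 0 R) x *\<^sub>R (Y x ^ DIM('a)))" "integrable lborel (\<lambda>x. indicator (cball 0 R) x *\<^sub>R J x)"
    using Y(3)[of R] J(3)[of R] by (auto simp: set_integrable_def)
  ultimately show "integrable lborel (\<lambda>x. c * (indicator (cball 0 R) x *\<^sub>R (1::real) + indicator (cball 0 R) x *\<^sub>R (Y x ^ DIM('a)) + indicator (cball 0 R) x *\<^sub>R J x))"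
    by (intro integrable_mult_right Bochner_Integration.integrable_add)
  show "f \<in> borel_measurable lborel" using f(1) by simp
  show "AE x in lborel. norm (f x) \<le> norm (c * (indicator (cball 0 R) x *\<^sub>R (1::real) + indicator (cball 0 R) x *\<^sub>R (Y x ^ DIM('a)) + indicator (cball 0 R) x *\<^sub>R J x))"
  proof (intro AE_I2)
    fix x
    show "norm (f x) \<le> norm (c * (indicator (cball 0 R) x *\<^sub>R (1::real) + indicator (cball 0 R) x *\<^sub>R (Y x ^ DIM('a)) + indicator (cball 0 R) x *\<^sub>R J x))"
      using f(2)[of x] f(3)[of x] by (cases "norm x \<le> R") (auto simp: indicator_def)
  qed
qed

lemma Y_pow_le: "Y x ^ (DIM('a) - 1) \<le> 1 + Y x ^ DIM('a)"
proof (cases "Y x \<le> 1")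
  case True
  then have "Y x ^ (DIM('a) - 1) \<le> 1" using Y(2)[of x] by (simp add: power_le_one)
  then show ?thesis using Y(2)[of x] by (simp add: add_increasing2)
next
  case False
  then have "Y x ^ (DIM('a) - 1) \<le> Y x ^ DIM('a)" by (intro power_increasing) auto
  then show ?thesis by simp
qed

text \<open>The mass inequality with a cutoff of gradient at most 3 / r leaves the integral of
  Y^(n-1) / r over the annulus. On \<open>D\<close> write Y = L X V with X = Y / (L + u) and V = (L
  + u) / L and apply Young with \<epsilon>: this yields the energy of X and the moment V^(n (n-1)) /
  r^n, bounded by \<open>moment_bound\<close>. Off \<open>D\<close> Young with \<delta> gives
  \<delta> Y^n, at most \<delta> c J, and a volume over r^n, which is a constant.\<close>

lemma mass_estimate:
  assumes r: "0 < r" and \<rho>: "0 < \<rho>" "\<rho> \<le> r / 4" and L: "1 \<le> L" and e: "0 < e" "e \<le> small_exponent"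
    and D: "D \<in> sets borel" "{x. L < u x} \<subseteq> D"
    and small: "emeasure lborel (D \<inter> annulus x\<^sub>0 r (r / 2)) \<le> ennreal (unit_ball_vol (real DIM('a)) * \<rho> ^ DIM('a) / 2)"
    and E: "(\<integral>\<^sup>+x\<in>annulus x\<^sub>0 r (r / 2). ennreal ((Y x / (L + u x)) ^ DIM('a)) \<partial>lborel) \<le> ennreal (e ^ DIM('a))"
    and c: "0 < c" "AE x in lborel. x \<notin> D \<longrightarrow> Y x ^ DIM('a) \<le> c * J x"
    and eps: "0 < \<epsilon>" "0 < \<delta>"
  shows "(\<integral>\<^sup>+x\<in>ball x\<^sub>0 r. ennreal (J x) \<partial>lborel)
    \<le> ennreal (3 * C * L ^ (DIM('a) - 1) * (\<epsilon> * e ^ DIM('a) + moment_const * (\<rho> / r) ^ DIM('a) / \<epsilon> ^ (DIM('a) - 1)))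
      + ennreal (3 * C * \<delta> * c) * (\<integral>\<^sup>+x\<in>annulus x\<^sub>0 r 0. ennreal (J x) \<partial>lborel)
      + ennreal (3 * C * unit_ball_vol (real DIM('a)) * 2 ^ DIM('a) / \<delta> ^ (DIM('a) - 1))"
proof -
  let ?N = "DIM('a)" and ?A = "annulus x\<^sub>0 r 0"
  define w where "w = unit_ball_vol (real DIM('a))"
  have w: "0 < w" by (simp add: w_def)
  note [measurable] = D(1)
  have L0: "0 < L" using L by simp
  define p where "p = ?N * (?N - 1)"
  define X where "X x = Y x / (L + u x)" for x
  define V where "V x = (L + u x) / L" for x
  have X0: "0 \<le> X x" and V0: "1 \<le> V x" for x using Y(2)[of x] u(2)[of x] L by (auto simp: X_def V_def)
  have [measurable]: "X \<in> borel_measurable borel" "V \<in> borel_measurable borel"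
    unfolding X_def[abs_def] V_def[abs_def] by measurable
  obtain \<eta> D\<eta> where \<eta>: "C1_cutoff \<eta> D\<eta>" "\<And>x. 0 \<le> \<eta> x" "\<And>x. \<eta> x \<le> 1"
    "\<And>x. dist x\<^sub>0 x \<le> r \<Longrightarrow> \<eta> x = 1" "\<And>x. 2 * r \<le> dist x\<^sub>0 x \<Longrightarrow> \<eta> x = 0"
    "\<And>x. dist x\<^sub>0 x \<le> r \<Longrightarrow> D\<eta> x = 0" "\<And>x. 2 * r \<le> dist x\<^sub>0 x \<Longrightarrow> D\<eta> x = 0"
    "\<And>x. norm (D\<eta> x) \<le> 3 / r" using radial_cutoff[OF r] by metis
  have [measurable]: "\<eta> \<in> borel_measurable borel" "D\<eta> \<in> borel_measurable borel"
    using C1_cutoff_continuous[OF \<eta>(1)] borel_measurable_continuous_onI by blast+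
  have far: "2 * r \<le> dist x\<^sub>0 x" if "norm x\<^sub>0 + 2 * r < norm x" for x
    using that norm_triangle_sub[of x x\<^sub>0] by (simp add: dist_norm norm_minus_commute)
  have int: "integrable lborel (\<lambda>x. \<eta> x * J x)"
  proof (rule integrable_of_bound[where c=1])
    show "\<bar>\<eta> x * J x\<bar> \<le> 1 * (1 + Y x ^ ?N + J x)" for x
      using \<eta>(2,3)[of x] J(2)[of x] Y(2)[of x] mult_right_mono[of "\<eta> x" 1 "J x"]
      by (auto simp: abs_mult intro: add_increasing)
    show "norm x\<^sub>0 + 2 * r < norm x \<Longrightarrow> \<eta> x * J x = 0" for x using far \<eta>(5) by simp
  qed measurable
  have "(\<integral>\<^sup>+x\<in>ball x\<^sub>0 r. ennreal (J x) \<partial>lborel) \<le> (\<integral>\<^sup>+x. ennreal (\<eta> x * J x) \<partial>lborel)"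
    using \<eta>(4) by (intro nn_integral_mono) (auto simp: indicator_def)
  also have "\<dots> = ennreal (LINT x|lborel. \<eta> x * J x)"
    using \<eta>(2) J(2) by (intro nn_integral_eq_integral int) auto
  also have "\<dots> \<le> ennreal (C * (LINT x|lborel. norm (D\<eta> x) * Y x ^ (?N - 1)))"
    by (intro ennreal_leI mass \<eta>)
  also have "\<dots> = ennreal C * ennreal (LINT x|lborel. norm (D\<eta> x) * Y x ^ (?N - 1))"
    using C Y(2) by (intro ennreal_mult integral_nonneg) auto
  also have "\<dots> \<le> ennreal C * (\<integral>\<^sup>+x. ennreal (norm (D\<eta> x) * Y x ^ (?N - 1)) \<partial>lborel)"
    using Y(2) by (intro mult_left_mono ennreal_integral_le_nn_integral) auto
  also have "(\<integral>\<^sup>+x. ennreal (norm (D\<eta> x) * Y x ^ (?N - 1)) \<partial>lborel) \<le>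
     (\<integral>\<^sup>+x. ennreal (3 * (L ^ (?N - 1) * \<epsilon>)) * (ennreal (X x ^ ?N) * indicator (annulus x\<^sub>0 r (r/2)) x)
        + ennreal (3 * (L ^ (?N - 1) / (r ^ ?N * \<epsilon> ^ (?N - 1)))) * (ennreal (V x ^ p) * indicator (D \<inter> ?A) x)
        + ennreal (3 * (\<delta> * c)) * (ennreal (J x) * indicator ?A x)
        + ennreal (3 / (r ^ ?N * \<delta> ^ (?N - 1))) * indicator ?A x \<partial>lborel)"
  proof (rule nn_integral_mono_AE)
    show "AE x in lborel. ennreal (norm (D\<eta> x) * Y x ^ (?N - 1)) \<le> ennreal (3 * (L ^ (?N - 1) * \<epsilon>)) * (ennreal (X x ^ ?N) * indicator (annulus x\<^sub>0 r (r/2)) x)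
        + ennreal (3 * (L ^ (?N - 1) / (r ^ ?N * \<epsilon> ^ (?N - 1)))) * (ennreal (V x ^ p) * indicator (D \<inter> ?A) x)
        + ennreal (3 * (\<delta> * c)) * (ennreal (J x) * indicator ?A x)
        + ennreal (3 / (r ^ ?N * \<delta> ^ (?N - 1))) * indicator ?A x"
      using c(2)
    proof eventually_elim
      case (elim x)
      show ?case
      proof (cases "x \<in> ?A")
        case False
        then have "D\<eta> x = 0" using \<eta>(6,7)[of x] by (auto simp: annulus_def)
        then show ?thesis by simp
      next
        case True
        then have True': "x \<in> annulus x\<^sub>0 r (r/2)" using r by (auto simp: annulus_def)
        have "norm (D\<eta> x) * Y x ^ (?N - 1) \<le> 3 / r * Y x ^ (?N - 1)"
          using \<eta>(8) Y(2) by (intro mult_right_mono) auto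
        then have le: "ennreal (norm (D\<eta> x) * Y x ^ (?N - 1)) \<le> ennreal (3 * (Y x ^ (?N - 1) * (1 / r)))"
          by (intro ennreal_leI) simp
        show ?thesis
        proof (cases "x \<in> D")
          case D: True
          have "Y x = L * (X x * V x)" using L u(2)[of x] by (simp add: X_def V_def)
          then have "Y x ^ (?N - 1) * (1 / r) = L ^ (?N - 1) * (X x ^ (?N - 1) * (V x ^ (?N - 1) / r))"
            by (simp add: power_mult_distrib)
          also have "\<dots> \<le> L ^ (?N - 1) * (\<epsilon> * X x ^ ?N + (V x ^ (?N - 1) / r) ^ ?N / \<epsilon> ^ (?N - 1))"
            using L r X0[of x] V0[of x] eps dim by (intro mult_left_mono pow_mult_le_young) auto
          also have "(V x ^ (?N - 1) / r) ^ ?N = V x ^ p / r ^ ?N"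
            by (simp add: power_divide p_def mult.commute flip: power_mult)
          finally have "3 * (Y x ^ (?N - 1) * (1 / r)) \<le> 3 * (L ^ (?N - 1) * \<epsilon>) * X x ^ ?N + 3 * (L ^ (?N - 1) / (r ^ ?N * \<epsilon> ^ (?N - 1))) * V x ^ p"
            by (simp add: distrib_left)
          then have "ennreal (3 * (Y x ^ (?N - 1) * (1 / r))) \<le> ennreal (3 * (L ^ (?N - 1) * \<epsilon>)) * ennreal (X x ^ ?N) + ennreal (3 * (L ^ (?N - 1) / (r ^ ?N * \<epsilon> ^ (?N - 1)))) * ennreal (V x ^ p)"
            using L r X0[of x] V0[of x] eps by (simp flip: ennreal_mult ennreal_plus add: ennreal_leI)
          with le show ?thesis using D True True' by (auto intro: order_trans add_increasing2)
        next
          case D: False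
          then have yc: "Y x ^ ?N \<le> c * J x" using elim by simp
          have "Y x ^ (?N - 1) * (1 / r) \<le> \<delta> * Y x ^ ?N + (1 / r) ^ ?N / \<delta> ^ (?N - 1)"
            using r Y(2) eps dim by (intro pow_mult_le_young) auto
          also have "\<dots> \<le> \<delta> * (c * J x) + (1 / r) ^ ?N / \<delta> ^ (?N - 1)"
            using yc eps by (intro add_mono mult_left_mono) auto
          finally have "3 * (Y x ^ (?N - 1) * (1 / r)) \<le> 3 * (\<delta> * c) * J x + 3 / (r ^ ?N * \<delta> ^ (?N - 1))"
            by (simp add: power_divide)
          then have "ennreal (3 * (Y x ^ (?N - 1) * (1 / r))) \<le> ennreal (3 * (\<delta> * c)) * ennreal (J x) + ennreal (3 / (r ^ ?N * \<delta> ^ (?N - 1)))"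
            using r c J(2)[of x] eps by (simp flip: ennreal_mult ennreal_plus add: ennreal_leI)
          with le show ?thesis using D True by (auto simp: add.assoc intro: order_trans add_increasing)
        qed
      qed
    qed
  qed
  also have "\<dots> = ennreal (3 * (L ^ (?N - 1) * \<epsilon>)) * (\<integral>\<^sup>+x\<in>annulus x\<^sub>0 r (r/2). ennreal (X x ^ ?N) \<partial>lborel)
        + ennreal (3 * (L ^ (?N - 1) / (r ^ ?N * \<epsilon> ^ (?N - 1)))) * (\<integral>\<^sup>+x\<in>D \<inter> ?A. ennreal (V x ^ p) \<partial>lborel)
        + ennreal (3 * (\<delta> * c)) * (\<integral>\<^sup>+x\<in>?A. ennreal (J x) \<partial>lborel)
        + ennreal (3 / (r ^ ?N * \<delta> ^ (?N - 1))) * emeasure lborel ?A"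
    by (simp add: nn_integral_add nn_integral_cmult nn_integral_cmult_indicator)
  also have "\<dots> \<le> ennreal (3 * (L ^ (?N - 1) * \<epsilon>)) * ennreal (e ^ ?N)
        + ennreal (3 * (L ^ (?N - 1) / (r ^ ?N * \<epsilon> ^ (?N - 1)))) * ennreal (moment_const * \<rho> ^ ?N)
        + ennreal (3 * (\<delta> * c)) * (\<integral>\<^sup>+x\<in>?A. ennreal (J x) \<partial>lborel)
        + ennreal (3 / (r ^ ?N * \<delta> ^ (?N - 1))) * ennreal (w * (2 * r) ^ ?N)"
  proof (intro add_mono mult_left_mono order_refl zero_le)
    show "(\<integral>\<^sup>+x\<in>annulus x\<^sub>0 r (r/2). ennreal (X x ^ ?N) \<partial>lborel) \<le> ennreal (e ^ ?N)"
      using E by (simp add: X_def)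
    show "(\<integral>\<^sup>+x\<in>D \<inter> ?A. ennreal (V x ^ p) \<partial>lborel) \<le> ennreal (moment_const * \<rho> ^ ?N)"
      unfolding V_def p_def by (rule moment_bound[OF r \<rho> L0 e D small E])
    have "emeasure lborel ?A \<le> emeasure lborel (cball x\<^sub>0 (2 * r))"
      by (intro emeasure_mono) (auto simp: annulus_def)
    then show "emeasure lborel ?A \<le> ennreal (w * (2 * r) ^ ?N)"
      using r by (simp add: emeasure_cball w_def)
  qed
  also have "\<dots> = ennreal (3 * L ^ (?N - 1) * (\<epsilon> * e ^ ?N + moment_const * (\<rho> / r) ^ ?N / \<epsilon> ^ (?N - 1)))
        + ennreal (3 * \<delta> * c) * (\<integral>\<^sup>+x\<in>?A. ennreal (J x) \<partial>lborel)
        + ennreal (3 * w * 2 ^ ?N / \<delta> ^ (?N - 1))"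
  proof -
    have m: "0 \<le> moment_const" by (simp add: moment_const_def)
    have "ennreal (3 * (L ^ (?N - 1) * \<epsilon>)) * ennreal (e ^ ?N) + ennreal (3 * (L ^ (?N - 1) / (r ^ ?N * \<epsilon> ^ (?N - 1)))) * ennreal (moment_const * \<rho> ^ ?N)
       = ennreal (3 * (L ^ (?N - 1) * \<epsilon>) * e ^ ?N + 3 * (L ^ (?N - 1) / (r ^ ?N * \<epsilon> ^ (?N - 1))) * (moment_const * \<rho> ^ ?N))"
      using m L r eps \<rho> e by (simp flip: ennreal_mult ennreal_plus)
    also have "3 * (L ^ (?N - 1) * \<epsilon>) * e ^ ?N + 3 * (L ^ (?N - 1) / (r ^ ?N * \<epsilon> ^ (?N - 1))) * (moment_const * \<rho> ^ ?N)
       = 3 * L ^ (?N - 1) * (\<epsilon> * e ^ ?N + moment_const * (\<rho> / r) ^ ?N / \<epsilon> ^ (?N - 1))"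
      using r eps by (simp add: power_divide field_simps)
    finally have 1: "ennreal (3 * (L ^ (?N - 1) * \<epsilon>)) * ennreal (e ^ ?N) + ennreal (3 * (L ^ (?N - 1) / (r ^ ?N * \<epsilon> ^ (?N - 1)))) * ennreal (moment_const * \<rho> ^ ?N) = \<dots>" .
    have "ennreal (3 / (r ^ ?N * \<delta> ^ (?N - 1))) * ennreal (w * (2 * r) ^ ?N) = ennreal (3 / (r ^ ?N * \<delta> ^ (?N - 1)) * (w * (2 * r) ^ ?N))"
      using r eps w by (intro ennreal_mult[symmetric]) auto
    also have "3 / (r ^ ?N * \<delta> ^ (?N - 1)) * (w * (2 * r) ^ ?N) = 3 * w * 2 ^ ?N / \<delta> ^ (?N - 1)"
      using r by (simp add: power_mult_distrib)
    finally show ?thesis unfolding 1 by (simp add: mult.assoc)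
  qed
  finally show ?thesis
    using C eps L e c w \<rho> r
    by (simp add: distrib_left mult_left_mono mult.assoc w_def[symmetric] mult.assoc[symmetric, of "ennreal C"] mult.left_commute[of C 3] flip: ennreal_mult')
qed

end

context growth_data begin

text \<open>The gradient term of \<open>log_energy\<close> is split as in
  \<open>mass_estimate\<close>. On \<open>D\<close> Young absorbs half of the energy into the
  left-hand side and leaves the density of \<open>D\<close>; off \<open>D\<close> the quotient X is
  at most Y / L and Y^n at most c J, so what remains carries the factor L^(1-n).\<close>

lemma log_energy_bound:
  assumes r: "0 < r" and L: "1 \<le> L" and D: "D \<in> sets borel"
    and c: "1 \<le> c" "AE x in lborel. x \<notin> D \<longrightarrow> Y x ^ DIM('a) \<le> c * J x"
  shows "(\<integral>\<^sup>+x\<in>ball x\<^sub>0 (4 * r). ennreal ((Y x / (L + u x)) ^ DIM('a)) \<partial>lborel)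
    \<le> ennreal (4 * C * (LINT x:ball x\<^sub>0 (8 * r)|lborel. J x) / L ^ (DIM('a) - 1)
        + (2 * C) ^ DIM('a) * (measure lborel (D \<inter> ball x\<^sub>0 (8 * r)) / r ^ DIM('a))
        + 2 * C * c ^ (DIM('a) - 1) * (unit_ball_vol (real DIM('a)) * 8 ^ DIM('a)) / L ^ (DIM('a) - 1))"
proof -
  let ?N = "DIM('a)" and ?B = "ball x\<^sub>0 (8 * r)"
  define w where "w = unit_ball_vol (real DIM('a))"
  have w: "0 < w" by (simp add: w_def)
  note [measurable] = D(1)
  define X where "X x = Y x / (L + u x)" for x
  have X0: "0 \<le> X x" "X x \<le> Y x" "X x \<le> Y x / L" for x
  proof -
    show "0 \<le> X x" using Y(2)[of x] u(2)[of x] L by (simp add: X_def)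
    show "X x \<le> Y x / L" using Y(2)[of x] u(2)[of x] L by (auto simp: X_def intro!: divide_left_mono)
    also have "Y x / L \<le> Y x" using Y(2)[of x] L by (simp add: divide_le_eq mult_left_le mult_le_cancel_left1)
    finally show "X x \<le> Y x" .
  qed
  have [measurable]: "X \<in> borel_measurable borel"
    unfolding X_def[abs_def] by measurable
  obtain \<eta> D\<eta> where \<eta>: "C1_cutoff \<eta> D\<eta>" "\<And>x. 0 \<le> \<eta> x" "\<And>x. \<eta> x \<le> 1"
    "\<And>x. dist x\<^sub>0 x \<le> 4 * r \<Longrightarrow> \<eta> x = 1" "\<And>x. 2 * (4 * r) \<le> dist x\<^sub>0 x \<Longrightarrow> \<eta> x = 0"
    "\<And>x. dist x\<^sub>0 x \<le> 4 * r \<Longrightarrow> D\<eta> x = 0" "\<And>x. 2 * (4 * r) \<le> dist x\<^sub>0 x \<Longrightarrow> D\<eta> x = 0"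
    "\<And>x. norm (D\<eta> x) \<le> 3 / (4 * r)" using radial_cutoff[of "4 * r"] r by (metis mult_pos_pos zero_less_numeral)
  have D\<eta>: "norm (D\<eta> x) \<le> 1 / r" for x using \<eta>(8)[of x] r by (rule_tac order_trans) (auto simp: field_simps)
  have [measurable]: "\<eta> \<in> borel_measurable borel" "D\<eta> \<in> borel_measurable borel"
    using C1_cutoff_continuous[OF \<eta>(1)] borel_measurable_continuous_onI by blast+
  have out: "\<eta> x = 0" "D\<eta> x = 0" if "x \<notin> ?B" for x using that \<eta>(5,7)[of x] by auto
  have far: "x \<notin> ?B" if "norm x\<^sub>0 + 8 * r < norm x" for x
    using that norm_triangle_sub[of x x\<^sub>0] by (simp add: dist_norm norm_minus_commute)
  have \<eta>X: "0 \<le> \<eta> x * X x" "\<eta> x * X x \<le> Y x" "\<eta> x * X x \<le> Y x / L" for x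
  proof -
    show "0 \<le> \<eta> x * X x" using \<eta>(2) X0 by simp
    have "\<eta> x * X x \<le> 1 * X x" using \<eta>(3) X0(1) by (intro mult_right_mono) auto
    then show "\<eta> x * X x \<le> Y x" "\<eta> x * X x \<le> Y x / L" using X0[of x] by auto
  qed
  have JY: "0 \<le> J x" "0 \<le> Y x ^ ?N" "0 \<le> Y x" for x using J(2) Y(2) by auto
  have i1: "integrable lborel (\<lambda>x. (\<eta> x * X x) ^ ?N)"
  proof (rule integrable_of_bound[where c=1])
    show "\<bar>(\<eta> x * X x) ^ ?N\<bar> \<le> 1 * (1 + Y x ^ ?N + J x)" for x
    proof -
      have "(\<eta> x * X x) ^ ?N \<le> Y x ^ ?N" using \<eta>X[of x] by (intro power_mono)
      moreover have "0 \<le> (\<eta> x * X x) ^ ?N" using \<eta>X(1)[of x] by (rule zero_le_power)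
      ultimately show ?thesis using JY(1)[of x] unfolding mult_1 by (simp only: abs_of_nonneg)
    qed
    show "norm x\<^sub>0 + 8 * r < norm x \<Longrightarrow> (\<eta> x * X x) ^ ?N = 0" for x using out far by simp
  qed measurable
  have i2: "integrable lborel (\<lambda>x. \<eta> x ^ ?N * J x)"
  proof (rule integrable_of_bound[where c=1])
    show "\<bar>\<eta> x ^ ?N * J x\<bar> \<le> 1 * (1 + Y x ^ ?N + J x)" for x
    proof -
      have "\<eta> x ^ ?N * J x \<le> 1 * J x" using \<eta>(2,3)[of x] JY(1)[of x] by (intro mult_right_mono power_le_one)
      moreover have "0 \<le> \<eta> x ^ ?N * J x" using \<eta>(2)[of x] JY(1)[of x] by simp
      ultimately show ?thesis using JY(2)[of x] unfolding mult_1 by (simp only: abs_of_nonneg)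
    qed
    show "norm x\<^sub>0 + 8 * r < norm x \<Longrightarrow> \<eta> x ^ ?N * J x = 0" for x using out far by simp
  qed measurable
  have i3: "integrable lborel (\<lambda>x. (\<eta> x * X x) ^ (?N - 1) * norm (D\<eta> x))"
  proof (rule integrable_of_bound[where c="1/r"])
    show "\<bar>(\<eta> x * X x) ^ (?N - 1) * norm (D\<eta> x)\<bar> \<le> 1/r * (1 + Y x ^ ?N + J x)" for x
    proof -
      have "(\<eta> x * X x) ^ (?N - 1) * norm (D\<eta> x) \<le> Y x ^ (?N - 1) * (1/r)"
        using \<eta>X[of x] D\<eta>[of x] JY[of x] by (intro mult_mono power_mono) auto
      also have "\<dots> \<le> (1 + Y x ^ ?N + J x) * (1/r)"
        using Y_pow_le[of x] JY[of x] r by (intro mult_right_mono) auto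
      finally show ?thesis using \<eta>X(1)[of x] by (simp add: mult.commute)
    qed
    show "norm x\<^sub>0 + 8 * r < norm x \<Longrightarrow> (\<eta> x * X x) ^ (?N - 1) * norm (D\<eta> x) = 0" for x using out far by simp
  qed measurable
  have [measurable]: "?B \<in> sets borel" by simp
  have fin: "emeasure lborel ?B < \<infinity>" by (rule emeasure_lborel_ball_finite)
  have i4: "integrable lborel (\<lambda>x. indicator (D \<inter> ?B) x :: real)"
    using emeasure_mono[of "D \<inter> ?B" ?B lborel] fin by (intro integrable_real_indicator) auto
  have i5: "integrable lborel (\<lambda>x. indicator ?B x * J x)"
  proof (rule integrable_of_bound[where c=1])
    show "\<bar>indicator ?B x * J x\<bar> \<le> 1 * (1 + Y x ^ ?N + J x)" for x
      using JY[of x] by (auto simp: indicator_def)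
    show "norm x\<^sub>0 + 8 * r < norm x \<Longrightarrow> indicator ?B x * J x = 0" for x using far by simp
  qed measurable
  have i6: "integrable lborel (\<lambda>x. indicator ?B x :: real)"
    using fin by (intro integrable_real_indicator) auto
  define m8 where "m8 = (LINT x|lborel. indicator ?B x * J x)"
  define d where "d = measure lborel (D \<inter> ?B) / r ^ ?N"
  have "(LINT x|lborel. (\<eta> x * X x) ^ (?N - 1) * norm (D\<eta> x)) \<le>
      (LINT x|lborel. 1 / (2 * C) * (\<eta> x * X x) ^ ?N + (2 * C) ^ (?N - 1) / r ^ ?N * indicator (D \<inter> ?B) x
        + (1 / L ^ (?N - 1) * (indicator ?B x * J x) + c ^ (?N - 1) / (r ^ ?N * L ^ (?N - 1)) * indicator ?B x))"
  proof (rule integral_mono_AE)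
    show "AE x in lborel. (\<eta> x * X x) ^ (?N - 1) * norm (D\<eta> x) \<le> 1 / (2 * C) * (\<eta> x * X x) ^ ?N + (2 * C) ^ (?N - 1) / r ^ ?N * indicator (D \<inter> ?B) x
        + (1 / L ^ (?N - 1) * (indicator ?B x * J x) + c ^ (?N - 1) / (r ^ ?N * L ^ (?N - 1)) * indicator ?B x)"
      using c(2)
    proof eventually_elim
      case (elim x)
      define a1 where "a1 = 1 / (2 * C) * (\<eta> x * X x) ^ ?N"
      have a1: "0 \<le> a1" using \<eta>X(1)[of x] C by (simp add: a1_def)
      define a2 where "a2 = 1 / L ^ (?N - 1) * (indicator ?B x * J x)"
      define a3 where "a3 = c ^ (?N - 1) / (r ^ ?N * L ^ (?N - 1)) * indicator ?B x"
      have a23: "0 \<le> a2" "0 \<le> a3" using JY[of x] L c r by (auto simp: a2_def a3_def)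
      show ?case
      proof (cases "x \<in> ?B")
        case False
        then show ?thesis using out[OF False] a1 unfolding a1_def[symmetric] a2_def[symmetric] a3_def[symmetric]
          using a23 dim by (simp add: indicator_def)
      next
        case B: True
        show ?thesis
        proof (cases "x \<in> D")
          case True
          \<comment> \<open>The weight 1 / (2 C) becomes 1/2 after multiplication by C, so the
            energy, finite by \<open>i1\<close>, can be absorbed.\<close>
          have "(\<eta> x * X x) ^ (?N - 1) * norm (D\<eta> x) \<le> 1 / (2 * C) * (\<eta> x * X x) ^ ?N + norm (D\<eta> x) ^ ?N / (1 / (2 * C)) ^ (?N - 1)"
            using \<eta>X(1)[of x] C dim by (intro pow_mult_le_young) auto
          also have "norm (D\<eta> x) ^ ?N / (1 / (2 * C)) ^ (?N - 1) = (2 * C) ^ (?N - 1) * norm (D\<eta> x) ^ ?N"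
            by (simp add: power_divide)
          also have "\<dots> \<le> (2 * C) ^ (?N - 1) * (1 / r) ^ ?N"
            using D\<eta>[of x] C by (intro mult_left_mono power_mono) auto
          finally have "(\<eta> x * X x) ^ (?N - 1) * norm (D\<eta> x) \<le> a1 + (2 * C) ^ (?N - 1) / r ^ ?N"
            by (simp add: a1_def power_divide)
          then show ?thesis using B True a23 unfolding a1_def[symmetric] a2_def[symmetric] a3_def[symmetric] by simp
        next
          case False
          then have yc: "Y x ^ ?N \<le> c * J x" using elim by simp
          have "(\<eta> x * X x) ^ (?N - 1) * norm (D\<eta> x) \<le> (Y x / L) ^ (?N - 1) * (1 / r)"
            using \<eta>X[of x] D\<eta>[of x] JY[of x] L by (intro mult_mono power_mono) auto
          also have "\<dots> = 1 / L ^ (?N - 1) * (Y x ^ (?N - 1) * (1 / r))" by (simp add: power_divide)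
          \<comment> \<open>The weight 1 / c turns the bound c J for Y^n into J.\<close>
          also have "\<dots> \<le> 1 / L ^ (?N - 1) * ((1 / c) * Y x ^ ?N + (1 / r) ^ ?N / (1 / c) ^ (?N - 1))"
            using JY[of x] r c L dim by (intro mult_left_mono pow_mult_le_young) auto
          also have "\<dots> \<le> 1 / L ^ (?N - 1) * (J x + (1 / r) ^ ?N / (1 / c) ^ (?N - 1))"
            using yc c L by (intro mult_left_mono add_right_mono) (auto simp: field_simps)
          also have "\<dots> = a2 + a3" using B by (simp add: a2_def a3_def power_divide add_divide_distrib)
          finally show ?thesis using False a1 unfolding a1_def[symmetric] a2_def[symmetric] a3_def[symmetric] by simp
        qed
      qed
    qed
    show "integrable lborel (\<lambda>x. 1 / (2 * C) * (\<eta> x * X x) ^ ?N + (2 * C) ^ (?N - 1) / r ^ ?N * indicator (D \<inter> ?B) x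
        + (1 / L ^ (?N - 1) * (indicator ?B x * J x) + c ^ (?N - 1) / (r ^ ?N * L ^ (?N - 1)) * indicator ?B x))"
      using i1 i4 i5 i6 by (intro Bochner_Integration.integrable_add integrable_mult_right)
  qed (rule i3)
  also have "\<dots> = 1 / (2 * C) * (LINT x|lborel. (\<eta> x * X x) ^ ?N) + (2 * C) ^ (?N - 1) * d
      + (1 / L ^ (?N - 1) * m8 + c ^ (?N - 1) / (r ^ ?N * L ^ (?N - 1)) * measure lborel ?B)"
    using i1 i4 i5 i6 by (simp add: d_def m8_def)
  finally have B: "(LINT x|lborel. (\<eta> x * X x) ^ (?N - 1) * norm (D\<eta> x)) \<le> 1 / (2 * C) * (LINT x|lborel. (\<eta> x * X x) ^ ?N) + (2 * C) ^ (?N - 1) * d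
      + (1 / L ^ (?N - 1) * m8 + c ^ (?N - 1) / (r ^ ?N * L ^ (?N - 1)) * measure lborel ?B)" .
  have "measure lborel ?B = w * (8 * r) ^ ?N"
    using r by (simp add: w_def content_ball)
  then have "c ^ (?N - 1) / (r ^ ?N * L ^ (?N - 1)) * measure lborel ?B = c ^ (?N - 1) * (w * 8 ^ ?N) / L ^ (?N - 1)"
    using r by (simp add: power_mult_distrib)
  note B = B[unfolded this]
  have J8: "(LINT x|lborel. \<eta> x ^ ?N * J x) \<le> m8"
    unfolding m8_def
  proof (rule integral_mono[OF i2 i5])
    fix x
    show "\<eta> x ^ ?N * J x \<le> indicator ?B x * J x"
      using JY[of x] \<eta>(2,3)[of x] out[of x] mult_right_mono[of "\<eta> x ^ ?N" 1 "J x"] dim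
      by (auto simp: indicator_def power_le_one zero_power)
  qed
  define I where "I = (LINT x|lborel. (\<eta> x * X x) ^ ?N)"
  define Q where "Q = L ^ (?N - 1)"
  have Q: "0 < Q" using L by (simp add: Q_def)
  have "I \<le> C / Q * (LINT x|lborel. \<eta> x ^ ?N * J x) + C * (LINT x|lborel. (\<eta> x * X x) ^ (?N - 1) * norm (D\<eta> x))"
    unfolding I_def X_def Q_def by (intro log_energy \<eta> L)
  also have "\<dots> \<le> C / Q * m8 + C * (1 / (2 * C) * I + (2 * C) ^ (?N - 1) * d + (1 / Q * m8 + c ^ (?N - 1) * (w * 8 ^ ?N) / Q))"
    using C Q J8 B unfolding I_def[symmetric] Q_def[symmetric] by (intro add_mono mult_left_mono) auto
  also have "\<dots> = I / 2 + (2 * C * m8 / Q + C * (2 * C) ^ (?N - 1) * d + C * c ^ (?N - 1) * (w * 8 ^ ?N) / Q)"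
    using C by (simp add: field_simps)
  finally have "I \<le> 4 * C * m8 / Q + 2 * C * (2 * C) ^ (?N - 1) * d + 2 * C * c ^ (?N - 1) * (w * 8 ^ ?N) / Q"
    by simp
  moreover have "2 * C * (2 * C) ^ (?N - 1) = (2 * C) ^ ?N" using dim by (cases ?N) auto
  ultimately have I: "I \<le> 4 * C * m8 / Q + (2 * C) ^ ?N * d + 2 * C * c ^ (?N - 1) * (w * 8 ^ ?N) / Q" by simp
  have "(\<integral>\<^sup>+x\<in>ball x\<^sub>0 (4 * r). ennreal (X x ^ ?N) \<partial>lborel) \<le> (\<integral>\<^sup>+x. ennreal ((\<eta> x * X x) ^ ?N) \<partial>lborel)"
    using \<eta>(4) by (intro nn_integral_mono) (auto simp: indicator_def)
  also have "\<dots> = ennreal I" unfolding I_def using \<eta>X(1) by (intro nn_integral_eq_integral i1) auto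
  also have "\<dots> \<le> ennreal (4 * C * m8 / Q + (2 * C) ^ ?N * d + 2 * C * c ^ (?N - 1) * (w * 8 ^ ?N) / Q)"
    by (rule ennreal_leI[OF I])
  finally show ?thesis
    by (simp add: m8_def Q_def X_def d_def w_def set_lebesgue_integral_def)
qed

end

section \<open>Contradictions on heavy doubling balls and on light annuli\<close>

context growth_data begin

lemma annulus_subset_ball: "0 < r \<Longrightarrow> s \<le> r \<Longrightarrow> annulus x\<^sub>0 r s \<subseteq> ball x\<^sub>0 (4 * r)"
  by (auto simp: annulus_def)

lemma small_exponent_pos: "0 < small_exponent"
  using C by (auto simp: small_exponent_def intro!: divide_pos_pos mult_pos_pos add_pos_pos)

lemma superlevel_borel: "{x. b < u x} \<in> sets borel"
  by measurable

lemma upper_off_superlevel: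
  "AE x in lborel. x \<notin> {x. b < u x} \<longrightarrow> Y x ^ DIM('a) \<le> (C * exp b) * J x"
  using upper
proof eventually_elim
  case (elim x)
  show ?case
  proof
    assume "x \<notin> {x. b < u x}"
    then have "C * exp (u x) * J x \<le> C * exp b * J x"
      using J(2)[of x] C by (intro mult_right_mono mult_left_mono) auto
    with elim show "Y x ^ DIM('a) \<le> (C * exp b) * J x" by simp
  qed
qed

text \<open>With \<rho> = \<sigma> r a density relative to r^n becomes the volume hypothesis of the
  level iteration, so \<sigma> can be chosen independently of the ball.\<close>

lemma scaled_small:
  assumes "0 < r" "measure lborel (D \<inter> ball x\<^sub>0 (8 * r)) / r ^ DIM('a) \<le> d" "D \<in> sets borel"
    "d \<le> unit_ball_vol (real DIM('a)) * \<sigma> ^ DIM('a) / 2"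
  shows "emeasure lborel (D \<inter> annulus x\<^sub>0 r (r / 2)) \<le> ennreal (unit_ball_vol (real DIM('a)) * (\<sigma> * r) ^ DIM('a) / 2)"
proof -
  have sub: "annulus x\<^sub>0 r (r / 2) \<subseteq> ball x\<^sub>0 (8 * r)"
    using assms(1) by (auto simp: annulus_def)
  have "emeasure lborel (D \<inter> annulus x\<^sub>0 r (r / 2)) \<le> emeasure lborel (D \<inter> ball x\<^sub>0 (8 * r))"
    using sub assms(3) by (intro emeasure_mono) auto
  also have "\<dots> = ennreal (measure lborel (D \<inter> ball x\<^sub>0 (8 * r)))"
    using emeasure_mono[of "D \<inter> ball x\<^sub>0 (8 * r)" "ball x\<^sub>0 (8 * r)" lborel] emeasure_lborel_ball_finite[of x\<^sub>0 "8 * r"]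
    by (intro emeasure_eq_ennreal_measure) (auto simp: top_unique)
  also have "\<dots> \<le> ennreal (unit_ball_vol (real DIM('a)) * (\<sigma> * r) ^ DIM('a) / 2)"
  proof (rule ennreal_leI)
    have "measure lborel (D \<inter> ball x\<^sub>0 (8 * r)) / r ^ DIM('a) \<le> unit_ball_vol (real DIM('a)) * \<sigma> ^ DIM('a) / 2"
      using order_trans[OF assms(2,4)] .
    then have "measure lborel (D \<inter> ball x\<^sub>0 (8 * r)) \<le> unit_ball_vol (real DIM('a)) * \<sigma> ^ DIM('a) / 2 * r ^ DIM('a)"
      using assms(1) by (simp add: pos_divide_le_eq)
    then show "measure lborel (D \<inter> ball x\<^sub>0 (8 * r)) \<le> unit_ball_vol (real DIM('a)) * (\<sigma> * r) ^ DIM('a) / 2"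
      by (simp add: power_mult_distrib)
  qed
  finally show ?thesis .
qed

text \<open>With L^(n-1) = \<Lambda> M the main terms scale like M. The three terms of
  \<open>log_energy_bound\<close> are each at most a third of the energy threshold: the first is of
  order H / \<Lambda> by doubling, the second comes from the density of \<open>D\<close>, the third
  is small because M is large. Then \<open>mass_estimate\<close> bounds M by M/4 + M/8 +
  M/8.\<close>

lemma no_heavy_doubling_ball:
  assumes r: "0 < r" and M: "0 < M" "(\<integral>\<^sup>+x\<in>ball x\<^sub>0 r. ennreal (J x) \<partial>lborel) = ennreal M"
    and H: "0 \<le> H" "(\<integral>\<^sup>+x\<in>ball x\<^sub>0 (8 * r). ennreal (J x) \<partial>lborel) \<le> ennreal (H * M)"
    and b: "1 \<le> b" and D: "D = {x. b < u x}" "measure lborel (D \<inter> ball x\<^sub>0 (8 * r)) / r ^ DIM('a) \<le> d"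
    and \<Lambda>: "0 < \<Lambda>" "b ^ (DIM('a) - 1) \<le> \<Lambda> * M"
    and sz: "4 * C * H / \<Lambda> \<le> small_exponent ^ DIM('a) / 3" "(2 * C) ^ DIM('a) * d \<le> small_exponent ^ DIM('a) / 3"
      "2 * C * (C * exp b) ^ (DIM('a) - 1) * (unit_ball_vol (real DIM('a)) * 8 ^ DIM('a)) / (\<Lambda> * M) \<le> small_exponent ^ DIM('a) / 3"
    and \<sigma>: "0 < \<sigma>" "\<sigma> \<le> 1/4" "d \<le> unit_ball_vol (real DIM('a)) * \<sigma> ^ DIM('a) / 2"
    and eps: "0 < \<epsilon>" "0 < \<delta>" "3 * C * \<Lambda> * (\<epsilon> * small_exponent ^ DIM('a) + moment_const * \<sigma> ^ DIM('a) / \<epsilon> ^ (DIM('a) - 1)) \<le> 1/4"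
      "3 * C * \<delta> * (C * exp b) * H \<le> 1/8" "3 * C * unit_ball_vol (real DIM('a)) * 2 ^ DIM('a) / \<delta> ^ (DIM('a) - 1) \<le> M / 8"
  shows False
proof -
  let ?N = "DIM('a)"
  define w where "w = unit_ball_vol (real DIM('a))"
  define L where "L = root (?N - 1) (\<Lambda> * M)"
  have N1: "0 < ?N - 1" using dim by simp
  have L: "L ^ (?N - 1) = \<Lambda> * M" unfolding L_def using N1 \<Lambda> M by (intro real_root_pow_pos2) auto
  have "root (?N - 1) (b ^ (?N - 1)) \<le> L" unfolding L_def using N1 \<Lambda>(2) by simp
  moreover have "root (?N - 1) (b ^ (?N - 1)) = b" using N1 b by (intro real_root_power_cancel) auto
  ultimately have Lb: "b \<le> L" by simp
  with b have L1: "1 \<le> L" by simp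
  have DL: "{x. L < u x} \<subseteq> D" using D Lb by auto
  have Db: "D \<in> sets borel" using D superlevel_borel by simp
  have cb: "1 \<le> C * exp b" using C b mult_mono[of 1 C 1 "exp b"] by simp
  have off: "AE x in lborel. x \<notin> D \<longrightarrow> Y x ^ ?N \<le> (C * exp b) * J x"
    unfolding D(1) by (rule upper_off_superlevel)
  define m8 where "m8 = (LINT x:ball x\<^sub>0 (8 * r)|lborel. J x)"
  have "ennreal m8 \<le> (\<integral>\<^sup>+x. ennreal (indicator (ball x\<^sub>0 (8 * r)) x * J x) \<partial>lborel)"
    unfolding m8_def set_lebesgue_integral_def real_scaleR_def
  proof (rule ennreal_integral_le_nn_integral)
    show "(\<lambda>x. indicator (ball x\<^sub>0 (8 * r)) x * J x) \<in> borel_measurable lborel"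
      using J(1) by (intro borel_measurable_times borel_measurable_indicator) auto
  qed (use J(2) in auto)
  also have "\<dots> = (\<integral>\<^sup>+x\<in>ball x\<^sub>0 (8 * r). ennreal (J x) \<partial>lborel)"
    by (intro nn_integral_cong) (auto simp: indicator_def)
  also have "\<dots> \<le> ennreal (H * M)" by (rule H)
  finally have m8: "m8 \<le> H * M" using H M by (simp add: ennreal_le_iff)
  have "(\<integral>\<^sup>+x\<in>annulus x\<^sub>0 r (r / 2). ennreal ((Y x / (L + u x)) ^ ?N) \<partial>lborel) \<le> (\<integral>\<^sup>+x\<in>ball x\<^sub>0 (4 * r). ennreal ((Y x / (L + u x)) ^ ?N) \<partial>lborel)"
    using annulus_subset_ball[of r "r / 2" x\<^sub>0] r by (intro nn_integral_mono) (auto simp: indicator_def)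
  also have "\<dots> \<le> ennreal (4 * C * m8 / L ^ (?N - 1) + (2 * C) ^ ?N * (measure lborel (D \<inter> ball x\<^sub>0 (8 * r)) / r ^ ?N)
        + 2 * C * (C * exp b) ^ (?N - 1) * (unit_ball_vol (real ?N) * 8 ^ ?N) / L ^ (?N - 1))"
    unfolding m8_def by (rule log_energy_bound[OF r L1 Db cb off])
  also have "\<dots> \<le> ennreal (small_exponent ^ ?N)"
  proof (rule ennreal_leI)
    have "4 * C * m8 / (\<Lambda> * M) \<le> 4 * C * (H * M) / (\<Lambda> * M)"
      using m8 C \<Lambda> M by (intro divide_right_mono mult_left_mono) auto
    also have "\<dots> = 4 * C * H / \<Lambda>" using M by simp
    finally have 1: "4 * C * m8 / (\<Lambda> * M) \<le> small_exponent ^ ?N / 3" using sz(1) by simp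
    have "(2 * C) ^ ?N * (measure lborel (D \<inter> ball x\<^sub>0 (8 * r)) / r ^ ?N) \<le> (2 * C) ^ ?N * d"
      using D(2) C by (intro mult_left_mono) auto
    with 1 sz show "4 * C * m8 / L ^ (?N - 1) + (2 * C) ^ ?N * (measure lborel (D \<inter> ball x\<^sub>0 (8 * r)) / r ^ ?N)
        + 2 * C * (C * exp b) ^ (?N - 1) * (unit_ball_vol (real ?N) * 8 ^ ?N) / L ^ (?N - 1) \<le> small_exponent ^ ?N"
      unfolding L by linarith
  qed
  finally have E: "(\<integral>\<^sup>+x\<in>annulus x\<^sub>0 r (r / 2). ennreal ((Y x / (L + u x)) ^ ?N) \<partial>lborel) \<le> ennreal (small_exponent ^ ?N)" .
  have \<rho>: "0 < \<sigma> * r" "\<sigma> * r \<le> r / 4" using \<sigma> r by auto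
  have "ennreal M \<le> ennreal (3 * C * L ^ (?N - 1) * (\<epsilon> * small_exponent ^ ?N + moment_const * (\<sigma> * r / r) ^ ?N / \<epsilon> ^ (?N - 1)))
      + ennreal (3 * C * \<delta> * (C * exp b)) * (\<integral>\<^sup>+x\<in>annulus x\<^sub>0 r 0. ennreal (J x) \<partial>lborel)
      + ennreal (3 * C * unit_ball_vol (real ?N) * 2 ^ ?N / \<delta> ^ (?N - 1))"
    unfolding M(2)[symmetric]
    using cb by (rule_tac mass_estimate[OF r \<rho> L1 small_exponent_pos order_refl Db DL scaled_small[OF r D(2) Db \<sigma>(3)] E _ off eps(1,2)]) auto
  also have "\<dots> \<le> ennreal (M / 4) + ennreal (3 * C * \<delta> * (C * exp b)) * ennreal (H * M) + ennreal (M / 8)"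
  proof (intro add_mono mult_left_mono ennreal_leI eps(5) zero_le)
    have "3 * C * L ^ (?N - 1) * (\<epsilon> * small_exponent ^ ?N + moment_const * (\<sigma> * r / r) ^ ?N / \<epsilon> ^ (?N - 1))
       = M * (3 * C * \<Lambda> * (\<epsilon> * small_exponent ^ ?N + moment_const * \<sigma> ^ ?N / \<epsilon> ^ (?N - 1)))"
      unfolding L using r by simp
    also have "\<dots> \<le> M * (1/4)" using eps(3) M by (intro mult_left_mono) auto
    finally show "3 * C * L ^ (?N - 1) * (\<epsilon> * small_exponent ^ ?N + moment_const * (\<sigma> * r / r) ^ ?N / \<epsilon> ^ (?N - 1)) \<le> M / 4" by simp
    have "(\<integral>\<^sup>+x\<in>annulus x\<^sub>0 r 0. ennreal (J x) \<partial>lborel) \<le> (\<integral>\<^sup>+x\<in>ball x\<^sub>0 (8 * r). ennreal (J x) \<partial>lborel)"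
      using annulus_subset_ball[of r 0 x\<^sub>0] r by (intro nn_integral_mono) (auto simp: indicator_def)
    then show "(\<integral>\<^sup>+x\<in>annulus x\<^sub>0 r 0. ennreal (J x) \<partial>lborel) \<le> ennreal (H * M)" using H(2) by (rule order_trans)
  qed
  also have "\<dots> = ennreal (M / 4 + 3 * C * \<delta> * (C * exp b) * (H * M) + M / 8)"
    using M C eps H by (simp flip: ennreal_mult ennreal_plus)
  finally have "M \<le> M / 4 + 3 * C * \<delta> * (C * exp b) * (H * M) + M / 8"
    using M C eps H by (subst (asm) ennreal_le_iff) auto
  moreover have "3 * C * \<delta> * (C * exp b) * (H * M) \<le> 1/8 * M"
    using mult_right_mono[OF eps(4), of M] M by (simp add: mult.assoc)
  ultimately show False using M by linarith
qed

text \<open>\<open>log_energy_bound\<close> with \<open>D = UNIV\<close>, where the condition off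
  \<open>D\<close> is vacuous. The density term is then the volume of a ball over r^n, a constant,
  so the bound does not depend on the radius.\<close>

lemma total_log_energy_finite:
  assumes M: "\<And>r. (LINT x:ball 0 r|lborel. J x) \<le> M" and L: "1 \<le> L"
  shows "\<exists>B. \<forall>n::nat. (\<integral>\<^sup>+x\<in>ball 0 n. ennreal ((Y x / (L + u x)) ^ DIM('a)) \<partial>lborel) \<le> ennreal B"
proof -
  let ?N = "DIM('a)"
  define B where "B = 4 * C * M / L ^ (?N - 1) + (2 * C) ^ ?N * (unit_ball_vol (real ?N) * 8 ^ ?N)
        + 2 * C * 1 ^ (?N - 1) * (unit_ball_vol (real ?N) * 8 ^ ?N) / L ^ (?N - 1)"
  have "(\<integral>\<^sup>+x\<in>ball 0 n. ennreal ((Y x / (L + u x)) ^ ?N) \<partial>lborel) \<le> ennreal B" for n :: nat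
  proof -
    define r where "r = (real n + 1) / 4"
    have r: "0 < r" by (simp add: r_def)
    have "(\<integral>\<^sup>+x\<in>ball 0 n. ennreal ((Y x / (L + u x)) ^ ?N) \<partial>lborel) \<le> (\<integral>\<^sup>+x\<in>ball 0 (4 * r). ennreal ((Y x / (L + u x)) ^ ?N) \<partial>lborel)"
      by (intro nn_integral_mono) (auto simp: indicator_def r_def)
    also have "\<dots> \<le> ennreal (4 * C * (LINT x:ball 0 (8 * r)|lborel. J x) / L ^ (?N - 1)
        + (2 * C) ^ ?N * (measure lborel (UNIV \<inter> ball (0::'a) (8 * r)) / r ^ ?N)
        + 2 * C * 1 ^ (?N - 1) * (unit_ball_vol (real ?N) * 8 ^ ?N) / L ^ (?N - 1))"
      by (rule log_energy_bound[OF r L]) auto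
    also have "\<dots> \<le> ennreal B"
    proof (rule ennreal_leI)
      have "measure lborel (UNIV \<inter> ball (0::'a) (8 * r)) / r ^ ?N = unit_ball_vol (real ?N) * 8 ^ ?N"
        using r by (simp add: content_ball power_mult_distrib)
      moreover have "4 * C * (LINT x:ball 0 (8 * r)|lborel. J x) / L ^ (?N - 1) \<le> 4 * C * M / L ^ (?N - 1)"
        using M[of "8 * r"] C L by (intro divide_right_mono mult_left_mono) auto
      ultimately show "4 * C * (LINT x:ball 0 (8 * r)|lborel. J x) / L ^ (?N - 1)
        + (2 * C) ^ ?N * (measure lborel (UNIV \<inter> ball (0::'a) (8 * r)) / r ^ ?N)
        + 2 * C * 1 ^ (?N - 1) * (unit_ball_vol (real ?N) * 8 ^ ?N) / L ^ (?N - 1) \<le> B"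
        unfolding B_def by simp
    qed
    finally show ?thesis .
  qed
  then show ?thesis by blast
qed

end

text \<open>The uniform bound makes the whole integral finite, so continuity from above applies to
  the complements of the balls.\<close>

lemma nn_integral_tail_small:
  fixes f :: "'a::euclidean_space \<Rightarrow> ennreal"
  assumes f: "f \<in> borel_measurable borel" and B: "\<And>n::nat. (\<integral>\<^sup>+x\<in>ball 0 n. f x \<partial>lborel) \<le> ennreal B" and e: "0 < e"
  shows "\<forall>\<^sub>F n in sequentially. (\<integral>\<^sup>+x\<in>- ball 0 (real n). f x \<partial>lborel) < ennreal e"
proof -
  define \<nu> where "\<nu> = density lborel f"
  have s: "sets \<nu> = sets borel" by (simp add: \<nu>_def)
  have em: "emeasure \<nu> S = (\<integral>\<^sup>+x\<in>S. f x \<partial>lborel)" if "S \<in> sets borel" for S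
    unfolding \<nu>_def using f that by (subst emeasure_density) auto
  have U: "(\<Union>n. ball (0::'a) (real n)) = UNIV"
    using reals_Archimedean2 by (auto simp: set_eq_iff)
  have "emeasure \<nu> UNIV = (SUP n. emeasure \<nu> (ball 0 (real n)))"
    unfolding U[symmetric] by (intro SUP_emeasure_incseq[symmetric]) (auto simp: s incseq_def)
  also have "\<dots> \<le> ennreal B" using B by (intro SUP_least) (simp add: em)
  finally have fin: "emeasure \<nu> UNIV \<le> ennreal B" .
  have "(\<lambda>n. emeasure \<nu> (- ball 0 (real n))) \<longlonglongrightarrow> emeasure \<nu> (\<Inter>n. - ball (0::'a) (real n))"
  proof (rule Lim_emeasure_decseq)
    show "range (\<lambda>n. - ball (0::'a) (real n)) \<subseteq> sets \<nu>" by (auto simp: s)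
    show "decseq (\<lambda>n. - ball (0::'a) (real n))" by (auto simp: decseq_def)
    show "emeasure \<nu> (- ball 0 (real n)) \<noteq> \<infinity>" for n
      using emeasure_mono[of "- ball 0 (real n)" UNIV \<nu>] fin by (auto simp: s top_unique)
  qed
  moreover have "(\<Inter>n. - ball (0::'a) (real n)) = {}" using U by blast
  ultimately have "(\<lambda>n. emeasure \<nu> (- ball 0 (real n))) \<longlonglongrightarrow> 0" by simp
  then have "\<forall>\<^sub>F n in sequentially. emeasure \<nu> (- ball 0 (real n)) < ennreal e"
    using e by (intro order_tendstoD) auto
  then show ?thesis by eventually_elim (simp add: em)
qed

text \<open>Otherwise the volumes of at least q disjoint pieces would add up to more than the volume
  of the ball. The bound is the same for all balls; the index is not.\<close>

lemma exists_small_disjoint: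
  fixes D :: "'i \<Rightarrow> 'a::euclidean_space set"
  assumes "finite I" "0 < q" "q \<le> card I" "\<And>i. i \<in> I \<Longrightarrow> D i \<in> sets borel" "disjoint_family_on D I" "0 < r"
  shows "\<exists>i\<in>I. measure lborel (D i \<inter> ball x\<^sub>0 (8 * r)) / r ^ DIM('a) \<le> unit_ball_vol (real DIM('a)) * 8 ^ DIM('a) / q"
proof (rule ccontr)
  let ?B = "ball x\<^sub>0 (8 * r)"
  assume "\<not> ?thesis"
  then have lt: "\<And>i. i \<in> I \<Longrightarrow> unit_ball_vol (real DIM('a)) * 8 ^ DIM('a) / q < measure lborel (D i \<inter> ?B) / r ^ DIM('a)" by force
  have fB: "?B \<in> fmeasurable lborel"
    using emeasure_lborel_ball_finite[of x\<^sub>0 "8 * r"] by (simp add: fmeasurable_def)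
  have fm: "D i \<inter> ?B \<in> fmeasurable lborel" if "i \<in> I" for i
    using fB by (rule fmeasurableI2) (use assms(4)[OF that] in auto)
  have "(\<Sum>i\<in>I. measure lborel (D i \<inter> ?B)) = measure lborel (\<Union>i\<in>I. D i \<inter> ?B)"
    using assms(1,5) fm by (intro measure_UNION'[symmetric]) (auto simp: disjoint_family_on_def pairwise_def disjnt_def)
  also have "\<dots> \<le> measure lborel ?B"
    using fm fB assms(1) by (intro measure_mono_fmeasurable sets.finite_UN) (auto intro!: sets.Int[of _ borel] assms(4))
  also have "\<dots> = unit_ball_vol (real DIM('a)) * 8 ^ DIM('a) * r ^ DIM('a)"
    using assms(6) by (simp add: content_ball power_mult_distrib)
  finally have 1: "(\<Sum>i\<in>I. measure lborel (D i \<inter> ?B) / r ^ DIM('a)) \<le> unit_ball_vol (real DIM('a)) * 8 ^ DIM('a)"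
    using assms(6) by (simp add: divide_le_eq flip: sum_divide_distrib)
  have "I \<noteq> {}" using assms by auto
  then have "(\<Sum>i\<in>I. unit_ball_vol (real DIM('a)) * 8 ^ DIM('a) / q) < (\<Sum>i\<in>I. measure lborel (D i \<inter> ?B) / r ^ DIM('a))"
    using assms(1) lt by (intro sum_strict_mono) auto
  with 1 have "card I * (unit_ball_vol (real DIM('a)) * 8 ^ DIM('a) / q) < unit_ball_vol (real DIM('a)) * 8 ^ DIM('a)" by simp
  moreover have "q * (unit_ball_vol (real DIM('a)) * 8 ^ DIM('a) / q) \<le> card I * (unit_ball_vol (real DIM('a)) * 8 ^ DIM('a) / q)"
    using assms(3) by (intro mult_right_mono) auto
  ultimately show False using assms(2) by simp
qed

context growth_data begin

text \<open>Variant for finite total mass. A fixed mass m sits in the ball, whereas energy and mass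
  on the annulus can be made as small as desired; the level L stays at b, and each of the three
  terms of \<open>mass_estimate\<close> is at most m/4.\<close>

lemma no_light_annulus:
  assumes r: "0 < r" and m: "0 < m" "ennreal m \<le> (\<integral>\<^sup>+x\<in>ball x\<^sub>0 r. ennreal (J x) \<partial>lborel)"
    and b: "1 \<le> b" and D: "D = {x. b < u x}" "measure lborel (D \<inter> ball x\<^sub>0 (8 * r)) / r ^ DIM('a) \<le> d"
    and \<sigma>: "0 < \<sigma>" "\<sigma> \<le> 1/4" "d \<le> unit_ball_vol (real DIM('a)) * \<sigma> ^ DIM('a) / 2"
    and e: "0 < e" "e \<le> small_exponent"
    and E: "(\<integral>\<^sup>+x\<in>annulus x\<^sub>0 r (r / 2). ennreal ((Y x / (b + u x)) ^ DIM('a)) \<partial>lborel) \<le> ennreal (e ^ DIM('a))"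
    and eps: "0 < \<epsilon>" "0 < \<delta>" "3 * C * b ^ (DIM('a) - 1) * (\<epsilon> * e ^ DIM('a) + moment_const * \<sigma> ^ DIM('a) / \<epsilon> ^ (DIM('a) - 1)) \<le> m / 4"
      "ennreal (3 * C * \<delta> * (C * exp b)) * (\<integral>\<^sup>+x\<in>annulus x\<^sub>0 r 0. ennreal (J x) \<partial>lborel) \<le> ennreal (m / 4)"
      "3 * C * unit_ball_vol (real DIM('a)) * 2 ^ DIM('a) / \<delta> ^ (DIM('a) - 1) \<le> m / 4"
  shows False
proof -
  have Db: "D \<in> sets borel" using D superlevel_borel by simp
  have cb: "0 < C * exp b" using C by simp
  have off: "AE x in lborel. x \<notin> D \<longrightarrow> Y x ^ DIM('a) \<le> (C * exp b) * J x"
    unfolding D(1) by (rule upper_off_superlevel)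
  have \<rho>: "0 < \<sigma> * r" "\<sigma> * r \<le> r / 4" using \<sigma> r by auto
  have DL: "{x. b < u x} \<subseteq> D" using D by simp
  note m(2)
  also note mass_estimate[OF r \<rho> b e Db DL scaled_small[OF r D(2) Db \<sigma>(3)] E cb off eps(1,2)]
  also have "3 * C * b ^ (DIM('a) - 1) * (\<epsilon> * e ^ DIM('a) + moment_const * (\<sigma> * r / r) ^ DIM('a) / \<epsilon> ^ (DIM('a) - 1))
      = 3 * C * b ^ (DIM('a) - 1) * (\<epsilon> * e ^ DIM('a) + moment_const * \<sigma> ^ DIM('a) / \<epsilon> ^ (DIM('a) - 1))"
    using r by simp
  also have "ennreal (3 * C * b ^ (DIM('a) - 1) * (\<epsilon> * e ^ DIM('a) + moment_const * \<sigma> ^ DIM('a) / \<epsilon> ^ (DIM('a) - 1)))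
      + ennreal (3 * C * \<delta> * (C * exp b)) * (\<integral>\<^sup>+x\<in>annulus x\<^sub>0 r 0. ennreal (J x) \<partial>lborel)
      + ennreal (3 * C * unit_ball_vol (real DIM('a)) * 2 ^ DIM('a) / \<delta> ^ (DIM('a) - 1))
      \<le> ennreal (m / 4) + ennreal (m / 4) + ennreal (m / 4)"
    by (intro add_mono ennreal_leI eps)
  also have "\<dots> = ennreal (3 * m / 4)" using m by (simp flip: ennreal_plus)
  finally show False using m by (simp add: ennreal_le_iff)
qed

end

section \<open>Choice of the constants\<close>

lemma large_power_exists:
  fixes a b :: real assumes "0 < b" "1 \<le> n"
  obtains t where "1 \<le> t" "a / t ^ n \<le> b"
proof
  define t where "t = max 1 (a / b)"
  show "1 \<le> t" by (simp add: t_def)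
  then have "t \<le> t ^ n" using assms by (simp add: self_le_power)
  moreover have "a / b \<le> t" by (simp add: t_def)
  ultimately have "a / b \<le> t ^ n" by linarith
  then show "a / t ^ n \<le> b" using assms \<open>1 \<le> t\<close> by (simp add: field_simps)
qed

lemma small_power_exists:
  fixes a b c :: real assumes "0 < b" "0 < c" "1 \<le> n" "0 \<le> a"
  obtains t where "0 < t" "t \<le> c" "a * t ^ n \<le> b"
proof
  define t where "t = min (min 1 c) (b / (a + 1))"
  show t: "0 < t" "t \<le> c" using assms by (auto simp: t_def)
  have "t \<le> 1" by (simp add: t_def)
  then have "t ^ n \<le> t" using t assms(3) by (simp add: power_le_one_iff power_decreasing[of 1 n t, simplified])
  then have "a * t ^ n \<le> a * t" using assms by (intro mult_left_mono)
  also have "\<dots> \<le> a * (b / (a + 1))" using assms by (intro mult_left_mono) (auto simp: t_def)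
  also have "\<dots> \<le> b" using assms by (simp add: field_simps)
  finally show "a * t ^ n \<le> b" .
qed

text \<open>The threshold precedes \<open>J\<close>, \<open>I\<close> and \<open>b\<close> in the
  order of quantifiers, since the level may be arbitrarily high. A whole family is considered
  because the index with small density changes with the ball.\<close>

theorem growth_family_bound:
  fixes C :: real
  shows "\<exists>q\<^sub>0::nat. \<forall>(J :: 'a::euclidean_space \<Rightarrow> real) (u :: 'i \<Rightarrow> 'a \<Rightarrow> real) Y I b.
    finite I \<longrightarrow> q\<^sub>0 \<le> card I \<longrightarrow> (\<forall>i\<in>I. growth_data C J (u i) (Y i)) \<longrightarrow>
    disjoint_family_on (\<lambda>i. {x. b < u i x}) I \<longrightarrow> (AE x in lborel. J x = 0)"
proof (cases "1 \<le> C \<and> 2 \<le> DIM('a)")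
  \<comment> \<open>The assumptions \<open>C\<close> and \<open>dim\<close> of the locale fail, so a
    nonempty family is already contradictory.\<close>
  case False
  show ?thesis
  proof (intro exI[of _ 1] allI impI)
    fix J :: "'a \<Rightarrow> real" and u :: "'i \<Rightarrow> 'a \<Rightarrow> real" and Y I b
    assume "finite I" "1 \<le> card I" "\<forall>i\<in>I. growth_data C J (u i) (Y i)"
    moreover from this obtain i where "i \<in> I" by fastforce
    ultimately have "growth_data C J (u i) (Y i)" by blast
    then have False using False growth_data.C growth_data.dim by blast
    then show "AE x in lborel. J x = 0" ..
  qed
next
  case True
  then have C: "1 \<le> C" and dim: "2 \<le> DIM('a)" by auto
  let ?N = "DIM('a)"
  define w where "w = unit_ball_vol (real ?N)"
  have w: "0 < w" by (simp add: w_def)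
  define s where "s = (1 / 2 ^ ?N) ^ ?N * w / (12 * C * (w + 2))"
  have s: "0 < s" using C w by (auto simp: s_def intro!: divide_pos_pos mult_pos_pos add_pos_pos)
  define K where "K = w / 2 * (2 ^ (?N * (?N - 1)) + 2 ^ (2 * (?N * (?N - 1)) + 1))"
  have K: "0 < K" using w by (auto simp: K_def intro!: mult_pos_pos add_pos_pos)
  obtain P :: "'a set" and c :: nat where P: "finite P" "P \<subseteq> cball 0 1"
    "cball 0 1 \<subseteq> (\<Union>p\<in>P. ball p (1/16))" "card P \<le> c" "2 \<le> c" by (rule ball_covering)
  define H where "H = (real c)^2"
  have H: "0 \<le> H" by (simp add: H_def)
  \<comment> \<open>\<Lambda> brings the energy below the threshold s^n, \<epsilon> then compensates
    the factor \<Lambda> in the mass estimate, and \<sigma> the negative power of \<epsilon>; none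
    of them depends on \<open>b\<close> or \<open>J\<close>.\<close>
  obtain \<Lambda> where \<Lambda>: "1 \<le> \<Lambda>" "4 * C * H / \<Lambda> ^ 1 \<le> s ^ ?N / 3"
    by (rule large_power_exists[of "s ^ ?N / 3" 1 "4 * C * H"]) (use s in auto)
  obtain \<epsilon> where \<epsilon>: "0 < \<epsilon>" "\<epsilon> \<le> 1" "3 * C * \<Lambda> * s ^ ?N * \<epsilon> ^ 1 \<le> 1/8"
    by (rule small_power_exists[of "1/8" 1 1 "3 * C * \<Lambda> * s ^ ?N"]) (use s C \<Lambda> in auto)
  obtain \<sigma> where \<sigma>: "0 < \<sigma>" "\<sigma> \<le> 1/4" "3 * C * \<Lambda> * K / \<epsilon> ^ (?N - 1) * \<sigma> ^ ?N \<le> 1/8"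
    by (rule small_power_exists[of "1/8" "1/4" ?N "3 * C * \<Lambda> * K / \<epsilon> ^ (?N - 1)"]) (use K C \<Lambda> \<epsilon> dim in auto)
  \<comment> \<open>Two requirements on the pigeonhole density w 8^n / q: q1 fits it to the scale
    \<sigma>, q2 keeps its share of the energy below a third of the threshold.\<close>
  obtain q1 where q1: "1 \<le> q1" "w * 8 ^ ?N / q1 ^ 1 \<le> w * \<sigma> ^ ?N / 2"
    by (rule large_power_exists[of "w * \<sigma> ^ ?N / 2" 1 "w * 8 ^ ?N"]) (use w \<sigma> in auto)
  obtain q2 where q2: "1 \<le> q2" "(2 * C) ^ ?N * (w * 8 ^ ?N) / q2 ^ 1 \<le> s ^ ?N / 3"
    by (rule large_power_exists[of "s ^ ?N / 3" 1 "(2 * C) ^ ?N * (w * 8 ^ ?N)"]) (use s in auto)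
  define q where "q = nat \<lceil>max q1 q2\<rceil>"
  have q: "q1 \<le> q" "q2 \<le> q" using q1 q2 by (auto simp: q_def le_nat_iff) linarith+
  then have q0: "0 < q" using q1 by (cases q) auto
  define d where "d = w * 8 ^ ?N / q"
  have "d \<le> w * 8 ^ ?N / q1 ^ 1" unfolding d_def using q q1 w by (intro divide_left_mono) auto
  with q1 have "d \<le> w * \<sigma> ^ ?N / 2" by linarith
  have "(2 * C) ^ ?N * d = (2 * C) ^ ?N * (w * 8 ^ ?N) / q" by (simp add: d_def)
  also have "\<dots> \<le> (2 * C) ^ ?N * (w * 8 ^ ?N) / q2 ^ 1" using q q2 w C by (intro divide_left_mono) auto
  finally have d2: "(2 * C) ^ ?N * d \<le> s ^ ?N / 3" using q2 by linarith
  show ?thesis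
  proof (intro exI[of _ q] allI impI)
    fix J :: "'a \<Rightarrow> real" and u :: "'i \<Rightarrow> 'a \<Rightarrow> real" and Y I b0
    assume I: "finite I" "q \<le> card I" and gd: "\<forall>i\<in>I. growth_data C J (u i) (Y i)"
      and disj0: "disjoint_family_on (\<lambda>i. {x. b0 < u i x}) I"
    have gd: "growth_data C J (u i) (Y i)" if "i \<in> I" for i using gd that by blast
    have "I \<noteq> {}" using I q0 by auto
    then obtain i0 where i0: "i0 \<in> I" by blast
    interpret i0: growth_data C J "u i0" "Y i0" by (rule gd[OF i0])
    \<comment> \<open>The logarithmic energy estimate is stated for L at least 1, and raising the
      level keeps the sets disjoint.\<close>
    define b where "b = max 1 b0"
    have b: "1 \<le> b" by (simp add: b_def)
    define D where "D i = {x. b < u i x}" for i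
    have disj: "disjoint_family_on D I" using disj0 by (auto simp: disjoint_family_on_def D_def b_def)
    have Db: "D i \<in> sets borel" if "i \<in> I" for i
      unfolding D_def by (rule growth_data.superlevel_borel[OF gd[OF that]])
    have small: "\<exists>i\<in>I. measure lborel (D i \<inter> ball x (8 * r)) / r ^ ?N \<le> d" if "0 < r" for x r
      unfolding d_def w_def using exists_small_disjoint[OF I(1) q0 I(2) Db disj that] by blast
    have se: "growth_data.small_exponent TYPE('a) C = s" "growth_data.moment_const TYPE('a) = K"
      using i0.small_exponent_def i0.moment_const_def by (auto simp: s_def w_def K_def)
    define m where "m x r = (LINT y:ball x r|lborel. J y)" for x r
    have Jint: "integrable lborel (\<lambda>y. indicator (ball x r) y * J y)" for x r
    proof -
      have "set_integrable lborel (ball x r) J"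
      proof (rule set_integrable_subset[OF i0.J(3)[of "norm x + r"]])
        show "ball x r \<subseteq> cball 0 (norm x + r)"
        proof
          fix y assume "y \<in> ball x r"
          then show "y \<in> cball 0 (norm x + r)"
            using norm_triangle_sub[of y x] by (simp add: dist_norm norm_minus_commute)
        qed
      qed simp
      then show ?thesis by (simp add: set_integrable_def)
    qed
    have m: "(\<integral>\<^sup>+y\<in>ball x r. ennreal (J y) \<partial>lborel) = ennreal (m x r)" for x r
    proof -
      have "(\<integral>\<^sup>+y\<in>ball x r. ennreal (J y) \<partial>lborel) = (\<integral>\<^sup>+y. ennreal (indicator (ball x r) y * J y) \<partial>lborel)"
        by (intro nn_integral_cong) (auto simp: indicator_def)
      also have "\<dots> = ennreal (m x r)" unfolding m_def set_lebesgue_integral_def real_scaleR_def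
        using i0.J(2) by (intro nn_integral_eq_integral Jint) auto
      finally show ?thesis .
    qed
    have m0: "0 \<le> m x r" for x r
      unfolding m_def set_lebesgue_integral_def using i0.J(2) by (intro Bochner_Integration.integral_nonneg) auto
    define \<mu> where "\<mu> = density lborel (\<lambda>y. ennreal (J y))"
    have \<mu>: "emeasure \<mu> S = (\<integral>\<^sup>+y\<in>S. ennreal (J y) \<partial>lborel)" if "S \<in> sets borel" for S
      unfolding \<mu>_def using i0.J(1) that by (subst emeasure_density) auto
    have \<mu>m: "measure \<mu> (ball x r) = m x r" for x r
      using m0[of x r] by (simp add: measure_def \<mu> m)
    show "AE x in lborel. J x = 0"
    proof (cases "\<exists>M. \<forall>r. m 0 r \<le> M")
      case False
      \<comment> \<open>\<delta> depends on exp b; the resulting large constants are compensated by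
        the mass \<open>M0\<close> demanded of the ball, not by the number of sets.\<close>
      define \<delta> where "\<delta> = 1 / (8 * (3 * C * (C * exp b) * (H + 1)))"
      have \<delta>: "0 < \<delta>" using C H by (auto simp: \<delta>_def intro!: divide_pos_pos mult_pos_pos)
      have \<delta>H: "3 * C * \<delta> * (C * exp b) * H \<le> 1/8"
      proof -
        have "3 * C * \<delta> * (C * exp b) * H \<le> 3 * C * \<delta> * (C * exp b) * (H + 1)"
          using C \<delta> by (intro mult_left_mono) auto
        also have "\<dots> = \<delta> * (3 * C * (C * exp b) * (H + 1))" by simp
        also have "\<dots> = 1/8"
        proof -
          have "3 * C * (C * exp b) * (H + 1) \<noteq> 0" using C H by auto
          then show ?thesis by (simp add: \<delta>_def)
        qed
        finally show ?thesis .
      qed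
      define T where "T = 2 * C * (C * exp b) ^ (?N - 1) * (w * 8 ^ ?N)"
      have T: "0 \<le> T" using C w by (simp add: T_def)
      define T' where "T' = 3 * C * w * 2 ^ ?N / \<delta> ^ (?N - 1)"
      \<comment> \<open>The sum of the lower bounds on the mass: for b \<le> L, for the last energy
        term and for the volume term.\<close>
      define M0 where "M0 = b ^ (?N - 1) + T / (s ^ ?N / 3) + 8 * \<bar>T'\<bar> + 1"
      have pos: "0 \<le> b ^ (?N - 1)" "0 \<le> T / (s ^ ?N / 3)" using b T s by auto
      have M0: "0 < M0" "b ^ (?N - 1) \<le> M0" "T / (s ^ ?N / 3) \<le> M0" "8 * T' \<le> M0"
        unfolding M0_def using pos by linarith+
      obtain r0 where r0: "c * M0 < m 0 r0" using False by (meson not_le)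
      have "0 < r0"
      proof (rule ccontr)
        assume "\<not> 0 < r0"
        then have "m 0 r0 = 0" by (simp add: m_def set_lebesgue_integral_def ball_empty not_less)
        moreover have "0 \<le> c * M0" using M0 by simp
        ultimately show False using r0 by simp
      qed
      then obtain x r where xr: "0 < r" "M0 \<le> m x r" "m x (8 * r) \<le> H * m x r"
        using exists_doubling_ball[OF P, of \<mu> M0 r0 0] M0 r0 m0
        by (auto simp: \<mu>m \<mu> m H_def) (auto simp: \<mu>_def)
      obtain i where i: "i \<in> I" "measure lborel (D i \<inter> ball x (8 * r)) / r ^ ?N \<le> d" using small[OF xr(1)] by blast
      interpret growth_data C J "u i" "Y i" by (rule gd[OF i(1)])
      have M: "0 < m x r" using xr M0 by simp
      have False
      proof (rule no_heavy_doubling_ball[OF xr(1) M m H _ b D_def i(2), where \<Lambda>=\<Lambda> and \<sigma>=\<sigma> and \<epsilon>=\<epsilon> and \<delta>=\<delta>, unfolded se, folded w_def, folded T_def T'_def])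
        show "(\<integral>\<^sup>+y\<in>ball x (8 * r). ennreal (J y) \<partial>lborel) \<le> ennreal (H * m x r)"
          unfolding m using xr by (intro ennreal_leI)
        show "0 < \<Lambda>" using \<Lambda> by simp
        have \<Lambda>M: "M0 \<le> \<Lambda> * m x r" using xr(2) M mult_right_mono[OF \<Lambda>(1), of "m x r"] by linarith
        then show "b ^ (?N - 1) \<le> \<Lambda> * m x r" using M0 by linarith
        show "4 * C * H / \<Lambda> \<le> s ^ ?N / 3" using \<Lambda>(2) by simp
        show "(2 * C) ^ ?N * d \<le> s ^ ?N / 3" by (rule d2)
        have "T / (s ^ ?N / 3) \<le> \<Lambda> * m x r" using \<Lambda>M M0 by linarith
        then have "T \<le> (\<Lambda> * m x r) * (s ^ ?N / 3)" using s by (subst (asm) pos_divide_le_eq) auto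
        then show "T / (\<Lambda> * m x r) \<le> s ^ ?N / 3"
          using \<Lambda> M by (subst pos_divide_le_eq) (auto simp: mult.commute)
        show "0 < \<sigma>" "\<sigma> \<le> 1/4" "d \<le> w * \<sigma> ^ ?N / 2" "0 < \<epsilon>" "0 < \<delta>" by fact+
        have "3 * C * \<Lambda> * (\<epsilon> * s ^ ?N + K * \<sigma> ^ ?N / \<epsilon> ^ (?N - 1)) = 3 * C * \<Lambda> * s ^ ?N * \<epsilon> ^ 1 + 3 * C * \<Lambda> * K / \<epsilon> ^ (?N - 1) * \<sigma> ^ ?N"
          by (simp add: distrib_left)
        then show "3 * C * \<Lambda> * (\<epsilon> * s ^ ?N + K * \<sigma> ^ ?N / \<epsilon> ^ (?N - 1)) \<le> 1/4"
          using \<epsilon>(3) \<sigma>(3) by linarith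
        show "3 * C * \<delta> * (C * exp b) * H \<le> 1/8" by (rule \<delta>H)
        show "T' \<le> m x r / 8" using M0(4) xr(2) by linarith
      qed
      then show ?thesis ..
    next
      case True
      then obtain Mt where Mt: "\<And>r. m 0 r \<le> Mt" by blast
      show ?thesis
      proof (rule ccontr)
        assume "\<not> ?thesis"
        moreover have "ennreal (J y) = 0 \<longleftrightarrow> J y = 0" for y
          using i0.J(2)[of y] by (auto simp: ennreal_eq_0_iff)
        ultimately have ne: "\<not> (AE y in lborel. ennreal (J y) = 0)" by simp
        have "\<exists>n::nat. 0 < m 0 n"
        proof (rule ccontr)
          assume "\<not> ?thesis"
          then have z: "m 0 (real n) = 0" for n :: nat using m0[of 0 n] by (simp add: order_antisym not_less)
          have "\<forall>n::nat. AE y in lborel. ennreal (J y) * indicator (ball 0 n) y = 0"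
          proof
            fix n :: nat
            have "(\<lambda>y. ennreal (J y) * indicator (ball 0 (real n)) y) \<in> borel_measurable lborel"
              using i0.J(1) by (intro borel_measurable_times_ennreal borel_measurable_indicator) auto
            moreover have "(\<integral>\<^sup>+y\<in>ball 0 (real n). ennreal (J y) \<partial>lborel) = 0" using m[of 0] z by simp
            ultimately show "AE y in lborel. ennreal (J y) * indicator (ball 0 (real n)) y = 0"
              by (simp add: nn_integral_0_iff_AE)
          qed
          then have "AE y in lborel. \<forall>n::nat. ennreal (J y) * indicator (ball 0 n) y = 0"
            unfolding AE_all_countable .
          then have "AE y in lborel. ennreal (J y) = 0"
          proof eventually_elim
            case (elim y)
            obtain n :: nat where "norm y < n" using reals_Archimedean2 by blast
            then show ?case using spec[OF elim, of n] by simp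
          qed
          with ne show False by blast
        qed
        then obtain n1 :: nat where n1: "0 < m 0 n1" by blast
        define m1 where "m1 = m 0 n1"
        have m1: "0 < m1" using n1 by (simp add: m1_def)
        define Lb where "Lb = b ^ (?N - 1)"
        have Lb: "0 < Lb" using b by (simp add: Lb_def)
        \<comment> \<open>Here \<sigma> is already fixed, so \<epsilon> is taken large to shrink the
          moment term. The energy term is then made small through e, which is possible because the
          energy tends to 0 at infinity.\<close>
        obtain \<epsilon> where \<epsilon>: "1 \<le> \<epsilon>" "3 * C * Lb * K * \<sigma> ^ ?N / \<epsilon> ^ (?N - 1) \<le> m1 / 8"
          by (rule large_power_exists[of "m1 / 8" "?N - 1" "3 * C * Lb * K * \<sigma> ^ ?N"]) (use m1 dim in auto)
        obtain e where e: "0 < e" "e \<le> s" "3 * C * Lb * \<epsilon> * e ^ ?N \<le> m1 / 8"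
          by (rule small_power_exists[of "m1 / 8" s ?N "3 * C * Lb * \<epsilon>"]) (use m1 s dim C Lb \<epsilon> in auto)
        obtain \<delta> where \<delta>: "1 \<le> \<delta>" "3 * C * w * 2 ^ ?N / \<delta> ^ (?N - 1) \<le> m1 / 4"
          by (rule large_power_exists[of "m1 / 4" "?N - 1" "3 * C * w * 2 ^ ?N"]) (use m1 dim in auto)
        define \<tau> where "\<tau> = m1 / 4 / (3 * C * \<delta> * (C * exp b))"
        have \<tau>: "0 < \<tau>" "3 * C * \<delta> * (C * exp b) * \<tau> = m1 / 4"
          using m1 C \<delta> by (auto simp: \<tau>_def intro!: divide_pos_pos mult_pos_pos)
        have ev1: "\<forall>\<^sub>F n in sequentially. \<forall>i\<in>I. (\<integral>\<^sup>+y\<in>- ball 0 (real n). ennreal ((Y i y / (b + u i y)) ^ ?N) \<partial>lborel) < ennreal (e ^ ?N)"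
        proof (intro eventually_ball_finite I(1) ballI)
          fix i assume i: "i \<in> I"
          interpret growth_data C J "u i" "Y i" by (rule gd[OF i])
          obtain B where B: "\<And>n::nat. (\<integral>\<^sup>+y\<in>ball 0 n. ennreal ((Y i y / (b + u i y)) ^ ?N) \<partial>lborel) \<le> ennreal B"
            using total_log_energy_finite[OF Mt[unfolded m_def] b] by blast
          show "\<forall>\<^sub>F n in sequentially. (\<integral>\<^sup>+y\<in>- ball 0 (real n). ennreal ((Y i y / (b + u i y)) ^ ?N) \<partial>lborel) < ennreal (e ^ ?N)"
            by (rule nn_integral_tail_small[OF _ B]) (use e in auto)
        qed
        have ev2: "\<forall>\<^sub>F n in sequentially. (\<integral>\<^sup>+y\<in>- ball 0 (real n). ennreal (J y) \<partial>lborel) < ennreal \<tau>"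
          by (rule nn_integral_tail_small[of _ Mt]) (use \<tau> Mt m i0.J(1) in \<open>auto intro: ennreal_leI\<close>)
        have "\<forall>\<^sub>F n in sequentially. n1 + 1 \<le> n" by (rule eventually_ge_at_top)
        with ev1 ev2 have "\<forall>\<^sub>F n in sequentially. n1 + 1 \<le> n \<and> (\<integral>\<^sup>+y\<in>- ball 0 (real n). ennreal (J y) \<partial>lborel) < ennreal \<tau> \<and>
           (\<forall>i\<in>I. (\<integral>\<^sup>+y\<in>- ball 0 (real n). ennreal ((Y i y / (b + u i y)) ^ ?N) \<partial>lborel) < ennreal (e ^ ?N))"
          by eventually_elim auto
        then obtain n where n: "n1 + 1 \<le> n" "(\<integral>\<^sup>+y\<in>- ball 0 (real n). ennreal (J y) \<partial>lborel) < ennreal \<tau>"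
          "\<And>i. i \<in> I \<Longrightarrow> (\<integral>\<^sup>+y\<in>- ball 0 (real n). ennreal ((Y i y / (b + u i y)) ^ ?N) \<partial>lborel) < ennreal (e ^ ?N)"
          using eventually_happens'[OF sequentially_bot] by blast
        \<comment> \<open>The annulus thickened by r / 2 starts at distance r - r / 2 = n from the
          origin, hence lies where the tails were estimated.\<close>
        define r where "r = 2 * real n"
        have r: "0 < r" using n by (simp add: r_def)
        obtain i where i: "i \<in> I" "measure lborel (D i \<inter> ball 0 (8 * r)) / r ^ ?N \<le> d" using small[OF r] by blast
        interpret growth_data C J "u i" "Y i" by (rule gd[OF i(1)])
        have sub: "annulus 0 r (r / 2) \<subseteq> - ball 0 (real n)" "annulus 0 r 0 \<subseteq> - ball 0 (real n)"
          by (auto simp: annulus_def r_def)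
        have "ennreal m1 = (\<integral>\<^sup>+y\<in>ball 0 n1. ennreal (J y) \<partial>lborel)" by (simp add: m m1_def)
        also have "\<dots> \<le> (\<integral>\<^sup>+y\<in>ball 0 r. ennreal (J y) \<partial>lborel)"
          using n by (intro nn_integral_mono) (auto simp: indicator_def r_def)
        finally have m1r: "ennreal m1 \<le> (\<integral>\<^sup>+y\<in>ball 0 r. ennreal (J y) \<partial>lborel)" .
        show False
        proof (rule no_light_annulus[OF r m1 m1r b D_def i(2), where \<sigma>=\<sigma> and \<epsilon>=\<epsilon> and \<delta>=\<delta> and e=e, unfolded se, folded w_def Lb_def])
          show "0 < \<sigma>" "\<sigma> \<le> 1/4" "d \<le> w * \<sigma> ^ ?N / 2" "0 < e" "e \<le> s" by fact+
          show "0 < \<epsilon>" "0 < \<delta>" using \<epsilon> \<delta> by auto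
          show "(\<integral>\<^sup>+y\<in>annulus 0 r (r / 2). ennreal ((Y i y / (b + u i y)) ^ ?N) \<partial>lborel) \<le> ennreal (e ^ ?N)"
            using sub(1) by (intro order_trans[OF nn_integral_mono less_imp_le[OF n(3)[OF i(1)]]]) (auto simp: indicator_def)
          have "3 * C * Lb * (\<epsilon> * e ^ ?N + K * \<sigma> ^ ?N / \<epsilon> ^ (?N - 1)) = 3 * C * Lb * \<epsilon> * e ^ ?N + 3 * C * Lb * K * \<sigma> ^ ?N / \<epsilon> ^ (?N - 1)"
            by (simp add: distrib_left)
          then show "3 * C * Lb * (\<epsilon> * e ^ ?N + K * \<sigma> ^ ?N / \<epsilon> ^ (?N - 1)) \<le> m1 / 4"
            using \<epsilon>(2) e(3) by linarith
          have "(\<integral>\<^sup>+y\<in>annulus 0 r 0. ennreal (J y) \<partial>lborel) \<le> ennreal \<tau>"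
            using sub(2) by (intro order_trans[OF nn_integral_mono less_imp_le[OF n(2)]]) (auto simp: indicator_def)
          then have "ennreal (3 * C * \<delta> * (C * exp b)) * (\<integral>\<^sup>+y\<in>annulus 0 r 0. ennreal (J y) \<partial>lborel) \<le> ennreal (3 * C * \<delta> * (C * exp b)) * ennreal \<tau>"
            by (intro mult_left_mono) auto
          also have "\<dots> = ennreal (m1 / 4)"
            using C \<delta> \<tau> by (subst ennreal_mult[symmetric]) auto
          finally show "ennreal (3 * C * \<delta> * (C * exp b)) * (\<integral>\<^sup>+y\<in>annulus 0 r 0. ennreal (J y) \<partial>lborel) \<le> ennreal (m1 / 4)" .
          show "3 * C * w * 2 ^ ?N / \<delta> ^ (?N - 1) \<le> m1 / 4" by (rule \<delta>)
        qed
      qed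
    qed
  qed
qed

section \<open>Null Lagrangians\<close>

text \<open>\<open>det (replace_row A k v)\<close> is the pairing of v with the k-th row of the
  cofactor matrix of A, in a form to which multilinearity and the alternating property apply
  directly.\<close>

definition replace_row :: "real^'n^'n \<Rightarrow> 'n \<Rightarrow> real^'n \<Rightarrow> real^'n^'n" where
  "replace_row A k v = (\<chi> i. if i = k then v else A $ i)"

lemma replace_row_nth [simp]: "replace_row A k v $ i = (if i = k then v else A $ i)"
  by (simp add: replace_row_def)

lemma replace_row_same [simp]: "replace_row A k (A $ k) = A"
  by (simp add: vec_eq_iff)

lemma replace_row_commute: "k \<noteq> l \<Longrightarrow> replace_row (replace_row A k v) l w = replace_row (replace_row A l w) k v"
  by (simp add: vec_eq_iff)

lemma linear_det_replace_row:
  fixes A :: "real^'n^'n"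
  shows "linear (\<lambda>v. det (replace_row A k v))"
proof (rule linearI)
  fix a b :: "real^'n"
  show "det (replace_row A k (a + b)) = det (replace_row A k a) + det (replace_row A k b)"
    using det_row_add[of k "\<lambda>_. a" "\<lambda>_. b" "\<lambda>i. A $ i"] by (simp add: replace_row_def)
next
  fix c :: real and a :: "real^'n"
  show "det (replace_row A k (c *\<^sub>R a)) = c *\<^sub>R det (replace_row A k a)"
  proof -
    have "c *s a = c *\<^sub>R a" by (simp add: vec_eq_iff)
    from det_row_mul[of k c "\<lambda>_. a" "\<lambda>i. A $ i", unfolded this] show ?thesis
      by (simp add: replace_row_def)
  qed
qed

lemma det_replace_row_0 [simp]: "det (replace_row A k 0) = 0"
  using linear_0[OF linear_det_replace_row] .

lemma det_replace_row_other: "l \<noteq> k \<Longrightarrow> det (replace_row A k (A $ l)) = 0"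
  by (rule det_identical_rows[of k l]) (auto simp: row_def vec_eq_iff)

text \<open>Laplace expansion along row k; the determinants on the right are the cofactors.\<close>

lemma det_replace_row_expand:
  "det (replace_row A k v) = (\<Sum>i\<in>UNIV. v $ i * det (replace_row A k (axis i 1)))"
proof -
  have "v = (\<Sum>i\<in>UNIV. v $ i *\<^sub>R axis i 1)"
    by (simp add: vec_eq_iff axis_def if_distrib[where f="\<lambda>t. _ * t"] cong: if_cong)
  then have "det (replace_row A k v) = det (replace_row A k (\<Sum>i\<in>UNIV. v $ i *\<^sub>R axis i 1))" by simp
  also have "\<dots> = (\<Sum>i\<in>UNIV. v $ i * det (replace_row A k (axis i 1)))"
    by (simp add: linear_sum[OF linear_det_replace_row] linear_scale[OF linear_det_replace_row])
  finally show ?thesis .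
qed

lemma det_replace_rows_swap:
  assumes "k \<noteq> l"
  shows "det (replace_row (replace_row A k v) l w) = - det (replace_row (replace_row A k w) l v)"
proof -
  define f where "f a b = det (replace_row (replace_row A k a) l b)" for a b
  have z: "f a a = 0" for a
    unfolding f_def using assms by (intro det_identical_rows[of k l]) (auto simp: row_def vec_eq_iff)
  have r: "f a (b + c) = f a b + f a c" for a b c
    unfolding f_def by (rule linear_add[OF linear_det_replace_row])
  have l: "f (a + b) c = f a c + f b c" for a b c
    unfolding f_def replace_row_commute[OF assms] by (rule linear_add[OF linear_det_replace_row])
  have "f v w + f w v = 0" using z[of "v + w"] z[of v] z[of w] by (simp add: r l)
  then show ?thesis by (simp add: f_def)
qed

text \<open>Leibniz formula, estimating each entry by the norm of its row; the number n! of
  permutations is the source of the factorial in \<open>growth_constant\<close>.\<close>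

lemma abs_det_le: "\<bar>det (A::real^'n^'n)\<bar> \<le> fact CARD('n) * (\<Prod>i\<in>UNIV. norm (A $ i))"
proof -
  have "\<bar>det A\<bar> \<le> (\<Sum>p\<in>{p. p permutes (UNIV::'n set)}. \<bar>of_int (sign p) * (\<Prod>i\<in>UNIV. A $ i $ p i)\<bar>)"
    unfolding det_def by (rule sum_abs)
  also have "\<dots> \<le> (\<Sum>p\<in>{p. p permutes (UNIV::'n set)}. (\<Prod>i\<in>UNIV. norm (A $ i)))"
  proof (rule sum_mono)
    fix p
    have "\<bar>of_int (sign p) * (\<Prod>i\<in>UNIV. A $ i $ p i)\<bar> = (\<Prod>i\<in>UNIV. \<bar>A $ i $ p i\<bar>)"
      by (simp add: abs_mult abs_prod sign_def)
    also have "\<dots> \<le> (\<Prod>i\<in>UNIV. norm (A $ i))"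
      by (intro prod_mono conjI component_le_norm_cart) auto
    finally show "\<bar>of_int (sign p) * (\<Prod>i\<in>UNIV. A $ i $ p i)\<bar> \<le> (\<Prod>i\<in>UNIV. norm (A $ i))" .
  qed
  also have "\<dots> = fact CARD('n) * (\<Prod>i\<in>UNIV. norm (A $ i))"
    by (simp add: card_permutations)
  finally show ?thesis .
qed

lemma abs_det_replace_row_le:
  fixes A :: "real^'n^'n"
  assumes "norm A \<le> a"
  shows "\<bar>det (replace_row A k v)\<bar> \<le> fact CARD('n) * (norm v * a ^ (CARD('n) - 1))" "\<bar>det A\<bar> \<le> fact CARD('n) * a ^ CARD('n)"
proof -
  have row: "norm (A $ i) \<le> a" for i
    by (rule order_trans[OF Finite_Cartesian_Product.norm_nth_le assms])
  have "(\<Prod>i\<in>UNIV. norm (replace_row A k v $ i)) = norm v * (\<Prod>i\<in>UNIV - {k}. norm (A $ i))"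
    by (subst prod.remove[of _ k]) auto
  also have "\<dots> \<le> norm v * (\<Prod>i\<in>UNIV - {k}. a)"
    using row by (intro mult_left_mono prod_mono) auto
  also have "\<dots> = norm v * a ^ (CARD('n) - 1)" by (simp add: card_Diff_singleton)
  finally show "\<bar>det (replace_row A k v)\<bar> \<le> fact CARD('n) * (norm v * a ^ (CARD('n) - 1))"
    using abs_det_le[of "replace_row A k v"] by (elim order_trans) (intro mult_left_mono, auto)
  have "(\<Prod>i\<in>UNIV. norm (A $ i)) \<le> (\<Prod>i\<in>(UNIV::'n set). a)"
    using row by (intro prod_mono) auto
  then show "\<bar>det A\<bar> \<le> fact CARD('n) * a ^ CARD('n)"
    using abs_det_le[of A] by (elim order_trans) (intro mult_left_mono, auto)
qed

lemma tendsto_det: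
  fixes A :: "'a \<Rightarrow> real^'n^'n"
  assumes "(A \<longlongrightarrow> B) F" shows "((\<lambda>x. det (A x)) \<longlongrightarrow> det B) F"
  unfolding det_def by (intro tendsto_intros assms)

lemma tendsto_replace_row:
  fixes A :: "'a \<Rightarrow> real^'n^'n"
  assumes "(A \<longlongrightarrow> B) F" "(v \<longlongrightarrow> w) F"
  shows "((\<lambda>x. replace_row (A x) k (v x)) \<longlongrightarrow> replace_row B k w) F"
proof (rule vec_tendstoI)
  fix i show "((\<lambda>x. replace_row (A x) k (v x) $ i) \<longlongrightarrow> replace_row B k w $ i) F"
    using assms by (cases "i = k") (auto intro!: tendsto_intros)
qed

lemma continuous_on_det:
  fixes A :: "'a::topological_space \<Rightarrow> real^'n^'n"
  shows "continuous_on S A \<Longrightarrow> continuous_on S (\<lambda>x. det (A x))"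
  unfolding continuous_on_def by (auto intro: tendsto_det)

lemma continuous_on_replace_row:
  fixes A :: "'a::topological_space \<Rightarrow> real^'n^'n"
  shows "continuous_on S A \<Longrightarrow> continuous_on S v \<Longrightarrow> continuous_on S (\<lambda>x. replace_row (A x) k (v x))"
  unfolding continuous_on_def by (auto intro: tendsto_replace_row)

text \<open>Product rule in each term of the Leibniz formula, the terms being collected again into
  determinants row by row.\<close>

lemma has_derivative_det:
  fixes A :: "'a::real_normed_vector \<Rightarrow> real^'n^'n"
  assumes "\<And>l i. ((\<lambda>x. A x $ l $ i) has_derivative D l i) (at x)"
  shows "((\<lambda>x. det (A x)) has_derivative (\<lambda>h. \<Sum>l\<in>UNIV. det (replace_row (A x) l (\<chi> i. D l i h)))) (at x)"
proof -
  let ?P = "{p. p permutes (UNIV::'n set)}"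
  have "((\<lambda>x. \<Sum>p\<in>?P. of_int (sign p) * (\<Prod>l\<in>UNIV. A x $ l $ p l)) has_derivative
     (\<lambda>h. \<Sum>p\<in>?P. of_int (sign p) * (\<Sum>l\<in>UNIV. D l (p l) h * (\<Prod>j\<in>UNIV - {l}. A x $ j $ p j)))) (at x)"
    by (intro has_derivative_sum has_derivative_mult_right has_derivative_prod assms)
  moreover have "(\<Sum>p\<in>?P. of_int (sign p) * (\<Sum>l\<in>UNIV. D l (p l) h * (\<Prod>j\<in>UNIV - {l}. A x $ j $ p j)))
      = (\<Sum>l\<in>UNIV. det (replace_row (A x) l (\<chi> i. D l i h)))" for h
  proof -
    have "(\<Sum>p\<in>?P. of_int (sign p) * (\<Sum>l\<in>UNIV. D l (p l) h * (\<Prod>j\<in>UNIV - {l}. A x $ j $ p j)))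
        = (\<Sum>l\<in>UNIV. \<Sum>p\<in>?P. of_int (sign p) * (D l (p l) h * (\<Prod>j\<in>UNIV - {l}. A x $ j $ p j)))"
      unfolding sum_distrib_left by (rule sum.swap)
    also have "\<dots> = (\<Sum>l\<in>UNIV. det (replace_row (A x) l (\<chi> i. D l i h)))"
      unfolding det_def
    proof (intro sum.cong refl arg_cong2[where f="(*)"])
      fix l p
      show "D l (p l) h * (\<Prod>j\<in>UNIV - {l}. A x $ j $ p j) = (\<Prod>j\<in>UNIV. replace_row (A x) l (\<chi> i. D l i h) $ j $ p j)"
        by (subst prod.remove[of UNIV l]) auto
    qed
    finally show ?thesis .
  qed
  ultimately show ?thesis by (simp add: det_def[abs_def])
qed

section \<open>Integration by parts with compact support\<close>

lemma integrable_indicator_cball: "integrable lborel (indicator (cball a R) :: 'a::euclidean_space \<Rightarrow> real)"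
  using emeasure_lborel_cball_finite[of a R] by (intro integrable_real_indicator) auto

lemma le_one_plus_power: "0 \<le> h \<Longrightarrow> 1 \<le> p \<Longrightarrow> h \<le> 1 + h ^ p" for h :: real
proof (cases "h \<le> 1")
  case True
  assume "0 \<le> h"
  then show ?thesis using True by (simp add: add_increasing2)
next
  case False
  assume "1 \<le> p"
  then show ?thesis using False self_le_power[of h p] by auto
qed

lemma C1_cutoff_out:
  assumes "C1_cutoff \<eta> D\<eta>" obtains R where "0 < R" "\<And>x. R < norm x \<Longrightarrow> \<eta> x = 0" "\<And>x. R < norm x \<Longrightarrow> D\<eta> x = 0"
proof -
  obtain R where "\<forall>x. R < norm x \<longrightarrow> \<eta> x = 0 \<and> D\<eta> x = 0" using assms by (auto simp: C1_cutoff_def)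
  then show ?thesis using that[of "max 1 R"] by auto
qed

lemma integrable_continuous_compact_support:
  fixes f :: "'a::euclidean_space \<Rightarrow> real"
  assumes "continuous_on UNIV f" "\<And>x. R < norm x \<Longrightarrow> f x = 0"
  shows "integrable lborel f"
proof -
  have "integrable lborel (\<lambda>x. indicator (cball 0 R) x *\<^sub>R f x)"
    by (intro borel_integrable_compact continuous_on_subset[OF assms(1)]) auto
  moreover have "(\<lambda>x. indicator (cball 0 R) x *\<^sub>R f x) = f"
    using assms(2) by (auto simp: indicator_def fun_eq_iff not_le)
  ultimately show ?thesis by simp
qed

lemma bounded_continuous_compact_support:
  fixes f :: "'a::euclidean_space \<Rightarrow> 'b::real_normed_vector"
  assumes "continuous_on UNIV f" "\<And>x. R < norm x \<Longrightarrow> f x = 0"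
  obtains B where "0 < B" "\<And>x. norm (f x) \<le> B"
proof -
  have "compact (f ` cball 0 R)"
    by (intro compact_continuous_image continuous_on_subset[OF assms(1)]) auto
  then obtain B where "0 < B" "\<And>y. y \<in> f ` cball 0 R \<Longrightarrow> norm y \<le> B"
    using compact_imp_bounded bounded_pos by metis
  moreover have "norm (f x) \<le> B" for x
    using calculation assms(2)[of x] by (cases "norm x \<le> R") (auto simp: not_le)
  ultimately show ?thesis using that by blast
qed

text \<open>Translating \<open>F\<close> does not change its integral, so the derivative of the translates integrates to zero.\<close>

lemma integral_derivative_compact_support:
  fixes F :: "'a::euclidean_space \<Rightarrow> real"
  assumes F: "C1_cutoff F DF"
  shows "(LINT x|lborel. DF x \<bullet> v) = 0"
proof -
  obtain R where R: "0 < R" "\<And>x. R < norm x \<Longrightarrow> F x = 0" "\<And>x. R < norm x \<Longrightarrow> DF x = 0"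
    using C1_cutoff_out[OF F] by metis
  have cont: "continuous_on UNIV F" "continuous_on UNIV DF" using C1_cutoff_continuous[OF F] by auto
  have der: "(F has_derivative (\<lambda>h. DF x \<bullet> h)) (at x)" for x using F by (simp add: C1_cutoff_def)
  obtain B where B: "0 < B" "\<And>x. norm (DF x) \<le> B"
    using bounded_continuous_compact_support[OF cont(2) R(3)] by metis
  define \<phi> where "\<phi> n x = (F (x + (1 / Suc n) *\<^sub>R v) - F x) * Suc n" for n :: nat and x
  have int: "integrable lborel F" by (rule integrable_continuous_compact_support[OF cont(1) R(2)])
  have shift: "integrable lborel (\<lambda>x. F (x + h))" "(LINT x|lborel. F (x + h)) = (LINT x|lborel. F x)" for h
  proof -
    have [measurable]: "F \<in> borel_measurable borel" using cont(1) by (rule borel_measurable_continuous_onI)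
    have "integrable (distr lborel borel (\<lambda>x. h + x)) F" using int by (simp add: lborel_distr_plus)
    then show "integrable lborel (\<lambda>x. F (x + h))"
      by (subst (asm) integrable_distr_eq) (auto simp: add.commute)
    have "(LINT x|lborel. F x) = (LINT x|distr lborel borel (\<lambda>x. h + x). F x)" by (simp add: lborel_distr_plus)
    also have "\<dots> = (LINT x|lborel. F (x + h))" by (subst integral_distr) (auto simp: add.commute)
    finally show "(LINT x|lborel. F (x + h)) = (LINT x|lborel. F x)" by simp
  qed
  have zero: "(LINT x|lborel. \<phi> n x) = 0" for n
    unfolding \<phi>_def using shift int by simp
  have "(\<lambda>n. LINT x|lborel. \<phi> n x) \<longlonglongrightarrow> (LINT x|lborel. DF x \<bullet> v)"
  proof (rule integral_dominated_convergence[where w="\<lambda>x. indicator (cball 0 (R + norm v)) x * (B * norm v)"])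
    show "(\<lambda>x. DF x \<bullet> v) \<in> borel_measurable lborel"
      by (simp, intro borel_measurable_continuous_onI continuous_intros cont)
    show "\<phi> n \<in> borel_measurable lborel" for n
      unfolding \<phi>_def[abs_def]
      by (simp, intro borel_measurable_continuous_onI continuous_intros continuous_on_compose2[OF cont(1)]) auto
    show "integrable lborel (\<lambda>x::'a. indicator (cball 0 (R + norm v)) x * (B * norm v))"
      using emeasure_lborel_cball_finite[of "0::'a" "R + norm v"] by (intro integrable_mult_left integrable_real_indicator) auto
    show "AE x in lborel. (\<lambda>n. \<phi> n x) \<longlonglongrightarrow> DF x \<bullet> v"
    proof (rule AE_I2)
      fix x
      have "((\<lambda>t. F (x + t *\<^sub>R v)) has_derivative (\<lambda>t. DF x \<bullet> (t *\<^sub>R v))) (at 0)"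
      proof -
        have "((\<lambda>t. x + t *\<^sub>R v) has_derivative (\<lambda>t. t *\<^sub>R v)) (at 0)" by (auto intro!: derivative_eq_intros)
        moreover have "(F has_derivative (\<lambda>h. DF x \<bullet> h)) (at (x + 0 *\<^sub>R v))" using der[of x] by simp
        ultimately show ?thesis by (rule has_derivative_compose)
      qed
      then have "((\<lambda>t. F (x + t *\<^sub>R v)) has_real_derivative DF x \<bullet> v) (at 0)"
        by (simp add: has_field_derivative_def mult_commute_abs)
      then have "(\<lambda>t. (F (x + t *\<^sub>R v) - F x) / t) \<midarrow>0\<rightarrow> DF x \<bullet> v" by (simp add: DERIV_def)
      moreover have "filterlim (\<lambda>n. 1 / real (Suc n)) (at 0) sequentially"
        using LIMSEQ_inverse_real_of_nat by (auto simp: filterlim_at divide_inverse intro!: always_eventually)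
      ultimately have "(\<lambda>n. (F (x + (1 / real (Suc n)) *\<^sub>R v) - F x) / (1 / real (Suc n))) \<longlonglongrightarrow> DF x \<bullet> v"
        by (rule filterlim_compose)
      then show "(\<lambda>n. \<phi> n x) \<longlonglongrightarrow> DF x \<bullet> v" by (simp add: \<phi>_def)
    qed
    show "AE x in lborel. norm (\<phi> n x) \<le> indicator (cball 0 (R + norm v)) x * (B * norm v)" for n
    proof (rule AE_I2)
      fix x
      define h where "h = (1 / real (Suc n)) *\<^sub>R v"
      have "norm h = (1 / real (Suc n)) * norm v" by (simp add: h_def)
      also have "\<dots> \<le> 1 * norm v" by (intro mult_right_mono) auto
      finally have h: "norm h \<le> norm v" by simp
      show "norm (\<phi> n x) \<le> indicator (cball 0 (R + norm v)) x * (B * norm v)"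
      proof (cases "norm x \<le> R + norm v")
        case False
        then have "R < norm x" "R < norm (x + h)" 
        proof -
          have "0 \<le> norm v" by simp
          then show "R < norm x" using False by linarith
          have "norm x \<le> norm (x + h) + norm h" using norm_triangle_ineq4[of "x + h" h] by simp
          then show "R < norm (x + h)" using h False by linarith
        qed
        then show ?thesis using R(2) False by (simp add: \<phi>_def h_def)
      next
        case True
        have "norm (F (x + h) - F x) \<le> B * norm (x + h - x)"
        proof (rule differentiable_bound[of UNIV F "\<lambda>x h. DF x \<bullet> h"])
          fix y
          show "onorm (\<lambda>h. DF y \<bullet> h) \<le> B"
          proof (rule onorm_bound)
            fix h
            have "\<bar>DF y \<bullet> h\<bar> \<le> norm (DF y) * norm h" by (rule Cauchy_Schwarz_ineq2)
            also have "\<dots> \<le> B * norm h" using B by (intro mult_right_mono) auto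
            finally show "norm (DF y \<bullet> h) \<le> B * norm h" by simp
          qed (use B in auto)
        qed (auto intro: has_derivative_at_withinI der)
        then have "\<bar>F (x + h) - F x\<bar> * Suc n \<le> B * norm h * Suc n" by (intro mult_right_mono) auto
        also have "\<dots> = B * norm v" by (simp add: h_def)
        finally show ?thesis using True by (simp add: \<phi>_def abs_mult h_def)
      qed
    qed
  qed
  then show ?thesis by (simp add: zero LIMSEQ_const_iff)
qed

text \<open>The rows of \<open>Dg\<close> are the gradients of the components, and
  \<open>H k j\<close> is the gradient of the entry (k, j). Symmetry of the second derivatives is
  built in: it is what \<open>null_lagrangian\<close> consumes, and mollifications have it by
  construction.\<close>

definition C2_map :: "(real^'n \<Rightarrow> real^'m) \<Rightarrow> (real^'n \<Rightarrow> real^'n^'m) \<Rightarrow> bool" where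
  "C2_map g Dg \<longleftrightarrow> (\<forall>x. (g has_derivative (\<lambda>h. Dg x *v h)) (at x)) \<and>
     (\<exists>H. \<forall>k j. (\<forall>x. ((\<lambda>x. Dg x $ k $ j) has_derivative (\<lambda>h. H k j x \<bullet> h)) (at x)) \<and>
        continuous_on UNIV (H k j) \<and> (\<forall>x i. H k j x $ i = H k i x $ j))"

lemma C2_mapE:
  assumes "C2_map g Dg"
  obtains H where "\<And>l j x. ((\<lambda>x. Dg x $ l $ j) has_derivative (\<lambda>h. H l j x \<bullet> h)) (at x)"
    "\<And>l j. continuous_on UNIV (H l j)" "\<And>l j x i. H l j x $ i = H l i x $ j"
proof -
  from assms obtain H where "\<forall>k j. (\<forall>x. ((\<lambda>x. Dg x $ k $ j) has_derivative (\<lambda>h. H k j x \<bullet> h)) (at x)) \<and>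
        continuous_on UNIV (H k j) \<and> (\<forall>x i. H k j x $ i = H k i x $ j)"
    unfolding C2_map_def by blast
  then show ?thesis by (intro that[of H]) simp_all
qed

lemma C2_map_continuous:
  assumes "C2_map g Dg" shows "continuous_on UNIV g" "continuous_on UNIV Dg"
proof -
  show "continuous_on UNIV g" using assms
    by (auto simp: C2_map_def intro!: continuous_at_imp_continuous_on has_derivative_continuous)
  obtain H where H: "\<And>l j x. ((\<lambda>x. Dg x $ l $ j) has_derivative (\<lambda>h. H l j x \<bullet> h)) (at x)"
    using C2_mapE[OF assms] by metis
  have "continuous_on UNIV (\<lambda>x. Dg x $ k $ j)" for k j
    by (intro continuous_at_imp_continuous_on ballI has_derivative_continuous[OF H])
  then have "continuous_on UNIV (\<lambda>x. \<chi> k. \<chi> j. Dg x $ k $ j)" by (intro continuous_on_vec_lambda)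
  then show "continuous_on UNIV Dg" by simp
qed

lemma C2_map_component_derivative:
  assumes "C2_map g Dg" shows "((\<lambda>x. g x $ k) has_derivative (\<lambda>h. Dg x $ k \<bullet> h)) (at x)"
proof -
  have "(g has_derivative (\<lambda>h. Dg x *v h)) (at x)" using assms by (simp add: C2_map_def)
  from bounded_linear.has_derivative[OF bounded_linear_vec_nth this, of k]
  show ?thesis by (simp add: matrix_vector_mul_component)
qed

text \<open>The cofactors of the Jacobian form divergence-free rows (Piola): in the divergence the
  second derivatives are symmetric while the determinants are antisymmetric.\<close>

lemma null_lagrangian:
  fixes g :: "real^'n \<Rightarrow> real^'n"
  assumes g: "C2_map g Dg" and \<zeta>: "C1_cutoff \<zeta> Z"
  shows "(LINT x|lborel. det (replace_row (Dg x) k (Z x))) = 0"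
proof -
  obtain H where H: "\<And>l j x. ((\<lambda>x. Dg x $ l $ j) has_derivative (\<lambda>h. H l j x \<bullet> h)) (at x)"
    "\<And>l j. continuous_on UNIV (H l j)" "\<And>l j x i. H l j x $ i = H l i x $ j"
    using C2_mapE[OF g] by metis
  have cont: "continuous_on UNIV Dg" by (rule C2_map_continuous[OF g])
  have c\<zeta>: "continuous_on UNIV \<zeta>" "continuous_on UNIV Z" using C1_cutoff_continuous[OF \<zeta>] by auto
  \<comment> \<open>\<open>det (A j x)\<close> is the cofactor (k, j) of the Jacobian and
    \<open>G j x\<close> its gradient; \<open>DA l x a\<close> is the derivative of row l in
    direction a, which is 0 for the constant row k.\<close>
  define A where "A j x = replace_row (Dg x) k (axis j 1)" for j x
  define DA where "DA l x a = (\<chi> i. if l = k then 0 else H l i x $ a)" for l x a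
  define G where "G j x = (\<chi> a. \<Sum>l\<in>UNIV. det (replace_row (A j x) l (DA l x a)))" for j x
  have cA: "continuous_on UNIV (A j)" for j
    unfolding A_def[abs_def] by (intro continuous_on_replace_row cont continuous_intros)
  have cDA: "continuous_on UNIV (\<lambda>x. DA l x a)" for l a
    unfolding DA_def by (cases "l = k") (auto intro!: continuous_on_vec_lambda continuous_intros H(2))
  have cG: "continuous_on UNIV (G j)" for j
    unfolding G_def[abs_def]
    by (intro continuous_on_vec_lambda continuous_on_sum continuous_on_det continuous_on_replace_row cA cDA)
  have dA: "((\<lambda>x. det (A j x)) has_derivative (\<lambda>h. G j x \<bullet> h)) (at x)" for j x
  proof -
    have "((\<lambda>x. A j x $ l $ i) has_derivative (\<lambda>h. if l = k then 0 else H l i x \<bullet> h)) (at x)" for l i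
      using H(1)[of l i x] by (cases "l = k") (auto simp: A_def)
    from has_derivative_det[OF this]
    have "((\<lambda>x. det (A j x)) has_derivative (\<lambda>h. \<Sum>l\<in>UNIV. det (replace_row (A j x) l (\<chi> i. if l = k then 0 else H l i x \<bullet> h)))) (at x)" .
    moreover have "(\<chi> i. if l = k then 0 else H l i x \<bullet> h) = (\<Sum>a\<in>UNIV. h $ a *\<^sub>R DA l x a)" for l h
      by (auto simp: vec_eq_iff DA_def inner_vec_def mult.commute)
    ultimately have "((\<lambda>x. det (A j x)) has_derivative (\<lambda>h. \<Sum>l\<in>UNIV. \<Sum>a\<in>UNIV. h $ a * det (replace_row (A j x) l (DA l x a)))) (at x)"
      by (simp add: linear_sum[OF linear_det_replace_row] linear_scale[OF linear_det_replace_row])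
    moreover have "(\<Sum>l\<in>UNIV. \<Sum>a\<in>UNIV. h $ a * det (replace_row (A j x) l (DA l x a))) = G j x \<bullet> h" for h
      unfolding G_def inner_vec_def
      by (subst sum.swap) (simp add: sum_distrib_left mult.commute)
    ultimately show ?thesis by simp
  qed
  have div0: "(\<Sum>j\<in>UNIV. G j x $ j) = 0" for x
  proof -
    have "(\<Sum>j\<in>UNIV. det (replace_row (A j x) l (DA l x j))) = 0" for l
    proof (cases "l = k")
      case True
      then have "DA l x j = 0" for j by (simp add: DA_def vec_eq_iff)
      then show ?thesis by simp
    next
      case False
      define d where "d j i = det (replace_row (A j x) l (axis i 1))" for j i
      define S where "S = (\<Sum>j\<in>UNIV. \<Sum>i\<in>UNIV. H l i x $ j * d j i)"
      have anti: "d j i = - d i j" for i j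
        unfolding d_def A_def by (rule det_replace_rows_swap) (use False in auto)
      have "S = (\<Sum>i\<in>UNIV. \<Sum>j\<in>UNIV. H l i x $ j * d j i)" unfolding S_def by (rule sum.swap)
      also have "\<dots> = (\<Sum>i\<in>UNIV. \<Sum>j\<in>UNIV. - (H l j x $ i * d i j))"
        by (intro sum.cong refl) (subst anti, subst H(3), simp)
      also have "\<dots> = - S" by (simp add: S_def sum_negf)
      finally have "S = 0" by simp
      moreover have "det (replace_row (A j x) l (DA l x j)) = (\<Sum>i\<in>UNIV. H l i x $ j * d j i)" for j
        by (subst det_replace_row_expand) (use False in \<open>simp add: DA_def d_def\<close>)
      ultimately show ?thesis by (simp add: S_def)
    qed
    then have "(\<Sum>l\<in>UNIV. \<Sum>j\<in>UNIV. det (replace_row (A j x) l (DA l x j))) = 0" by simp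
    then show ?thesis by (subst (asm) sum.swap) (simp add: G_def)
  qed
  define DF where "DF j x = det (A j x) *\<^sub>R Z x + \<zeta> x *\<^sub>R G j x" for j x
  have cut: "C1_cutoff (\<lambda>x. \<zeta> x * det (A j x)) (DF j)" for j
    unfolding C1_cutoff_def
  proof (intro conjI allI)
    show "((\<lambda>x. \<zeta> x * det (A j x)) has_derivative (\<lambda>h. DF j x \<bullet> h)) (at x)" for x
    proof -
      have "(\<zeta> has_derivative (\<lambda>h. Z x \<bullet> h)) (at x)" using \<zeta> by (simp add: C1_cutoff_def)
      from has_derivative_mult[OF this dA] show ?thesis
        by (rule has_derivative_eq_rhs) (auto simp: DF_def inner_add_left fun_eq_iff algebra_simps)
    qed
    show "continuous_on UNIV (DF j)" unfolding DF_def[abs_def]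
      by (intro continuous_intros continuous_on_det cA c\<zeta> cG)
    show "\<exists>R. \<forall>x. R < norm x \<longrightarrow> \<zeta> x * det (A j x) = 0 \<and> DF j x = 0"
      using \<zeta> by (auto simp: C1_cutoff_def DF_def)
  qed
  obtain R where R: "\<And>x. R < norm x \<Longrightarrow> \<zeta> x = 0" "\<And>x. R < norm x \<Longrightarrow> Z x = 0" using C1_cutoff_out[OF \<zeta>] by metis
  have cDF: "continuous_on UNIV (\<lambda>x. DF j x \<bullet> axis j 1)" for j
    using C1_cutoff_continuous(2)[OF cut] by (intro continuous_intros)
  have int: "integrable lborel (\<lambda>x. DF j x \<bullet> axis j 1)" for j
    by (rule integrable_continuous_compact_support[where R=R, OF cDF]) (simp add: DF_def R)
  have "det (replace_row (Dg x) k (Z x)) = (\<Sum>j\<in>UNIV. DF j x \<bullet> axis j 1)" for x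
  proof -
    have "(\<Sum>j\<in>UNIV. DF j x \<bullet> axis j 1) = (\<Sum>j\<in>UNIV. Z x $ j * det (A j x)) + \<zeta> x * (\<Sum>j\<in>UNIV. G j x $ j)"
      by (simp add: DF_def inner_axis inner_add_left sum.distrib sum_distrib_left mult.commute)
    then show ?thesis by (simp add: div0 A_def det_replace_row_expand[of _ _ "Z x"])
  qed
  then have "(LINT x|lborel. det (replace_row (Dg x) k (Z x))) = (\<Sum>j\<in>UNIV. LINT x|lborel. DF j x \<bullet> axis j 1)"
    using int by simp
  also have "\<dots> = 0" by (simp add: integral_derivative_compact_support[OF cut])
  finally show ?thesis .
qed

section \<open>Testing with radial functions of the map\<close>

lemma has_derivative_norm_power:
  fixes y :: "'a::real_inner"
  assumes "2 \<le> n"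
  shows "((\<lambda>y. norm y ^ n) has_derivative (\<lambda>h. real n * norm y ^ (n - 2) * (y \<bullet> h))) (at y)"
proof (cases "y = 0")
  case False
  have "((\<lambda>y. norm y ^ n) has_derivative (\<lambda>h. real n * (sgn y \<bullet> h) * norm y ^ (n - 1))) (at y)"
    using has_derivative_power[OF has_derivative_norm[OF False], of n] by (simp add: inner_commute)
  moreover have "real n * (sgn y \<bullet> h) * norm y ^ (n - 1) = real n * norm y ^ (n - 2) * (y \<bullet> h)" for h
  proof -
    have "n - 1 = Suc (n - 2)" using assms by simp
    then show ?thesis using False by (simp add: sgn_div_norm)
  qed
  ultimately show ?thesis by (rule has_derivative_eq_rhs[OF _ ext])
next
  case True
  have "((\<lambda>h::'a. norm h ^ n / norm h) \<longlongrightarrow> 0) (at 0)"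
  proof -
    have "norm h ^ n / norm h = norm h ^ (n - 1)" for h :: 'a
      using assms by (cases n) auto
    moreover have "((\<lambda>h::'a. norm h ^ (n - 1)) \<longlongrightarrow> 0) (at 0)"
      using assms by (auto intro!: tendsto_eq_intros)
    ultimately show ?thesis by simp
  qed
  then show ?thesis using True assms
    by (auto simp: has_derivative_at zero_power bounded_linear_zero)
qed

text \<open>The bilinear form y . cof(A) z; with z the gradient of a cutoff it is the boundary term
  of the integrations by parts.\<close>

definition flux :: "real^'n^'n \<Rightarrow> real^'n \<Rightarrow> real^'n \<Rightarrow> real" where
  "flux A y z = (\<Sum>k\<in>UNIV. y $ k * det (replace_row A k z))"

lemma abs_flux_le:
  fixes A :: "real^'n^'n"
  shows "\<bar>flux A y z\<bar> \<le> (fact CARD('n) * CARD('n)) * (norm z * (norm y * norm A ^ (CARD('n) - 1)))"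
proof -
  have "\<bar>flux A y z\<bar> \<le> (\<Sum>k\<in>(UNIV::'n set). \<bar>y $ k * det (replace_row A k z)\<bar>)"
    unfolding flux_def by (rule sum_abs)
  also have "\<dots> \<le> (\<Sum>k\<in>(UNIV::'n set). norm y * (fact CARD('n) * (norm z * norm A ^ (CARD('n) - 1))))"
    unfolding abs_mult
    by (intro sum_mono mult_mono component_le_norm_cart abs_det_replace_row_le) auto
  also have "\<dots> = (fact CARD('n) * CARD('n)) * (norm z * (norm y * norm A ^ (CARD('n) - 1)))"
    by simp
  finally show ?thesis .
qed

text \<open>Sum of \<open>null_lagrangian\<close> over k with the test functions \<eta>
  \<kappa>(|g|^n) g_k. A derivative falling on g_k or on |g|^n produces rows of Dg, and only row k
  survives in the determinant. The power n matters: both contributions then carry the factor n and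
  combine into the derivative of t \<kappa>(t) at t = |g|^n.\<close>

lemma radial_identity_C2:
  fixes g :: "real^'n \<Rightarrow> real^'n" and \<kappa> \<kappa>' :: "real \<Rightarrow> real"
    and \<eta> :: "real^'n \<Rightarrow> real"
  assumes g: "C2_map g Dg" and n: "2 \<le> CARD('n)" and \<eta>: "C1_cutoff \<eta> D\<eta>"
    and \<kappa>: "\<And>t. 0 \<le> t \<Longrightarrow> (\<kappa> has_real_derivative \<kappa>' t) (at t)" "continuous_on {0..} \<kappa>'"
  shows "(LINT x|lborel. \<kappa> (norm (g x) ^ CARD('n)) * flux (Dg x) (g x) (D\<eta> x)
     + CARD('n) * \<eta> x * (\<kappa> (norm (g x) ^ CARD('n)) + norm (g x) ^ CARD('n) * \<kappa>' (norm (g x) ^ CARD('n))) * det (Dg x)) = 0"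
proof -
  let ?N = "CARD('n)"
  define \<tau> where "\<tau> x = norm (g x) ^ ?N" for x
  have \<tau>0: "0 \<le> \<tau> x" for x by (simp add: \<tau>_def)
  have cont: "continuous_on UNIV g" "continuous_on UNIV Dg" using C2_map_continuous[OF g] by auto
  have c\<eta>: "continuous_on UNIV \<eta>" "continuous_on UNIV D\<eta>" using C1_cutoff_continuous[OF \<eta>] by auto
  have c\<tau>: "continuous_on UNIV \<tau>" unfolding \<tau>_def[abs_def] by (intro continuous_intros cont)
  have c\<kappa>: "continuous_on {0..} \<kappa>" using \<kappa>(1) by (auto intro!: continuous_at_imp_continuous_on DERIV_isCont)
  have c\<kappa>\<tau>: "continuous_on UNIV (\<lambda>x. \<kappa> (\<tau> x))" "continuous_on UNIV (\<lambda>x. \<kappa>' (\<tau> x))"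
    by (auto intro!: continuous_on_compose2[OF c\<kappa> c\<tau>] continuous_on_compose2[OF \<kappa>(2) c\<tau>] \<tau>0)
  \<comment> \<open>Half the gradient of |g|^2.\<close>
  define P where "P x = (\<Sum>l\<in>UNIV. g x $ l *\<^sub>R Dg x $ l)" for x
  have d\<tau>: "(\<tau> has_derivative (\<lambda>h. real ?N * norm (g x) ^ (?N - 2) * (P x \<bullet> h))) (at x)" for x
  proof -
    have "(g has_derivative (\<lambda>h. Dg x *v h)) (at x)" using g by (simp add: C2_map_def)
    from has_derivative_compose[OF this has_derivative_norm_power[OF n]]
    have "(\<tau> has_derivative (\<lambda>h. real ?N * norm (g x) ^ (?N - 2) * (g x \<bullet> (Dg x *v h)))) (at x)"
      by (simp add: \<tau>_def[abs_def])
    moreover have "g x \<bullet> (Dg x *v h) = P x \<bullet> h" for h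
      by (simp add: P_def inner_sum_left inner_vec_def[of "g x"] matrix_vector_mul_component)
    ultimately show ?thesis by simp
  qed
  define Z where "Z k x = (\<kappa> (\<tau> x) * g x $ k) *\<^sub>R D\<eta> x + (\<eta> x * \<kappa> (\<tau> x)) *\<^sub>R Dg x $ k
     + (\<eta> x * g x $ k * \<kappa>' (\<tau> x) * (real ?N * norm (g x) ^ (?N - 2))) *\<^sub>R P x" for k x
  have cut: "C1_cutoff (\<lambda>x. \<eta> x * (g x $ k * \<kappa> (\<tau> x))) (Z k)" for k
    unfolding C1_cutoff_def
  proof (intro conjI allI)
    show "((\<lambda>x. \<eta> x * (g x $ k * \<kappa> (\<tau> x))) has_derivative (\<lambda>h. Z k x \<bullet> h)) (at x)" for x
    proof -
      have 1: "(\<eta> has_derivative (\<lambda>h. D\<eta> x \<bullet> h)) (at x)" using \<eta> by (simp add: C1_cutoff_def)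
      have 2: "((\<lambda>x. \<kappa> (\<tau> x)) has_derivative (\<lambda>h. \<kappa>' (\<tau> x) * (real ?N * norm (g x) ^ (?N - 2) * (P x \<bullet> h)))) (at x)"
        using has_derivative_compose[OF d\<tau> \<kappa>(1)[OF \<tau>0, unfolded has_field_derivative_def]] .
      show ?thesis
        by (rule has_derivative_eq_rhs[OF has_derivative_mult[OF 1 has_derivative_mult[OF C2_map_component_derivative[OF g] 2]]])
           (simp add: Z_def inner_add_left fun_eq_iff algebra_simps)
    qed
    show "continuous_on UNIV (Z k)" unfolding Z_def[abs_def] P_def
      by (intro continuous_intros cont c\<eta> c\<kappa>\<tau>)
    show "\<exists>R. \<forall>x. R < norm x \<longrightarrow> \<eta> x * (g x $ k * \<kappa> (\<tau> x)) = 0 \<and> Z k x = 0"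
      using \<eta> by (auto simp: C1_cutoff_def Z_def)
  qed
  have dP: "det (replace_row (Dg x) k (P x)) = g x $ k * det (Dg x)" for k x
  proof -
    have "det (replace_row (Dg x) k (P x)) = (\<Sum>l\<in>UNIV. g x $ l * det (replace_row (Dg x) k (Dg x $ l)))"
      by (simp add: P_def linear_sum[OF linear_det_replace_row] linear_scale[OF linear_det_replace_row])
    also have "\<dots> = (\<Sum>l\<in>UNIV. if l = k then g x $ k * det (Dg x) else 0)"
      by (intro sum.cong refl) (auto simp: det_replace_row_other)
    finally show ?thesis by simp
  qed
  have dZ: "det (replace_row (Dg x) k (Z k x)) = \<kappa> (\<tau> x) * (g x $ k * det (replace_row (Dg x) k (D\<eta> x))) + \<eta> x * \<kappa> (\<tau> x) * det (Dg x)
      + \<eta> x * \<kappa>' (\<tau> x) * real ?N * norm (g x) ^ (?N - 2) * (g x $ k)^2 * det (Dg x)" for k x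
    unfolding Z_def
    by (simp add: linear_add[OF linear_det_replace_row] linear_scale[OF linear_det_replace_row] dP power2_eq_square algebra_simps)
  have sum: "(\<Sum>k\<in>UNIV. det (replace_row (Dg x) k (Z k x))) = \<kappa> (\<tau> x) * flux (Dg x) (g x) (D\<eta> x)
     + ?N * \<eta> x * (\<kappa> (\<tau> x) + \<tau> x * \<kappa>' (\<tau> x)) * det (Dg x)" for x
  proof -
    have nn: "(\<Sum>k\<in>UNIV. (g x $ k)^2) = (norm (g x))^2"
      by (simp add: norm_vec_def L2_set_def sum_nonneg)
    have "norm (g x) ^ (?N - 2) * (norm (g x))^2 = \<tau> x"
    proof -
      have "?N - 2 + 2 = ?N" using n by simp
      then show ?thesis unfolding \<tau>_def power_add[symmetric] by (simp only:)
    qed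
    moreover have "(\<Sum>k\<in>UNIV. det (replace_row (Dg x) k (Z k x))) = \<kappa> (\<tau> x) * flux (Dg x) (g x) (D\<eta> x) + ?N * (\<eta> x * \<kappa> (\<tau> x) * det (Dg x))
      + \<eta> x * \<kappa>' (\<tau> x) * real ?N * norm (g x) ^ (?N - 2) * (norm (g x))^2 * det (Dg x)"
      unfolding dZ sum.distrib nn[symmetric] flux_def by (simp add: sum_distrib_left sum_distrib_right)
    ultimately show ?thesis by (simp add: algebra_simps)
  qed
  obtain R where R: "\<And>x. R < norm x \<Longrightarrow> \<eta> x = 0" "\<And>x. R < norm x \<Longrightarrow> D\<eta> x = 0" using C1_cutoff_out[OF \<eta>] by metis
  have int: "integrable lborel (\<lambda>x. det (replace_row (Dg x) k (Z k x)))" for k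
  proof (rule integrable_continuous_compact_support[where R=R])
    show "continuous_on UNIV (\<lambda>x. det (replace_row (Dg x) k (Z k x)))"
      by (intro continuous_on_det continuous_on_replace_row cont C1_cutoff_continuous(2)[OF cut])
    show "R < norm x \<Longrightarrow> det (replace_row (Dg x) k (Z k x)) = 0" for x
      by (simp add: Z_def R)
  qed
  have "(LINT x|lborel. (\<Sum>k\<in>UNIV. det (replace_row (Dg x) k (Z k x)))) = (\<Sum>k\<in>UNIV. (LINT x|lborel. det (replace_row (Dg x) k (Z k x))))"
    using int by simp
  also have "\<dots> = 0" using null_lagrangian[OF g cut] by simp
  finally show ?thesis unfolding sum by (simp add: \<tau>_def)
qed

text \<open>Maps of class \<open>W\<^sup>1\<^sup>,\<^sup>p\<close> locally enter the argument only through such approximations.\<close>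

definition locally_approximable :: "nat \<Rightarrow> (real^'n \<Rightarrow> real^'m) \<Rightarrow> (real^'n \<Rightarrow> real^'n^'m) \<Rightarrow> bool" where
  "locally_approximable p g Dg \<longleftrightarrow> continuous_on UNIV g \<and> Dg \<in> borel_measurable borel \<and>
    (\<forall>R. \<exists>G DG H. (\<forall>m. C2_map (G m) (DG m)) \<and> uniform_limit (cball 0 R) G g sequentially \<and>
      (AE x in lborel. x \<in> cball 0 R \<longrightarrow> (\<lambda>m. DG m x) \<longlonglongrightarrow> Dg x) \<and>
      H \<in> borel_measurable borel \<and> (\<forall>x. 0 \<le> H x) \<and> set_integrable lborel (cball 0 R) (\<lambda>x. H x ^ p) \<and>
      (AE x in lborel. x \<in> cball 0 R \<longrightarrow> (\<forall>m. norm (DG m x) \<le> H x)))"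

lemma locally_approximableE:
  assumes "locally_approximable p g Dg"
  obtains G DG H where "\<And>m. C2_map (G m) (DG m)" "uniform_limit (cball 0 R) G g sequentially"
    "AE x in lborel. x \<in> cball 0 R \<longrightarrow> (\<lambda>m. DG m x) \<longlonglongrightarrow> Dg x"
    "H \<in> borel_measurable borel" "\<And>x. 0 \<le> H x" "set_integrable lborel (cball 0 R) (\<lambda>x. H x ^ p)"
    "AE x in lborel. x \<in> cball 0 R \<longrightarrow> (\<forall>m. norm (DG m x) \<le> H x)"
  using assms unfolding locally_approximable_def
  by (elim conjE allE[of _ R] exE, intro that) simp_all

text \<open>The limit of the Jacobians inherits their majorant H.\<close>

lemma locally_approximable_norm_power_integrable:
  assumes g: "locally_approximable p g Dg"
  shows "set_integrable lborel (cball 0 R) (\<lambda>x. norm (Dg x) ^ p)"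
proof -
  obtain G DG H where G: "\<And>m. C2_map (G m) (DG m)" "uniform_limit (cball 0 R) G g sequentially"
    "AE x in lborel. x \<in> cball 0 R \<longrightarrow> (\<lambda>m. DG m x) \<longlonglongrightarrow> Dg x"
    "H \<in> borel_measurable borel" "\<And>x. 0 \<le> H x" "set_integrable lborel (cball 0 R) (\<lambda>x. H x ^ p)"
    "AE x in lborel. x \<in> cball 0 R \<longrightarrow> (\<forall>m. norm (DG m x) \<le> H x)"
    by (rule locally_approximableE[OF g, of R]) (rule that)
  have [measurable]: "Dg \<in> borel_measurable borel" using g by (simp add: locally_approximable_def)
  show ?thesis
    using G(6) unfolding set_integrable_def
  proof (rule Bochner_Integration.integrable_bound)
    show "(\<lambda>x. indicat_real (cball 0 R) x *\<^sub>R norm (Dg x) ^ p) \<in> borel_measurable lborel"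
      by (simp, intro borel_measurable_times borel_measurable_indicator borel_measurable_power borel_measurable_norm) auto
    show "AE x in lborel. norm (indicat_real (cball 0 R) x *\<^sub>R norm (Dg x) ^ p) \<le> norm (indicat_real (cball 0 R) x *\<^sub>R H x ^ p)"
      using G(3,7)
    proof eventually_elim
      case (elim x)
      show ?case
      proof (cases "x \<in> cball 0 R")
        case True
        then have "(\<lambda>m. norm (DG m x)) \<longlonglongrightarrow> norm (Dg x)" using elim by (intro tendsto_norm) auto
        then have "norm (Dg x) \<le> H x" by (rule LIMSEQ_le_const2) (use elim True in auto)
        then show ?thesis using G(5)[of x] by (auto simp: indicator_def intro: power_mono)
      qed simp
    qed
  qed
qed

text \<open>Passage to the limit in \<open>radial_identity_C2\<close>. The integrand grows at most
  like the n-th power of the Jacobian, with coefficients bounded on the support of \<eta>, so a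
  multiple of 1 + H^n dominates it; this is where the integrability exponent n is used.\<close>

lemma radial_identity:
  fixes g :: "real^'n \<Rightarrow> real^'n" and \<kappa> \<kappa>' :: "real \<Rightarrow> real"
    and \<eta> :: "real^'n \<Rightarrow> real"
  assumes g: "locally_approximable CARD('n) g Dg" and n: "2 \<le> CARD('n)" and \<eta>: "C1_cutoff \<eta> D\<eta>"
    and \<kappa>: "\<And>t. 0 \<le> t \<Longrightarrow> (\<kappa> has_real_derivative \<kappa>' t) (at t)" "continuous_on {0..} \<kappa>'"
  shows "(LINT x|lborel. \<kappa> (norm (g x) ^ CARD('n)) * flux (Dg x) (g x) (D\<eta> x)
     + CARD('n) * \<eta> x * (\<kappa> (norm (g x) ^ CARD('n)) + norm (g x) ^ CARD('n) * \<kappa>' (norm (g x) ^ CARD('n))) * det (Dg x)) = 0"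
proof -
  let ?N = "CARD('n)"
  obtain R where R: "0 < R" "\<And>x. R < norm x \<Longrightarrow> \<eta> x = 0" "\<And>x. R < norm x \<Longrightarrow> D\<eta> x = 0" using C1_cutoff_out[OF \<eta>] by metis
  obtain G DG H where G: "\<And>m. C2_map (G m) (DG m)" "uniform_limit (cball 0 R) G g sequentially"
    "AE x in lborel. x \<in> cball 0 R \<longrightarrow> (\<lambda>m. DG m x) \<longlonglongrightarrow> Dg x"
    "H \<in> borel_measurable borel" "\<And>x. 0 \<le> H x" "set_integrable lborel (cball 0 R) (\<lambda>x. H x ^ ?N)"
    "AE x in lborel. x \<in> cball 0 R \<longrightarrow> (\<forall>m. norm (DG m x) \<le> H x)"
    by (rule locally_approximableE[OF g, of R]) (rule that)
  have cg: "continuous_on UNIV g" and mDg: "Dg \<in> borel_measurable borel"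
    using g by (auto simp: locally_approximable_def)
  have c\<eta>: "continuous_on UNIV \<eta>" "continuous_on UNIV D\<eta>" using C1_cutoff_continuous[OF \<eta>] by auto
  have c\<kappa>: "continuous_on {0..} \<kappa>" using \<kappa>(1) by (auto intro!: continuous_at_imp_continuous_on DERIV_isCont)
  define \<Psi> where "\<Psi> x y A = \<kappa> (norm y ^ ?N) * flux A y (D\<eta> x) + ?N * \<eta> x * (\<kappa> (norm y ^ ?N) + norm y ^ ?N * \<kappa>' (norm y ^ ?N)) * det A" for x and y :: "real^'n" and A
  have c\<Psi>: "((\<lambda>m. \<Psi> x (y m) (A m)) \<longlongrightarrow> \<Psi> x y0 A0) F" if "(y \<longlongrightarrow> y0) F" "(A \<longlongrightarrow> A0) F" for x y y0 A A0 and F :: "nat filter"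
  proof -
    have t: "((\<lambda>m. norm (y m) ^ ?N) \<longlongrightarrow> norm y0 ^ ?N) F" by (intro tendsto_intros that)
    have "((\<lambda>m. \<kappa> (norm (y m) ^ ?N)) \<longlongrightarrow> \<kappa> (norm y0 ^ ?N)) F" "((\<lambda>m. \<kappa>' (norm (y m) ^ ?N)) \<longlongrightarrow> \<kappa>' (norm y0 ^ ?N)) F"
      by (auto intro!: continuous_on_tendsto_compose[OF c\<kappa> t] continuous_on_tendsto_compose[OF \<kappa>(2) t] always_eventually)
    then show ?thesis unfolding \<Psi>_def flux_def
      by (intro tendsto_intros tendsto_det tendsto_replace_row that)
  qed
  obtain B where B: "0 < B" "\<And>x. x \<in> cball 0 R \<Longrightarrow> norm (g x) \<le> B"
  proof -
    have "compact (g ` cball 0 R)" by (intro compact_continuous_image continuous_on_subset[OF cg]) auto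
    then show ?thesis using that compact_imp_bounded[of "g ` cball 0 R"] by (auto simp: bounded_pos)
  qed
  obtain b where b: "0 < b" "\<And>t. t \<in> {0..(B+1)^?N} \<Longrightarrow> \<bar>\<kappa> t\<bar> \<le> b" "\<And>t. t \<in> {0..(B+1)^?N} \<Longrightarrow> \<bar>\<kappa>' t\<bar> \<le> b"
  proof -
    have "compact (\<kappa> ` {0..(B+1)^?N} \<union> \<kappa>' ` {0..(B+1)^?N})"
      by (intro compact_Un compact_continuous_image continuous_on_subset[OF c\<kappa>] continuous_on_subset[OF \<kappa>(2)]) auto
    then obtain b where "0 < b" "\<forall>y\<in>\<kappa> ` {0..(B+1)^?N} \<union> \<kappa>' ` {0..(B+1)^?N}. norm y \<le> b"
      using compact_imp_bounded bounded_pos by metis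
    then show ?thesis using that[of b] by auto
  qed
  obtain E where E: "0 < E" "\<And>x. norm (\<eta> x) \<le> E" using bounded_continuous_compact_support[OF c\<eta>(1) R(2)] by metis
  obtain E' where E': "0 < E'" "\<And>x. norm (D\<eta> x) \<le> E'" using bounded_continuous_compact_support[OF c\<eta>(2) R(3)] by metis
  define c where "c = b * ((fact ?N * ?N) * (E' * (B + 1))) + ?N * E * (b + (B+1)^?N * b) * fact ?N"
  have bound: "\<bar>\<Psi> x y A\<bar> \<le> c * (1 + h ^ ?N)" if "norm y \<le> B + 1" "norm A \<le> h" for x y A h
  proof -
    have h: "0 \<le> h" using that(2) norm_ge_zero order_trans by blast
    have \<tau>: "norm y ^ ?N \<in> {0..(B+1)^?N}" using that by (auto intro: power_mono)
    have k: "\<bar>\<kappa> (norm y ^ ?N)\<bar> \<le> b" "\<bar>\<kappa>' (norm y ^ ?N)\<bar> \<le> b" using b \<tau> by auto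
    have hp: "h ^ (?N - 1) \<le> 1 + h ^ ?N"
    proof (cases "h \<le> 1")
      case True
      then have "h ^ (?N - 1) \<le> 1" using h by (simp add: power_le_one)
      then show ?thesis using h by (simp add: add_increasing2)
    next
      case False
      then have "h ^ (?N - 1) \<le> h ^ ?N" by (intro power_increasing) auto
      then show ?thesis by simp
    qed
    have "\<bar>\<kappa> (norm y ^ ?N) * flux A y (D\<eta> x)\<bar> \<le> b * ((fact ?N * ?N) * (norm (D\<eta> x) * (norm y * norm A ^ (?N - 1))))"
      unfolding abs_mult using b(1) by (intro mult_mono k abs_flux_le) auto
    also have "\<dots> \<le> b * ((fact ?N * ?N) * (E' * ((B + 1) * h ^ (?N - 1))))"
      using b(1) E' B that h by (intro mult_left_mono mult_mono power_mono) auto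
    also have "\<dots> \<le> b * ((fact ?N * ?N) * (E' * ((B + 1) * (1 + h ^ ?N))))"
      using b(1) E' B h hp by (intro mult_left_mono) auto
    finally have 1: "\<bar>\<kappa> (norm y ^ ?N) * flux A y (D\<eta> x)\<bar> \<le> b * ((fact ?N * ?N) * (E' * (B + 1))) * (1 + h ^ ?N)"
      by (simp only: mult.assoc)
    have "\<bar>\<kappa> (norm y ^ ?N) + norm y ^ ?N * \<kappa>' (norm y ^ ?N)\<bar> \<le> \<bar>\<kappa> (norm y ^ ?N)\<bar> + \<bar>norm y ^ ?N * \<kappa>' (norm y ^ ?N)\<bar>" by (rule abs_triangle_ineq)
    also have "\<dots> \<le> b + (B+1)^?N * b"
      unfolding abs_mult using k \<tau> b(1) B(1) by (intro add_mono mult_mono) auto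
    finally have 2: "\<bar>\<kappa> (norm y ^ ?N) + norm y ^ ?N * \<kappa>' (norm y ^ ?N)\<bar> \<le> b + (B+1)^?N * b" .
    have "\<bar>?N * \<eta> x * (\<kappa> (norm y ^ ?N) + norm y ^ ?N * \<kappa>' (norm y ^ ?N)) * det A\<bar>
       = ?N * \<bar>\<eta> x\<bar> * \<bar>\<kappa> (norm y ^ ?N) + norm y ^ ?N * \<kappa>' (norm y ^ ?N)\<bar> * \<bar>det A\<bar>" by (simp add: abs_mult)
    also have "\<dots> \<le> ?N * E * (b + (B+1)^?N * b) * (fact ?N * h ^ ?N)"
      using 2 E abs_det_replace_row_le(2)[OF that(2)] b(1) B(1) by (intro mult_mono) auto
    also have "\<dots> \<le> ?N * E * (b + (B+1)^?N * b) * (fact ?N * (1 + h ^ ?N))"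
      using E(1) b(1) B(1) by (intro mult_left_mono) auto
    finally have 3: "\<bar>?N * \<eta> x * (\<kappa> (norm y ^ ?N) + norm y ^ ?N * \<kappa>' (norm y ^ ?N)) * det A\<bar> \<le> ?N * E * (b + (B+1)^?N * b) * fact ?N * (1 + h ^ ?N)"
      by (simp only: mult.assoc)
    show ?thesis unfolding \<Psi>_def c_def distrib_right
      by (rule order_trans[OF abs_triangle_ineq add_mono[OF 1 3]])
  qed
  \<comment> \<open>From m0 on the approximations stay within distance 1 of g on the ball, so the
    bounds for \<kappa> and \<kappa>' on [0, (B+1)^n] apply to them.\<close>
  obtain m0 where m0: "\<And>m x. m0 \<le> m \<Longrightarrow> x \<in> cball 0 R \<Longrightarrow> dist (G m x) (g x) < 1"
    using G(2) unfolding uniform_limit_iff eventually_sequentially by (metis zero_less_one)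
  have Gb: "norm (G (m + m0) x) \<le> B + 1" if "x \<in> cball 0 R" for m x
    using m0[of "m + m0" x] B(2)[OF that] that norm_triangle_sub[of "G (m + m0) x" "g x"] by (simp add: dist_norm)
  have "(\<lambda>m. LINT x|lborel. \<Psi> x (G (m + m0) x) (DG (m + m0) x)) \<longlonglongrightarrow> (LINT x|lborel. \<Psi> x (g x) (Dg x))"
  proof (rule integral_dominated_convergence[where w="\<lambda>x. c * (indicator (cball 0 R) x + indicator (cball 0 R) x *\<^sub>R H x ^ ?N)"])
    have meas: "(\<lambda>x. \<Psi> x (y x) (A x)) \<in> borel_measurable lborel"
      if y: "continuous_on UNIV y" and A: "A \<in> borel_measurable borel" for y :: "real^'n \<Rightarrow> real^'n" and A :: "real^'n \<Rightarrow> real^'n^'n"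
    proof -
      have [measurable]: "y \<in> borel_measurable borel" using y by (rule borel_measurable_continuous_onI)
      have [measurable]: "\<eta> \<in> borel_measurable borel" "D\<eta> \<in> borel_measurable borel"
        using c\<eta> by (auto intro: borel_measurable_continuous_onI)
      have cn: "continuous_on UNIV (\<lambda>x. norm (y x) ^ ?N)" by (intro continuous_intros y)
      have [measurable]: "(\<lambda>x. \<kappa> (norm (y x) ^ ?N)) \<in> borel_measurable borel" "(\<lambda>x. \<kappa>' (norm (y x) ^ ?N)) \<in> borel_measurable borel"
        by (auto intro!: borel_measurable_continuous_onI continuous_on_compose2[OF c\<kappa> cn] continuous_on_compose2[OF \<kappa>(2) cn])
      have comp: "(\<lambda>x. A x $ i $ j) \<in> borel_measurable borel" for i j
        by (rule borel_measurable_continuous_on[OF _ A]) (intro continuous_intros)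
      have comp': "(\<lambda>x. y x $ i) \<in> borel_measurable borel" "(\<lambda>x. D\<eta> x $ i) \<in> borel_measurable borel" for i
        by (rule borel_measurable_continuous_onI, intro continuous_intros y c\<eta>)+
      have 1: "(\<lambda>x. det (A x)) \<in> borel_measurable borel"
        unfolding det_def by (intro borel_measurable_sum borel_measurable_times borel_measurable_prod comp) auto
      have 2: "(\<lambda>x. det (replace_row (A x) k (D\<eta> x))) \<in> borel_measurable borel" for k
      proof -
        have "(\<lambda>x. replace_row (A x) k (D\<eta> x) $ i $ j) \<in> borel_measurable borel" for i j
          using comp comp' by (cases "i = k") auto
        then show ?thesis
          unfolding det_def by (intro borel_measurable_sum borel_measurable_times borel_measurable_prod) auto
      qed
      note [measurable] = comp' 1 2
      show ?thesis unfolding \<Psi>_def flux_def by measurable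
    qed
    show "(\<lambda>x. \<Psi> x (g x) (Dg x)) \<in> borel_measurable lborel" by (rule meas[OF cg mDg])
    show "(\<lambda>x. \<Psi> x (G (m + m0) x) (DG (m + m0) x)) \<in> borel_measurable lborel" for m
      by (intro meas borel_measurable_continuous_onI C2_map_continuous[OF G(1)])
    have "integrable lborel (indicator (cball 0 R) :: real^'n \<Rightarrow> real)" by (rule integrable_indicator_cball)
    then show "integrable lborel (\<lambda>x. c * (indicator (cball 0 R) x + indicator (cball 0 R) x *\<^sub>R H x ^ ?N))"
      using G(6) unfolding set_integrable_def by (intro integrable_mult_right Bochner_Integration.integrable_add)
    have out: "\<Psi> x y A = 0" if "x \<notin> cball 0 R" for x y A
      using R that by (simp add: \<Psi>_def flux_def)
    show "AE x in lborel. (\<lambda>m. \<Psi> x (G (m + m0) x) (DG (m + m0) x)) \<longlonglongrightarrow> \<Psi> x (g x) (Dg x)"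
      using G(3)
    proof eventually_elim
      case (elim x)
      show ?case
      proof (cases "x \<in> cball 0 R")
        case True
        then have "(\<lambda>m. G m x) \<longlonglongrightarrow> g x" "(\<lambda>m. DG m x) \<longlonglongrightarrow> Dg x"
          using tendsto_uniform_limitI[OF G(2)] elim by auto
        then show ?thesis by (intro c\<Psi> LIMSEQ_ignore_initial_segment)
      qed (simp add: out)
    qed
    show "AE x in lborel. norm (\<Psi> x (G (m + m0) x) (DG (m + m0) x)) \<le> c * (indicator (cball 0 R) x + indicator (cball 0 R) x *\<^sub>R H x ^ ?N)" for m
      using G(7)
    proof eventually_elim
      case (elim x)
      show ?case
      proof (cases "x \<in> cball 0 R")
        case True
        have "\<bar>\<Psi> x (G (m + m0) x) (DG (m + m0) x)\<bar> \<le> c * (1 + H x ^ ?N)"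
          by (rule bound[OF Gb[OF True]]) (use elim True in auto)
        then show ?thesis using True by simp
      qed (simp add: out)
    qed
  qed
  moreover have "(LINT x|lborel. \<Psi> x (G m x) (DG m x)) = 0" for m
    unfolding \<Psi>_def by (rule radial_identity_C2[OF G(1) n \<eta> \<kappa>])
  ultimately have "(LINT x|lborel. \<Psi> x (g x) (Dg x)) = 0" by (simp add: LIMSEQ_const_iff)
  then show ?thesis by (simp add: \<Psi>_def)
qed

section \<open>Variation of Sobolev maps under translations\<close>

lemma nn_integral_translate:
  fixes f :: "'a::euclidean_space \<Rightarrow> ennreal"
  assumes "f \<in> borel_measurable borel"
  shows "(\<integral>\<^sup>+x. f (x + c) \<partial>lborel) = (\<integral>\<^sup>+x. f x \<partial>lborel)"
proof -
  have "(\<integral>\<^sup>+x. f x \<partial>lborel) = (\<integral>\<^sup>+x. f x \<partial>distr lborel borel (\<lambda>x. c + x))"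
    by (simp add: lborel_distr_plus)
  also have "\<dots> = (\<integral>\<^sup>+x. f (x + c) \<partial>lborel)"
    using assms by (subst nn_integral_distr) (auto simp: add.commute)
  finally show ?thesis by simp
qed

text \<open>Fundamental theorem of calculus along the segment from x to x + z, then Fubini: for
  every t in [0,1] the translate of A by t z lies in A'.\<close>

lemma C1_variation:
  fixes k :: "'a::euclidean_space \<Rightarrow> real"
  assumes k: "\<And>x. (k has_derivative (\<lambda>h. Dk x \<bullet> h)) (at x)" "continuous_on UNIV Dk"
    and A: "A \<in> sets borel" "A' \<in> sets borel" "\<And>x t. x \<in> A \<Longrightarrow> 0 \<le> t \<Longrightarrow> t \<le> 1 \<Longrightarrow> x + t *\<^sub>R z \<in> A'"
  shows "(\<integral>\<^sup>+x\<in>A. ennreal \<bar>k (x + z) - k x\<bar> \<partial>lborel) \<le> ennreal (norm z) * (\<integral>\<^sup>+x\<in>A'. ennreal (norm (Dk x)) \<partial>lborel)"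
proof -
  define \<phi> where "\<phi> x = norm (Dk x)" for x
  have c\<phi>: "continuous_on UNIV \<phi>" unfolding \<phi>_def[abs_def] by (intro continuous_intros k)
  have [measurable]: "\<phi> \<in> borel_measurable borel" using c\<phi> by (rule borel_measurable_continuous_onI)
  note [measurable] = A(1,2)
  have seg: "ennreal \<bar>k (x + z) - k x\<bar> \<le> (\<integral>\<^sup>+t\<in>{0..1}. ennreal (norm z * \<phi> (x + t *\<^sub>R z)) \<partial>lborel)" for x
  proof -
    define q' where "q' t = Dk (x + t *\<^sub>R z) \<bullet> z" for t
    have cq': "continuous_on S q'" for S unfolding q'_def[abs_def]
      by (intro continuous_intros continuous_on_compose2[OF k(2)]) auto
    have d: "((\<lambda>t. k (x + t *\<^sub>R z)) has_vector_derivative q' t) (at t within S)" for t S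
    proof -
      have "((\<lambda>t. x + t *\<^sub>R z) has_derivative (\<lambda>t. t *\<^sub>R z)) (at t within S)" by (auto intro!: derivative_eq_intros)
      from has_derivative_compose[OF this k(1)] show ?thesis
        by (simp add: has_vector_derivative_def q'_def)
    qed
    have "(LINT t|lborel. indicator {0..1} t *\<^sub>R q' t) = k (x + 1 *\<^sub>R z) - k (x + 0 *\<^sub>R z)"
      by (rule integral_FTC_atLeastAtMost[OF _ d cq']) simp
    then have "ennreal \<bar>k (x + z) - k x\<bar> = ennreal (norm (LINT t|lborel. indicator {0..1} t *\<^sub>R q' t))" by simp
    also have "\<dots> \<le> (\<integral>\<^sup>+t. ennreal (norm (indicator {0..1} t *\<^sub>R q' t)) \<partial>lborel)"
      by (intro integral_norm_bound_ennreal borel_integrable_compact cq') auto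
    also have "\<dots> \<le> (\<integral>\<^sup>+t\<in>{0..1}. ennreal (norm z * \<phi> (x + t *\<^sub>R z)) \<partial>lborel)"
    proof (rule nn_integral_mono)
      fix t
      have "\<bar>q' t\<bar> \<le> norm z * \<phi> (x + t *\<^sub>R z)"
        unfolding q'_def \<phi>_def by (subst mult.commute) (rule Cauchy_Schwarz_ineq2)
      then show "ennreal (norm (indicator {0..1} t *\<^sub>R q' t)) \<le> ennreal (norm z * \<phi> (x + t *\<^sub>R z)) * indicator {0..1} t"
        by (auto simp: indicator_def intro: ennreal_leI)
    qed
    finally show ?thesis .
  qed
  have "(\<integral>\<^sup>+x\<in>A. ennreal \<bar>k (x + z) - k x\<bar> \<partial>lborel) \<le> (\<integral>\<^sup>+x\<in>A. (\<integral>\<^sup>+t\<in>{0..1}. ennreal (norm z * \<phi> (x + t *\<^sub>R z)) \<partial>lborel) \<partial>lborel)"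
    by (intro nn_integral_mono mult_right_mono seg) auto
  also have "\<dots> = (\<integral>\<^sup>+x. (\<integral>\<^sup>+t. ennreal (norm z * \<phi> (x + t *\<^sub>R z)) * indicator {0..1::real} t * indicator A x \<partial>lborel) \<partial>lborel)"
    by (intro nn_integral_cong nn_integral_multc[symmetric]) measurable
  also have "\<dots> = (\<integral>\<^sup>+t. (\<integral>\<^sup>+x. ennreal (norm z * \<phi> (x + t *\<^sub>R z)) * indicator {0..1::real} t * indicator A x \<partial>lborel) \<partial>lborel)"
    by (rule lborel_pair.Fubini') measurable
  also have "\<dots> \<le> (\<integral>\<^sup>+t. (ennreal (norm z) * (\<integral>\<^sup>+x\<in>A'. ennreal (\<phi> x) \<partial>lborel)) * indicator {0..1::real} t \<partial>lborel)"
  proof (rule nn_integral_mono)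
    fix t :: real
    show "(\<integral>\<^sup>+x. ennreal (norm z * \<phi> (x + t *\<^sub>R z)) * indicator {0..1::real} t * indicator A x \<partial>lborel) \<le> (ennreal (norm z) * (\<integral>\<^sup>+x\<in>A'. ennreal (\<phi> x) \<partial>lborel)) * indicator {0..1::real} t"
    proof (cases "t \<in> {0..1}")
      case True
      have "(\<integral>\<^sup>+x. ennreal (norm z * \<phi> (x + t *\<^sub>R z)) * indicator {0..1::real} t * indicator A x \<partial>lborel)
          \<le> (\<integral>\<^sup>+x. ennreal (norm z) * (ennreal (\<phi> (x + t *\<^sub>R z)) * indicator A' (x + t *\<^sub>R z)) \<partial>lborel)"
        using A(3) True by (intro nn_integral_mono) (auto simp: indicator_def ennreal_mult')
      also have "\<dots> = (\<integral>\<^sup>+x. ennreal (norm z) * (ennreal (\<phi> x) * indicator A' x) \<partial>lborel)"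
        by (rule nn_integral_translate[of "\<lambda>x. ennreal (norm z) * (ennreal (\<phi> x) * indicator A' x)"]) measurable
      also have "\<dots> = ennreal (norm z) * (\<integral>\<^sup>+x\<in>A'. ennreal (\<phi> x) \<partial>lborel)"
        by (rule nn_integral_cmult) measurable
      finally show ?thesis using True by simp
    qed simp
  qed
  also have "\<dots> = ennreal (norm z) * (\<integral>\<^sup>+x\<in>A'. ennreal (\<phi> x) \<partial>lborel)"
    by (subst nn_integral_cmult_indicator) auto
  finally show ?thesis by (simp add: \<phi>_def)
qed

lemma norm_matrix_vector_mult_le:
  fixes M :: "real^'n^'m" shows "norm (M *v v) \<le> norm M * norm v"
proof -
  have "norm (M *v v) = L2_set (\<lambda>i. norm ((M *v v) $ i)) UNIV" by (simp add: norm_vec_def)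
  also have "\<dots> \<le> L2_set (\<lambda>i. norm (M $ i) * norm v) UNIV"
    by (rule L2_set_mono) (simp_all add: matrix_vector_mul_component Cauchy_Schwarz_ineq2)
  also have "\<dots> = L2_set (\<lambda>i. norm (M $ i)) UNIV * norm v" by (rule L2_set_left_distrib[symmetric]) simp
  also have "\<dots> = norm M * norm v" by (simp only: norm_vec_def[of M])
  finally show ?thesis .
qed

text \<open>\<open>C1_variation\<close> for h composed with the smooth approximations; the left side
  passes to the limit by Fatou's lemma, the right side by dominated convergence.\<close>

lemma locally_approximable_variation:
  fixes g :: "real^'n \<Rightarrow> real^'m"
  assumes g: "locally_approximable p g Dg" and p: "1 \<le> p"
    and h: "\<And>y. (h has_derivative (\<lambda>v. Dh y \<bullet> v)) (at y)" "continuous_on UNIV Dh"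
    and A: "A \<in> sets borel" "A' \<in> sets borel" "bounded A'" "\<And>x t. x \<in> A \<Longrightarrow> 0 \<le> t \<Longrightarrow> t \<le> 1 \<Longrightarrow> x + t *\<^sub>R z \<in> A'"
  shows "(\<integral>\<^sup>+x\<in>A. ennreal \<bar>h (g (x + z)) - h (g x)\<bar> \<partial>lborel) \<le> ennreal (norm z) * (\<integral>\<^sup>+x\<in>A'. ennreal (norm (Dh (g x)) * norm (Dg x)) \<partial>lborel)"
proof -
  obtain R where R: "A' \<subseteq> cball 0 R" using A(3) by (auto simp: bounded_iff subset_iff)
  obtain G DG H where G: "\<And>m. C2_map (G m) (DG m)" "uniform_limit (cball 0 R) G g sequentially"
    "AE x in lborel. x \<in> cball 0 R \<longrightarrow> (\<lambda>m. DG m x) \<longlonglongrightarrow> Dg x"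
    "H \<in> borel_measurable borel" "\<And>x. 0 \<le> H x" "set_integrable lborel (cball 0 R) (\<lambda>x. H x ^ p)"
    "AE x in lborel. x \<in> cball 0 R \<longrightarrow> (\<forall>m. norm (DG m x) \<le> H x)"
    by (rule locally_approximableE[OF g, of R]) (rule that)
  have cg: "continuous_on UNIV g" and [measurable]: "Dg \<in> borel_measurable borel"
    using g by (auto simp: locally_approximable_def)
  note [measurable] = A(1,2) G(4)
  have ch: "continuous_on UNIV h" using h(1) by (auto intro!: continuous_at_imp_continuous_on has_derivative_continuous)
  have cG: "continuous_on UNIV (G m)" "continuous_on UNIV (DG m)" for m using C2_map_continuous[OF G(1)] by auto
  define Dk where "Dk m x = Dh (G m x) v* DG m x" for m x
  have Dkh: "Dk m x \<bullet> v = Dh (G m x) \<bullet> (DG m x *v v)" for m x v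
    unfolding Dk_def by (rule dot_lmul_matrix)
  have dk: "((\<lambda>x. h (G m x)) has_derivative (\<lambda>v. Dk m x \<bullet> v)) (at x)" for m x
  proof -
    have "(G m has_derivative (\<lambda>v. DG m x *v v)) (at x)" using G(1) by (simp add: C2_map_def)
    from has_derivative_compose[OF this h(1)] show ?thesis by (simp add: Dkh)
  qed
  have cDk: "continuous_on UNIV (Dk m)" for m
    unfolding Dk_def[abs_def] vector_matrix_mult_def
    by (intro continuous_on_vec_lambda continuous_on_sum continuous_intros continuous_on_compose2[OF h(2) cG(1)] cG) auto
  have nDk: "norm (Dk m x) \<le> norm (Dh (G m x)) * norm (DG m x)" for m x
  proof -
    have "norm (Dk m x) * norm (Dk m x) = Dh (G m x) \<bullet> (DG m x *v Dk m x)"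
      using Dkh[of m x "Dk m x"] by (simp add: power2_norm_eq_inner flip: power2_eq_square)
    also have "\<dots> \<le> norm (Dh (G m x)) * norm (DG m x *v Dk m x)" by (rule norm_cauchy_schwarz)
    also have "\<dots> \<le> norm (Dh (G m x)) * (norm (DG m x) * norm (Dk m x))" by (intro mult_left_mono norm_matrix_vector_mult_le) auto
    finally show ?thesis by (cases "Dk m x = 0") (auto simp: mult.assoc[symmetric])
  qed
  define B where "B m x = norm (Dh (G m x)) * norm (DG m x)" for m x
  have step: "(\<integral>\<^sup>+x\<in>A. ennreal \<bar>h (G m (x + z)) - h (G m x)\<bar> \<partial>lborel) \<le> ennreal (norm z) * (\<integral>\<^sup>+x\<in>A'. ennreal (B m x) \<partial>lborel)" for m
  proof -
    have "(\<integral>\<^sup>+x\<in>A. ennreal \<bar>h (G m (x + z)) - h (G m x)\<bar> \<partial>lborel) \<le> ennreal (norm z) * (\<integral>\<^sup>+x\<in>A'. ennreal (norm (Dk m x)) \<partial>lborel)"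
      by (rule C1_variation[OF dk cDk A(1,2,4)])
    also have "\<dots> \<le> ennreal (norm z) * (\<integral>\<^sup>+x\<in>A'. ennreal (B m x) \<partial>lborel)"
      unfolding B_def by (intro mult_left_mono nn_integral_mono mult_right_mono ennreal_leI nDk) auto
    finally show ?thesis .
  qed
  obtain b0 where b0: "0 < b0" "\<And>x. x \<in> cball 0 R \<Longrightarrow> norm (g x) \<le> b0"
  proof -
    have "compact (g ` cball 0 R)" by (intro compact_continuous_image continuous_on_subset[OF cg]) auto
    then show ?thesis using that compact_imp_bounded[of "g ` cball 0 R"] by (auto simp: bounded_pos)
  qed
  obtain b where b: "0 < b" "\<And>y. y \<in> cball 0 (b0 + 1) \<Longrightarrow> norm (Dh y) \<le> b"
  proof -
    have "compact (Dh ` cball 0 (b0 + 1))" by (intro compact_continuous_image continuous_on_subset[OF h(2)]) auto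
    then show ?thesis using that compact_imp_bounded[of "Dh ` cball 0 (b0 + 1)"] by (auto simp: bounded_pos)
  qed
  obtain m0 where m0: "\<And>m x. m0 \<le> m \<Longrightarrow> x \<in> cball 0 R \<Longrightarrow> dist (G m x) (g x) < 1"
    using G(2) unfolding uniform_limit_iff eventually_sequentially by (metis zero_less_one)
  have Gb: "norm (Dh (G (m + m0) x)) \<le> b" if "x \<in> cball 0 R" for m x
    using m0[of "m + m0" x] b0(2)[OF that] that norm_triangle_sub[of "G (m + m0) x" "g x"]
    by (intro b(2)) (simp add: dist_norm)
  have tG: "(\<lambda>m. G (m + m0) x) \<longlonglongrightarrow> g x" if "x \<in> cball 0 R" for x
    using tendsto_uniform_limitI[OF G(2) that] by (rule LIMSEQ_ignore_initial_segment)
  have lim: "(\<lambda>m. \<integral>\<^sup>+x\<in>A'. ennreal (B (m + m0) x) \<partial>lborel) \<longlonglongrightarrow> (\<integral>\<^sup>+x\<in>A'. ennreal (norm (Dh (g x)) * norm (Dg x)) \<partial>lborel)"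
  proof (rule nn_integral_dominated_convergence[where w="\<lambda>x. ennreal (b * (indicator (cball 0 R) x + indicator (cball 0 R) x *\<^sub>R H x ^ p))"])
    have cB: "continuous_on UNIV (B m)" for m unfolding B_def[abs_def]
      by (intro continuous_intros continuous_on_compose2[OF h(2) cG(1)] cG) auto
    have [measurable]: "B m \<in> borel_measurable borel" for m using cB by (rule borel_measurable_continuous_onI)
    show "(\<lambda>x. ennreal (B (m + m0) x) * indicator A' x) \<in> borel_measurable lborel" for m by measurable
    have "continuous_on UNIV (\<lambda>x. norm (Dh (g x)))" by (intro continuous_intros continuous_on_compose2[OF h(2) cg]) auto
    then have [measurable]: "(\<lambda>x. norm (Dh (g x))) \<in> borel_measurable borel" by (rule borel_measurable_continuous_onI)
    show "(\<lambda>x. ennreal (norm (Dh (g x)) * norm (Dg x)) * indicator A' x) \<in> borel_measurable lborel" by measurable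
    have "(\<lambda>x. b * (indicator (cball 0 R) x + indicator (cball 0 R) x *\<^sub>R H x ^ p)) \<in> borel_measurable borel"
      by (intro borel_measurable_times borel_measurable_add borel_measurable_scaleR borel_measurable_indicator borel_measurable_power G(4)) auto
    then show "(\<lambda>x. ennreal (b * (indicator (cball 0 R) x + indicator (cball 0 R) x *\<^sub>R H x ^ p))) \<in> borel_measurable lborel" by simp
    have "integrable lborel (indicator (cball 0 R) :: real^'n \<Rightarrow> real)" by (rule integrable_indicator_cball)
    then have "integrable lborel (\<lambda>x. b * (indicator (cball 0 R) x + indicator (cball 0 R) x *\<^sub>R H x ^ p))"
      using G(6) unfolding set_integrable_def by (intro integrable_mult_right Bochner_Integration.integrable_add)
    then show "(\<integral>\<^sup>+x. ennreal (b * (indicator (cball 0 R) x + indicator (cball 0 R) x *\<^sub>R H x ^ p)) \<partial>lborel) < \<infinity>"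
      using b G(5) by (subst nn_integral_eq_integral) auto
    show "AE x in lborel. (\<lambda>m. ennreal (B (m + m0) x) * indicator A' x) \<longlonglongrightarrow> ennreal (norm (Dh (g x)) * norm (Dg x)) * indicator A' x"
      using G(3)
    proof eventually_elim
      case (elim x)
      show ?case
      proof (cases "x \<in> A'")
        case True
        then have x: "x \<in> cball 0 R" using R by auto
        have "(\<lambda>m. DG (m + m0) x) \<longlonglongrightarrow> Dg x" using elim x by (intro LIMSEQ_ignore_initial_segment) auto
        moreover have "(\<lambda>m. Dh (G (m + m0) x)) \<longlonglongrightarrow> Dh (g x)"
          by (rule continuous_on_tendsto_compose[OF h(2) tG[OF x]]) auto
        ultimately show ?thesis unfolding B_def by (simp add: True, intro tendsto_ennrealI tendsto_mult tendsto_norm)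
      qed simp
    qed
    show "AE x in lborel. ennreal (B (m + m0) x) * indicator A' x \<le> ennreal (b * (indicator (cball 0 R) x + indicator (cball 0 R) x *\<^sub>R H x ^ p))" for m
      using G(7)
    proof eventually_elim
      case (elim x)
      show ?case
      proof (cases "x \<in> A'")
        case True
        then have x: "x \<in> cball 0 R" using R by auto
        have "B (m + m0) x \<le> b * H x"
          unfolding B_def using Gb[OF x] elim x b by (intro mult_mono) auto
        also have "H x \<le> 1 + H x ^ p" by (rule le_one_plus_power[OF G(5) p])
        finally show ?thesis using True x b(1) by (auto intro: ennreal_leI)
      qed simp
    qed
  qed
  have "(\<integral>\<^sup>+x\<in>A. ennreal \<bar>h (g (x + z)) - h (g x)\<bar> \<partial>lborel)
      = (\<integral>\<^sup>+x. liminf (\<lambda>m. ennreal \<bar>h (G (m + m0) (x + z)) - h (G (m + m0) x)\<bar> * indicator A x) \<partial>lborel)"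
  proof (rule nn_integral_cong)
    fix x
    have "(\<lambda>m. ennreal \<bar>h (G (m + m0) (x + z)) - h (G (m + m0) x)\<bar> * indicator A x) \<longlonglongrightarrow> ennreal \<bar>h (g (x + z)) - h (g x)\<bar> * indicator A x"
    proof (cases "x \<in> A")
      case True
      then have "x \<in> cball 0 R" "x + z \<in> cball 0 R" using A(4)[of x 0] A(4)[of x 1] R by auto
      then have "(\<lambda>m. h (G (m + m0) (x + z))) \<longlonglongrightarrow> h (g (x + z))" "(\<lambda>m. h (G (m + m0) x)) \<longlonglongrightarrow> h (g x)"
        by (auto intro!: continuous_on_tendsto_compose[OF ch] tG)
      then show ?thesis by (simp add: True, intro tendsto_ennrealI tendsto_rabs tendsto_diff)
    qed simp
    from lim_imp_Liminf[OF _ this] show "ennreal \<bar>h (g (x + z)) - h (g x)\<bar> * indicator A x = liminf (\<lambda>m. ennreal \<bar>h (G (m + m0) (x + z)) - h (G (m + m0) x)\<bar> * indicator A x)"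
      by simp
  qed
  also have "\<dots> \<le> liminf (\<lambda>m. \<integral>\<^sup>+x\<in>A. ennreal \<bar>h (G (m + m0) (x + z)) - h (G (m + m0) x)\<bar> \<partial>lborel)"
  proof (rule nn_integral_liminf)
    fix m
    have "continuous_on UNIV (\<lambda>x. h (G (m + m0) (x + z)) - h (G (m + m0) x))"
      by (intro continuous_intros continuous_on_compose2[OF ch] continuous_on_compose2[OF cG(1)] cG(1)) auto
    then have [measurable]: "(\<lambda>x. h (G (m + m0) (x + z)) - h (G (m + m0) x)) \<in> borel_measurable borel" by (rule borel_measurable_continuous_onI)
    show "(\<lambda>x. ennreal \<bar>h (G (m + m0) (x + z)) - h (G (m + m0) x)\<bar> * indicator A x) \<in> borel_measurable lborel"
      by measurable
  qed
  also have "\<dots> \<le> liminf (\<lambda>m. ennreal (norm z) * (\<integral>\<^sup>+x\<in>A'. ennreal (B (m + m0) x) \<partial>lborel))"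
    by (intro Liminf_mono always_eventually allI step)
  also have "\<dots> = ennreal (norm z) * (\<integral>\<^sup>+x\<in>A'. ennreal (norm (Dh (g x)) * norm (Dg x)) \<partial>lborel)"
    using lim by (intro lim_imp_Liminf ennreal_tendsto_cmult) auto
  finally show ?thesis .
qed

section \<open>Mollification\<close>

text \<open>With s = 1 / (1 - t^2), so that s' = 2 t s^2, the derivative of P s^(2k) exp(-s) has the
  form Q s^(2k+2) exp(-s); the recursion expresses Q through P, the polynomial
  \<open>[:1, 0, -1:]\<close> being 1 / s.\<close>

fun bump_poly :: "nat \<Rightarrow> real poly" where
  "bump_poly 0 = 1"
| "bump_poly (Suc k) = pderiv (bump_poly k) * [:1, 0, -1:]^2 + smult (4 * real k) ([:0, 1:] * bump_poly k * [:1, 0, -1:])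
     - smult 2 ([:0, 1:] * bump_poly k)"

text \<open>The \<open>k\<close>-th derivative of \<open>exp (-1 / (1 - t\<^sup>2))\<close> on \<open>(-1, 1)\<close>, extended by zero.\<close>

definition bump :: "nat \<Rightarrow> real \<Rightarrow> real" where
  "bump k t = (if \<bar>t\<bar> < 1 then poly (bump_poly k) t * (1 / (1 - t^2)) ^ (2 * k) * exp (- (1 / (1 - t^2))) else 0)"

lemma power_le_fact_mult_exp:
  assumes "0 \<le> (x::real)" shows "x ^ n \<le> fact n * exp x"
proof -
  have "(\<Sum>k\<in>{n}. x ^ k /\<^sub>R fact k) \<le> (\<Sum>k. x ^ k /\<^sub>R fact k)"
    using assms by (intro sum_le_suminf summable_exp_generic) auto
  then have "x ^ n / fact n \<le> exp x" by (simp add: exp_def divide_inverse mult.commute)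
  then show ?thesis by (simp add: pos_divide_le_eq mult.commute)
qed

lemma has_real_derivative_zero_of_quadratic_bound:
  fixes f :: "real \<Rightarrow> real"
  assumes "\<And>x. \<bar>f x\<bar> \<le> c * (x - t)^2"
  shows "(f has_real_derivative 0) (at t)"
proof -
  have ft: "f t = 0" using assms[of t] by simp
  have "((\<lambda>h. f (t + h) / h) \<longlongrightarrow> 0) (at 0)"
  proof (rule tendsto_0_le[where K=c])
    show "((\<lambda>h::real. h) \<longlongrightarrow> 0) (at 0)" by (rule tendsto_ident_at)
    show "\<forall>\<^sub>F h in at 0. norm (f (t + h) / h) \<le> norm h * c"
    proof (rule eventually_at_topological[THEN iffD2], intro exI[of _ UNIV] conjI ballI impI)
      fix h :: real assume "h \<noteq> 0"
      have "\<bar>f (t + h)\<bar> \<le> c * h^2" using assms[of "t + h"] by simp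
      then have "\<bar>f (t + h)\<bar> / \<bar>h\<bar> \<le> c * h^2 / \<bar>h\<bar>" by (intro divide_right_mono) auto
      also have "\<dots> = \<bar>h\<bar> * c" using \<open>h \<noteq> 0\<close> by (simp add: power2_eq_square abs_if)
      finally show "norm (f (t + h) / h) \<le> norm h * c" by simp
    qed auto
  qed
  then show ?thesis by (simp add: DERIV_def ft)
qed

text \<open>The points t = 1 and t = -1 are the issue. From s^(2k+2) \<le> (2k+2)! exp s one gets
  s^(2k) exp(-s) \<le> (2k+2)! (1 - x^2)^2, and 1 - x^2 is at most 2 |x - t|, so the function is
  quadratically small there and has derivative 0.\<close>

lemma has_real_derivative_bump: "(bump k has_real_derivative bump (Suc k) t) (at t)"
proof -
  consider "\<bar>t\<bar> < 1" | "1 < \<bar>t\<bar>" | "\<bar>t\<bar> = 1" by linarith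
  then show ?thesis
  proof cases
    case 1
    then have t2: "0 < 1 - t^2" by (simp add: abs_square_less_1)
    define s where "s = 1 / (1 - t^2)"
    have s0: "s \<noteq> 0" using t2 by (simp add: s_def)
    define R where "R = poly (bump_poly k) t"
    define R' where "R' = poly (pderiv (bump_poly k)) t"
    have ds: "((\<lambda>t. 1 / (1 - t^2)) has_real_derivative 2 * t * s^2) (at t)"
      using t2 by (auto intro!: derivative_eq_intros simp: s_def power2_eq_square field_simps)
    have dp: "((\<lambda>t. (1 / (1 - t^2)) ^ (2 * k)) has_real_derivative real (2 * k) * s ^ (2 * k - 1) * (2 * t * s^2)) (at t)"
      using DERIV_power[OF ds, of "2 * k"] by (simp add: s_def mult.commute mult.left_commute)
    have de: "((\<lambda>t. exp (- (1 / (1 - t^2)))) has_real_derivative exp (- s) * (- (2 * t * s^2))) (at t)"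
      using DERIV_chain2[OF DERIV_exp DERIV_minus[OF ds]] by (simp add: s_def)
    have "((\<lambda>t. poly (bump_poly k) t * (1 / (1 - t^2)) ^ (2 * k) * exp (- (1 / (1 - t^2)))) has_real_derivative
        (R' * s ^ (2 * k) + real (2 * k) * s ^ (2 * k - 1) * (2 * t * s^2) * R) * exp (- s) + exp (- s) * (- (2 * t * s^2)) * (R * s ^ (2 * k))) (at t)"
      using DERIV_mult[OF DERIV_mult[OF poly_DERIV dp] de] by (simp add: s_def R_def R'_def)
    moreover have "(R' * s ^ (2 * k) + real (2 * k) * s ^ (2 * k - 1) * (2 * t * s^2) * R) * exp (- s) + exp (- s) * (- (2 * t * s^2)) * (R * s ^ (2 * k))
        = bump (Suc k) t"
    proof -
      have i: "1 - t^2 = 1 / s" by (simp add: s_def)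
      have "poly (bump_poly (Suc k)) t = R' * (1 / s)^2 + 4 * real k * (t * R * (1 / s)) - 2 * (t * R)"
        unfolding i[symmetric] by (simp add: R_def R'_def power2_eq_square algebra_simps)
      then have "bump (Suc k) t = (R' * (1 / s)^2 + 4 * real k * (t * R * (1 / s)) - 2 * (t * R)) * s ^ (2 * Suc k) * exp (- s)"
        using 1 by (simp add: bump_def s_def)
      also have "s ^ (2 * Suc k) = s ^ (2 * k) * s^2" by (simp add: power2_eq_square)
      also have "(R' * (1 / s)^2 + 4 * real k * (t * R * (1 / s)) - 2 * (t * R)) * (s ^ (2 * k) * s^2)
          = R' * s ^ (2 * k) + 4 * real k * (t * R) * (s * s ^ (2 * k)) - 2 * (t * R) * (s ^ (2 * k) * s^2)"
        using s0 by (simp add: field_simps power2_eq_square)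
      finally have e: "bump (Suc k) t = (R' * s ^ (2 * k) + 4 * real k * (t * R) * (s * s ^ (2 * k)) - 2 * (t * R) * (s ^ (2 * k) * s^2)) * exp (- s)" .
      have "real (2 * k) * s ^ (2 * k - 1) * (2 * t * s^2) * R = 4 * real k * (t * R) * (s * s ^ (2 * k))"
        by (cases k) (auto simp: power2_eq_square)
      then show ?thesis unfolding e by (simp add: algebra_simps)
    qed
    ultimately have "((\<lambda>t. poly (bump_poly k) t * (1 / (1 - t^2)) ^ (2 * k) * exp (- (1 / (1 - t^2)))) has_real_derivative bump (Suc k) t) (at t)" by simp
    then show ?thesis
      by (rule DERIV_cong_ev[THEN iffD1, rotated -1, OF _ refl _ refl])
         (rule eventually_mono[OF eventually_nhds_in_open[of "{-1<..<1}"]], use 1 in \<open>auto simp: bump_def\<close>)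
  next
    case 2
    have "((\<lambda>t::real. 0::real) has_real_derivative bump (Suc k) t) (at t)" using 2 by (simp add: bump_def)
    moreover have "open {t::real. 1 < \<bar>t\<bar>}" by (intro open_Collect_less continuous_intros)
    ultimately show ?thesis
      by (elim DERIV_cong_ev[THEN iffD1, rotated -1, OF _ refl _ refl])
         (rule eventually_mono[OF eventually_nhds_in_open[of "{t. 1 < \<bar>t\<bar>}"]], use 2 in \<open>auto simp: bump_def\<close>)
  next
    case 3
    obtain M where M: "0 < M" "\<And>x. x \<in> {-1..1} \<Longrightarrow> \<bar>poly (bump_poly k) x\<bar> \<le> M"
    proof -
      have "compact (poly (bump_poly k) ` {-1..1})" by (intro compact_continuous_image continuous_intros) auto
      then show ?thesis using that compact_imp_bounded[of "poly (bump_poly k) ` {-1..1}"] by (auto simp: bounded_pos)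
    qed
    define c where "c = M * fact (2 * k + 2) * 4"
    have "\<bar>bump k x\<bar> \<le> c * (x - t)^2" for x
    proof (cases "\<bar>x\<bar> < 1")
      case False
      then show ?thesis using M by (simp add: bump_def c_def)
    next
      case True
      then have x2: "0 < 1 - x^2" by (simp add: abs_square_less_1)
      define s where "s = 1 / (1 - x^2)"
      have s: "0 < s" "1 - x^2 = 1 / s" using x2 by (simp_all add: s_def)
      have "s ^ (2 * k + 2) \<le> fact (2 * k + 2) * exp s" by (rule power_le_fact_mult_exp) (use s in auto)
      then have "s ^ (2 * k) * s^2 * exp (- s) \<le> fact (2 * k + 2) * exp s * exp (- s)"
        unfolding power_add by (intro mult_right_mono) auto
      also have "\<dots> = fact (2 * k + 2) * (exp s * exp (- s))" by (rule mult.assoc)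
      also have "exp s * exp (- s) = 1" by (simp flip: exp_add)
      finally have "s ^ (2 * k) * exp (- s) * s^2 \<le> fact (2 * k + 2)"
        by (simp only: mult.assoc mult.commute mult.left_commute mult_1_right)
      then have "s ^ (2 * k) * exp (- s) \<le> fact (2 * k + 2) / s^2" using s by (simp add: pos_le_divide_eq)
      also have "\<dots> = fact (2 * k + 2) * (1 - x^2)^2" unfolding s(2) by (simp add: power_divide)
      also have "\<dots> \<le> fact (2 * k + 2) * (4 * (x - t)^2)"
      proof (intro mult_left_mono)
        have "1 - x^2 = (1 - \<bar>x\<bar>) * (1 + \<bar>x\<bar>)" by (simp add: algebra_simps power2_eq_square)
        also have "\<dots> \<le> \<bar>x - t\<bar> * 2" using True 3 by (intro mult_mono) auto
        finally have "(1 - x^2)^2 \<le> (\<bar>x - t\<bar> * 2)^2" using x2 by (intro power_mono) auto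
        then show "(1 - x^2)^2 \<le> 4 * (x - t)^2" by (simp add: power_mult_distrib)
      qed auto
      finally have e: "s ^ (2 * k) * exp (- s) \<le> fact (2 * k + 2) * (4 * (x - t)^2)" .
      have pm: "\<bar>poly (bump_poly k) x\<bar> \<le> M" by (rule M(2)) (use True in auto)
      have "\<bar>poly (bump_poly k) x\<bar> * (s ^ (2 * k) * exp (- s)) \<le> M * (fact (2 * k + 2) * (4 * (x - t)^2))"
        by (rule mult_mono[OF pm e]) (use M s in auto)
      moreover have "\<bar>bump k x\<bar> = \<bar>poly (bump_poly k) x\<bar> * (s ^ (2 * k) * exp (- s))"
        using True s(1) unfolding bump_def s_def[symmetric] by (simp add: abs_mult)
      moreover have "c * (x - t)^2 = M * (fact (2 * k + 2) * (4 * (x - t)^2))" by (simp only: c_def mult.assoc)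
      ultimately show ?thesis by linarith
    qed
    then have "(bump k has_real_derivative 0) (at t)" by (rule has_real_derivative_zero_of_quadratic_bound)
    then show ?thesis using 3 by (simp add: bump_def)
  qed
qed

text \<open>\<kappa> is a multi-index of derivative orders: these product kernels are closed under
  partial derivatives, each of which raises one entry of \<kappa>, so one induction covers all
  orders of smoothness.\<close>

definition prod_bump :: "('n \<Rightarrow> nat) \<Rightarrow> real^'n \<Rightarrow> real" where
  "prod_bump \<kappa> w = (\<Prod>i\<in>UNIV. bump (\<kappa> i) (w $ i))"

lemma has_derivative_prod_bump:
  "(prod_bump \<kappa> has_derivative (\<lambda>h. \<Sum>j\<in>UNIV. h $ j * prod_bump (\<kappa>(j := Suc (\<kappa> j))) w)) (at w)"
proof -
  have "((\<lambda>w. bump (\<kappa> i) (w $ i)) has_derivative (\<lambda>h. bump (Suc (\<kappa> i)) (w $ i) * h $ i)) (at w)" for i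
    using has_derivative_compose[OF bounded_linear_imp_has_derivative[OF bounded_linear_vec_nth] has_real_derivative_bump[unfolded has_field_derivative_def]] .
  then have "(prod_bump \<kappa> has_derivative (\<lambda>h. \<Sum>j\<in>UNIV. (bump (Suc (\<kappa> j)) (w $ j) * h $ j) * (\<Prod>i\<in>UNIV - {j}. bump (\<kappa> i) (w $ i)))) (at w)"
    unfolding prod_bump_def[abs_def] by (intro has_derivative_prod)
  moreover have "(bump (Suc (\<kappa> j)) (w $ j) * h $ j) * (\<Prod>i\<in>UNIV - {j}. bump (\<kappa> i) (w $ i)) = h $ j * prod_bump (\<kappa>(j := Suc (\<kappa> j))) w" for j h
    unfolding prod_bump_def by (subst prod.remove[of UNIV j]) auto
  ultimately show ?thesis by simp
qed

lemma prod_bump_eq_0: "1 \<le> \<bar>w $ i\<bar> \<Longrightarrow> prod_bump \<kappa> w = 0"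
  unfolding prod_bump_def by (rule prod_zero) (auto simp: bump_def intro!: exI[of _ i])

lemma continuous_on_prod_bump: "continuous_on A (prod_bump \<kappa>)"
  by (intro continuous_at_imp_continuous_on ballI has_derivative_continuous[OF has_derivative_prod_bump])

text \<open>The kernel lives on the cube [-1,1]^n, whose circumscribed ball has radius sqrt n; this
  radius recurs wherever a mollifier enlarges a ball.\<close>

lemma prod_bump_outside: "sqrt CARD('n) < norm w \<Longrightarrow> prod_bump \<kappa> (w::real^'n) = 0"
proof (rule ccontr)
  assume w: "sqrt CARD('n) < norm w" and nz: "prod_bump \<kappa> w \<noteq> 0"
  have "\<bar>w $ i\<bar> \<le> 1" for i using nz prod_bump_eq_0[of w i \<kappa>] by force
  then have "norm w \<le> L2_set (\<lambda>i. 1) (UNIV :: 'n set)"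
    unfolding norm_vec_def by (intro L2_set_mono) auto
  with w show False by (simp add: L2_set_def)
qed

lemma prod_bump_0_nonneg: "0 \<le> prod_bump (\<lambda>_. 0) w"
  unfolding prod_bump_def by (intro prod_nonneg) (auto simp: bump_def)

lemma has_derivative_prod_bump_reflected:
  "((\<lambda>z. prod_bump \<kappa> (a *\<^sub>R (x - z))) has_derivative (\<lambda>h. \<Sum>j\<in>UNIV. h $ j * (- a * prod_bump (\<kappa>(j := Suc (\<kappa> j))) (a *\<^sub>R (x - z))))) (at z)"
proof -
  have "((\<lambda>z. a *\<^sub>R (x - z)) has_derivative (\<lambda>h. a *\<^sub>R (- h))) (at z)"
    by (auto intro!: derivative_eq_intros)
  from has_derivative_compose[OF this has_derivative_prod_bump] show ?thesis
    by (rule has_derivative_eq_rhs) (auto simp: fun_eq_iff mult_ac sum_negf)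
qed

lemma partial_deriv_prod_bump:
  "partial_deriv j (\<lambda>z. c * prod_bump \<kappa> (a *\<^sub>R (x - z))) = (\<lambda>z. (- a * c) * prod_bump (\<kappa>(j := Suc (\<kappa> j))) (a *\<^sub>R (x - z)))"
proof
  fix z
  have "((\<lambda>z. c * prod_bump \<kappa> (a *\<^sub>R (x - z))) has_derivative (\<lambda>h. c * (\<Sum>j\<in>UNIV. h $ j * (- a * prod_bump (\<kappa>(j := Suc (\<kappa> j))) (a *\<^sub>R (x - z)))))) (at z)"
    by (intro has_derivative_mult_right has_derivative_prod_bump_reflected)
  from frechet_derivative_at[OF this, symmetric]
  show "partial_deriv j (\<lambda>z. c * prod_bump \<kappa> (a *\<^sub>R (x - z))) z = (- a * c) * prod_bump (\<kappa>(j := Suc (\<kappa> j))) (a *\<^sub>R (x - z))"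
    by (simp add: partial_deriv_def axis_def sum_negf if_distrib[where f="\<lambda>t. t * _"] cong: if_cong)
qed

lemma test_function_prod_bump:
  fixes x :: "real^'n"
  assumes "0 < a" shows "test_function (\<lambda>z. prod_bump \<kappa> (a *\<^sub>R (x - z)))"
  unfolding test_function_def
proof (intro conjI allI)
  have "times_cont_diff k (\<lambda>z. c * prod_bump \<kappa> (a *\<^sub>R (x - z)))" for k c \<kappa>
  proof (induction k arbitrary: c \<kappa>)
    case 0
    show ?case by (auto intro!: continuous_intros continuous_on_compose2[OF continuous_on_prod_bump[of UNIV]])
  next
    case (Suc k)
    have "(\<lambda>z. c * prod_bump \<kappa> (a *\<^sub>R (x - z))) differentiable_on UNIV"
      unfolding differentiable_on_def differentiable_def
      using has_derivative_mult_right[OF has_derivative_prod_bump_reflected] has_derivative_at_withinI by blast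
    then show ?case unfolding times_cont_diff.simps partial_deriv_prod_bump
      by (intro conjI allI Suc)
  qed
  from this[of _ 1] show "times_cont_diff k (\<lambda>z. prod_bump \<kappa> (a *\<^sub>R (x - z)))" for k by simp
  have "{z. prod_bump \<kappa> (a *\<^sub>R (x - z)) \<noteq> 0} \<subseteq> cball x (sqrt CARD('n) / a)"
  proof
    fix z assume "z \<in> {z. prod_bump \<kappa> (a *\<^sub>R (x - z)) \<noteq> 0}"
    then have "norm (a *\<^sub>R (x - z)) \<le> sqrt CARD('n)" using prod_bump_outside not_le by blast
    then show "z \<in> cball x (sqrt CARD('n) / a)" using assms by (simp add: dist_norm pos_le_divide_eq mult.commute)
  qed
  then show "compact (closure {z. prod_bump \<kappa> (a *\<^sub>R (x - z)) \<noteq> 0})"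
    using bounded_subset compact_closure bounded_cball by blast
qed

section \<open>Convolution with the kernel\<close>

definition locally_integrable :: "('a::euclidean_space \<Rightarrow> real) \<Rightarrow> bool" where
  "locally_integrable F \<longleftrightarrow> F \<in> borel_measurable borel \<and> (\<forall>R. set_integrable lborel (cball 0 R) F)"

lemma locally_integrable_measurable: "locally_integrable F \<Longrightarrow> F \<in> borel_measurable borel"
  by (simp add: locally_integrable_def)

lemma integrable_mult_compact_support:
  fixes F \<phi> :: "'a::euclidean_space \<Rightarrow> real"
  assumes F: "locally_integrable F" and \<phi>: "\<phi> \<in> borel_measurable borel" "\<And>z. \<bar>\<phi> z\<bar> \<le> B" "\<And>z. R < norm z \<Longrightarrow> \<phi> z = 0"
  shows "integrable lborel (\<lambda>z. F z * \<phi> z)"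
proof (rule Bochner_Integration.integrable_bound)
  show "integrable lborel (\<lambda>z. B * (indicator (cball 0 R) z *\<^sub>R F z))"
    using F by (intro integrable_mult_right) (auto simp: locally_integrable_def set_integrable_def)
  show "(\<lambda>z. F z * \<phi> z) \<in> borel_measurable lborel"
    using locally_integrable_measurable[OF F] \<phi>(1) by (intro borel_measurable_times) auto
  show "AE z in lborel. norm (F z * \<phi> z) \<le> norm (B * (indicator (cball 0 R) z *\<^sub>R F z))"
  proof (rule AE_I2)
    fix z
    show "norm (F z * \<phi> z) \<le> norm (B * (indicator (cball 0 R) z *\<^sub>R F z))"
    proof (cases "norm z \<le> R")
      case True
      have "\<bar>\<phi> z\<bar> \<le> \<bar>B\<bar>" using \<phi>(2)[of z] by linarith
      then have "\<bar>F z\<bar> * \<bar>\<phi> z\<bar> \<le> \<bar>F z\<bar> * \<bar>B\<bar>" by (intro mult_left_mono) auto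
      then show ?thesis using True by (simp add: abs_mult mult.commute)
    qed (use \<phi>(3)[of z] in \<open>auto simp: not_le\<close>)
  qed
qed

lemma prod_bump_bounded:
  fixes \<kappa> :: "'n::finite \<Rightarrow> nat"
  obtains B where "0 < B" "\<And>w. \<bar>prod_bump \<kappa> w\<bar> \<le> B"
proof -
  obtain B where "0 < B" "\<And>w. norm (prod_bump \<kappa> w) \<le> B"
    using bounded_continuous_compact_support[of "prod_bump \<kappa>" "sqrt CARD('n)"] continuous_on_prod_bump prod_bump_outside by blast
  then show ?thesis using that by auto
qed

lemma prod_bump_lipschitz:
  obtains L where "0 \<le> L" "\<And>w w'. \<bar>prod_bump \<kappa> w' - prod_bump \<kappa> (w::real^'n)\<bar> \<le> L * norm (w' - w)"
proof -
  have "\<forall>j. \<exists>B. \<forall>w. \<bar>prod_bump (\<kappa>(j := Suc (\<kappa> j))) w\<bar> \<le> B"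
    using prod_bump_bounded by metis
  then obtain B where B: "\<And>j w. \<bar>prod_bump (\<kappa>(j := Suc (\<kappa> j))) w\<bar> \<le> B j" by metis
  have B0: "0 \<le> B j" for j using B[of j 0] by linarith
  define L where "L = (\<Sum>j\<in>UNIV. B j)"
  have "norm (prod_bump \<kappa> w' - prod_bump \<kappa> w) \<le> L * norm (w' - w)" for w w' :: "real^'n"
  proof (rule differentiable_bound[of UNIV "prod_bump \<kappa>" "\<lambda>w h. \<Sum>j\<in>UNIV. h $ j * prod_bump (\<kappa>(j := Suc (\<kappa> j))) w"])
    fix y :: "real^'n"
    show "onorm (\<lambda>h. \<Sum>j\<in>UNIV. h $ j * prod_bump (\<kappa>(j := Suc (\<kappa> j))) y) \<le> L"
    proof (rule onorm_bound)
      fix h :: "real^'n"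
      have "norm (\<Sum>j\<in>UNIV. h $ j * prod_bump (\<kappa>(j := Suc (\<kappa> j))) y) \<le> (\<Sum>j\<in>UNIV. norm h * B j)"
        using B component_le_norm_cart[of h]
        by (intro order_trans[OF norm_sum] sum_mono) (auto simp: abs_mult intro!: mult_mono)
      also have "(\<Sum>j\<in>UNIV. norm h * B j) = L * norm h"
        unfolding L_def sum_distrib_left[symmetric] by (rule mult.commute)
      finally show "norm (\<Sum>j\<in>UNIV. h $ j * prod_bump (\<kappa>(j := Suc (\<kappa> j))) y) \<le> L * norm h" .
    qed (simp add: L_def B0 sum_nonneg)
  qed (auto intro: has_derivative_at_withinI has_derivative_prod_bump)
  then show ?thesis using that[of L] by (auto simp: L_def B0 sum_nonneg)
qed

text \<open>Mean value inequality for the kernel minus its linearisation at w, whose derivative is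
  small by the Lipschitz bound. The estimate is uniform in w, which lets a convolution be
  differentiated under the integral.\<close>

lemma prod_bump_taylor:
  obtains L where "0 \<le> L" "\<And>w h. \<bar>prod_bump \<kappa> (w + h) - prod_bump \<kappa> (w::real^'n)
      - (\<Sum>j\<in>UNIV. h $ j * prod_bump (\<kappa>(j := Suc (\<kappa> j))) w)\<bar> \<le> L * (norm h)^2"
proof -
  have "\<forall>j. \<exists>L\<ge>0. \<forall>w w'. \<bar>prod_bump (\<kappa>(j := Suc (\<kappa> j))) w' - prod_bump (\<kappa>(j := Suc (\<kappa> j))) (w::real^'n)\<bar> \<le> L * norm (w' - w)"
    using prod_bump_lipschitz by metis
  then obtain K where K: "\<And>j. 0 \<le> K j"
    "\<And>j w w'. \<bar>prod_bump (\<kappa>(j := Suc (\<kappa> j))) w' - prod_bump (\<kappa>(j := Suc (\<kappa> j))) (w::real^'n)\<bar> \<le> K j * norm (w' - w)" by metis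
  define L where "L = (\<Sum>j\<in>UNIV. K j)"
  have "\<bar>prod_bump \<kappa> (w + h) - prod_bump \<kappa> w - (\<Sum>j\<in>UNIV. h $ j * prod_bump (\<kappa>(j := Suc (\<kappa> j))) w)\<bar> \<le> L * (norm h)^2" for w h :: "real^'n"
  proof -
    define q where "q y = prod_bump \<kappa> y - (\<Sum>j\<in>UNIV. y $ j * prod_bump (\<kappa>(j := Suc (\<kappa> j))) w)" for y
    define q' where "q' y v = (\<Sum>j\<in>UNIV. v $ j * (prod_bump (\<kappa>(j := Suc (\<kappa> j))) y - prod_bump (\<kappa>(j := Suc (\<kappa> j))) w))" for y v
    have dq: "(q has_derivative q' y) (at y)" for y
    proof -
      have "(q has_derivative (\<lambda>v. (\<Sum>j\<in>UNIV. v $ j * prod_bump (\<kappa>(j := Suc (\<kappa> j))) y) - (\<Sum>j\<in>UNIV. v $ j * prod_bump (\<kappa>(j := Suc (\<kappa> j))) w))) (at y)"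
        unfolding q_def[abs_def]
        by (intro has_derivative_diff has_derivative_prod_bump has_derivative_sum has_derivative_mult_left
            bounded_linear_imp_has_derivative bounded_linear_vec_nth)
      then show ?thesis by (simp add: q'_def[abs_def] right_diff_distrib sum_subtractf)
    qed
    have "norm (q (w + h) - q w) \<le> (L * norm h) * norm (w + h - w)"
    proof (rule differentiable_bound[of "cball w (norm h)" q q'])
      fix y assume y: "y \<in> cball w (norm h)"
      show "onorm (q' y) \<le> L * norm h"
      proof (rule onorm_bound)
        fix v
        have "norm (q' y v) \<le> (\<Sum>j\<in>UNIV. norm v * (K j * norm h))"
          unfolding q'_def
        proof (intro order_trans[OF norm_sum] sum_mono)
          fix j
          have "K j * norm (y - w) \<le> K j * norm h" using y K(1) by (intro mult_left_mono) (auto simp: dist_norm norm_minus_commute)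
          then have "\<bar>prod_bump (\<kappa>(j := Suc (\<kappa> j))) y - prod_bump (\<kappa>(j := Suc (\<kappa> j))) w\<bar> \<le> K j * norm h"
            using K(2)[where j=j and w=w and w'=y] by linarith
          then show "norm (v $ j * (prod_bump (\<kappa>(j := Suc (\<kappa> j))) y - prod_bump (\<kappa>(j := Suc (\<kappa> j))) w)) \<le> norm v * (K j * norm h)"
            using component_le_norm_cart[of v j] by (auto simp: abs_mult intro!: mult_mono)
        qed
        also have "\<dots> = L * norm h * norm v"
          by (simp add: L_def sum_distrib_left sum_distrib_right mult_ac)
        finally show "norm (q' y v) \<le> L * norm h * norm v" .
      qed (simp add: L_def K sum_nonneg)
    qed (auto intro: has_derivative_at_withinI dq simp: dist_norm)
    moreover have "q (w + h) - q w = prod_bump \<kappa> (w + h) - prod_bump \<kappa> w - (\<Sum>j\<in>UNIV. h $ j * prod_bump (\<kappa>(j := Suc (\<kappa> j))) w)"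
      by (simp add: q_def distrib_right sum.distrib)
    ultimately show ?thesis by (simp add: power2_eq_square mult.assoc)
  qed
  then show ?thesis using that[of L] by (auto simp: L_def K sum_nonneg)
qed

text \<open>\<open>a\<close> is the reciprocal of the scale. The normalising constant and the
  factors \<open>a\<close> from the chain rule are kept outside, so that one function serves for all
  derivatives.\<close>

definition bump_conv :: "(real^'n \<Rightarrow> real) \<Rightarrow> ('n \<Rightarrow> nat) \<Rightarrow> real \<Rightarrow> real^'n \<Rightarrow> real" where
  "bump_conv F \<kappa> a x = (LINT z|lborel. F z * prod_bump \<kappa> (a *\<^sub>R (x - z)))"

lemma prod_bump_shift_measurable: "(\<lambda>z. prod_bump \<kappa> (a *\<^sub>R (x - z))) \<in> borel_measurable borel"
  by (intro borel_measurable_continuous_onI continuous_on_compose2[OF continuous_on_prod_bump[of UNIV]] continuous_intros) auto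

lemma prod_bump_shift_outside:
  fixes x :: "real^'n"
  assumes "0 < a" "sqrt CARD('n) / a < norm (x - z)" shows "prod_bump \<kappa> (a *\<^sub>R (x - z)) = 0"
  using assms by (intro prod_bump_outside) (simp add: pos_divide_less_eq mult.commute)

lemma bump_conv_integrable:
  fixes x :: "real^'n"
  assumes F: "locally_integrable F" and a: "0 < a"
  shows "integrable lborel (\<lambda>z. F z * prod_bump \<kappa> (a *\<^sub>R (x - z)))"
proof -
  obtain B where B: "0 < B" "\<And>w. \<bar>prod_bump \<kappa> w\<bar> \<le> B" using prod_bump_bounded by blast
  show ?thesis
  proof (rule integrable_mult_compact_support[OF F prod_bump_shift_measurable B(2)])
    fix z :: "real^'n" assume "norm x + sqrt CARD('n) / a < norm z"
    then have "sqrt CARD('n) / a < norm (x - z)" using norm_triangle_sub[of z x] by (simp add: norm_minus_commute)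
    then show "prod_bump \<kappa> (a *\<^sub>R (x - z)) = 0" by (rule prod_bump_shift_outside[OF a])
  qed
qed

lemma has_derivative_bump_conv:
  fixes x :: "real^'n"
  assumes F: "locally_integrable F" and a: "0 < a"
  shows "(bump_conv F \<kappa> a has_derivative (\<lambda>h. \<Sum>j\<in>UNIV. h $ j * (a * bump_conv F (\<kappa>(j := Suc (\<kappa> j))) a x))) (at x)"
proof -
  obtain L where L: "0 \<le> L" "\<And>w h. \<bar>prod_bump \<kappa> (w + h) - prod_bump \<kappa> (w::real^'n)
      - (\<Sum>j\<in>UNIV. h $ j * prod_bump (\<kappa>(j := Suc (\<kappa> j))) w)\<bar> \<le> L * (norm h)^2" using prod_bump_taylor by blast
  \<comment> \<open>Large enough for the supports of the kernels centred at x and at any y within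
    distance 1 of x.\<close>
  define R where "R = norm x + 1 + sqrt CARD('n) / a"
  define I where "I = (LINT z|lborel. indicator (cball 0 R) z *\<^sub>R \<bar>F z\<bar>)"
  have Fi: "integrable lborel (\<lambda>z. indicator (cball 0 R) z *\<^sub>R \<bar>F z\<bar>)"
  proof -
    have "integrable lborel (\<lambda>z. norm (indicator (cball 0 R) z *\<^sub>R F z))"
      using F by (intro integrable_norm) (auto simp: locally_integrable_def set_integrable_def)
    then show ?thesis by (simp add: abs_mult)
  qed
  note int = bump_conv_integrable[OF F a]
  show ?thesis
  proof (rule has_derivativeI_sandwich[where e=1 and H="\<lambda>y. L * a^2 * I * norm (y - x)"])
    show "bounded_linear (\<lambda>h::real^'n. \<Sum>j\<in>UNIV. h $ j * (a * bump_conv F (\<kappa>(j := Suc (\<kappa> j))) a x))"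
      by (intro bounded_linear_sum bounded_linear_compose[OF bounded_linear_mult_left bounded_linear_vec_nth])
    have "((\<lambda>y. L * a^2 * I * norm (y - x)) \<longlongrightarrow> L * a^2 * I * norm (x - x)) (at x)" by (intro tendsto_intros)
    then show "((\<lambda>y. L * a^2 * I * norm (y - x)) \<longlongrightarrow> 0) (at x)" by simp
    fix y assume y: "y \<noteq> x" "dist y x < 1"
    define E where "E z = prod_bump \<kappa> (a *\<^sub>R (y - z)) - prod_bump \<kappa> (a *\<^sub>R (x - z))
       - (\<Sum>j\<in>UNIV. (y - x) $ j * (a * prod_bump (\<kappa>(j := Suc (\<kappa> j))) (a *\<^sub>R (x - z))))" for z
    have Eb: "\<bar>E z\<bar> \<le> L * a^2 * (norm (y - x))^2" for z
    proof -
      have "a *\<^sub>R (x - z) + a *\<^sub>R (y - x) = a *\<^sub>R (y - z)" by (simp add: algebra_simps)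
      moreover have "(norm (a *\<^sub>R (y - x)))^2 = a^2 * (norm (y - x))^2" by (simp add: power_mult_distrib)
      ultimately show ?thesis using L(2)[of "a *\<^sub>R (x - z)" "a *\<^sub>R (y - x)"]
        by (simp add: E_def mult_ac)
    qed
    have E0: "E z = 0" if "z \<notin> cball 0 R" for z :: "real^'n"
    proof -
      have "R < norm z" using that by simp
      moreover have "norm z \<le> norm (x - z) + norm x" "norm z \<le> norm (y - z) + norm y" "norm y \<le> norm x + dist y x"
        using norm_triangle_sub[of z x] norm_triangle_sub[of z y] norm_triangle_sub[of y x] by (auto simp: norm_minus_commute dist_norm)
      ultimately have "sqrt CARD('n) / a < norm (x - z)" "sqrt CARD('n) / a < norm (y - z)"
        using y unfolding R_def by linarith+
      then show ?thesis unfolding E_def by (simp add: prod_bump_shift_outside[OF a])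
    qed
    have FE: "F z * E z = F z * prod_bump \<kappa> (a *\<^sub>R (y - z)) - F z * prod_bump \<kappa> (a *\<^sub>R (x - z))
         - (\<Sum>j\<in>UNIV. ((y - x) $ j * a) * (F z * prod_bump (\<kappa>(j := Suc (\<kappa> j))) (a *\<^sub>R (x - z))))" for z
      unfolding E_def right_diff_distrib sum_distrib_left
      by (intro arg_cong2[where f="(-)"] refl sum.cong) (simp only: mult_ac)
    have "bump_conv F \<kappa> a y - bump_conv F \<kappa> a x - (\<Sum>j\<in>UNIV. (y - x) $ j * (a * bump_conv F (\<kappa>(j := Suc (\<kappa> j))) a x))
       = (LINT z|lborel. F z * prod_bump \<kappa> (a *\<^sub>R (y - z)) - F z * prod_bump \<kappa> (a *\<^sub>R (x - z))
         - (\<Sum>j\<in>UNIV. ((y - x) $ j * a) * (F z * prod_bump (\<kappa>(j := Suc (\<kappa> j))) (a *\<^sub>R (x - z)))))"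
      unfolding bump_conv_def using int by (simp add: mult.assoc)
    also have "\<dots> = (LINT z|lborel. F z * E z)"
      by (simp only: FE)
    finally have eq: "bump_conv F \<kappa> a y - bump_conv F \<kappa> a x - (\<Sum>j\<in>UNIV. (y - x) $ j * (a * bump_conv F (\<kappa>(j := Suc (\<kappa> j))) a x)) = (LINT z|lborel. F z * E z)" .
    have "norm (LINT z|lborel. F z * E z) \<le> (LINT z|lborel. L * a^2 * (norm (y - x))^2 * (indicator (cball 0 R) z *\<^sub>R \<bar>F z\<bar>))"
    proof (rule order_trans[OF integral_norm_bound integral_mono])
      show "integrable lborel (\<lambda>z. norm (F z * E z))" unfolding FE using int by (intro integrable_norm) simp
      show "integrable lborel (\<lambda>z. L * a^2 * (norm (y - x))^2 * (indicator (cball 0 R) z *\<^sub>R \<bar>F z\<bar>))"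
        by (intro integrable_mult_right Fi)
      show "norm (F z * E z) \<le> L * a^2 * (norm (y - x))^2 * (indicator (cball 0 R) z *\<^sub>R \<bar>F z\<bar>)" for z
      proof (cases "z \<in> cball 0 R")
        case True
        have "\<bar>F z\<bar> * \<bar>E z\<bar> \<le> \<bar>F z\<bar> * (L * a^2 * (norm (y - x))^2)" by (intro mult_left_mono Eb) auto
        then show ?thesis using True by (simp add: abs_mult mult.commute)
      qed (simp add: E0)
    qed
    also have "\<dots> = L * a^2 * I * (norm (y - x))^2" using Fi by (simp add: I_def)
    finally have "norm (bump_conv F \<kappa> a y - bump_conv F \<kappa> a x - (\<Sum>j\<in>UNIV. (y - x) $ j * (a * bump_conv F (\<kappa>(j := Suc (\<kappa> j))) a x))) \<le> L * a^2 * I * norm (y - x) * norm (y - x)"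
      unfolding eq by (simp add: power2_eq_square mult.assoc)
    then show "norm (bump_conv F \<kappa> a y - bump_conv F \<kappa> a x - (\<Sum>j\<in>UNIV. (y - x) $ j * (a * bump_conv F (\<kappa>(j := Suc (\<kappa> j))) a x))) / norm (y - x) \<le> L * a^2 * I * norm (y - x)"
      using y(1) by (subst pos_divide_le_eq) auto
  qed simp
qed

lemma continuous_on_bump_conv:
  fixes F :: "real^'n \<Rightarrow> real"
  shows "locally_integrable F \<Longrightarrow> 0 < a \<Longrightarrow> continuous_on A (bump_conv F \<kappa> a)"
  by (intro continuous_at_imp_continuous_on ballI has_derivative_continuous[OF has_derivative_bump_conv])

lemma has_derivative_vec_componentwise:
  fixes f :: "'a::real_normed_vector \<Rightarrow> real^'m"
  assumes "\<And>k. ((\<lambda>x. f x $ k) has_derivative (\<lambda>h. f' h $ k)) (at x)"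
  shows "(f has_derivative f') (at x)"
  using assms by (subst has_derivative_componentwise_within) (auto simp: Basis_vec_def inner_axis)

text \<open>All derivatives fall on the kernel, and raising the order first in direction j and then
  in direction i gives the same multi-index as the other way round; hence the symmetry.\<close>

lemma C2_map_bump_conv:
  fixes g :: "real^'n \<Rightarrow> real^'m"
  assumes g: "\<And>k. locally_integrable (\<lambda>x. g x $ k)" and a: "0 < a"
  shows "C2_map (\<lambda>x. \<chi> k. c * bump_conv (\<lambda>z. g z $ k) (\<lambda>_. 0) a x)
    (\<lambda>x. \<chi> k j. c * (a * bump_conv (\<lambda>z. g z $ k) ((\<lambda>_. 0)(j := Suc 0)) a x))"
  unfolding C2_map_def
proof (intro conjI allI exI)
  note d = has_derivative_bump_conv[OF g a]
  show "((\<lambda>x. \<chi> k. c * bump_conv (\<lambda>z. g z $ k) (\<lambda>_. 0) a x) has_derivative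
      (\<lambda>h. (\<chi> k j. c * (a * bump_conv (\<lambda>z. g z $ k) ((\<lambda>_. 0)(j := Suc 0)) a x)) *v h)) (at x)" for x
  proof -
    have "((\<lambda>x. \<chi> k. c * bump_conv (\<lambda>z. g z $ k) (\<lambda>_. 0) a x) has_derivative
      (\<lambda>h. \<chi> k. c * (\<Sum>j\<in>UNIV. h $ j * (a * bump_conv (\<lambda>z. g z $ k) ((\<lambda>_. 0)(j := Suc 0)) a x)))) (at x)"
      by (rule has_derivative_vec_componentwise) (simp only: vec_lambda_beta, intro has_derivative_mult_right d[where \<kappa>="\<lambda>_. 0"])
    moreover have "(\<chi> k j. c * (a * bump_conv (\<lambda>z. g z $ k) ((\<lambda>_. 0)(j := Suc 0)) a x)) *v h
        = (\<chi> k. c * (\<Sum>j\<in>UNIV. h $ j * (a * bump_conv (\<lambda>z. g z $ k) ((\<lambda>_. 0)(j := Suc 0)) a x)))" for h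
      by (simp add: matrix_vector_mult_def vec_eq_iff sum_distrib_left mult_ac)
    ultimately show ?thesis by simp
  qed
  define H where "H k j x = (\<chi> i. c * (a * (a * bump_conv (\<lambda>z. g z $ k) ((\<lambda>_. 0)(j := Suc 0, i := Suc (((\<lambda>_. 0)(j := Suc 0)) i))) a x)))" for k :: 'm and j :: 'n and x
  fix k j
  show "((\<lambda>x. (\<chi> k j. c * (a * bump_conv (\<lambda>z. g z $ k) ((\<lambda>_. 0)(j := Suc 0)) a x)) $ k $ j) has_derivative (\<lambda>h. H k j x \<bullet> h)) (at x)" for x
  proof -
    have "((\<lambda>x. c * (a * bump_conv (\<lambda>z. g z $ k) ((\<lambda>_. 0)(j := Suc 0)) a x)) has_derivative
      (\<lambda>h. c * (a * (\<Sum>i\<in>UNIV. h $ i * (a * bump_conv (\<lambda>z. g z $ k) ((\<lambda>_. 0)(j := Suc 0, i := Suc (((\<lambda>_. 0)(j := Suc 0)) i))) a x))))) (at x)"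
      by (intro has_derivative_mult_right d)
    then show ?thesis
      by (simp add: H_def inner_vec_def sum_distrib_left mult_ac)
  qed
  show "continuous_on UNIV (H k j)"
    unfolding H_def by (intro continuous_on_vec_lambda continuous_intros continuous_on_bump_conv g a)
  show "H k j x $ i = H k i x $ j" for x i
  proof (cases "i = j")
    case False
    then have "(\<lambda>_. 0)(j := Suc 0, i := Suc 0) = (\<lambda>_. 0)(i := Suc 0, j := Suc 0)" by (simp add: fun_upd_twist)
    with False show ?thesis by (simp add: H_def)
  qed simp
qed

text \<open>Truncation at height n reduces to a bounded function. The predicate
  \<open>measurable_on\<close> supplies continuous functions converging off a negligible set;
  truncating these as well makes bounded convergence applicable on the ball.\<close>

lemma continuous_L1_approximation:
  fixes F :: "'a::euclidean_space \<Rightarrow> real"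
  assumes F: "F \<in> borel_measurable borel" "set_integrable lborel (cball 0 R) F" and e: "0 < e"
  shows "\<exists>k. continuous_on UNIV k \<and> (\<integral>\<^sup>+x\<in>cball 0 R. ennreal \<bar>F x - k x\<bar> \<partial>lborel) < ennreal e"
proof -
  define cl where "cl n v = max (- real n) (min (real n) v)" for n :: nat and v :: real
  note [measurable] = F(1)
  have [measurable]: "cball (0::'a) R \<in> sets borel" by simp
  have cl_cont: "continuous_on A (cl n)" for A n unfolding cl_def[abs_def] by (intro continuous_intros)
  have [measurable]: "cl n \<in> borel_measurable borel" for n using cl_cont by (rule borel_measurable_continuous_onI)
  have "(\<lambda>n. \<integral>\<^sup>+x. ennreal \<bar>F x - cl n (F x)\<bar> * indicator (cball 0 R) x \<partial>lborel) \<longlonglongrightarrow> (\<integral>\<^sup>+x. 0 \<partial>(lborel :: 'a measure))"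
  proof (rule nn_integral_dominated_convergence[where w="\<lambda>x. ennreal (norm (indicator (cball 0 R) x *\<^sub>R F x))"])
    show "(\<lambda>x. ennreal \<bar>F x - cl n (F x)\<bar> * indicator (cball 0 R) x) \<in> borel_measurable lborel" for n by measurable
    show "(\<lambda>x. ennreal (norm (indicator (cball 0 R) x *\<^sub>R F x))) \<in> borel_measurable lborel" by measurable
    show "(\<integral>\<^sup>+x. ennreal (norm (indicator (cball 0 R) x *\<^sub>R F x)) \<partial>lborel) < \<infinity>"
      using F(2) by (simp add: set_integrable_def integrable_iff_bounded)
    show "AE x in lborel. ennreal \<bar>F x - cl n (F x)\<bar> * indicator (cball 0 R) x \<le> ennreal (norm (indicator (cball 0 R) x *\<^sub>R F x))" for n
      by (rule AE_I2) (auto simp: indicator_def cl_def intro!: ennreal_leI)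
    show "AE x in lborel. (\<lambda>n. ennreal \<bar>F x - cl n (F x)\<bar> * indicator (cball 0 R) x) \<longlonglongrightarrow> 0"
    proof (rule AE_I2)
      fix x
      obtain n0 :: nat where "\<bar>F x\<bar> \<le> n0" using real_arch_simple by blast
      then have "\<forall>n\<ge>n0. ennreal \<bar>F x - cl n (F x)\<bar> * indicator (cball 0 R) x = 0" by (auto simp: cl_def max_def min_def)
      then show "(\<lambda>n. ennreal \<bar>F x - cl n (F x)\<bar> * indicator (cball 0 R) x) \<longlonglongrightarrow> 0"
        by (intro tendsto_eventually) (auto simp: eventually_sequentially)
    qed
  qed auto
  then have "\<forall>\<^sub>F n in sequentially. (\<integral>\<^sup>+x\<in>cball 0 R. ennreal \<bar>F x - cl n (F x)\<bar> \<partial>lborel) < ennreal (e / 2)"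
    using e by (intro order_tendstoD) auto
  then obtain n where n: "(\<integral>\<^sup>+x\<in>cball 0 R. ennreal \<bar>F x - cl n (F x)\<bar> \<partial>lborel) < ennreal (e / 2)"
    using eventually_happens'[OF sequentially_bot] by blast
  have "F \<in> borel_measurable (lebesgue_on UNIV)" using F(1) by (simp add: lebesgue_on_UNIV_eq borel_measurable_if_D measurable_completion)
  then have "F measurable_on UNIV" by (subst measurable_on_iff_borel_measurable) auto
  then obtain Z g where g: "negligible Z" "\<And>j. continuous_on UNIV (g j)" "\<And>x. x \<notin> Z \<Longrightarrow> (\<lambda>j. g j x) \<longlonglongrightarrow> F x"
    by (auto simp: measurable_on_def)
  have AEZ: "AE x in lborel. x \<notin> Z"
    using AE_not_in[of Z lebesgue] g(1) by (simp add: negligible_iff_null_sets AE_completion_iff)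
  have kc: "continuous_on UNIV (\<lambda>x. cl n (g j x))" for j
    by (rule continuous_on_compose2[OF cl_cont g(2)]) auto
  have [measurable]: "g j \<in> borel_measurable borel" for j using g(2) by (rule borel_measurable_continuous_onI)
  have "(\<lambda>j. \<integral>\<^sup>+x. ennreal \<bar>cl n (F x) - cl n (g j x)\<bar> * indicator (cball 0 R) x \<partial>lborel) \<longlonglongrightarrow> (\<integral>\<^sup>+x. 0 \<partial>(lborel :: 'a measure))"
  proof (rule nn_integral_dominated_convergence[where w="\<lambda>x. ennreal (2 * n) * indicator (cball 0 R) x"])
    show "(\<lambda>x. ennreal \<bar>cl n (F x) - cl n (g j x)\<bar> * indicator (cball 0 R) x) \<in> borel_measurable lborel" for j by measurable
    show "(\<lambda>x::'a. ennreal (2 * n) * indicator (cball 0 R) x) \<in> borel_measurable lborel" by measurable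
    show "(\<integral>\<^sup>+x. ennreal (2 * n) * indicator (cball (0::'a) R) x \<partial>lborel) < \<infinity>"
      using emeasure_lborel_cball_finite[of "0::'a" R] by (simp add: nn_integral_cmult_indicator ennreal_mult_less_top)
    show "AE x in lborel. ennreal \<bar>cl n (F x) - cl n (g j x)\<bar> * indicator (cball 0 R) x \<le> ennreal (2 * n) * indicator (cball 0 R) x" for j
    proof (rule AE_I2)
      fix x
      have "\<bar>cl n (F x)\<bar> \<le> n" "\<bar>cl n (g j x)\<bar> \<le> n" by (auto simp: cl_def)
      then have "\<bar>cl n (F x) - cl n (g j x)\<bar> \<le> 2 * n" by linarith
      then show "ennreal \<bar>cl n (F x) - cl n (g j x)\<bar> * indicator (cball 0 R) x \<le> ennreal (2 * n) * indicator (cball 0 R) x"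
        by (intro mult_right_mono ennreal_leI) auto
    qed
    show "AE x in lborel. (\<lambda>j. ennreal \<bar>cl n (F x) - cl n (g j x)\<bar> * indicator (cball 0 R) x) \<longlonglongrightarrow> 0"
      using AEZ
    proof eventually_elim
      case (elim x)
      have "(\<lambda>j. cl n (g j x)) \<longlonglongrightarrow> cl n (F x)"
        by (rule continuous_on_tendsto_compose[OF cl_cont[of UNIV] g(3)[OF elim]]) auto
      then have "(\<lambda>j. \<bar>cl n (F x) - cl n (g j x)\<bar>) \<longlonglongrightarrow> \<bar>cl n (F x) - cl n (F x)\<bar>" by (intro tendsto_intros)
      then have "(\<lambda>j. ennreal \<bar>cl n (F x) - cl n (g j x)\<bar>) \<longlonglongrightarrow> ennreal 0" by (intro tendsto_ennrealI) simp
      then show ?case by (cases "x \<in> cball 0 R") auto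
    qed
  qed auto
  then have "\<forall>\<^sub>F j in sequentially. (\<integral>\<^sup>+x\<in>cball 0 R. ennreal \<bar>cl n (F x) - cl n (g j x)\<bar> \<partial>lborel) < ennreal (e / 2)"
    using e by (intro order_tendstoD) auto
  then obtain j where j: "(\<integral>\<^sup>+x\<in>cball 0 R. ennreal \<bar>cl n (F x) - cl n (g j x)\<bar> \<partial>lborel) < ennreal (e / 2)"
    using eventually_happens'[OF sequentially_bot] by blast
  have "(\<integral>\<^sup>+x\<in>cball 0 R. ennreal \<bar>F x - cl n (g j x)\<bar> \<partial>lborel)
      \<le> (\<integral>\<^sup>+x. ennreal \<bar>F x - cl n (F x)\<bar> * indicator (cball 0 R) x + ennreal \<bar>cl n (F x) - cl n (g j x)\<bar> * indicator (cball 0 R) x \<partial>lborel)"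
    by (intro nn_integral_mono) (auto simp: indicator_def simp flip: ennreal_plus intro!: ennreal_leI)
  also have "\<dots> = (\<integral>\<^sup>+x\<in>cball 0 R. ennreal \<bar>F x - cl n (F x)\<bar> \<partial>lborel) + (\<integral>\<^sup>+x\<in>cball 0 R. ennreal \<bar>cl n (F x) - cl n (g j x)\<bar> \<partial>lborel)"
    by (rule nn_integral_add) measurable
  also have "\<dots> < ennreal (e / 2) + ennreal (e / 2)" by (intro add_strict_mono n j)
  also have "\<dots> = ennreal e" using e by (simp flip: ennreal_plus)
  finally show ?thesis using kc by blast
qed

section \<open>Normalised mollifiers and their convergence\<close>

definition bump_mass :: "'n::finite itself \<Rightarrow> real" where
  "bump_mass _ = (LINT w|lborel. prod_bump (\<lambda>_::'n. 0) w)"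

lemma prod_bump_measurable [measurable]: "prod_bump \<kappa> \<in> borel_measurable borel"
  by (rule borel_measurable_continuous_onI[OF continuous_on_prod_bump])

lemma prod_bump_integrable: "integrable lborel (prod_bump \<kappa>)"
  by (rule integrable_continuous_compact_support[OF continuous_on_prod_bump prod_bump_outside])

lemma bump_mass_pos: "0 < bump_mass TYPE('n::finite)"
proof -
  let ?p = "prod_bump (\<lambda>_::'n. 0)"
  let ?B = "ball (0::real^'n) (1/2)"
  have low: "exp (- 2) ^ CARD('n) \<le> ?p w" if "w \<in> ?B" for w
  proof -
    have "exp (- 2) \<le> bump 0 (w $ i)" for i
    proof -
      have t: "\<bar>w $ i\<bar> \<le> 1/2" using component_le_norm_cart[of w i] that by simp
      have "(w $ i)^2 \<le> (1/2)^2" using power_mono[OF t, of 2] by simp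
      then have "1/2 \<le> 1 - (w $ i)^2" by (simp add: power2_eq_square)
      then have "1 / (1 - (w $ i)^2) \<le> 1 / (1/2)" by (intro divide_left_mono) auto
      then show ?thesis using t by (simp add: bump_def)
    qed
    then have "(\<Prod>i\<in>(UNIV::'n set). exp (- 2)) \<le> ?p w" unfolding prod_bump_def by (intro prod_mono) auto
    then show ?thesis by simp
  qed
  have "(LINT w|lborel. indicator ?B w * exp (- 2) ^ CARD('n)) \<le> bump_mass TYPE('n)"
    unfolding bump_mass_def
  proof (rule integral_mono)
    show "integrable lborel (\<lambda>w. indicator ?B w * exp (- 2) ^ CARD('n) :: real)"
      using emeasure_lborel_ball_finite[of "0::real^'n" "1/2"] by (intro integrable_mult_left integrable_real_indicator) auto
    show "indicator ?B w * exp (- 2) ^ CARD('n) \<le> ?p w" for w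
      using low[of w] prod_bump_0_nonneg[of w] by (auto simp: indicator_def)
  qed (rule prod_bump_integrable)
  moreover have "(LINT w|lborel. indicator ?B w * exp (- 2) ^ CARD('n)) = measure lborel ?B * exp (- 2) ^ CARD('n)" by simp
  moreover have "0 < measure lborel ?B * exp (- 2) ^ CARD('n)" by (intro mult_pos_pos) (auto simp: content_ball)
  ultimately show ?thesis by linarith
qed

definition mollify :: "(real^'n \<Rightarrow> real) \<Rightarrow> real \<Rightarrow> real^'n \<Rightarrow> real" where
  "mollify F a x = (a ^ CARD('n) / bump_mass TYPE('n)) * bump_conv F (\<lambda>_. 0) a x"

definition mollifier :: "real \<Rightarrow> real^'n \<Rightarrow> real" where
  "mollifier a z = (a ^ CARD('n) / bump_mass TYPE('n)) * prod_bump (\<lambda>_. 0) (a *\<^sub>R z)"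

lemma mollify_eq: "mollify F a x = (LINT z|lborel. F z * mollifier a (x - z))"
  unfolding mollify_def bump_conv_def mollifier_def
  by (subst integral_mult_right_zero[symmetric]) (simp add: mult_ac)

lemma mollifier_nonneg: "0 < a \<Longrightarrow> 0 \<le> mollifier a (z::real^'n)"
  using bump_mass_pos[where 'n='n] prod_bump_0_nonneg[of "a *\<^sub>R z"] by (simp add: mollifier_def)

lemma mollifier_measurable [measurable]: "mollifier a \<in> borel_measurable borel"
  unfolding mollifier_def[abs_def] by measurable

lemma mollifier_outside: "0 < a \<Longrightarrow> sqrt CARD('n) / a < norm z \<Longrightarrow> mollifier a (z::real^'n) = 0"
  unfolding mollifier_def by (subst prod_bump_outside) (auto simp: pos_divide_less_eq mult.commute)

text \<open>Substitution w = a z in the integral defining \<open>bump_mass\<close>; the form with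
  values in \<open>ennreal\<close> is the one that Fubini requires below.\<close>

lemma nn_integral_mollifier:
  assumes a: "0 < a" shows "(\<integral>\<^sup>+z. ennreal (mollifier a (z::real^'n)) \<partial>lborel) = 1"
proof -
  let ?p = "prod_bump (\<lambda>_::'n. 0)"
  have m: "(\<integral>\<^sup>+w. ennreal (?p w) \<partial>lborel) = ennreal (bump_mass TYPE('n))"
    unfolding bump_mass_def by (intro nn_integral_eq_integral prod_bump_integrable) (auto simp: prod_bump_0_nonneg)
  have "(\<integral>\<^sup>+w. ennreal (?p w) \<partial>lborel) = (\<integral>\<^sup>+w. ennreal (?p w) \<partial>density (distr lborel borel (\<lambda>x. 0 + a *\<^sub>R x)) (\<lambda>_. ennreal (\<bar>a\<bar> ^ DIM(real^'n))))"
    using a by (subst lborel_affine[of a 0]) auto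
  also have "\<dots> = (\<integral>\<^sup>+z. ennreal (a ^ CARD('n)) * ennreal (?p (a *\<^sub>R z)) \<partial>lborel)"
    using a by (simp add: nn_integral_density nn_integral_distr)
  finally have "ennreal (bump_mass TYPE('n)) = ennreal (a ^ CARD('n)) * (\<integral>\<^sup>+z. ennreal (?p (a *\<^sub>R z)) \<partial>lborel)"
    unfolding m by (simp add: nn_integral_cmult)
  then have 1: "ennreal (a ^ CARD('n)) * (\<integral>\<^sup>+z. ennreal (?p (a *\<^sub>R z)) \<partial>lborel) = ennreal (bump_mass TYPE('n))" by simp
  define c where "c = 1 / bump_mass TYPE('n)"
  have c: "0 < c" using bump_mass_pos[where 'n='n] by (simp add: c_def)
  have "(\<integral>\<^sup>+z. ennreal (mollifier a (z::real^'n)) \<partial>lborel) = (\<integral>\<^sup>+z. ennreal (c * a ^ CARD('n)) * ennreal (?p (a *\<^sub>R z)) \<partial>lborel)"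
  proof (rule nn_integral_cong)
    fix z :: "real^'n"
    have "mollifier a z = (c * a ^ CARD('n)) * ?p (a *\<^sub>R z)" by (simp add: mollifier_def c_def)
    also have "ennreal \<dots> = ennreal (c * a ^ CARD('n)) * ennreal (?p (a *\<^sub>R z))"
      using a c by (intro ennreal_mult prod_bump_0_nonneg) auto
    finally show "ennreal (mollifier a z) = ennreal (c * a ^ CARD('n)) * ennreal (?p (a *\<^sub>R z))" .
  qed
  also have "\<dots> = ennreal (c * a ^ CARD('n)) * (\<integral>\<^sup>+z. ennreal (?p (a *\<^sub>R z)) \<partial>lborel)"
    by (rule nn_integral_cmult) measurable
  also have "ennreal (c * a ^ CARD('n)) = ennreal c * ennreal (a ^ CARD('n))"
    using a c by (intro ennreal_mult) auto
  also have "ennreal c * ennreal (a ^ CARD('n)) * (\<integral>\<^sup>+z. ennreal (?p (a *\<^sub>R z)) \<partial>lborel) = ennreal c * ennreal (bump_mass TYPE('n))"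
    unfolding mult.assoc 1 ..
  also have "\<dots> = ennreal (c * bump_mass TYPE('n))"
    using c bump_mass_pos[where 'n='n] by (intro ennreal_mult[symmetric]) auto
  also have "c * bump_mass TYPE('n) = 1" using bump_mass_pos[where 'n='n] by (simp add: c_def)
  finally show ?thesis by simp
qed

lemma nn_integral_mollifier_shift:
  assumes a: "0 < a" shows "(\<integral>\<^sup>+x. ennreal (mollifier a (x - z :: real^'n)) \<partial>lborel) = 1"
  using nn_integral_translate[of "\<lambda>x. ennreal (mollifier a x)" "- z"] nn_integral_mollifier[OF a] by simp

lemma prod_bump_0_even: "prod_bump (\<lambda>_. 0) (- w) = prod_bump (\<lambda>_. 0) w"
proof -
  have "bump 0 (- t) = bump 0 t" for t by (auto simp: bump_def)
  then show ?thesis by (simp add: prod_bump_def)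
qed

lemma mollifier_even: "mollifier a (- z) = mollifier a z"
  by (simp add: mollifier_def prod_bump_0_even)

lemma mollifier_commute: "mollifier a (x - z) = mollifier a (z - x)"
  using mollifier_even[of a "x - z"] by simp

lemma integral_mollifier:
  assumes a: "0 < a"
  shows "integrable lborel (\<lambda>z::real^'n. mollifier a (x - z))" "(LINT z|lborel. mollifier a (x - z :: real^'n)) = 1"
proof -
  have "has_bochner_integral lborel (\<lambda>z::real^'n. mollifier a (x - z)) 1"
    using nn_integral_mollifier_shift[OF a, of x]
    by (intro has_bochner_integral_nn_integral) (auto simp: mollifier_nonneg[OF a] mollifier_commute[of a x])
  then show "integrable lborel (\<lambda>z::real^'n. mollifier a (x - z))" "(LINT z|lborel. mollifier a (x - z :: real^'n)) = 1"
    by (auto simp: has_bochner_integral_iff)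
qed

lemma mollify_integrable:
  fixes x :: "real^'n"
  assumes F: "locally_integrable F" and a: "0 < a"
  shows "integrable lborel (\<lambda>z. F z * mollifier a (x - z))"
proof -
  have "integrable lborel (\<lambda>z. (a ^ CARD('n) / bump_mass TYPE('n)) * (F z * prod_bump (\<lambda>_. 0) (a *\<^sub>R (x - z))))"
    by (intro integrable_mult_right bump_conv_integrable F a)
  then show ?thesis by (simp add: mollifier_def mult_ac)
qed

lemma mollify_diff:
  fixes x :: "real^'n"
  assumes "locally_integrable F" "locally_integrable G" "0 < a"
  shows "mollify (\<lambda>x. F x - G x) a x = mollify F a x - mollify G a x"
  unfolding mollify_eq left_diff_distrib
  by (intro Bochner_Integration.integral_diff mollify_integrable assms)

text \<open>Fubini and a kernel of total mass 1. For a at least 1 its support lies in the ball of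
  radius sqrt n, whence the larger ball on the right.\<close>

lemma mollify_L1_contraction:
  fixes F :: "real^'n \<Rightarrow> real"
  assumes F: "locally_integrable F" and a: "1 \<le> a"
  shows "(\<integral>\<^sup>+x\<in>cball 0 R. ennreal \<bar>mollify F a x\<bar> \<partial>lborel) \<le> (\<integral>\<^sup>+x\<in>cball 0 (R + sqrt CARD('n)). ennreal \<bar>F x\<bar> \<partial>lborel)"
proof -
  have a0: "0 < a" using a by simp
  note [measurable] = locally_integrable_measurable[OF F]
  have [measurable]: "cball (0::real^'n) r \<in> sets borel" for r by simp
  have "(\<integral>\<^sup>+x\<in>cball 0 R. ennreal \<bar>mollify F a x\<bar> \<partial>lborel) \<le> (\<integral>\<^sup>+x\<in>cball 0 R. (\<integral>\<^sup>+z. ennreal (\<bar>F z\<bar> * mollifier a (x - z)) \<partial>lborel) \<partial>lborel)"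
  proof (intro nn_integral_mono mult_right_mono)
    fix x
    have "ennreal (norm (mollify F a x)) \<le> (\<integral>\<^sup>+z. ennreal (norm (F z * mollifier a (x - z))) \<partial>lborel)"
      unfolding mollify_eq by (intro integral_norm_bound_ennreal mollify_integrable F a0)
    then show "ennreal \<bar>mollify F a x\<bar> \<le> (\<integral>\<^sup>+z. ennreal (\<bar>F z\<bar> * mollifier a (x - z)) \<partial>lborel)"
      by (simp add: abs_mult mollifier_nonneg[OF a0])
  qed auto
  also have "\<dots> = (\<integral>\<^sup>+x. (\<integral>\<^sup>+z. ennreal (\<bar>F z\<bar> * mollifier a (x - z)) * indicator (cball 0 R) x \<partial>lborel) \<partial>lborel)"
    by (intro nn_integral_cong nn_integral_multc[symmetric]) measurable
  also have "\<dots> = (\<integral>\<^sup>+z. (\<integral>\<^sup>+x. ennreal (\<bar>F z\<bar> * mollifier a (x - z)) * indicator (cball 0 R) x \<partial>lborel) \<partial>lborel)"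
    by (rule lborel_pair.Fubini') measurable
  also have "\<dots> \<le> (\<integral>\<^sup>+z. (ennreal \<bar>F z\<bar> * indicator (cball 0 (R + sqrt CARD('n))) z) * (\<integral>\<^sup>+x. ennreal (mollifier a (x - z)) \<partial>lborel) \<partial>lborel)"
  proof (rule nn_integral_mono)
    fix z :: "real^'n"
    have "(\<integral>\<^sup>+x. ennreal (\<bar>F z\<bar> * mollifier a (x - z)) * indicator (cball 0 R) x \<partial>lborel)
       \<le> (\<integral>\<^sup>+x. (ennreal \<bar>F z\<bar> * indicator (cball 0 (R + sqrt CARD('n))) z) * ennreal (mollifier a (x - z)) \<partial>lborel)"
    proof (rule nn_integral_mono)
      fix x :: "real^'n"
      show "ennreal (\<bar>F z\<bar> * mollifier a (x - z)) * indicator (cball 0 R) x \<le> (ennreal \<bar>F z\<bar> * indicator (cball 0 (R + sqrt CARD('n))) z) * ennreal (mollifier a (x - z))"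
      proof (cases "norm x \<le> R \<and> \<not> norm z \<le> R + sqrt CARD('n)")
        case True
        have "sqrt CARD('n) / a \<le> sqrt CARD('n)" using a by (simp add: divide_le_eq mult_le_cancel_left1)
        moreover have "norm z \<le> norm (x - z) + norm x" using norm_triangle_sub[of z x] by (simp add: norm_minus_commute)
        ultimately have "sqrt CARD('n) / a < norm (x - z)" using True by linarith
        then have "mollifier a (x - z) = 0" by (rule mollifier_outside[OF a0])
        then show ?thesis by simp
      next
        case False
        then show ?thesis using mollifier_nonneg[OF a0, of "x - z"] by (auto simp: indicator_def ennreal_mult)
      qed
    qed
    also have "\<dots> = (ennreal \<bar>F z\<bar> * indicator (cball 0 (R + sqrt CARD('n))) z) * (\<integral>\<^sup>+x. ennreal (mollifier a (x - z)) \<partial>lborel)"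
      by (rule nn_integral_cmult) measurable
    finally show "(\<integral>\<^sup>+x. ennreal (\<bar>F z\<bar> * mollifier a (x - z)) * indicator (cball 0 R) x \<partial>lborel)
       \<le> (ennreal \<bar>F z\<bar> * indicator (cball 0 (R + sqrt CARD('n))) z) * (\<integral>\<^sup>+x. ennreal (mollifier a (x - z)) \<partial>lborel)" .
  qed
  also have "\<dots> = (\<integral>\<^sup>+x\<in>cball 0 (R + sqrt CARD('n)). ennreal \<bar>F x\<bar> \<partial>lborel)"
    by (simp add: nn_integral_mollifier_shift[OF a0])
  finally show ?thesis .
qed

lemma locally_integrable_continuous:
  assumes "continuous_on UNIV g" shows "locally_integrable g"
  unfolding locally_integrable_def set_integrable_def
  by (intro conjI allI borel_measurable_continuous_onI assms borel_integrable_compact continuous_on_subset[OF assms]) auto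

text \<open>A weighted mean of g over a ball of radius sqrt n / a, and g is uniformly continuous on
  a slightly larger compact ball.\<close>

lemma mollify_uniform:
  fixes g :: "real^'n \<Rightarrow> real"
  assumes g: "continuous_on UNIV g"
  shows "uniform_limit (cball 0 R) (\<lambda>m. mollify g (real (Suc m))) g sequentially"
proof (rule uniform_limitI)
  fix e :: real assume e: "0 < e"
  have "uniformly_continuous_on (cball 0 (R + sqrt CARD('n))) g"
    by (intro compact_uniformly_continuous continuous_on_subset[OF g]) auto
  then obtain d where d: "0 < d" "\<And>x z. x \<in> cball 0 (R + sqrt CARD('n)) \<Longrightarrow> z \<in> cball 0 (R + sqrt CARD('n)) \<Longrightarrow> dist z x < d \<Longrightarrow> dist (g z) (g x) < e / 2"
    using e unfolding uniformly_continuous_on_def by (meson half_gt_zero)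
  obtain m0 :: nat where m0: "sqrt CARD('n) / d < m0" using reals_Archimedean2 by blast
  have "dist (mollify g (real (Suc m)) x) (g x) < e" if "m0 \<le> m" "x \<in> cball 0 R" for m x
  proof -
    define a where "a = real (Suc m)"
    have a: "1 \<le> a" "0 < a" by (auto simp: a_def)
    have sd: "sqrt CARD('n) / a < d"
    proof -
      have "sqrt CARD('n) / d < a" using m0 that by (simp add: a_def)
      then show ?thesis using d(1) a by (simp add: field_simps)
    qed
    have s1: "sqrt CARD('n) / a \<le> sqrt CARD('n)" using a by (simp add: divide_le_eq mult_le_cancel_left1)
    have int: "integrable lborel (\<lambda>z. g z * mollifier a (x - z))" "integrable lborel (\<lambda>z. g x * mollifier a (x - z))"
      using mollify_integrable[OF locally_integrable_continuous[OF g] a(2)] integral_mollifier(1)[OF a(2)] by auto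
    have "mollify g a x - g x = (LINT z|lborel. g z * mollifier a (x - z)) - (LINT z|lborel. g x * mollifier a (x - z))"
      using integral_mollifier(2)[OF a(2), of x] by (simp add: mollify_eq)
    also have "\<dots> = (LINT z|lborel. (g z - g x) * mollifier a (x - z))"
      using int by (simp add: left_diff_distrib)
    finally have eq: "mollify g a x - g x = (LINT z|lborel. (g z - g x) * mollifier a (x - z))" .
    have "norm (LINT z|lborel. (g z - g x) * mollifier a (x - z)) \<le> (LINT z|lborel. e / 2 * mollifier a (x - z))"
    proof (rule order_trans[OF integral_norm_bound integral_mono])
      show "integrable lborel (\<lambda>z. norm ((g z - g x) * mollifier a (x - z)))"
        using int by (intro integrable_norm) (simp add: left_diff_distrib)
      show "integrable lborel (\<lambda>z. e / 2 * mollifier a (x - z))"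
        by (intro integrable_mult_right integral_mollifier a)
      fix z
      show "norm ((g z - g x) * mollifier a (x - z)) \<le> e / 2 * mollifier a (x - z)"
      proof (cases "sqrt CARD('n) / a < norm (x - z)")
        case True
        then show ?thesis using mollifier_outside[OF a(2) True] by simp
      next
        case False
        then have "dist z x < d" using sd by (simp add: dist_norm norm_minus_commute)
        moreover have "norm z \<le> R + sqrt CARD('n)"
          using False s1 that norm_triangle_sub[of z x] by (simp add: norm_minus_commute)
        moreover have "norm x \<le> R + sqrt CARD('n)" using that by (simp add: add_increasing2)
        ultimately have "dist (g z) (g x) < e / 2" by (intro d(2)) auto
        then have "\<bar>g z - g x\<bar> \<le> e / 2" by (simp add: dist_real_def)
        then have "\<bar>g z - g x\<bar> * mollifier a (x - z) \<le> e / 2 * mollifier a (x - z)"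
          by (intro mult_right_mono mollifier_nonneg a)
        then show ?thesis using mollifier_nonneg[OF a(2), of "x - z"] by (simp add: abs_mult)
      qed
    qed
    also have "\<dots> = e / 2" using integral_mollifier(2)[OF a(2), of x] by simp
    also have "\<dots> < e" using e by simp
    finally show ?thesis unfolding a_def[symmetric] dist_real_def eq[symmetric] by simp
  qed
  then show "\<forall>\<^sub>F m in sequentially. \<forall>x\<in>cball 0 R. dist (mollify g (real (Suc m)) x) (g x) < e"
    unfolding eventually_sequentially by blast
qed

lemma mollify_measurable [measurable]:
  fixes F :: "real^'n \<Rightarrow> real"
  assumes "locally_integrable F" "0 < a" shows "mollify F a \<in> borel_measurable borel"
  unfolding mollify_def[abs_def]
  by (intro borel_measurable_continuous_onI continuous_intros continuous_on_bump_conv assms)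

lemma locally_integrable_diff:
  assumes "locally_integrable F" "locally_integrable G" shows "locally_integrable (\<lambda>x. F x - G x)"
  using assms unfolding locally_integrable_def set_integrable_def
  by (auto simp: right_diff_distrib intro!: borel_measurable_diff Bochner_Integration.integrable_diff)

text \<open>Density argument: F is replaced by a continuous k; the contraction property controls the
  mollified difference, and the mollifications of k converge uniformly on the ball.\<close>

lemma mollify_L1_convergence:
  fixes F :: "real^'n \<Rightarrow> real"
  assumes F: "locally_integrable F"
  shows "(\<lambda>m. \<integral>\<^sup>+x\<in>cball 0 R. ennreal \<bar>mollify F (real (Suc m)) x - F x\<bar> \<partial>lborel) \<longlonglongrightarrow> 0"
proof (rule order_tendstoI)
  fix l :: ennreal assume l: "0 < l"
  obtain e :: real where e: "0 < e" "ennreal e \<le> l"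
  proof (cases l)
    case (real r)
    then show ?thesis using l that[of r] by auto
  next
    case top
    then show ?thesis using that[of 1] by simp
  qed
  note mF = locally_integrable_measurable[OF F]
  have [measurable]: "F \<in> borel_measurable borel" by (rule mF)
  have [measurable]: "cball (0::real^'n) r \<in> sets borel" for r by simp
  have "set_integrable lborel (cball 0 (R + sqrt CARD('n))) F" using F by (simp add: locally_integrable_def)
  from continuous_L1_approximation[OF mF this, of "e / 3"] e obtain k where
    k: "continuous_on UNIV k" "(\<integral>\<^sup>+x\<in>cball 0 (R + sqrt CARD('n)). ennreal \<bar>F x - k x\<bar> \<partial>lborel) < ennreal (e / 3)" by auto
  have lk: "locally_integrable k" by (rule locally_integrable_continuous[OF k(1)])
  have lFk: "locally_integrable (\<lambda>x. F x - k x)" by (rule locally_integrable_diff[OF F lk])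
  note [measurable] = locally_integrable_measurable[OF lk]
  define V where "V = measure lborel (cball (0::real^'n) R)"
  have V: "emeasure lborel (cball (0::real^'n) R) = ennreal V" "0 \<le> V"
    using emeasure_lborel_cball_finite[of "0::real^'n" R] by (auto simp: V_def intro!: emeasure_eq_ennreal_measure)
  \<comment> \<open>The summand 1 keeps the denominator positive when the ball has volume 0.\<close>
  define c where "c = e / 6 / (V + 1)"
  have c: "0 < c" "c * V < e / 3"
  proof -
    show "0 < c" using e V by (simp add: c_def)
    then have "c * V \<le> c * (V + 1)" by (intro mult_left_mono) auto
    also have "\<dots> = e / 6"
    proof -
      have "V + 1 \<noteq> 0" using V(2) by linarith
      then show ?thesis unfolding c_def by (rule nonzero_mult_div_cancel_right[of "V + 1" "e / 6", unfolded times_divide_eq_left[symmetric]])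
    qed
    also have "\<dots> < e / 3" using e by simp
    finally show "c * V < e / 3" .
  qed
  have "\<forall>\<^sub>F m in sequentially. \<forall>x\<in>cball 0 R. dist (mollify k (real (Suc m)) x) (k x) < c"
    using mollify_uniform[OF k(1)] c(1) by (rule uniform_limitD)
  then show "\<forall>\<^sub>F m in sequentially. (\<integral>\<^sup>+x\<in>cball 0 R. ennreal \<bar>mollify F (real (Suc m)) x - F x\<bar> \<partial>lborel) < l"
  proof eventually_elim
    case (elim m)
    define a where "a = real (Suc m)"
    have a: "0 < a" "1 \<le> a" by (auto simp: a_def)
    note [measurable] = mollify_measurable[OF F a(1)] mollify_measurable[OF lk a(1)] mollify_measurable[OF lFk a(1)]
    have "(\<integral>\<^sup>+x\<in>cball 0 R. ennreal \<bar>mollify F a x - F x\<bar> \<partial>lborel) \<le>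
      (\<integral>\<^sup>+x. ennreal \<bar>mollify (\<lambda>x. F x - k x) a x\<bar> * indicator (cball 0 R) x + ennreal \<bar>F x - k x\<bar> * indicator (cball 0 R) x
         + ennreal c * indicator (cball 0 R) x \<partial>lborel)"
    proof (rule nn_integral_mono)
      fix x :: "real^'n"
      show "ennreal \<bar>mollify F a x - F x\<bar> * indicator (cball 0 R) x \<le> ennreal \<bar>mollify (\<lambda>x. F x - k x) a x\<bar> * indicator (cball 0 R) x + ennreal \<bar>F x - k x\<bar> * indicator (cball 0 R) x
         + ennreal c * indicator (cball 0 R) x"
      proof (cases "x \<in> cball 0 R")
        case True
        have "dist (mollify k a x) (k x) < c" using elim True unfolding a_def by blast
        then have "\<bar>mollify k a x - k x\<bar> \<le> c" by (simp add: dist_real_def)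
        then have "\<bar>mollify F a x - F x\<bar> \<le> \<bar>mollify (\<lambda>x. F x - k x) a x\<bar> + \<bar>F x - k x\<bar> + c"
          unfolding mollify_diff[OF F lk a(1)] by linarith
        then show ?thesis using True c by (simp flip: ennreal_plus add: ennreal_leI)
      qed simp
    qed
    also have "\<dots> = (\<integral>\<^sup>+x\<in>cball 0 R. ennreal \<bar>mollify (\<lambda>x. F x - k x) a x\<bar> \<partial>lborel) + (\<integral>\<^sup>+x\<in>cball 0 R. ennreal \<bar>F x - k x\<bar> \<partial>lborel) + ennreal c * ennreal V"
      unfolding V(1)[symmetric] by (simp add: nn_integral_add nn_integral_cmult_indicator)
    also have "\<dots> < ennreal (e / 3) + ennreal (e / 3) + ennreal (e / 3)"
    proof -
      have 1: "(\<integral>\<^sup>+x\<in>cball 0 R. ennreal \<bar>mollify (\<lambda>x. F x - k x) a x\<bar> \<partial>lborel) < ennreal (e / 3)"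
        by (rule order_le_less_trans[OF mollify_L1_contraction[OF lFk a(2)] k(2)])
      have "(\<integral>\<^sup>+x\<in>cball 0 R. ennreal \<bar>F x - k x\<bar> \<partial>lborel) \<le> (\<integral>\<^sup>+x\<in>cball 0 (R + sqrt CARD('n)). ennreal \<bar>F x - k x\<bar> \<partial>lborel)"
        by (intro nn_integral_mono) (auto simp: indicator_def intro: order_trans)
      then have 2: "(\<integral>\<^sup>+x\<in>cball 0 R. ennreal \<bar>F x - k x\<bar> \<partial>lborel) < ennreal (e / 3)" using k(2) by (rule order_le_less_trans)
      have 3: "ennreal c * ennreal V < ennreal (e / 3)" using c V e by (simp flip: ennreal_mult add: ennreal_less_iff)
      show ?thesis by (intro add_strict_mono 1 2 3)
    qed
    also have "\<dots> = ennreal e" using e by (simp flip: ennreal_plus)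
    also note e(2)
    finally show ?case unfolding a_def by simp
  qed
qed auto

text \<open>Convexity in the form that Jensen's inequality needs. In the induction, multiplication
  by t leaves a nonnegative multiple of (t - s)^2 to discard.\<close>

lemma power_tangent:
  fixes s t :: real
  assumes "0 \<le> s" "0 \<le> t"
  shows "s ^ Suc p + (1 + real p) * s ^ p * (t - s) \<le> t ^ Suc p"
proof (induction p)
  case (Suc p)
  have "t * (s ^ Suc p + (1 + real p) * s ^ p * (t - s)) \<le> t * t ^ Suc p"
    using Suc assms by (intro mult_left_mono) auto
  moreover have "0 \<le> (1 + real p) * s ^ p * (t - s)^2" using assms by simp
  moreover have "t * (s ^ Suc p + (1 + real p) * s ^ p * (t - s)) = s ^ Suc (Suc p) + (1 + real (Suc p)) * s ^ Suc p * (t - s) + (1 + real p) * s ^ p * (t - s)^2"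
    by (simp add: algebra_simps power2_eq_square)
  ultimately show ?case by simp
qed simp

text \<open>Jensen's inequality for the probability density of the mollifier: integrate the tangent
  inequality at the mean s of |D|, where the linear term drops out.\<close>

lemma mollify_power_le:
  fixes D :: "real^'n \<Rightarrow> real"
  assumes D: "locally_integrable D" and E: "locally_integrable E" "\<And>z. \<bar>D z\<bar> ^ p \<le> E z" and a: "0 < a" and p: "1 \<le> p"
  shows "\<bar>mollify D a x\<bar> ^ p \<le> mollify E a x"
proof -
  obtain r where r: "p = Suc r" using p by (cases p) auto
  have absD: "locally_integrable (\<lambda>z. \<bar>D z\<bar>)"
    unfolding locally_integrable_def set_integrable_def
  proof (intro conjI allI)
    show "(\<lambda>z. \<bar>D z\<bar>) \<in> borel_measurable borel" using locally_integrable_measurable[OF D] by measurable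
    fix R
    have "integrable lborel (\<lambda>z. norm (indicator (cball 0 R) z *\<^sub>R D z))"
      using D by (intro integrable_norm) (auto simp: locally_integrable_def set_integrable_def)
    then show "integrable lborel (\<lambda>z. indicator (cball 0 R) z *\<^sub>R \<bar>D z\<bar>)" by (simp add: abs_mult)
  qed
  define s where "s = mollify (\<lambda>z. \<bar>D z\<bar>) a x"
  have s: "0 \<le> s" unfolding s_def mollify_eq
    by (intro Bochner_Integration.integral_nonneg mult_nonneg_nonneg mollifier_nonneg[OF a]) simp
  have "\<bar>mollify D a x\<bar> \<le> (LINT z|lborel. norm (D z * mollifier a (x - z)))"
    unfolding mollify_eq using integral_norm_bound[of lborel "\<lambda>z. D z * mollifier a (x - z)"] by simp
  also have "\<dots> = s" unfolding s_def mollify_eq by (simp add: abs_mult mollifier_nonneg[OF a])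
  finally have "\<bar>mollify D a x\<bar> ^ p \<le> s ^ p" by (intro power_mono) auto
  also have "s ^ p = (LINT z|lborel. s ^ p * mollifier a (x - z) + (1 + real r) * s ^ r * (\<bar>D z\<bar> * mollifier a (x - z) - s * mollifier a (x - z)))"
    using mollify_integrable[OF absD a, of x] integral_mollifier[OF a, of x] by (simp add: mollify_eq[symmetric] s_def[symmetric])
  also have "\<dots> \<le> mollify E a x"
    unfolding mollify_eq
  proof (rule integral_mono)
    show "integrable lborel (\<lambda>z. s ^ p * mollifier a (x - z) + (1 + real r) * s ^ r * (\<bar>D z\<bar> * mollifier a (x - z) - s * mollifier a (x - z)))"
      using mollify_integrable[OF absD a, of x] integral_mollifier[OF a, of x] by simp
    show "integrable lborel (\<lambda>z. E z * mollifier a (x - z))" by (rule mollify_integrable[OF E(1) a])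
    fix z
    have "s ^ p + (1 + real r) * s ^ r * (\<bar>D z\<bar> - s) \<le> E z"
      using power_tangent[OF s abs_ge_zero, of r "D z"] E(2)[of z] by (simp add: r)
    from mult_right_mono[OF this mollifier_nonneg[OF a, of "x - z"]]
    show "s ^ p * mollifier a (x - z) + (1 + real r) * s ^ r * (\<bar>D z\<bar> * mollifier a (x - z) - s * mollifier a (x - z)) \<le> E z * mollifier a (x - z)"
      by (simp add: algebra_simps)
  qed
  finally show ?thesis .
qed

section \<open>From weak derivatives to dominated smooth approximation\<close>

lemma has_weak_partial_bump_conv:
  fixes u d :: "real^'n \<Rightarrow> real"
  assumes weak: "\<And>\<phi>. test_function \<phi> \<Longrightarrow> (LINT x|lborel. u x * partial_deriv j \<phi> x) = - (LINT x|lborel. d x * \<phi> x)"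
    and a: "0 < a"
  shows "a * bump_conv u ((\<lambda>_. 0)(j := Suc 0)) a x = bump_conv d (\<lambda>_. 0) a x"
proof -
  \<comment> \<open>The kernel reflected and centred at x serves as the test function; its
    derivative in z carries the factor -a.\<close>
  have "(LINT z|lborel. u z * (- a * prod_bump ((\<lambda>_. 0)(j := Suc 0)) (a *\<^sub>R (x - z)))) = - (LINT z|lborel. d z * prod_bump (\<lambda>_. 0) (a *\<^sub>R (x - z)))"
    using weak[OF test_function_prod_bump[OF a, of "\<lambda>_. 0" x]] partial_deriv_prod_bump[of j 1 "\<lambda>_. 0" a x] by simp
  moreover have "(LINT z|lborel. u z * (- a * prod_bump ((\<lambda>_. 0)(j := Suc 0)) (a *\<^sub>R (x - z)))) = - a * bump_conv u ((\<lambda>_. 0)(j := Suc 0)) a x"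
    unfolding bump_conv_def by (subst integral_mult_right_zero[symmetric]) (simp add: mult_ac)
  ultimately show ?thesis by (simp add: bump_conv_def)
qed

lemma locally_integrable_of_power:
  fixes D :: "'a::euclidean_space \<Rightarrow> real"
  assumes D: "D \<in> borel_measurable borel" and E: "locally_integrable (\<lambda>x. \<bar>D x\<bar> ^ p)" and p: "1 \<le> p"
  shows "locally_integrable D"
  unfolding locally_integrable_def
proof (intro conjI allI D)
  fix R
  have one: "integrable lborel (indicator (cball 0 R) :: 'a \<Rightarrow> real)" by (rule integrable_indicator_cball)
  have "integrable lborel (\<lambda>x::'a. indicator (cball 0 R) x + indicator (cball 0 R) x *\<^sub>R \<bar>D x\<bar> ^ p)"
    using E one by (intro Bochner_Integration.integrable_add) (auto simp: locally_integrable_def set_integrable_def)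
  then show "set_integrable lborel (cball 0 R) D"
    unfolding set_integrable_def
  proof (rule Bochner_Integration.integrable_bound)
    show "(\<lambda>x. indicator (cball 0 R) x *\<^sub>R D x) \<in> borel_measurable lborel"
      using D by (intro borel_measurable_scaleR borel_measurable_indicator) auto
    show "AE x in lborel. norm (indicator (cball 0 R) x *\<^sub>R D x) \<le> norm (indicator (cball 0 R) x + indicator (cball 0 R) x *\<^sub>R \<bar>D x\<bar> ^ p)"
    proof (rule AE_I2)
      fix x
      have "\<bar>D x\<bar> \<le> 1 + \<bar>D x\<bar> ^ p" by (rule le_one_plus_power[OF abs_ge_zero p])
      then show "norm (indicator (cball 0 R) x *\<^sub>R D x) \<le> norm (indicator (cball 0 R) x + indicator (cball 0 R) x *\<^sub>R \<bar>D x\<bar> ^ p)"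
        by (auto simp: indicator_def)
    qed
  qed
qed

lemma locally_integrable_sum:
  assumes "finite I" "\<And>i. i \<in> I \<Longrightarrow> locally_integrable (F i)"
  shows "locally_integrable (\<lambda>x. \<Sum>i\<in>I. F i x)"
  using assms unfolding locally_integrable_def set_integrable_def scaleR_sum_right
  by (intro conjI allI borel_measurable_sum Bochner_Integration.integrable_sum) auto

lemma norm_matrix_le_sum:
  fixes A :: "real^'n^'m" shows "norm A \<le> (\<Sum>k\<in>UNIV. \<Sum>j\<in>UNIV. \<bar>A $ k $ j\<bar>)"
proof -
  have "norm A \<le> (\<Sum>k\<in>UNIV. norm (A $ k))" unfolding norm_vec_def by (intro L2_set_le_sum) auto
  also have "\<dots> \<le> (\<Sum>k\<in>UNIV. \<Sum>j\<in>UNIV. \<bar>A $ k $ j\<bar>)" by (intro sum_mono norm_le_l1_cart)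
  finally show ?thesis .
qed

text \<open>Mollification converges in L^1, while convergence almost everywhere with a fixed
  majorant is required. A subsequence with errors below 2^(-m) has an integrable sum \<Phi> of
  errors, which forces convergence almost everywhere. For the majorant, Jensen bounds the p-th power
  of each mollified entry by the mollification of E, the sum of the p-th powers, and this exceeds E
  by at most \<Phi>.\<close>

theorem weak_differential_imp_locally_approximable:
  fixes g :: "real^'n \<Rightarrow> real^'m"
  assumes g: "continuous_on UNIV g" and Dg: "Dg \<in> borel_measurable borel" and p: "1 \<le> p"
    and int: "\<And>k j. locally_integrable (\<lambda>x. \<bar>Dg x $ k $ j\<bar> ^ p)"
    and weak: "\<And>k j \<phi>. test_function \<phi> \<Longrightarrow> (LINT x|lborel. g x $ k * partial_deriv j \<phi> x) = - (LINT x|lborel. Dg x $ k $ j * \<phi> x)"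
  shows "locally_approximable p g Dg"
  unfolding locally_approximable_def
proof (intro conjI allI g Dg)
  fix R :: real
  define D where "D k j x = Dg x $ k $ j" for k j x
  have mD: "D k j \<in> borel_measurable borel" for k j
    unfolding D_def[abs_def] by (rule borel_measurable_continuous_on[OF _ Dg]) (intro continuous_intros)
  note [measurable] = mD
  have lD: "locally_integrable (D k j)" for k j
    by (rule locally_integrable_of_power[OF mD _ p]) (use int in \<open>simp add: D_def\<close>)
  define E where "E x = (\<Sum>k\<in>UNIV. \<Sum>j\<in>UNIV. \<bar>D k j x\<bar> ^ p)" for x
  have lE: "locally_integrable E"
    unfolding E_def[abs_def] using int by (intro locally_integrable_sum) (auto simp: D_def)
  have E0: "0 \<le> E x" for x by (simp add: E_def sum_nonneg)
  have DE: "\<bar>D k j x\<bar> ^ p \<le> E x" for k j x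
  proof -
    have "\<bar>D k j x\<bar> ^ p \<le> (\<Sum>j\<in>UNIV. \<bar>D k j x\<bar> ^ p)" by (rule member_le_sum) auto
    also have "\<dots> \<le> E x" unfolding E_def by (rule member_le_sum[of k UNIV "\<lambda>k. \<Sum>j\<in>UNIV. \<bar>D k j x\<bar> ^ p"]) (auto intro: sum_nonneg)
    finally show ?thesis .
  qed
  have lg: "locally_integrable (\<lambda>x. g x $ k)" for k
    by (intro locally_integrable_continuous continuous_intros g)
  \<comment> \<open>The error of E is included so that one subsequence serves both the convergence
    and the majorant.\<close>
  define err where "err m x = indicator (cball 0 R) x * ((\<Sum>k\<in>UNIV. \<Sum>j\<in>UNIV. \<bar>mollify (D k j) (real (Suc m)) x - D k j x\<bar>) + \<bar>mollify E (real (Suc m)) x - E x\<bar>)" for m x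
  have err0: "0 \<le> err m x" for m x by (auto simp: err_def intro!: mult_nonneg_nonneg add_nonneg_nonneg sum_nonneg)
  note mE = locally_integrable_measurable[OF lE]
  have [measurable]: "E \<in> borel_measurable borel" by (rule mE)
  have [measurable]: "mollify (D k j) (real (Suc m)) \<in> borel_measurable borel" "mollify E (real (Suc m)) \<in> borel_measurable borel" for k j m
    by (auto intro: mollify_measurable lD lE)
  have [measurable]: "cball (0::real^'n) R \<in> sets borel" by simp
  have merr [measurable]: "err m \<in> borel_measurable borel" for m unfolding err_def[abs_def] by measurable
  have nnerr: "(\<integral>\<^sup>+x. ennreal (err m x) \<partial>lborel) =
     (\<Sum>k\<in>UNIV. \<Sum>j\<in>UNIV. \<integral>\<^sup>+x\<in>cball 0 R. ennreal \<bar>mollify (D k j) (real (Suc m)) x - D k j x\<bar> \<partial>lborel)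
      + (\<integral>\<^sup>+x\<in>cball 0 R. ennreal \<bar>mollify E (real (Suc m)) x - E x\<bar> \<partial>lborel)" for m
  proof -
    have "ennreal (err m x) = (\<Sum>k\<in>UNIV. \<Sum>j\<in>UNIV. ennreal \<bar>mollify (D k j) (real (Suc m)) x - D k j x\<bar> * indicator (cball 0 R) x)
      + ennreal \<bar>mollify E (real (Suc m)) x - E x\<bar> * indicator (cball 0 R) x" for x
    proof (cases "x \<in> cball 0 R")
      case True
      have "ennreal (err m x) = ennreal (\<Sum>k\<in>UNIV. \<Sum>j\<in>UNIV. \<bar>mollify (D k j) (real (Suc m)) x - D k j x\<bar>) + ennreal \<bar>mollify E (real (Suc m)) x - E x\<bar>"
        using True by (subst ennreal_plus[symmetric]) (auto simp: err_def sum_nonneg)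
      also have "ennreal (\<Sum>k\<in>UNIV. \<Sum>j\<in>UNIV. \<bar>mollify (D k j) (real (Suc m)) x - D k j x\<bar>) = (\<Sum>k\<in>UNIV. \<Sum>j\<in>UNIV. ennreal \<bar>mollify (D k j) (real (Suc m)) x - D k j x\<bar>)"
        by (subst sum_ennreal[symmetric], simp add: sum_nonneg, intro sum.cong refl sum_ennreal[symmetric], simp)
      finally show ?thesis using True by simp
    qed (simp add: err_def)
    then show ?thesis by (simp add: nn_integral_add nn_integral_sum del: of_nat_Suc sum_ennreal sum_mult_indicator)
  qed
  have "(\<lambda>m. \<integral>\<^sup>+x. ennreal (err m x) \<partial>lborel) \<longlonglongrightarrow> (\<Sum>k\<in>(UNIV::'m set). \<Sum>j\<in>(UNIV::'n set). 0) + 0"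
    unfolding nnerr by (intro tendsto_add tendsto_sum mollify_L1_convergence lD lE)
  then have err_lim: "(\<lambda>m. \<integral>\<^sup>+x. ennreal (err m x) \<partial>lborel) \<longlonglongrightarrow> 0" by simp
  have "\<exists>n\<ge>m. (\<integral>\<^sup>+x. ennreal (err n x) \<partial>lborel) < ennreal ((1/2) ^ m)" for m
  proof -
    have "\<forall>\<^sub>F n in sequentially. (\<integral>\<^sup>+x. ennreal (err n x) \<partial>lborel) < ennreal ((1/2) ^ m)"
      by (rule order_tendstoD(2)[OF err_lim]) simp
    then have "\<forall>\<^sub>F n in sequentially. m \<le> n \<and> (\<integral>\<^sup>+x. ennreal (err n x) \<partial>lborel) < ennreal ((1/2) ^ m)"
      using eventually_ge_at_top[of m] by eventually_elim auto
    then show ?thesis using eventually_happens'[OF sequentially_bot] by blast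
  qed
  then obtain r where r: "\<And>m. m \<le> r m" "\<And>m. (\<integral>\<^sup>+x. ennreal (err (r m) x) \<partial>lborel) < ennreal ((1/2) ^ m)" by metis
  have rlim: "filterlim r at_top sequentially"
    using r(1) by (intro filterlim_at_top_mono[OF filterlim_ident]) auto
  define \<Phi> where "\<Phi> x = (\<Sum>m. ennreal (err (r m) x))" for x
  have m\<Phi> [measurable]: "\<Phi> \<in> borel_measurable borel" unfolding \<Phi>_def[abs_def] by measurable
  have "(\<integral>\<^sup>+x. \<Phi> x \<partial>lborel) = (\<Sum>m. \<integral>\<^sup>+x. ennreal (err (r m) x) \<partial>lborel)"
    unfolding \<Phi>_def by (rule nn_integral_suminf) measurable
  also have "\<dots> \<le> (\<Sum>m. ennreal ((1/2) ^ m))"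
    using r(2) by (intro suminf_le summableI) (auto intro: less_imp_le)
  also have "\<dots> = ennreal 2"
    using geometric_sums[of "1/2::real"] by (intro suminf_ennreal_eq) auto
  finally have \<Phi>fin: "(\<integral>\<^sup>+x. \<Phi> x \<partial>lborel) \<le> ennreal 2" .
  then have "(\<integral>\<^sup>+x. \<Phi> x \<partial>lborel) \<noteq> \<infinity>" by (auto simp: top_unique)
  then have AE\<Phi>: "AE x in lborel. \<Phi> x \<noteq> \<infinity>" by (intro nn_integral_PInf_AE) auto
  define c where "c = real CARD('m) * real CARD('n)"
  \<comment> \<open>\<open>c\<close> counts the matrix entries; \<Phi> may be infinite on a null
    set, where \<open>enn2real\<close> sets it to 0.\<close>
  define H where "H x = c * root p (E x + enn2real (\<Phi> x))" for x
  have p0: "0 < p" using p by simp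
  have H0: "0 \<le> H x" for x using p0 E0[of x] by (simp add: H_def c_def)
  have mH: "H \<in> borel_measurable borel"
    unfolding H_def[abs_def] by measurable
  have Hp: "H x ^ p = c ^ p * (E x + enn2real (\<Phi> x))" for x
    using p0 E0[of x] by (simp add: H_def power_mult_distrib)
  define G where "G m x = (\<chi> k. (real (Suc m) ^ CARD('n) / bump_mass TYPE('n)) * bump_conv (\<lambda>z. g z $ k) (\<lambda>_. 0) (real (Suc m)) x)" for m x
  define DG where "DG m x = (\<chi> k j. (real (Suc m) ^ CARD('n) / bump_mass TYPE('n)) * (real (Suc m) * bump_conv (\<lambda>z. g z $ k) ((\<lambda>_. 0)(j := Suc 0)) (real (Suc m)) x))" for m x
  have C2: "C2_map (G m) (DG m)" for m
    unfolding G_def DG_def by (rule C2_map_bump_conv[OF lg]) simp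
  have Gm: "G m x $ k = mollify (\<lambda>z. g z $ k) (real (Suc m)) x" for m x k by (simp add: G_def mollify_def)
  have DGm: "DG m x $ k $ j = mollify (D k j) (real (Suc m)) x" for m x k j
    using has_weak_partial_bump_conv[OF weak[where k=k and j=j], where a="real (Suc m)" and x=x]
    by (simp add: DG_def mollify_def D_def[abs_def])
  have unif: "uniform_limit (cball 0 R) G g sequentially"
  proof (rule uniform_limitI)
    fix e :: real assume e: "0 < e"
    have "\<forall>\<^sub>F m in sequentially. \<forall>k. \<forall>x\<in>cball 0 R. dist (mollify (\<lambda>z. g z $ k) (real (Suc m)) x) (g x $ k) < e / (real CARD('m) + 1)"
      using e by (intro eventually_all_finite allI uniform_limitD[OF mollify_uniform] continuous_intros g) auto
    then show "\<forall>\<^sub>F m in sequentially. \<forall>x\<in>cball 0 R. dist (G m x) (g x) < e"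
    proof eventually_elim
      case (elim m)
      show ?case
      proof
        fix x :: "real^'n" assume x: "x \<in> cball 0 R"
        have "dist (G m x) (g x) \<le> (\<Sum>k\<in>UNIV. \<bar>(G m x - g x) $ k\<bar>)" unfolding dist_norm by (rule norm_le_l1_cart)
        also have "\<dots> \<le> (\<Sum>k\<in>(UNIV::'m set). e / (real CARD('m) + 1))"
          using elim x by (intro sum_mono) (auto simp: Gm dist_real_def intro: less_imp_le)
        also have "\<dots> < e" using e by (simp add: field_simps)
        finally show "dist (G m x) (g x) < e" .
      qed
    qed
  qed
  have AEterms: "AE x in lborel. (\<forall>m. err (r m) x \<le> enn2real (\<Phi> x)) \<and> (\<lambda>m. err (r m) x) \<longlonglongrightarrow> 0"
    using AE\<Phi>
  proof eventually_elim
    case (elim x)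
    have s: "summable (\<lambda>m. err (r m) x)"
      by (rule summable_suminf_not_top) (use err0 elim in \<open>auto simp: \<Phi>_def\<close>)
    have "\<Phi> x = ennreal (\<Sum>m. err (r m) x)" unfolding \<Phi>_def using err0 s by (intro suminf_ennreal2) auto
    then have "enn2real (\<Phi> x) = (\<Sum>m. err (r m) x)" using err0 s by (simp add: suminf_nonneg)
    moreover have "err (r m) x \<le> (\<Sum>m. err (r m) x)" for m
      using sum_le_suminf[OF s, of "{m}"] err0 by simp
    ultimately show ?case using summable_LIMSEQ_zero[OF s] by simp
  qed
  show "\<exists>G DG H. (\<forall>m. C2_map (G m) (DG m)) \<and> uniform_limit (cball 0 R) G g sequentially \<and>
      (AE x in lborel. x \<in> cball 0 R \<longrightarrow> (\<lambda>m. DG m x) \<longlonglongrightarrow> Dg x) \<and>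
      H \<in> borel_measurable borel \<and> (\<forall>x. 0 \<le> H x) \<and> set_integrable lborel (cball 0 R) (\<lambda>x. H x ^ p) \<and>
      (AE x in lborel. x \<in> cball 0 R \<longrightarrow> (\<forall>m. norm (DG m x) \<le> H x))"
  proof (rule exI[of _ "\<lambda>m. G (r m)"], rule exI[of _ "\<lambda>m. DG (r m)"], rule exI[of _ H], intro conjI allI C2 mH H0)
    show "uniform_limit (cball 0 R) (\<lambda>m. G (r m)) g sequentially"
      using unif rlim by (rule filterlim_compose)
    show "AE x in lborel. x \<in> cball 0 R \<longrightarrow> (\<lambda>m. DG (r m) x) \<longlonglongrightarrow> Dg x"
      using AEterms
    proof eventually_elim
      case (elim x)
      show ?case
      proof
        assume x: "x \<in> cball 0 R"
        show "(\<lambda>m. DG (r m) x) \<longlonglongrightarrow> Dg x"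
        proof (intro vec_tendstoI)
          fix k j
          have "(\<lambda>m. DG (r m) x $ k $ j - D k j x) \<longlonglongrightarrow> 0"
          proof (rule Lim_null_comparison)
            show "\<forall>\<^sub>F m in sequentially. norm (DG (r m) x $ k $ j - D k j x) \<le> err (r m) x"
            proof (intro always_eventually allI)
              fix m
              define q where "q k j = \<bar>mollify (D k j) (real (Suc (r m))) x - D k j x\<bar>" for k j
              have "q k j \<le> (\<Sum>j\<in>UNIV. q k j)" by (rule member_le_sum) (auto simp: q_def)
              also have "\<dots> \<le> (\<Sum>k\<in>UNIV. \<Sum>j\<in>UNIV. q k j)"
                by (rule member_le_sum[of k UNIV "\<lambda>k. \<Sum>j\<in>UNIV. q k j"]) (auto simp: q_def intro: sum_nonneg)
              finally show "norm (DG (r m) x $ k $ j - D k j x) \<le> err (r m) x"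
                using x by (simp add: err_def DGm q_def add_increasing2)
            qed
          qed (use elim in simp)
          then have "(\<lambda>m. (DG (r m) x $ k $ j - D k j x) + D k j x) \<longlonglongrightarrow> 0 + D k j x" by (intro tendsto_add tendsto_const)
          then show "(\<lambda>m. DG (r m) x $ k $ j) \<longlonglongrightarrow> Dg x $ k $ j" by (simp add: D_def)
        qed
      qed
    qed
    show "set_integrable lborel (cball 0 R) (\<lambda>x. H x ^ p)"
    proof -
      have "integrable lborel (\<lambda>x. enn2real (\<Phi> x))"
      proof (rule integrableI_nonneg)
        have "(\<integral>\<^sup>+x. ennreal (enn2real (\<Phi> x)) \<partial>lborel) \<le> (\<integral>\<^sup>+x. \<Phi> x \<partial>lborel)"
          by (intro nn_integral_mono) (simp add: ennreal_enn2real_if)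
        then show "(\<integral>\<^sup>+x. ennreal (enn2real (\<Phi> x)) \<partial>lborel) < \<infinity>" using \<Phi>fin
          by (auto intro: order_le_less_trans[OF order_trans])
      qed auto
      then have "integrable lborel (\<lambda>x. indicator (cball 0 R) x *\<^sub>R enn2real (\<Phi> x))"
        by (intro integrable_mult_indicator) auto
      moreover have "integrable lborel (\<lambda>x. indicator (cball 0 R) x *\<^sub>R E x)"
        using lE by (auto simp: locally_integrable_def set_integrable_def)
      ultimately have "integrable lborel (\<lambda>x. c ^ p * (indicator (cball 0 R) x *\<^sub>R E x + indicator (cball 0 R) x *\<^sub>R enn2real (\<Phi> x)))"
        by (intro integrable_mult_right Bochner_Integration.integrable_add)
      then show ?thesis unfolding set_integrable_def Hp by (simp add: algebra_simps)
    qed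
    show "AE x in lborel. x \<in> cball 0 R \<longrightarrow> (\<forall>m. norm (DG (r m) x) \<le> H x)"
      using AEterms
    proof eventually_elim
      case (elim x)
      show ?case
      proof (intro impI allI)
        fix m assume x: "x \<in> cball 0 R"
        define a where "a = real (Suc (r m))"
        have a: "0 < a" by (simp add: a_def)
        have "\<bar>mollify E a x - E x\<bar> \<le> err (r m) x"
          using x by (simp add: err_def a_def sum_nonneg)
        then have Ea: "mollify E a x \<le> E x + enn2real (\<Phi> x)" using elim by (smt (verit))
        have "\<bar>mollify (D k j) a x\<bar> \<le> root p (E x + enn2real (\<Phi> x))" for k j
        proof -
          have "\<bar>mollify (D k j) a x\<bar> ^ p \<le> E x + enn2real (\<Phi> x)"
            using mollify_power_le[OF lD lE DE a p] Ea by (rule order_trans)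
          then have "root p (\<bar>mollify (D k j) a x\<bar> ^ p) \<le> root p (E x + enn2real (\<Phi> x))" using p0 by simp
          then show ?thesis using p0 by (simp add: real_root_power_cancel)
        qed
        then have "(\<Sum>k\<in>UNIV. \<Sum>j\<in>UNIV. \<bar>DG (r m) x $ k $ j\<bar>) \<le> (\<Sum>k\<in>(UNIV::'m set). \<Sum>j\<in>(UNIV::'n set). root p (E x + enn2real (\<Phi> x)))"
          by (intro sum_mono) (simp add: DGm a_def)
        also have "\<dots> = H x" by (simp add: H_def c_def)
        finally show "norm (DG (r m) x) \<le> H x" using norm_matrix_le_sum[of "DG (r m) x"] by linarith
      qed
    qed
  qed
qed

section \<open>Composition of Sobolev maps with smooth maps\<close>

text \<open>Links the test functions of weak derivatives to the cutoffs of the integrations by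
  parts; outside a ball containing the support the function is locally 0, and so are its partial
  derivatives.\<close>

lemma test_function_imp_C1_cutoff:
  fixes \<phi> :: "real^'n \<Rightarrow> real"
  assumes "test_function \<phi>"
  shows "C1_cutoff \<phi> (\<lambda>x. \<chi> j. partial_deriv j \<phi> x)"
proof -
  have "times_cont_diff (Suc 0) \<phi>" using assms by (simp only: test_function_def)
  then have d: "\<phi> differentiable_on UNIV" and c: "\<And>j. continuous_on UNIV (partial_deriv j \<phi>)" by auto
  have der: "(\<phi> has_derivative (\<lambda>h. (\<chi> j. partial_deriv j \<phi> x) \<bullet> h)) (at x)" for x
  proof -
    have f: "(\<phi> has_derivative frechet_derivative \<phi> (at x)) (at x)"
      using d frechet_derivative_works by (auto simp: differentiable_on_def)
    have "frechet_derivative \<phi> (at x) h = (\<chi> j. partial_deriv j \<phi> x) \<bullet> h" for h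
    proof -
      interpret bounded_linear "frechet_derivative \<phi> (at x)" using f by (rule has_derivative_bounded_linear)
      have "frechet_derivative \<phi> (at x) h = frechet_derivative \<phi> (at x) (\<Sum>j\<in>UNIV. (h $ j) *\<^sub>R axis j 1)"
        by (simp add: basis_expansion flip: scalar_mult_eq_scaleR)
      also have "\<dots> = (\<Sum>j\<in>UNIV. h $ j * partial_deriv j \<phi> x)" by (simp add: sum scaleR partial_deriv_def)
      finally show ?thesis by (simp add: inner_vec_def mult.commute)
    qed
    then have "frechet_derivative \<phi> (at x) = (\<lambda>h. (\<chi> j. partial_deriv j \<phi> x) \<bullet> h)" by (rule ext)
    with f show ?thesis by simp
  qed
  have "bounded {x. \<phi> x \<noteq> 0}"
    using assms by (auto simp: test_function_def intro: bounded_subset[OF compact_imp_bounded closure_subset])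
  then obtain R where R: "\<And>x. \<phi> x \<noteq> 0 \<Longrightarrow> norm x \<le> R" by (auto simp: bounded_iff)
  have z: "partial_deriv j \<phi> x = 0" if "R < norm x" for j x
  proof -
    have "open {y::real^'n. R < norm y}" by (intro open_Collect_less continuous_intros)
    then have "eventually (\<lambda>y. y \<in> {y. R < norm y}) (nhds x)" using that by (intro eventually_nhds_in_open) auto
    then have "eventually (\<lambda>y. 0 = \<phi> y) (nhds x)" by eventually_elim (use R in force)
    then have "(\<phi> has_derivative (\<lambda>_. 0)) (at x)"
      using has_derivative_transform_eventually[of "\<lambda>_. 0" "\<lambda>_. 0" x UNIV \<phi>] eventually_nhds_x_imp_x
      by (fastforce simp: eventually_nhds_conv_at)
    then have "frechet_derivative \<phi> (at x) = (\<lambda>_. 0)" by (rule frechet_derivative_at[symmetric])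
    then show ?thesis by (simp add: partial_deriv_def)
  qed
  show ?thesis unfolding C1_cutoff_def
  proof (intro conjI allI der)
    show "continuous_on UNIV (\<lambda>x. \<chi> j. partial_deriv j \<phi> x)" by (intro continuous_on_vec_lambda c)
    show "\<exists>R. \<forall>x. R < norm x \<longrightarrow> \<phi> x = 0 \<and> (\<chi> j. partial_deriv j \<phi> x) = 0"
      using R z by (intro exI[of _ R]) (force simp: vec_eq_iff)
  qed
qed

text \<open>For a smooth approximation G the function \<phi> times h(G) has compact support, so its
  derivative integrates to 0. The limit is taken in the sum \<Psi> of both terms at once, which is
  split afterwards by means of the integrability in the second claim.\<close>

lemma weak_chain_rule:
  fixes f :: "real^'n \<Rightarrow> real^'m"
  assumes f: "locally_approximable p f Df" and p: "1 \<le> p"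
    and h: "\<And>y. (h has_derivative (\<lambda>v. Dh y \<bullet> v)) (at y)" "continuous_on UNIV Dh"
    and \<phi>: "C1_cutoff \<phi> D\<phi>"
  shows "(LINT x|lborel. h (f x) * (D\<phi> x \<bullet> v)) = - (LINT x|lborel. (Dh (f x) \<bullet> (Df x *v v)) * \<phi> x)"
    and "integrable lborel (\<lambda>x. (Dh (f x) \<bullet> (Df x *v v)) * \<phi> x)"
proof -
  obtain R where R: "0 < R" "\<And>x. R < norm x \<Longrightarrow> \<phi> x = 0" "\<And>x. R < norm x \<Longrightarrow> D\<phi> x = 0" using C1_cutoff_out[OF \<phi>] by metis
  obtain G DG H where G: "\<And>m. C2_map (G m) (DG m)" "uniform_limit (cball 0 R) G f sequentially"
    "AE x in lborel. x \<in> cball 0 R \<longrightarrow> (\<lambda>m. DG m x) \<longlonglongrightarrow> Df x"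
    "H \<in> borel_measurable borel" "\<And>x. 0 \<le> H x" "set_integrable lborel (cball 0 R) (\<lambda>x. H x ^ p)"
    "AE x in lborel. x \<in> cball 0 R \<longrightarrow> (\<forall>m. norm (DG m x) \<le> H x)"
    by (rule locally_approximableE[OF f, of R]) (rule that)
  have cf: "continuous_on UNIV f" and [measurable]: "Df \<in> borel_measurable borel"
    using f by (auto simp: locally_approximable_def)
  note [measurable] = G(4)
  have c\<phi>: "continuous_on UNIV \<phi>" "continuous_on UNIV D\<phi>" using C1_cutoff_continuous[OF \<phi>] by auto
  have ch: "continuous_on UNIV h" using h(1) by (auto intro!: continuous_at_imp_continuous_on has_derivative_continuous)
  have cG: "continuous_on UNIV (G m)" "continuous_on UNIV (DG m)" for m using C2_map_continuous[OF G(1)] by auto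
  define \<Psi> where "\<Psi> x y A = h y * (D\<phi> x \<bullet> v) + (Dh y \<bullet> (A *v v)) * \<phi> x" for x y A
  have zero: "(LINT x|lborel. \<Psi> x (G m x) (DG m x)) = 0" for m
  proof -
    define Dk where "Dk x = Dh (G m x) v* DG m x" for x
    have Dkh: "Dk x \<bullet> w = Dh (G m x) \<bullet> (DG m x *v w)" for x w
      unfolding Dk_def by (rule dot_lmul_matrix)
    have dk: "((\<lambda>x. h (G m x)) has_derivative (\<lambda>w. Dk x \<bullet> w)) (at x)" for x
    proof -
      have "(G m has_derivative (\<lambda>v. DG m x *v v)) (at x)" using G(1) by (simp add: C2_map_def)
      from has_derivative_compose[OF this h(1)] show ?thesis by (simp add: Dkh)
    qed
    have cDk: "continuous_on UNIV Dk"
      unfolding Dk_def[abs_def] vector_matrix_mult_def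
      by (intro continuous_on_vec_lambda continuous_on_sum continuous_intros continuous_on_compose2[OF h(2) cG(1)] cG) auto
    have "C1_cutoff (\<lambda>x. h (G m x) * \<phi> x) (\<lambda>x. h (G m x) *\<^sub>R D\<phi> x + \<phi> x *\<^sub>R Dk x)"
      unfolding C1_cutoff_def
    proof (intro conjI allI)
      fix x
      have "(\<phi> has_derivative (\<lambda>h. D\<phi> x \<bullet> h)) (at x)" using \<phi> by (simp add: C1_cutoff_def)
      from has_derivative_mult[OF dk this]
      show "((\<lambda>x. h (G m x) * \<phi> x) has_derivative (\<lambda>w. (h (G m x) *\<^sub>R D\<phi> x + \<phi> x *\<^sub>R Dk x) \<bullet> w)) (at x)"
        by (simp add: inner_add_left algebra_simps)
    next
      show "continuous_on UNIV (\<lambda>x. h (G m x) *\<^sub>R D\<phi> x + \<phi> x *\<^sub>R Dk x)"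
        by (intro continuous_intros c\<phi> cDk continuous_on_compose2[OF ch cG(1)]) auto
      show "\<exists>R. \<forall>x. R < norm x \<longrightarrow> h (G m x) * \<phi> x = 0 \<and> h (G m x) *\<^sub>R D\<phi> x + \<phi> x *\<^sub>R Dk x = 0"
        using R by (intro exI[of _ R]) auto
    qed
    from integral_derivative_compact_support[OF this, of v]
    show ?thesis by (simp add: \<Psi>_def inner_add_left Dkh mult.commute)
  qed
  obtain b0 where b0: "0 < b0" "\<And>x. x \<in> cball 0 R \<Longrightarrow> norm (f x) \<le> b0"
  proof -
    have "compact (f ` cball 0 R)" by (intro compact_continuous_image continuous_on_subset[OF cf]) auto
    then show ?thesis using that compact_imp_bounded[of "f ` cball 0 R"] by (auto simp: bounded_pos)
  qed
  obtain b where b: "0 < b" "\<And>y. y \<in> cball 0 (b0 + 1) \<Longrightarrow> norm (Dh y) \<le> b"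
  proof -
    have "compact (Dh ` cball 0 (b0 + 1))" by (intro compact_continuous_image continuous_on_subset[OF h(2)]) auto
    then show ?thesis using that compact_imp_bounded[of "Dh ` cball 0 (b0 + 1)"] by (auto simp: bounded_pos)
  qed
  obtain b' where b': "0 < b'" "\<And>y. y \<in> cball 0 (b0 + 1) \<Longrightarrow> \<bar>h y\<bar> \<le> b'"
  proof -
    have "compact (h ` cball 0 (b0 + 1))" by (intro compact_continuous_image continuous_on_subset[OF ch]) auto
    then show ?thesis using that compact_imp_bounded[of "h ` cball 0 (b0 + 1)"] by (auto simp: bounded_pos)
  qed
  obtain E where E: "0 < E" "\<And>x. norm (\<phi> x) \<le> E" using bounded_continuous_compact_support[OF c\<phi>(1) R(2)] by metis
  obtain E' where E': "0 < E'" "\<And>x. norm (D\<phi> x) \<le> E'" using bounded_continuous_compact_support[OF c\<phi>(2) R(3)] by metis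
  obtain m0 where m0: "\<And>m x. m0 \<le> m \<Longrightarrow> x \<in> cball 0 R \<Longrightarrow> dist (G m x) (f x) < 1"
    using G(2) unfolding uniform_limit_iff eventually_sequentially by (metis zero_less_one)
  have Gb: "G (m + m0) x \<in> cball 0 (b0 + 1)" if "x \<in> cball 0 R" for m x
    using m0[of "m + m0" x] b0(2)[OF that] that norm_triangle_sub[of "G (m + m0) x" "f x"]
    by (simp add: dist_norm)
  have tG: "(\<lambda>m. G (m + m0) x) \<longlonglongrightarrow> f x" if "x \<in> cball 0 R" for x
    using tendsto_uniform_limitI[OF G(2) that] by (rule LIMSEQ_ignore_initial_segment)
  define c where "c = b' * (E' * norm v) + b * norm v * E"
  define W where "W x = c * (indicator (cball 0 R) x + indicator (cball 0 R) x *\<^sub>R H x ^ p)" for x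
  have "integrable lborel (indicator (cball 0 R) :: real^'n \<Rightarrow> real)" by (rule integrable_indicator_cball)
  then have W: "integrable lborel W"
    using G(6) unfolding set_integrable_def W_def by (intro integrable_mult_right Bochner_Integration.integrable_add)
  have bound: "\<bar>\<Psi> x y A\<bar> \<le> W x" "\<bar>(Dh y \<bullet> (A *v v)) * \<phi> x\<bar> \<le> W x"
    if "x \<in> cball 0 R \<longrightarrow> y \<in> cball 0 (b0 + 1) \<and> norm A \<le> H x" for x y A
  proof -
    have "\<bar>\<Psi> x y A\<bar> \<le> W x \<and> \<bar>(Dh y \<bullet> (A *v v)) * \<phi> x\<bar> \<le> W x"
    proof (cases "x \<in> cball 0 R")
      case True
      with that have y: "y \<in> cball 0 (b0 + 1)" and A: "norm A \<le> H x" by auto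
      have 1: "\<bar>h y * (D\<phi> x \<bullet> v)\<bar> \<le> b' * (E' * norm v)"
        unfolding abs_mult using b' y E'(1) by (intro mult_mono order_trans[OF Cauchy_Schwarz_ineq2] E') auto
      have "\<bar>(Dh y \<bullet> (A *v v)) * \<phi> x\<bar> \<le> (norm (Dh y) * (norm A * norm v)) * E"
        unfolding abs_mult using E by (intro mult_mono order_trans[OF Cauchy_Schwarz_ineq2] mult_left_mono norm_matrix_vector_mult_le) auto
      also have "\<dots> \<le> (b * ((1 + H x ^ p) * norm v)) * E"
        using b y E(1) order_trans[OF A le_one_plus_power[OF G(5) p]] G(5)[of x] by (intro mult_right_mono mult_mono) auto
      finally have 2: "\<bar>(Dh y \<bullet> (A *v v)) * \<phi> x\<bar> \<le> b * norm v * E * (1 + H x ^ p)" by (simp add: mult_ac)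
      have Hp: "0 \<le> H x ^ p" using G(5) by simp
      have "b' * (E' * norm v) * 1 \<le> b' * (E' * norm v) * (1 + H x ^ p)" using b' E' Hp by (intro mult_left_mono) auto
      moreover have "W x = b' * (E' * norm v) * (1 + H x ^ p) + b * norm v * E * (1 + H x ^ p)"
        using True by (simp add: W_def c_def distrib_right)
      ultimately show ?thesis using 1 2 unfolding \<Psi>_def by linarith
    next
      case False
      then show ?thesis using R by (simp add: \<Psi>_def W_def)
    qed
    then show "\<bar>\<Psi> x y A\<bar> \<le> W x" "\<bar>(Dh y \<bullet> (A *v v)) * \<phi> x\<bar> \<le> W x" by auto
  qed
  have [measurable]: "\<phi> \<in> borel_measurable borel" "D\<phi> \<in> borel_measurable borel" using c\<phi> by (auto intro: borel_measurable_continuous_onI)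
  have meas: "(\<lambda>x. (Dh (y x) \<bullet> (A x *v v)) * \<phi> x) \<in> borel_measurable lborel" "(\<lambda>x. \<Psi> x (y x) (A x)) \<in> borel_measurable lborel"
    if y: "continuous_on UNIV y" and A: "A \<in> borel_measurable borel" for y and A :: "real^'n \<Rightarrow> real^'n^'m"
  proof -
    have [measurable]: "(\<lambda>x. Dh (y x)) \<in> borel_measurable borel" "(\<lambda>x. h (y x)) \<in> borel_measurable borel"
      by (auto intro!: borel_measurable_continuous_onI continuous_on_compose2[OF h(2) y] continuous_on_compose2[OF ch y])
    have [measurable]: "(\<lambda>x. A x *v v) \<in> borel_measurable borel"
      by (rule borel_measurable_continuous_on[OF _ A]) (unfold matrix_vector_mult_def, intro continuous_intros)
    show "(\<lambda>x. (Dh (y x) \<bullet> (A x *v v)) * \<phi> x) \<in> borel_measurable lborel" by measurable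
    show "(\<lambda>x. \<Psi> x (y x) (A x)) \<in> borel_measurable lborel" unfolding \<Psi>_def by measurable
  qed
  have mDf: "Df \<in> borel_measurable borel" by simp
  have lim: "(\<lambda>m. LINT x|lborel. \<Psi> x (G (m + m0) x) (DG (m + m0) x)) \<longlonglongrightarrow> (LINT x|lborel. \<Psi> x (f x) (Df x))"
  proof (rule integral_dominated_convergence[where w=W])
    show "(\<lambda>x. \<Psi> x (f x) (Df x)) \<in> borel_measurable lborel" by (rule meas(2)[OF cf mDf])
    show "(\<lambda>x. \<Psi> x (G (m + m0) x) (DG (m + m0) x)) \<in> borel_measurable lborel" for m
      by (intro meas borel_measurable_continuous_onI cG)
    show "AE x in lborel. (\<lambda>m. \<Psi> x (G (m + m0) x) (DG (m + m0) x)) \<longlonglongrightarrow> \<Psi> x (f x) (Df x)"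
      using G(3)
    proof eventually_elim
      case (elim x)
      show ?case
      proof (cases "x \<in> cball 0 R")
        case True
        have 1: "(\<lambda>m. DG (m + m0) x *v v) \<longlonglongrightarrow> Df x *v v"
          unfolding matrix_vector_mult_def using elim True
          by (intro tendsto_vec_lambda tendsto_intros tendsto_vec_nth LIMSEQ_ignore_initial_segment[where k=m0]) auto
        have "(\<lambda>m. Dh (G (m + m0) x)) \<longlonglongrightarrow> Dh (f x)" "(\<lambda>m. h (G (m + m0) x)) \<longlonglongrightarrow> h (f x)"
          by (auto intro!: continuous_on_tendsto_compose[OF h(2) tG[OF True]] continuous_on_tendsto_compose[OF ch tG[OF True]])
        then show ?thesis unfolding \<Psi>_def by (intro tendsto_intros 1)
      qed (use R in \<open>simp add: \<Psi>_def\<close>)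
    qed
    show "AE x in lborel. norm (\<Psi> x (G (m + m0) x) (DG (m + m0) x)) \<le> W x" for m
      using G(7)
    proof eventually_elim
      case (elim x)
      then show ?case unfolding real_norm_def using Gb by (intro bound) auto
    qed
  qed (rule W)
  have DfH: "AE x in lborel. x \<in> cball 0 R \<longrightarrow> norm (Df x) \<le> H x"
    using G(3,7)
  proof eventually_elim
    case (elim x)
    then show ?case by (auto intro: Lim_bounded[OF tendsto_norm])
  qed
  show int: "integrable lborel (\<lambda>x. (Dh (f x) \<bullet> (Df x *v v)) * \<phi> x)"
  proof (rule Bochner_Integration.integrable_bound[OF W])
    show "(\<lambda>x. (Dh (f x) \<bullet> (Df x *v v)) * \<phi> x) \<in> borel_measurable lborel" by (rule meas(1)[OF cf mDf])
    show "AE x in lborel. norm ((Dh (f x) \<bullet> (Df x *v v)) * \<phi> x) \<le> norm (W x)"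
      using DfH
    proof eventually_elim
      case (elim x)
      have "\<bar>(Dh (f x) \<bullet> (Df x *v v)) * \<phi> x\<bar> \<le> W x" using elim b0 by (intro bound) fastforce
      then show ?case by simp
    qed
  qed
  have int': "integrable lborel (\<lambda>x. h (f x) * (D\<phi> x \<bullet> v))"
    by (rule integrable_continuous_compact_support[where R=R])
      (auto intro!: continuous_intros continuous_on_compose2[OF ch cf] c\<phi> simp: R)
  have "(LINT x|lborel. \<Psi> x (f x) (Df x)) = 0"
    using LIMSEQ_unique[OF lim] by (simp add: zero)
  then show "(LINT x|lborel. h (f x) * (D\<phi> x \<bullet> v)) = - (LINT x|lborel. (Dh (f x) \<bullet> (Df x *v v)) * \<phi> x)"
    unfolding \<Psi>_def using int int' by (simp add: Bochner_Integration.integral_add)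
qed

text \<open>Approximations are demanded ball by ball, so on each ball they can be borrowed from
  another map. Stereographic projection needs this, being C^1 only away from its pole.\<close>

lemma locally_approximable_local:
  fixes g :: "real^'n \<Rightarrow> real^'m"
  assumes g: "continuous_on UNIV g" and Dg: "Dg \<in> borel_measurable borel"
    and loc: "\<And>R. \<exists>g' Dg'. locally_approximable p g' Dg' \<and> (\<forall>x\<in>cball 0 R. g' x = g x \<and> Dg' x = Dg x)"
  shows "locally_approximable p g Dg"
  unfolding locally_approximable_def
proof (intro conjI allI g Dg)
  fix R
  obtain g' Dg' where g': "locally_approximable p g' Dg'" "\<And>x. x \<in> cball 0 R \<Longrightarrow> g' x = g x" "\<And>x. x \<in> cball 0 R \<Longrightarrow> Dg' x = Dg x"
    using loc[of R] by blast
  obtain G DG H where G: "\<And>m. C2_map (G m) (DG m)" "uniform_limit (cball 0 R) G g' sequentially"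
    "AE x in lborel. x \<in> cball 0 R \<longrightarrow> (\<lambda>m. DG m x) \<longlonglongrightarrow> Dg' x"
    "H \<in> borel_measurable borel" "\<And>x. 0 \<le> H x" "set_integrable lborel (cball 0 R) (\<lambda>x. H x ^ p)"
    "AE x in lborel. x \<in> cball 0 R \<longrightarrow> (\<forall>m. norm (DG m x) \<le> H x)"
    by (rule locally_approximableE[OF g'(1), of R]) (rule that)
  have "uniform_limit (cball 0 R) G g sequentially"
    using G(2) g'(2) by (subst uniform_limit_cong'[where g=G and i=g']) auto
  moreover have "AE x in lborel. x \<in> cball 0 R \<longrightarrow> (\<lambda>m. DG m x) \<longlonglongrightarrow> Dg x"
    using G(3) g'(3) by (auto elim!: eventually_mono)
  ultimately show "\<exists>G DG H. (\<forall>m. C2_map (G m) (DG m)) \<and> uniform_limit (cball 0 R) G g sequentially \<and>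
      (AE x in lborel. x \<in> cball 0 R \<longrightarrow> (\<lambda>m. DG m x) \<longlonglongrightarrow> Dg x) \<and>
      H \<in> borel_measurable borel \<and> (\<forall>x. 0 \<le> H x) \<and> set_integrable lborel (cball 0 R) (\<lambda>x. H x ^ p) \<and>
      (AE x in lborel. x \<in> cball 0 R \<longrightarrow> (\<forall>m. norm (DG m x) \<le> H x))"
    using G by (intro exI[of _ G] exI[of _ DG] exI[of _ H]) simp
qed

lemma borel_measurable_matrixI:
  fixes F :: "'a \<Rightarrow> real^'n^'m"
  assumes "\<And>k j. (\<lambda>x. F x $ k $ j) \<in> borel_measurable M"
  shows "F \<in> borel_measurable M"
  by (rule borel_measurable_euclidean_space[THEN iffD2]) (use assms in \<open>auto simp: Basis_vec_def inner_axis\<close>)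

text \<open>For h of class C^1 the compositions with the C^2 approximations are only C^1. Hence the
  weak derivative is computed by the chain rule and the composed map is mollified anew.\<close>

lemma locally_approximable_compose_C1:
  fixes f :: "real^'n \<Rightarrow> real^'m" and h :: "real^'m \<Rightarrow> real^'l"
  assumes f: "locally_approximable p f Df" and p: "1 \<le> p"
    and h: "\<And>y. (h has_derivative (\<lambda>v. Dh y *v v)) (at y)" "continuous_on UNIV Dh"
  shows "locally_approximable p (\<lambda>x. h (f x)) (\<lambda>x. Dh (f x) ** Df x)"
proof (rule weak_differential_imp_locally_approximable[OF _ _ p])
  have cf: "continuous_on UNIV f" and mDf: "Df \<in> borel_measurable borel"
    using f by (auto simp: locally_approximable_def)
  have ch: "continuous_on UNIV h" using h(1) by (auto intro!: continuous_at_imp_continuous_on has_derivative_continuous)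
  show "continuous_on UNIV (\<lambda>x. h (f x))" by (rule continuous_on_compose2[OF ch cf]) auto
  have cDh: "continuous_on UNIV (\<lambda>x. Dh (f x))" by (rule continuous_on_compose2[OF h(2) cf]) auto
  have entry: "(Dh (f x) ** Df x) $ k $ j = (\<Sum>i\<in>UNIV. Dh (f x) $ k $ i * Df x $ i $ j)" for x k j
    by (simp add: matrix_matrix_mult_def)
  have m1: "(\<lambda>x. Dh (f x) $ k $ i) \<in> borel_measurable borel" for k i
    by (intro borel_measurable_continuous_onI bounded_linear.continuous_on[OF bounded_linear_vec_nth] cDh)
  have m2: "(\<lambda>x. Df x $ i $ j) \<in> borel_measurable borel" for i j
    by (rule borel_measurable_continuous_on[OF _ mDf]) (intro continuous_intros)
  have m3: "(\<lambda>x. (Dh (f x) ** Df x) $ k $ j) \<in> borel_measurable borel" for k j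
    unfolding entry by (intro borel_measurable_sum borel_measurable_times m1 m2)
  show "(\<lambda>x. Dh (f x) ** Df x) \<in> borel_measurable borel"
    by (rule borel_measurable_matrixI[OF m3])
  have comp: "((\<lambda>y. h y $ k) has_derivative (\<lambda>v. Dh y $ k \<bullet> v)) (at y)" for k y
    using bounded_linear.has_derivative[OF bounded_linear_vec_nth h(1), of k y] by (simp add: matrix_vector_mul_component)
  have ck: "continuous_on UNIV (\<lambda>y. Dh y $ k)" for k by (intro bounded_linear.continuous_on[OF bounded_linear_vec_nth] h)
  have ent2: "Dh (f x) $ k \<bullet> (Df x *v axis j 1) = (Dh (f x) ** Df x) $ k $ j" for x k j
    by (simp add: entry inner_vec_def matrix_vector_mult_basis column_def)
  show "(LINT x|lborel. h (f x) $ k * partial_deriv j \<phi> x) = - (LINT x|lborel. (Dh (f x) ** Df x) $ k $ j * \<phi> x)"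
    if "test_function \<phi>" for \<phi> k j
    using weak_chain_rule(1)[OF f p comp ck test_function_imp_C1_cutoff[OF that], where v="axis j 1"]
    by (simp add: ent2 inner_axis)
  show "locally_integrable (\<lambda>x. \<bar>(Dh (f x) ** Df x) $ k $ j\<bar> ^ p)" for k j
    unfolding locally_integrable_def
  proof (intro conjI allI)
    show m: "(\<lambda>x. \<bar>(Dh (f x) ** Df x) $ k $ j\<bar> ^ p) \<in> borel_measurable borel"
      by (intro borel_measurable_power borel_measurable_abs m3)
    fix R
    have "compact ((\<lambda>x. Dh (f x)) ` cball 0 R)" by (intro compact_continuous_image continuous_on_subset[OF cDh]) auto
    then obtain b where b: "0 < b" "\<And>x. x \<in> cball 0 R \<Longrightarrow> norm (Dh (f x)) \<le> b"
      using compact_imp_bounded[of "(\<lambda>x. Dh (f x)) ` cball 0 R"] by (auto simp: bounded_pos)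
    have "set_integrable lborel (cball 0 R) (\<lambda>x. b ^ p * norm (Df x) ^ p)"
      using locally_approximable_norm_power_integrable[OF f] by (intro set_integrable_mult_right)
    then show "set_integrable lborel (cball 0 R) (\<lambda>x. \<bar>(Dh (f x) ** Df x) $ k $ j\<bar> ^ p)"
      unfolding set_integrable_def
    proof (rule Bochner_Integration.integrable_bound)
      show "(\<lambda>x. indicator (cball 0 R) x *\<^sub>R \<bar>(Dh (f x) ** Df x) $ k $ j\<bar> ^ p) \<in> borel_measurable lborel"
        using m by (intro borel_measurable_scaleR borel_measurable_indicator) auto
      show "AE x in lborel. norm (indicator (cball 0 R) x *\<^sub>R \<bar>(Dh (f x) ** Df x) $ k $ j\<bar> ^ p) \<le> norm (indicator (cball 0 R) x *\<^sub>R (b ^ p * norm (Df x) ^ p))"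
      proof (rule AE_I2)
        fix x
        show "norm (indicator (cball 0 R) x *\<^sub>R \<bar>(Dh (f x) ** Df x) $ k $ j\<bar> ^ p) \<le> norm (indicator (cball 0 R) x *\<^sub>R (b ^ p * norm (Df x) ^ p))"
        proof (cases "x \<in> cball 0 R")
          case True
          have "\<bar>(Dh (f x) ** Df x) $ k $ j\<bar> \<le> norm (Dh (f x) $ k) * norm (Df x *v axis j 1)"
            unfolding ent2[symmetric] by (rule Cauchy_Schwarz_ineq2)
          also have "\<dots> \<le> norm (Dh (f x)) * (norm (Df x) * 1)"
            by (intro mult_mono Finite_Cartesian_Product.norm_nth_le order_trans[OF norm_matrix_vector_mult_le]) auto
          also have "\<dots> \<le> b * norm (Df x)" using b(2)[OF True] by (simp add: mult_right_mono)
          finally have "\<bar>(Dh (f x) ** Df x) $ k $ j\<bar> ^ p \<le> (b * norm (Df x)) ^ p" by (intro power_mono) auto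
          then show ?thesis using True b(1) by (simp add: power_mult_distrib)
        qed simp
      qed
    qed
  qed
qed

text \<open>D is a weak partial derivative of the zero function, so all its mollifications vanish,
  and they converge to D in L^1.\<close>

lemma weakly_zero_imp_AE_zero:
  fixes D :: "real^'n \<Rightarrow> real"
  assumes D: "locally_integrable D" and zero: "\<And>\<phi>. test_function \<phi> \<Longrightarrow> (LINT x|lborel. D x * \<phi> x) = 0"
  shows "AE x in lborel. D x = 0"
proof -
  have "mollify D (real (Suc m)) x = 0" for m x
  proof -
    have "bump_conv D (\<lambda>_. 0) (real (Suc m)) x = 0"
      using has_weak_partial_bump_conv[where u="\<lambda>_. 0" and d=D and a="real (Suc m)" and x=x] zero
      by (simp add: bump_conv_def)
    then show ?thesis by (simp add: mollify_def)
  qed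
  then have lim: "(\<lambda>m::nat. \<integral>\<^sup>+x\<in>cball 0 R. ennreal \<bar>D x\<bar> \<partial>lborel) \<longlonglongrightarrow> 0" for R
    using mollify_L1_convergence[OF D, of R] by simp
  have mD [measurable]: "D \<in> borel_measurable borel" by (rule locally_integrable_measurable[OF D])
  have "AE x in lborel. x \<in> cball 0 (real r) \<longrightarrow> D x = 0" for r :: nat
  proof -
    have [measurable]: "cball (0::real^'n) (real r) \<in> sets borel" by simp
    have "(\<integral>\<^sup>+x\<in>cball 0 (real r). ennreal \<bar>D x\<bar> \<partial>lborel) = 0"
      using LIMSEQ_unique[OF lim tendsto_const] by simp
    then have "AE x in lborel. ennreal \<bar>D x\<bar> * indicator (cball 0 (real r)) x = 0"
      by (subst (asm) nn_integral_0_iff_AE) auto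
    then show ?thesis by eventually_elim (auto simp: indicator_def split: if_splits)
  qed
  then have "AE x in lborel. \<forall>r::nat. x \<in> cball 0 (real r) \<longrightarrow> D x = 0" by (subst AE_all_countable) blast
  then show ?thesis
  proof eventually_elim
    case (elim x)
    then show ?case using real_arch_simple[of "norm x"] by auto
  qed
qed

text \<open>Chain rule for the constant function |f|^2: the product of 2 f . Df(e_j) with every test
  function has integral 0.\<close>

lemma sphere_valued_tangential:
  fixes f :: "real^'n \<Rightarrow> real^'m"
  assumes f: "locally_approximable p f Df" and p: "1 \<le> p" and sph: "\<And>x. norm (f x) = 1"
  shows "AE x in lborel. \<forall>v. f x \<bullet> (Df x *v v) = 0"
proof -
  have cf: "continuous_on UNIV f" and mDf: "Df \<in> borel_measurable borel"
    using f by (auto simp: locally_approximable_def)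
  have "AE x in lborel. f x \<bullet> (Df x *v axis j 1) = 0" for j
  proof (rule weakly_zero_imp_AE_zero)
    have m1: "(\<lambda>x. Df x *v axis j 1) \<in> borel_measurable borel"
      by (rule borel_measurable_continuous_on[OF _ mDf]) (unfold matrix_vector_mult_def, intro continuous_intros)
    have m2: "f \<in> borel_measurable borel" using cf by (rule borel_measurable_continuous_onI)
    have m: "(\<lambda>x. f x \<bullet> (Df x *v axis j 1)) \<in> borel_measurable borel"
      by (intro borel_measurable_inner m1 m2)
    have E: "locally_integrable (\<lambda>x. norm (Df x) ^ p)"
      unfolding locally_integrable_def using locally_approximable_norm_power_integrable[OF f] mDf by auto
    show "locally_integrable (\<lambda>x. f x \<bullet> (Df x *v axis j 1))"
    proof (rule locally_integrable_of_power[OF m _ p])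
      show "locally_integrable (\<lambda>x. \<bar>f x \<bullet> (Df x *v axis j 1)\<bar> ^ p)"
        unfolding locally_integrable_def
      proof (intro conjI allI)
        show mm: "(\<lambda>x. \<bar>f x \<bullet> (Df x *v axis j 1)\<bar> ^ p) \<in> borel_measurable borel"
          by (intro borel_measurable_power borel_measurable_abs m)
        fix R
        have "set_integrable lborel (cball 0 R) (\<lambda>x. norm (Df x) ^ p)" using E by (simp add: locally_integrable_def)
        then show "set_integrable lborel (cball 0 R) (\<lambda>x. \<bar>f x \<bullet> (Df x *v axis j 1)\<bar> ^ p)"
          unfolding set_integrable_def
        proof (rule Bochner_Integration.integrable_bound)
          show "(\<lambda>x. indicator (cball 0 R) x *\<^sub>R \<bar>f x \<bullet> (Df x *v axis j 1)\<bar> ^ p) \<in> borel_measurable lborel"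
            using mm by (intro borel_measurable_scaleR borel_measurable_indicator) auto
          have "\<bar>f x \<bullet> (Df x *v axis j 1)\<bar> \<le> norm (Df x)" for x
            using order_trans[OF Cauchy_Schwarz_ineq2[of "f x" "Df x *v axis j 1"]] norm_matrix_vector_mult_le[of "Df x" "axis j 1"] by (simp add: sph)
          then have "\<bar>f x \<bullet> (Df x *v axis j 1)\<bar> ^ p \<le> norm (Df x) ^ p" for x by (intro power_mono) auto
          then show "AE x in lborel. norm (indicator (cball 0 R) x *\<^sub>R \<bar>f x \<bullet> (Df x *v axis j 1)\<bar> ^ p) \<le> norm (indicator (cball 0 R) x *\<^sub>R norm (Df x) ^ p)"
            by (auto simp: indicator_def)
        qed
      qed
    qed
    fix \<phi> :: "real^'n \<Rightarrow> real" assume "test_function \<phi>"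
    then have \<phi>: "C1_cutoff \<phi> (\<lambda>x. \<chi> j. partial_deriv j \<phi> x)" by (rule test_function_imp_C1_cutoff)
    have h: "((\<lambda>y::real^'m. y \<bullet> y) has_derivative (\<lambda>v. (2 *\<^sub>R y) \<bullet> v)) (at y)" for y
      by (auto intro!: derivative_eq_intros simp: inner_commute)
    have "(LINT x|lborel. f x \<bullet> f x * partial_deriv j \<phi> x) = - (LINT x|lborel. (2 *\<^sub>R f x \<bullet> (Df x *v axis j 1)) * \<phi> x)"
      using weak_chain_rule(1)[OF f p h _ \<phi>, where v="axis j 1"] by (simp add: inner_axis continuous_intros)
    moreover have "(LINT x|lborel. f x \<bullet> f x * partial_deriv j \<phi> x) = 0"
      using integral_derivative_compact_support[OF \<phi>, of "axis j 1"] by (simp add: sph dot_square_norm inner_axis)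
    ultimately show "(LINT x|lborel. (f x \<bullet> (Df x *v axis j 1)) * \<phi> x) = 0" by (simp add: mult.assoc)
  qed
  then have "AE x in lborel. \<forall>j. f x \<bullet> (Df x *v axis j 1) = 0" by (simp add: AE_all_countable)
  then show ?thesis
  proof eventually_elim
    case (elim x)
    show ?case
    proof
      fix v :: "real^'n"
      have "Df x *v v = Df x *v (\<Sum>j\<in>UNIV. (v $ j) *\<^sub>R axis j 1)" by (simp add: basis_expansion flip: scalar_mult_eq_scaleR)
      also have "\<dots> = (\<Sum>j\<in>UNIV. (v $ j) *\<^sub>R (Df x *v axis j 1))"
        by (simp add: linear_sum[OF matrix_vector_mul_linear] linear_scale[OF matrix_vector_mul_linear])
      finally show "f x \<bullet> (Df x *v v) = 0" using elim by (simp add: inner_sum_right)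
    qed
  qed
qed

text \<open>The variation estimate for the coordinates shows that f(y + z) and f(y) agree for almost
  all y in a ball; continuity extends this to all y there, since a nonempty open set is not
  negligible.\<close>

lemma zero_differential_imp_constant:
  fixes f :: "real^'n \<Rightarrow> real^'m"
  assumes f: "locally_approximable p f Df" and p: "1 \<le> p" and zero: "AE x in lborel. Df x = 0"
  shows "f constant_on UNIV"
proof -
  have cf: "continuous_on UNIV f" using f by (simp add: locally_approximable_def)
  have "f (x + z) $ k = f x $ k" for x z k
  proof -
    define A where "A = ball (0::real^'n) (norm x + 1)"
    define A' where "A' = cball (0::real^'n) (norm x + 1 + norm z)"
    have seg: "y + t *\<^sub>R z \<in> A'" if "y \<in> A" "0 \<le> t" "t \<le> 1" for y t
    proof -
      have "norm (y + t *\<^sub>R z) \<le> norm y + norm (t *\<^sub>R z)" by (rule norm_triangle_ineq)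
      also have "norm (t *\<^sub>R z) \<le> 1 * norm z" unfolding norm_scaleR using that by (intro mult_right_mono) auto
      finally show ?thesis using that by (simp add: A_def A'_def)
    qed
    have h: "((\<lambda>y::real^'m. y $ k) has_derivative (\<lambda>v. axis k 1 \<bullet> v)) (at y)" for y
      by (auto intro!: derivative_eq_intros bounded_linear_imp_has_derivative bounded_linear_vec_nth simp: inner_axis' )
    have "(\<integral>\<^sup>+y\<in>A. ennreal \<bar>f (y + z) $ k - f y $ k\<bar> \<partial>lborel) \<le> ennreal (norm z) * (\<integral>\<^sup>+y\<in>A'. ennreal (norm (axis k 1 :: real^'m) * norm (Df y)) \<partial>lborel)"
      by (rule locally_approximable_variation[OF f p h _ _ _ _ seg]) (auto simp: A_def A'_def)
    also have "(\<integral>\<^sup>+y\<in>A'. ennreal (norm (axis k 1 :: real^'m) * norm (Df y)) \<partial>lborel) = (\<integral>\<^sup>+(y::real^'n). 0 \<partial>lborel)"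
      using zero by (intro nn_integral_cong_AE) (auto elim!: eventually_mono)
    finally have 0: "(\<integral>\<^sup>+y\<in>A. ennreal \<bar>f (y + z) $ k - f y $ k\<bar> \<partial>lborel) = 0" by simp
    define d where "d y = f (y + z) $ k - f y $ k" for y
    have cd: "continuous_on UNIV d" unfolding d_def[abs_def]
      by (intro continuous_intros cf continuous_on_compose2[OF cf]) auto
    have [measurable]: "d \<in> borel_measurable borel" using cd by (rule borel_measurable_continuous_onI)
    have [measurable]: "A \<in> sets borel" by (simp add: A_def)
    have "AE y in lborel. ennreal \<bar>d y\<bar> * indicator A y = 0"
      using 0 unfolding d_def[symmetric] by (subst (asm) nn_integral_0_iff_AE) auto
    then have AE: "AE y in lborel. y \<notin> A \<inter> {y. d y \<noteq> 0}" by eventually_elim (auto simp: indicator_def split: if_splits)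
    have op: "open (A \<inter> {y. d y \<noteq> 0})"
      unfolding A_def by (intro open_Int open_ball open_Collect_neq cd continuous_intros)
    have "A \<inter> {y. d y \<noteq> 0} \<in> null_sets lborel"
      using AE op AE_iff_null_sets[of "A \<inter> {y. d y \<noteq> 0}" lborel] by simp
    then have "negligible (A \<inter> {y. d y \<noteq> 0})"
      by (simp add: negligible_iff_null_sets null_sets_completionI)
    with op have "A \<inter> {y. d y \<noteq> 0} = {}" using open_not_negligible by blast
    moreover have "x \<in> A" by (simp add: A_def)
    ultimately show ?thesis by (auto simp: d_def)
  qed
  then have "f (0 + z) = f 0" for z by (subst vec_eq_iff) blast
  then show ?thesis unfolding constant_on_def by auto
qed

text \<open>A weak differential is only Lebesgue measurable, whereas the estimates use Borel
  functions and \<open>lborel\<close>. A change on a null set affects neither the weak identities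
  nor the distortion inequality.\<close>

lemma sobolev_borel_representative:
  fixes f :: "real^'n \<Rightarrow> real^'m"
  assumes f: "continuous_on UNIV f" "has_W1p_loc_differential p f Df" and p: "1 \<le> p"
  obtains D where "locally_approximable p f D" "AE x in lborel. Df x = D x"
proof -
  have Df: "\<And>k j. loc_Lp p (\<lambda>x. Df x $ k $ j)" "\<And>k j. has_weak_partial j (\<lambda>x. f x $ k) (\<lambda>x. Df x $ k $ j)"
    using f(2) by (auto simp: has_W1p_loc_differential_def)
  have "\<exists>h\<in>borel_measurable lborel. AE x in lborel. Df x $ k $ j = h x" for k j
    using Df(1)[of k j] by (intro completion_ex_borel_measurable_real) (simp add: loc_Lp_def)
  then obtain h where h: "\<And>k j. h k j \<in> borel_measurable lborel" "\<And>k j. AE x in lborel. Df x $ k $ j = h k j x"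
    by metis
  have [measurable]: "h k j \<in> borel_measurable borel" for k j using h(1) by simp
  define D where "D x = (\<chi> k j. h k j x)" for x
  have comp: "D x $ k $ j = h k j x" for x k j by (simp add: D_def)
  have mD: "D \<in> borel_measurable borel"
    by (rule borel_measurable_matrixI) (simp add: comp)
  have "AE x in lborel. \<forall>k j. Df x $ k $ j = h k j x" using h(2) by (simp add: AE_all_countable)
  then have AE: "AE x in lborel. Df x = D x" by eventually_elim (simp add: vec_eq_iff D_def)
  have AEk: "AE x in lebesgue. Df x $ k $ j = h k j x" for k j using h(2) by (rule AE_completion)
  have "locally_approximable p f D"
  proof (rule weak_differential_imp_locally_approximable[OF f(1) mD p])
    show "locally_integrable (\<lambda>x. \<bar>D x $ k $ j\<bar> ^ p)" for k j
      unfolding locally_integrable_def comp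
    proof (intro conjI allI)
      fix R
      have "compact (cball (0::real^'n) R)" by simp
      then have "set_integrable lebesgue (cball 0 R) (\<lambda>x. \<bar>Df x $ k $ j\<bar> ^ p)"
        using Df(1)[of k j] unfolding loc_Lp_def by blast
      then have i: "integrable lebesgue (\<lambda>x. indicator (cball 0 R) x *\<^sub>R \<bar>Df x $ k $ j\<bar> ^ p)"
        by (simp only: set_integrable_def)
      have m: "(\<lambda>x. indicator (cball 0 R) x *\<^sub>R \<bar>h k j x\<bar> ^ p) \<in> borel_measurable lborel"
        by (intro borel_measurable_scaleR borel_measurable_indicator borel_measurable_power borel_measurable_abs) (auto simp: h)
      from i have "integrable lebesgue (\<lambda>x. indicator (cball 0 R) x *\<^sub>R \<bar>h k j x\<bar> ^ p)"
      proof (rule integrable_cong_AE_imp)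
        show "(\<lambda>x. indicator (cball 0 R) x *\<^sub>R \<bar>h k j x\<bar> ^ p) \<in> borel_measurable lebesgue" using m by (rule measurable_completion)
        show "AE x in lebesgue. indicat_real (cball 0 R) x *\<^sub>R \<bar>Df x $ k $ j\<bar> ^ p = indicat_real (cball 0 R) x *\<^sub>R \<bar>h k j x\<bar> ^ p"
          using AEk[of k j] by eventually_elim simp
      qed
      then show "set_integrable lborel (cball 0 R) (\<lambda>x. \<bar>h k j x\<bar> ^ p)"
        unfolding set_integrable_def using integrable_completion[OF m] by simp
    qed simp
    fix \<phi> :: "real^'n \<Rightarrow> real" and k j assume t: "test_function \<phi>"
    note c = C1_cutoff_continuous[OF test_function_imp_C1_cutoff[OF t]]
    have [measurable]: "\<phi> \<in> borel_measurable borel" using c by (intro borel_measurable_continuous_onI)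
    have "continuous_on UNIV (\<lambda>x. (\<chi> j. partial_deriv j \<phi> x) $ j)" by (intro bounded_linear.continuous_on[OF bounded_linear_vec_nth] c)
    then have "continuous_on UNIV (\<lambda>x. f x $ k * partial_deriv j \<phi> x)" by (intro continuous_intros f) simp
    then have m1: "(\<lambda>x. f x $ k * partial_deriv j \<phi> x) \<in> borel_measurable lborel" by (simp add: borel_measurable_continuous_onI)
    have m2: "(\<lambda>x. h k j x * \<phi> x) \<in> borel_measurable lborel" by measurable
    have "(LINT x|lborel. f x $ k * partial_deriv j \<phi> x) = (LINT x|lebesgue. f x $ k * partial_deriv j \<phi> x)"
      by (rule integral_completion[OF m1, symmetric])
    also have "\<dots> = - (LINT x|lebesgue. Df x $ k $ j * \<phi> x)" using Df(2) t by (simp add: has_weak_partial_def)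
    also have "(LINT x|lebesgue. Df x $ k $ j * \<phi> x) = (LINT x|lebesgue. h k j x * \<phi> x)"
    proof (rule integral_cong_AE)
      show "(\<lambda>x. Df x $ k $ j * \<phi> x) \<in> borel_measurable lebesgue"
        using Df(1)[of k j] by (intro borel_measurable_times measurable_completion[of \<phi>]) (auto simp: loc_Lp_def)
      show "(\<lambda>x. h k j x * \<phi> x) \<in> borel_measurable lebesgue" using m2 by (rule measurable_completion)
      show "AE x in lebesgue. Df x $ k $ j * \<phi> x = h k j x * \<phi> x" using AEk[of k j] by eventually_elim simp
    qed
    also have "\<dots> = (LINT x|lborel. D x $ k $ j * \<phi> x)" unfolding comp by (rule integral_completion[OF m2])
    finally show "(LINT x|lborel. f x $ k * partial_deriv j \<phi> x) = - (LINT x|lborel. D x $ k $ j * \<phi> x)" .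
  qed
  then show ?thesis using AE that by blast
qed

section \<open>Growth data of a map of bounded distortion\<close>

text \<open>A sum chosen to dominate all the constants collected in \<open>C_bounds\<close> at
  once.\<close>

definition growth_constant :: "nat \<Rightarrow> real \<Rightarrow> real" where
  "growth_constant n c = 1 + n + 2 ^ (n + 2) * (fact n * n) * (1 + 2 * c)"

text \<open>\<open>g\<close> is the map seen in one stereographic chart and \<open>J\<close> its
  Jacobian into the sphere, related to det Dg by the conformal factor (2 / (1 + |g|^2))^n.
  \<open>J\<close> and \<open>C\<close> are parameters because all charts have to share
  them.\<close>

locale bounded_distortion =
  fixes c :: real and g :: "real^'n \<Rightarrow> real^'n" and Dg :: "real^'n \<Rightarrow> real^'n^'n" and J :: "real^'n \<Rightarrow> real"
    and C :: real
  assumes C_def: "C = growth_constant CARD('n) c" and c: "0 < c" and n: "2 \<le> CARD('n)" and g: "locally_approximable CARD('n) g Dg"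
    and distortion: "AE x in lborel. norm (Dg x) ^ CARD('n) \<le> c * det (Dg x)"
    and J: "J \<in> borel_measurable borel" "\<And>x. 0 \<le> J x"
    and J_eq: "AE x in lborel. J x * (1 + norm (g x) ^ 2) ^ CARD('n) = 2 ^ CARD('n) * det (Dg x)"
begin

definition \<tau> where "\<tau> x = norm (g x) ^ CARD('n)"
definition r where "r x = root CARD('n) (1 + \<tau> x)"
definition u where "u x = ln (1 + \<tau> x)"
text \<open>Up to the factor n this bounds the gradient of u, because r^n = 1 + |g|^n and |g| is at
  most r.\<close>

definition Y where "Y x = norm (Dg x) / r x"
definition d where "d x = det (Dg x) / (1 + \<tau> x) ^ 2"

lemma continuous_g: "continuous_on UNIV g" and measurable_Dg: "Dg \<in> borel_measurable borel"
  using g by (auto simp: locally_approximable_def)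

lemma \<tau>_nonneg: "0 \<le> \<tau> x" by (simp add: \<tau>_def)

lemma continuous_\<tau>: "continuous_on UNIV \<tau>"
  unfolding \<tau>_def[abs_def] by (intro continuous_intros continuous_g)

lemma r_ge_1: "1 \<le> r x" using n \<tau>_nonneg[of x] by (simp add: r_def)

lemma r_pos: "0 < r x" using r_ge_1[of x] by simp

lemma r_power: "r x ^ CARD('n) = 1 + \<tau> x"
  using n \<tau>_nonneg[of x] by (simp add: r_def)

lemma norm_g_le_r: "norm (g x) \<le> r x"
proof (rule power_le_imp_le_base[of _ "CARD('n) - 1"])
  show "norm (g x) ^ Suc (CARD('n) - 1) \<le> r x ^ Suc (CARD('n) - 1)"
    using r_power[of x] by (simp add: \<tau>_def)
qed (use r_pos in \<open>simp add: less_imp_le\<close>)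

lemma r_power_pred: "r x ^ (CARD('n) - 1) * r x = 1 + \<tau> x"
  using r_power[of x] n by (cases "CARD('n)") (auto simp: mult.commute)

lemma continuous_r: "continuous_on UNIV r"
  unfolding r_def[abs_def] by (intro continuous_intros continuous_\<tau>)

lemma continuous_u: "continuous_on UNIV u"
  unfolding u_def[abs_def] by (intro continuous_intros continuous_\<tau>) (use \<tau>_nonneg in \<open>auto simp: add_nonneg_eq_0_iff\<close>)

lemma u_nonneg: "0 \<le> u x" using \<tau>_nonneg[of x] by (simp add: u_def)

lemma exp_u: "exp (u x) = 1 + \<tau> x" using \<tau>_nonneg[of x] by (simp add: u_def)

lemma Y_nonneg: "0 \<le> Y x" using r_pos[of x] by (simp add: Y_def)

lemma Y_le: "Y x \<le> norm (Dg x)"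
  using r_ge_1[of x] by (simp add: Y_def divide_le_eq mult_left_le_one_le mult_le_cancel_left1)

lemma measurable_Y: "Y \<in> borel_measurable borel"
proof -
  note [measurable] = measurable_Dg borel_measurable_continuous_onI[OF continuous_r]
  show ?thesis unfolding Y_def[abs_def] by measurable
qed

lemma Y_power: "Y x ^ CARD('n) = norm (Dg x) ^ CARD('n) / (1 + \<tau> x)"
  by (simp add: Y_def power_divide r_power)

lemma measurable_det: "(\<lambda>x. det (Dg x)) \<in> borel_measurable borel"
proof -
  have "(\<lambda>x. Dg x $ i $ j) \<in> borel_measurable borel" for i j
    by (rule borel_measurable_continuous_on[OF _ measurable_Dg]) (intro continuous_intros)
  then show ?thesis unfolding det_def by (intro borel_measurable_sum borel_measurable_times borel_measurable_prod) auto
qed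

lemma measurable_flux:
  assumes "continuous_on UNIV z" shows "(\<lambda>x. flux (Dg x) (g x) (z x)) \<in> borel_measurable borel"
proof -
  have comp: "(\<lambda>x. Dg x $ i $ j) \<in> borel_measurable borel" for i j
    by (rule borel_measurable_continuous_on[OF _ measurable_Dg]) (intro continuous_intros)
  have comp': "(\<lambda>x. g x $ i) \<in> borel_measurable borel" "(\<lambda>x. z x $ i) \<in> borel_measurable borel" for i
    by (rule borel_measurable_continuous_onI, intro continuous_intros continuous_g assms)+
  have "(\<lambda>x. det (replace_row (Dg x) k (z x))) \<in> borel_measurable borel" for k
  proof -
    have "(\<lambda>x. replace_row (Dg x) k (z x) $ i $ j) \<in> borel_measurable borel" for i j
      using comp comp' by (cases "i = k") auto
    then show ?thesis
      unfolding det_def by (intro borel_measurable_sum borel_measurable_times borel_measurable_prod) auto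
  qed
  then show ?thesis unfolding flux_def by (intro borel_measurable_sum borel_measurable_times comp')
qed

text \<open>For k \<le> n the power |Dg|^k is at most 1 + |Dg|^n, which is locally integrable; the
  integrability of flux and determinant terms is reduced to this.\<close>

lemma integrable_power:
  fixes \<beta> :: "real^'n \<Rightarrow> real"
  assumes \<beta>: "continuous_on UNIV \<beta>" "\<And>x. R < norm x \<Longrightarrow> \<beta> x = 0" and k: "k \<le> CARD('n)"
  shows "integrable lborel (\<lambda>x. \<beta> x * norm (Dg x) ^ k)"
proof -
  obtain b where b: "0 < b" "\<And>x. norm (\<beta> x) \<le> b" using bounded_continuous_compact_support[OF \<beta>] by metis
  have one: "integrable lborel (indicator (cball 0 R) :: real^'n \<Rightarrow> real)" by (rule integrable_indicator_cball)
  have "integrable lborel (\<lambda>x. b * (indicator (cball 0 R) x + indicator (cball 0 R) x *\<^sub>R norm (Dg x) ^ CARD('n)))"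
    using one locally_approximable_norm_power_integrable[OF g, of R] unfolding set_integrable_def
    by (intro integrable_mult_right Bochner_Integration.integrable_add)
  then show ?thesis
  proof (rule Bochner_Integration.integrable_bound)
    show "(\<lambda>x. \<beta> x * norm (Dg x) ^ k) \<in> borel_measurable lborel"
      using borel_measurable_continuous_onI[OF \<beta>(1)] measurable_Dg by simp
    show "AE x in lborel. norm (\<beta> x * norm (Dg x) ^ k) \<le> norm (b * (indicator (cball 0 R) x + indicator (cball 0 R) x *\<^sub>R norm (Dg x) ^ CARD('n)))"
    proof (rule AE_I2)
      fix x
      have "norm (Dg x) ^ k \<le> 1 + norm (Dg x) ^ CARD('n)"
      proof (cases "norm (Dg x) \<le> 1")
        case True
        then have "norm (Dg x) ^ k \<le> 1" by (simp add: power_le_one)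
        then show ?thesis by (simp add: add_increasing2)
      next
        case False
        then have "norm (Dg x) ^ k \<le> norm (Dg x) ^ CARD('n)" using k by (intro power_increasing) auto
        then show ?thesis by simp
      qed
      then have "\<bar>\<beta> x\<bar> * norm (Dg x) ^ k \<le> b * (1 + norm (Dg x) ^ CARD('n))"
        using b(1) b(2)[of x] by (intro mult_mono) auto
      then show "norm (\<beta> x * norm (Dg x) ^ k) \<le> norm (b * (indicator (cball 0 R) x + indicator (cball 0 R) x *\<^sub>R norm (Dg x) ^ CARD('n)))"
        using \<beta>(2)[of x] b(1) by (cases "x \<in> cball 0 R") (auto simp: abs_mult)
    qed
  qed
qed

lemma integrable_flux:
  assumes \<alpha>: "continuous_on UNIV \<alpha>" and z: "continuous_on UNIV z" "\<And>x. R < norm x \<Longrightarrow> z x = 0"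
  shows "integrable lborel (\<lambda>x. \<alpha> x * flux (Dg x) (g x) (z x))"
proof -
  have "integrable lborel (\<lambda>x. (\<bar>\<alpha> x\<bar> * ((fact CARD('n) * CARD('n)) * (norm (z x) * norm (g x)))) * norm (Dg x) ^ (CARD('n) - 1))"
    by (rule integrable_power[where R=R]) (auto intro!: continuous_intros \<alpha> z continuous_g simp: z)
  then show ?thesis
  proof (rule Bochner_Integration.integrable_bound)
    show "(\<lambda>x. \<alpha> x * flux (Dg x) (g x) (z x)) \<in> borel_measurable lborel"
      using borel_measurable_continuous_onI[OF \<alpha>] measurable_flux[OF z(1)] by simp
    show "AE x in lborel. norm (\<alpha> x * flux (Dg x) (g x) (z x)) \<le> norm ((\<bar>\<alpha> x\<bar> * ((fact CARD('n) * CARD('n)) * (norm (z x) * norm (g x)))) * norm (Dg x) ^ (CARD('n) - 1))"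
    proof (rule AE_I2)
      fix x
      have "\<bar>\<alpha> x\<bar> * \<bar>flux (Dg x) (g x) (z x)\<bar> \<le> \<bar>\<alpha> x\<bar> * ((fact CARD('n) * CARD('n)) * (norm (z x) * (norm (g x) * norm (Dg x) ^ (CARD('n) - 1))))"
        by (intro mult_left_mono abs_flux_le) auto
      then show "norm (\<alpha> x * flux (Dg x) (g x) (z x)) \<le> norm ((\<bar>\<alpha> x\<bar> * ((fact CARD('n) * CARD('n)) * (norm (z x) * norm (g x)))) * norm (Dg x) ^ (CARD('n) - 1))"
        by (simp add: abs_mult mult.assoc)
    qed
  qed
qed

lemma integrable_det:
  assumes \<beta>: "continuous_on UNIV \<beta>" "\<And>x. R < norm x \<Longrightarrow> \<beta> x = 0"
  shows "integrable lborel (\<lambda>x. \<beta> x * det (Dg x))"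
proof -
  have "integrable lborel (\<lambda>x. (fact CARD('n) * \<bar>\<beta> x\<bar>) * norm (Dg x) ^ CARD('n))"
    by (rule integrable_power[where R=R]) (auto intro!: continuous_intros \<beta> simp: \<beta>(2))
  then show ?thesis
  proof (rule Bochner_Integration.integrable_bound)
    show "(\<lambda>x. \<beta> x * det (Dg x)) \<in> borel_measurable lborel"
      using borel_measurable_continuous_onI[OF \<beta>(1)] measurable_det by simp
    show "AE x in lborel. norm (\<beta> x * det (Dg x)) \<le> norm ((fact CARD('n) * \<bar>\<beta> x\<bar>) * norm (Dg x) ^ CARD('n))"
    proof (rule AE_I2)
      fix x
      have "\<bar>\<beta> x\<bar> * \<bar>det (Dg x)\<bar> \<le> \<bar>\<beta> x\<bar> * (fact CARD('n) * norm (Dg x) ^ CARD('n))"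
        by (intro mult_left_mono abs_det_replace_row_le(2)) auto
      then show "norm (\<beta> x * det (Dg x)) \<le> norm ((fact CARD('n) * \<bar>\<beta> x\<bar>) * norm (Dg x) ^ CARD('n))"
        by (simp add: abs_mult mult_ac)
    qed
  qed
qed

text \<open>\<open>d\<close> replaces the spherical density \<open>2\<^sup>n / (1 + |g|\<^sup>2)\<^sup>n\<close> by the comparable \<open>1 / (1 + |g|\<^sup>n)\<^sup>2\<close>, which is a
  derivative in \<open>|g|\<^sup>n\<close>.\<close>

lemma comparability:
  "AE x in lborel. 0 \<le> d x \<and> d x \<le> J x \<and> J x \<le> 2 ^ (CARD('n) + 2) * d x \<and> Y x ^ CARD('n) \<le> c * ((1 + \<tau> x) * d x)"
  using distortion J_eq
proof eventually_elim
  case (elim x)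
  let ?N = "CARD('n)"
  define s where "s = norm (g x) ^ 2"
  have s0: "0 \<le> s" by (simp add: s_def)
  have "s ^ ?N = \<tau> x ^ 2" by (simp add: s_def \<tau>_def power_mult[symmetric] mult.commute)
  have \<tau>0: "0 \<le> \<tau> x" by (rule \<tau>_nonneg)
  have det0: "0 \<le> det (Dg x)"
    using elim(1) c order_trans[of 0 "norm (Dg x) ^ ?N" "c * det (Dg x)"] by (simp add: zero_le_mult_iff)
  \<comment> \<open>As s^n = \<tau>^2, both densities have the same growth; the constant 2^n comes
    from splitting at s = 1, the constant 4 below from (1 + \<tau>)^2 \<le> 2 (1 +
    \<tau>^2).\<close>
  have up: "(1 + s) ^ ?N \<le> 2 ^ ?N * (1 + \<tau> x) ^ 2"
  proof (cases "s \<le> 1")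
    case True
    have "(1 + s) ^ ?N \<le> 2 ^ ?N * 1" using True s0 by (simp add: power_mono)
    also have "\<dots> \<le> 2 ^ ?N * (1 + \<tau> x) ^ 2" using \<tau>0 by (intro mult_left_mono one_le_power) auto
    finally show ?thesis .
  next
    case False
    have "(1 + s) ^ ?N \<le> (2 * s) ^ ?N" using False by (intro power_mono) auto
    also have "\<dots> = 2 ^ ?N * \<tau> x ^ 2" using \<open>s ^ ?N = \<tau> x ^ 2\<close> by (simp add: power_mult_distrib)
    also have "\<dots> \<le> 2 ^ ?N * (1 + \<tau> x) ^ 2" using \<tau>0 by (intro mult_left_mono power_mono) auto
    finally show ?thesis .
  qed
  have lo: "(1 + \<tau> x) ^ 2 \<le> 4 * (1 + s) ^ ?N"
  proof -
    have "(1 + \<tau> x) ^ 2 \<le> 2 * (1 + \<tau> x ^ 2)" using sum_squares_bound[of 1 "\<tau> x"] by (simp add: power2_sum)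
    also have "\<dots> \<le> 2 * ((1 + s) ^ ?N + (1 + s) ^ ?N)"
    proof (intro mult_left_mono add_mono)
      show "\<tau> x ^ 2 \<le> (1 + s) ^ ?N" using s0 by (subst \<open>s ^ ?N = \<tau> x ^ 2\<close>[symmetric]) (intro power_mono, auto)
    qed (use s0 in \<open>auto simp: one_le_power\<close>)
    finally show ?thesis by simp
  qed
  have p: "0 < (1 + s) ^ ?N" "0 < (1 + \<tau> x) ^ 2" using s0 \<tau>0 by auto
  have Jx: "J x = 2 ^ ?N * det (Dg x) / (1 + s) ^ ?N" using elim(2) unfolding s_def[symmetric] by (rule eq_divide_imp[OF less_imp_neq[OF p(1), symmetric]])
  have "d x \<le> J x"
  proof -
    have "2 ^ ?N * det (Dg x) / (2 ^ ?N * (1 + \<tau> x) ^ 2) \<le> J x"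
      unfolding Jx using det0 by (intro divide_left_mono up mult_pos_pos p) auto
    then show ?thesis by (simp add: d_def)
  qed
  moreover have "J x \<le> 2 ^ (?N + 2) * d x"
  proof -
    have "J x = 4 * (2 ^ ?N * det (Dg x)) / (4 * (1 + s) ^ ?N)" unfolding Jx by simp
    also have "\<dots> \<le> 4 * (2 ^ ?N * det (Dg x)) / (1 + \<tau> x) ^ 2"
      using det0 by (intro divide_left_mono lo mult_pos_pos p) auto
    finally show ?thesis by (simp add: d_def)
  qed
  moreover have "Y x ^ ?N \<le> c * ((1 + \<tau> x) * d x)"
  proof -
    have "Y x ^ ?N \<le> c * det (Dg x) / (1 + \<tau> x)"
      unfolding Y_power using elim(1) \<tau>0 by (intro divide_right_mono) auto
    also have "\<dots> = c * ((1 + \<tau> x) * d x)" using \<tau>0 by (simp add: d_def power2_eq_square)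
    finally show ?thesis .
  qed
  ultimately show ?case using det0 by (simp add: d_def)
qed

lemma integrable_J:
  assumes \<beta>: "continuous_on UNIV \<beta>" "\<And>x. R < norm x \<Longrightarrow> \<beta> x = 0"
  shows "integrable lborel (\<lambda>x. \<beta> x * J x)"
proof -
  have "integrable lborel (\<lambda>x. (2 ^ (CARD('n) + 2) * (\<bar>\<beta> x\<bar> / (1 + \<tau> x) ^ 2)) * det (Dg x))"
  proof (rule integrable_det[where R=R])
    show "continuous_on UNIV (\<lambda>x. 2 ^ (CARD('n) + 2) * (\<bar>\<beta> x\<bar> / (1 + \<tau> x) ^ 2))"
      by (intro continuous_intros \<beta> continuous_\<tau>) (use \<tau>_nonneg in \<open>auto simp: add_nonneg_eq_0_iff\<close>)
  qed (simp add: \<beta>)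
  then show ?thesis
  proof (rule Bochner_Integration.integrable_bound)
    show "(\<lambda>x. \<beta> x * J x) \<in> borel_measurable lborel"
      using borel_measurable_continuous_onI[OF \<beta>(1)] J(1) by simp
    show "AE x in lborel. norm (\<beta> x * J x) \<le> norm ((2 ^ (CARD('n) + 2) * (\<bar>\<beta> x\<bar> / (1 + \<tau> x) ^ 2)) * det (Dg x))"
      using comparability
    proof eventually_elim
      case (elim x)
      then have "\<bar>\<beta> x\<bar> * J x \<le> \<bar>\<beta> x\<bar> * (2 ^ (CARD('n) + 2) * d x)" by (intro mult_left_mono) auto
      also have "\<dots> = 2 ^ (CARD('n) + 2) * (\<bar>\<beta> x\<bar> / (1 + \<tau> x) ^ 2) * det (Dg x)" by (simp add: d_def)
      finally have "norm (\<beta> x * J x) \<le> 2 ^ (CARD('n) + 2) * (\<bar>\<beta> x\<bar> / (1 + \<tau> x) ^ 2) * det (Dg x)"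
        using J(2)[of x] by (simp add: abs_mult)
      then show ?case by (rule order_trans) (unfold real_norm_def, rule abs_ge_self)
    qed
  qed
qed

lemma locally_integrable_J: "set_integrable lborel (cball 0 R) J"
proof -
  define \<rho> where "\<rho> = max 1 R"
  have \<rho>: "0 < \<rho>" "R \<le> \<rho>" by (auto simp: \<rho>_def)
  obtain \<eta> D\<eta> where \<eta>: "C1_cutoff \<eta> D\<eta>" "\<And>x::real^'n. 0 \<le> \<eta> x" "\<And>x. dist 0 x \<le> \<rho> \<Longrightarrow> \<eta> x = 1"
    by (rule radial_cutoff[OF \<rho>(1)]) (rule that)
  obtain R' where R': "\<And>x. R' < norm x \<Longrightarrow> \<eta> x = 0" using C1_cutoff_out[OF \<eta>(1)] by metis
  have i: "integrable lborel (\<lambda>x. \<eta> x * J x)"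
    using C1_cutoff_continuous[OF \<eta>(1)] R' by (intro integrable_J)
  show ?thesis
    unfolding set_integrable_def
  proof (rule Bochner_Integration.integrable_bound[OF i])
    show "(\<lambda>x. indicator (cball 0 R) x *\<^sub>R J x) \<in> borel_measurable lborel"
      using J(1) by (intro borel_measurable_scaleR borel_measurable_indicator) auto
    show "AE x in lborel. norm (indicator (cball 0 R) x *\<^sub>R J x) \<le> norm (\<eta> x * J x)"
      using \<eta>(3) \<rho>(2) by (intro AE_I2) (auto simp: indicator_def)
  qed
qed

text \<open>Since |g| \<le> r and |Dg| = r Y, the flux carries n factors r, which cancel against 1 +
  \<tau> = r^n.\<close>

lemma flux_bound: "\<bar>flux (Dg x) (g x) z\<bar> / (1 + \<tau> x) \<le> (fact CARD('n) * CARD('n)) * (norm z * Y x ^ (CARD('n) - 1))"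
proof -
  let ?N = "CARD('n)"
  have "\<bar>flux (Dg x) (g x) z\<bar> \<le> (fact ?N * ?N) * (norm z * (norm (g x) * norm (Dg x) ^ (?N - 1)))" by (rule abs_flux_le)
  also have "\<dots> \<le> (fact ?N * ?N) * (norm z * (r x * norm (Dg x) ^ (?N - 1)))"
    by (intro mult_left_mono mult_right_mono norm_g_le_r) auto
  also have "norm (Dg x) ^ (?N - 1) = Y x ^ (?N - 1) * r x ^ (?N - 1)"
    using r_pos[of x] by (simp add: Y_def power_divide)
  finally have "\<bar>flux (Dg x) (g x) z\<bar> \<le> (fact ?N * ?N) * (norm z * Y x ^ (?N - 1)) * (r x ^ (?N - 1) * r x)"
    by (simp add: mult_ac)
  then show ?thesis unfolding r_power_pred using \<tau>_nonneg[of x] by (simp add: divide_le_eq)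
qed

lemma C_bounds: "1 \<le> C" "real CARD('n) \<le> C" "2 * c \<le> C" "c * (fact CARD('n) * CARD('n)) \<le> C"
  "2 ^ (CARD('n) + 2) / CARD('n) * (fact CARD('n) * CARD('n)) \<le> C"
proof -
  let ?N = "CARD('n)"
  define F where "F = (fact ?N * ?N :: real)"
  have F: "1 \<le> F" using n mult_mono[of 1 "fact ?N" 1 "real ?N"] by (simp add: F_def fact_ge_1)
  have P: "1 \<le> (2::real) ^ (?N + 2)" by (rule one_le_power) simp
  have "1 * F \<le> 2 ^ (?N + 2) * F" using P F by (intro mult_right_mono) auto
  then have PF: "F \<le> 2 ^ (?N + 2) * F" "1 \<le> 2 ^ (?N + 2) * F" using F by linarith+
  have C: "C = 1 + ?N + 2 ^ (?N + 2) * F + 2 ^ (?N + 2) * F * (2 * c)" by (simp add: C_def growth_constant_def F_def algebra_simps)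
  have 1: "0 \<le> 2 ^ (?N + 2) * F" using PF by linarith
  have 2: "0 \<le> 2 ^ (?N + 2) * F * (2 * c)" using F c by (intro mult_nonneg_nonneg) auto
  show "1 \<le> C" "real ?N \<le> C" using C 1 2 by linarith+
  have "1 * (2 * c) \<le> 2 ^ (?N + 2) * F * (2 * c)" using PF c by (intro mult_right_mono) auto
  then show "2 * c \<le> C" using C 1 by linarith
  have "F * (2 * c) \<le> 2 ^ (?N + 2) * F * (2 * c)" using PF c by (intro mult_right_mono) auto
  moreover have "c * F \<le> F * (2 * c)" using c F by simp
  ultimately have "c * F \<le> C" using C 1 by linarith
  then show "c * (fact ?N * ?N) \<le> C" by (simp add: F_def)
  have "2 ^ (?N + 2) / real ?N * F \<le> 2 ^ (?N + 2) / 1 * F" using n F by (intro mult_right_mono divide_left_mono) auto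
  then have "2 ^ (?N + 2) / real ?N * F \<le> C" using C 2 by linarith
  then show "2 ^ (?N + 2) / ?N * (fact ?N * ?N) \<le> C" by (simp only: F_def)
qed

text \<open>\<open>radial_identity\<close> with \<kappa>(t) = 1 / (1 + t): the derivative of t
  \<kappa>(t) is 1 / (1 + t)^2, so the determinant term is n \<eta> d, comparable to \<eta> J, and
  the flux term is handled by \<open>flux_bound\<close>.\<close>

lemma mass:
  assumes \<eta>: "C1_cutoff \<eta> D\<eta>" "\<And>x. 0 \<le> \<eta> x"
  shows "(LINT x|lborel. \<eta> x * J x) \<le> C * (LINT x|lborel. norm (D\<eta> x) * Y x ^ (CARD('n) - 1))"
proof -
  let ?N = "CARD('n)"
  obtain R where R: "0 < R" "\<And>x. R < norm x \<Longrightarrow> \<eta> x = 0" "\<And>x. R < norm x \<Longrightarrow> D\<eta> x = 0" using C1_cutoff_out[OF \<eta>(1)] by metis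
  have c\<eta>: "continuous_on UNIV \<eta>" "continuous_on UNIV D\<eta>" using C1_cutoff_continuous[OF \<eta>(1)] by auto
  define X where "X x = 1 / (1 + \<tau> x) * flux (Dg x) (g x) (D\<eta> x) + ?N * (\<eta> x / (1 + \<tau> x) ^ 2) * det (Dg x)" for x
  have p: "0 < 1 + \<tau> x" for x using \<tau>_nonneg[of x] by simp
  have cq: "continuous_on UNIV (\<lambda>x. 1 / (1 + \<tau> x))"
    by (intro continuous_intros continuous_\<tau>) (use p in \<open>auto simp: less_imp_neq[symmetric]\<close>)
  have cq2: "continuous_on UNIV (\<lambda>x. ?N * (\<eta> x / (1 + \<tau> x) ^ 2))"
    by (intro continuous_intros continuous_\<tau> c\<eta>) (use p in \<open>auto simp: less_imp_neq[symmetric]\<close>)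
  have iX: "integrable lborel X"
    unfolding X_def using R
    by (intro Bochner_Integration.integrable_add integrable_flux[OF cq c\<eta>(2) R(3)] integrable_det[OF cq2, where R=R]) auto
  have X0: "(LINT x|lborel. X x) = 0"
  proof -
    have "((\<lambda>t. 1 / (1 + t)) has_real_derivative - 1 / (1 + t) ^ 2) (at t)" if "0 \<le> t" for t :: real
      using that by (auto intro!: derivative_eq_intros simp: power2_eq_square)
    moreover have "continuous_on {0..} (\<lambda>t::real. - 1 / (1 + t) ^ 2)"
      by (intro continuous_intros) (auto simp: add_nonneg_eq_0_iff)
    ultimately have "(LINT x|lborel. 1 / (1 + \<tau> x) * flux (Dg x) (g x) (D\<eta> x)
     + ?N * \<eta> x * (1 / (1 + \<tau> x) + \<tau> x * (- 1 / (1 + \<tau> x) ^ 2)) * det (Dg x)) = 0"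
      unfolding \<tau>_def by (rule radial_identity[OF g n \<eta>(1)])
    moreover have "?N * \<eta> x * (1 / (1 + \<tau> x) + \<tau> x * (- 1 / (1 + \<tau> x) ^ 2)) * det (Dg x) = ?N * (\<eta> x / (1 + \<tau> x) ^ 2) * det (Dg x)" for x
    proof -
      have "1 / w + (w - 1) * (- 1 / w ^ 2) = 1 / w ^ 2" if "0 < w" for w :: real
        using that by (simp add: field_simps power2_eq_square)
      from this[OF p[of x]] show ?thesis by simp
    qed
    ultimately show ?thesis by (simp add: X_def)
  qed
  have iY: "integrable lborel (\<lambda>x. norm (D\<eta> x) * Y x ^ (?N - 1))"
  proof -
    have "integrable lborel (\<lambda>x. (norm (D\<eta> x) / r x ^ (?N - 1)) * norm (Dg x) ^ (?N - 1))"
      by (rule integrable_power[where R=R]) (auto intro!: continuous_intros c\<eta> continuous_r simp: R r_pos less_imp_neq[OF r_pos, symmetric])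
    then show ?thesis by (simp add: Y_def power_divide)
  qed
  have iJ: "integrable lborel (\<lambda>x. \<eta> x * J x)" by (rule integrable_J[OF c\<eta>(1) R(2)])
  have "(LINT x|lborel. \<eta> x * J x) \<le> (LINT x|lborel. 2 ^ (?N + 2) / ?N * X x + C * (norm (D\<eta> x) * Y x ^ (?N - 1)))"
  proof (rule integral_mono_AE[OF iJ])
    show "integrable lborel (\<lambda>x. 2 ^ (?N + 2) / ?N * X x + C * (norm (D\<eta> x) * Y x ^ (?N - 1)))"
      by (intro Bochner_Integration.integrable_add integrable_mult_right iX iY)
    show "AE x in lborel. \<eta> x * J x \<le> 2 ^ (?N + 2) / ?N * X x + C * (norm (D\<eta> x) * Y x ^ (?N - 1))"
      using comparability
    proof eventually_elim
      case (elim x)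
      define f where "f = flux (Dg x) (g x) (D\<eta> x) / (1 + \<tau> x)"
      have f: "- f \<le> (fact ?N * ?N) * (norm (D\<eta> x) * Y x ^ (?N - 1))"
        using flux_bound[of x "D\<eta> x"] p[of x] abs_ge_minus_self[of f] by (simp add: f_def)
      have Xx: "X x = f + ?N * (\<eta> x * d x)" by (simp add: X_def f_def d_def)
      have "\<eta> x * J x \<le> \<eta> x * (2 ^ (?N + 2) * d x)" using elim \<eta>(2) by (intro mult_left_mono) auto
      also have "\<dots> = 2 ^ (?N + 2) / ?N * (X x + - f)" using n unfolding Xx by simp
      also have "\<dots> \<le> 2 ^ (?N + 2) / ?N * X x + 2 ^ (?N + 2) / ?N * ((fact ?N * ?N) * (norm (D\<eta> x) * Y x ^ (?N - 1)))"
        unfolding distrib_left by (intro add_left_mono mult_left_mono f) auto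
      also have "2 ^ (?N + 2) / ?N * ((fact ?N * ?N) * (norm (D\<eta> x) * Y x ^ (?N - 1))) = (2 ^ (?N + 2) / ?N * (fact ?N * ?N)) * (norm (D\<eta> x) * Y x ^ (?N - 1))"
        by (simp only: mult.assoc)
      also have "\<dots> \<le> C * (norm (D\<eta> x) * Y x ^ (?N - 1))"
        by (intro mult_right_mono C_bounds) (simp add: Y_nonneg)
      finally show ?case by simp
    qed
  qed
  also have "\<dots> = C * (LINT x|lborel. norm (D\<eta> x) * Y x ^ (?N - 1))"
    using iX iY by (simp add: X0)
  finally show ?thesis .
qed

text \<open>\<open>radial_identity\<close> with the cutoff \<eta>^n and \<kappa>(t) = 1 / ((1 + t)
  (L + ln (1 + t))^(n-1)). Up to the factor 1 / (1 + t)^2, differentiating the logarithm in t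
  \<kappa>(t) produces -(n - 1) t / (L + ln (1 + t))^n, and this negative term controls the energy;
  the other terms are bounded by J / L^(n-1) and by the flux.\<close>

lemma log_energy:
  assumes \<eta>: "C1_cutoff \<eta> D\<eta>" "\<And>x. 0 \<le> \<eta> x" and L: "1 \<le> L"
  shows "(LINT x|lborel. (\<eta> x * (Y x / (L + u x))) ^ CARD('n))
        \<le> C / L ^ (CARD('n) - 1) * (LINT x|lborel. \<eta> x ^ CARD('n) * J x)
          + C * (LINT x|lborel. (\<eta> x * (Y x / (L + u x))) ^ (CARD('n) - 1) * norm (D\<eta> x))"
proof -
  let ?N = "CARD('n)"
  obtain k where k: "?N = Suc (Suc k)" using n by (cases "CARD('n)"; cases "CARD('n) - 1") auto
  then have k1: "?N - Suc 0 = Suc k" by simp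
  obtain R where R: "0 < R" "\<And>x. R < norm x \<Longrightarrow> \<eta> x = 0" "\<And>x. R < norm x \<Longrightarrow> D\<eta> x = 0" using C1_cutoff_out[OF \<eta>(1)] by metis
  have c\<eta>: "continuous_on UNIV \<eta>" "continuous_on UNIV D\<eta>" using C1_cutoff_continuous[OF \<eta>(1)] by auto
  define W where "W x = L + u x" for x
  have W: "1 \<le> W x" "L \<le> W x" "0 < W x" for x using L u_nonneg[of x] by (auto simp: W_def)
  have cW: "continuous_on UNIV W" unfolding W_def[abs_def] by (intro continuous_intros continuous_u)
  have p: "0 < 1 + \<tau> x" for x using \<tau>_nonneg[of x] by simp
  define D where "D x = (?N * \<eta> x ^ Suc k) *\<^sub>R D\<eta> x" for x
  have cut: "C1_cutoff (\<lambda>x. \<eta> x ^ ?N) D"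
    unfolding C1_cutoff_def
  proof (intro conjI allI)
    fix x
    have "(\<eta> has_derivative (\<lambda>h. D\<eta> x \<bullet> h)) (at x)" using \<eta>(1) by (simp add: C1_cutoff_def)
    from has_derivative_power[OF this, of ?N]
    show "((\<lambda>x. \<eta> x ^ ?N) has_derivative (\<lambda>h. D x \<bullet> h)) (at x)"
      by (rule has_derivative_eq_rhs) (simp add: D_def k1 fun_eq_iff)
    show "continuous_on UNIV D" unfolding D_def[abs_def] by (intro continuous_intros c\<eta>)
    show "\<exists>R. \<forall>x. R < norm x \<longrightarrow> \<eta> x ^ ?N = 0 \<and> D x = 0"
      using R n by (intro exI[of _ R]) (auto simp: D_def)
  qed
  have cD: "continuous_on UNIV D" using C1_cutoff_continuous[OF cut] by auto
  have RD: "D x = 0" if "R < norm x" for x using R(3)[OF that] by (simp add: D_def)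
  define \<alpha> where "\<alpha> x = 1 / ((1 + \<tau> x) * W x ^ Suc k)" for x
  \<comment> \<open>(1 + \<tau>)^2 times the derivative of t \<kappa>(t) at \<tau>; the second part
    carries the energy.\<close>
  define \<beta> where "\<beta> x = 1 / W x ^ Suc k - Suc k * \<tau> x / W x ^ ?N" for x
  define X where "X x = \<alpha> x * flux (Dg x) (g x) (D x) + (?N * \<eta> x ^ ?N * \<beta> x / (1 + \<tau> x) ^ 2) * det (Dg x)" for x
  have nz: "1 + \<tau> x \<noteq> 0" "W x \<noteq> 0" for x using p[of x] W(3)[of x] by auto
  have c\<alpha>: "continuous_on UNIV \<alpha>"
    unfolding \<alpha>_def[abs_def] by (intro continuous_intros continuous_\<tau> cW) (simp add: nz)
  have c\<beta>: "continuous_on UNIV (\<lambda>x. ?N * \<eta> x ^ ?N * \<beta> x / (1 + \<tau> x) ^ 2)"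
    unfolding \<beta>_def[abs_def] by (intro continuous_intros continuous_\<tau> cW c\<eta>) (simp_all add: nz)
  have iX: "integrable lborel X"
    unfolding X_def using R n
    by (intro Bochner_Integration.integrable_add integrable_flux[OF c\<alpha> cD RD] integrable_det[OF c\<beta>, where R=R]) auto
  have X0: "(LINT x|lborel. X x) = 0"
  proof -
    define \<kappa> where "\<kappa> t = 1 / ((1 + t) * (L + ln (1 + t)) ^ Suc k)" for t
    define \<kappa>' where "\<kappa>' t = - (((L + ln (1 + t)) ^ Suc k + Suc k * (L + ln (1 + t)) ^ k) / ((1 + t) * (L + ln (1 + t)) ^ Suc k) ^ 2)" for t
    have Lp: "0 < L + ln (1 + t)" if "0 \<le> t" for t using L ln_ge_zero[of "1 + t"] that by linarith
    have dW: "((\<lambda>t. (1 + t) * (L + ln (1 + t)) ^ Suc k) has_real_derivative (L + ln (1 + t)) ^ Suc k + Suc k * (L + ln (1 + t)) ^ k) (at t)" if "0 \<le> t" for t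
    proof -
      have dl: "((\<lambda>t. L + ln (1 + t)) has_real_derivative 1 / (1 + t)) (at t)"
        using that by (auto intro!: derivative_eq_intros simp: field_simps)
      have "((\<lambda>t. 1 + t) has_real_derivative 1) (at t)" by (auto intro!: derivative_eq_intros)
      from DERIV_mult[OF this DERIV_power[OF dl, of "Suc k"]] show ?thesis
        using that by (auto intro: DERIV_cong simp del: power_Suc)
    qed
    have "(\<kappa> has_real_derivative \<kappa>' t) (at t)" if "0 \<le> t" for t
    proof -
      have "(1 + t) * (L + ln (1 + t)) ^ Suc k \<noteq> 0" using Lp[OF that] that by simp
      from DERIV_inverse'[OF dW[OF that] this]
      have "((\<lambda>t. 1 / ((1 + t) * (L + ln (1 + t)) ^ Suc k)) has_real_derivative \<kappa>' t) (at t)"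
        unfolding inverse_eq_divide by (rule DERIV_cong) (simp add: \<kappa>'_def power2_eq_square del: power_Suc)
      then show ?thesis by (simp only: \<kappa>_def[abs_def])
    qed
    moreover have "continuous_on {0..} \<kappa>'"
      unfolding \<kappa>'_def[abs_def] using Lp by (intro continuous_intros) (auto simp: less_imp_neq[symmetric])
    ultimately have "(LINT x|lborel. \<kappa> (\<tau> x) * flux (Dg x) (g x) (D x)
     + ?N * \<eta> x ^ ?N * (\<kappa> (\<tau> x) + \<tau> x * \<kappa>' (\<tau> x)) * det (Dg x)) = 0"
      unfolding \<tau>_def by (rule radial_identity[OF g n cut])
    moreover have "\<kappa> (\<tau> x) = \<alpha> x" for x by (simp add: \<kappa>_def \<alpha>_def W_def u_def)
    moreover have "\<alpha> x + \<tau> x * \<kappa>' (\<tau> x) = \<beta> x / (1 + \<tau> x) ^ 2" for x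
    proof -
      have alg0: "1 / (v * (w * a)) + (v - 1) * (- ((w * a + m * a) / (v * (w * a)) ^ 2)) = (1 / (w * a) - m * (v - 1) / (w * (w * a))) / v ^ 2"
        if "v \<noteq> 0" "w \<noteq> 0" "a \<noteq> 0" for v w a m :: real
        using that by (simp add: field_simps power2_eq_square)
      have alg: "1 / (v * w ^ Suc k) + (v - 1) * (- ((w ^ Suc k + Suc k * w ^ k) / (v * w ^ Suc k) ^ 2))
          = (1 / w ^ Suc k - Suc k * (v - 1) / w ^ Suc (Suc k)) / v ^ 2" if "0 < v" "0 < w" for v w :: real
        using alg0[of v w "w ^ k" "Suc k"] that by (simp only: power_Suc) simp
      show ?thesis using alg[OF p[of x] W(3)[of x]]
        unfolding \<alpha>_def \<kappa>'_def \<beta>_def k by (simp add: W_def u_def del: power_Suc of_nat_Suc)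
    qed
    ultimately show ?thesis by (simp add: X_def)
  qed
  define E where "E x = (\<eta> x * (Y x / W x)) ^ (?N - 1) * norm (D\<eta> x)" for x
  have E0: "0 \<le> E x" for x using \<eta>(2)[of x] Y_nonneg[of x] W(3)[of x] by (simp add: E_def)
  have iE: "integrable lborel E"
  proof -
    have "integrable lborel (\<lambda>x. ((\<eta> x / (r x * W x)) ^ (?N - 1) * norm (D\<eta> x)) * norm (Dg x) ^ (?N - 1))"
      using less_imp_neq[OF r_pos, symmetric]
      by (intro integrable_power[where R=R]) (auto intro!: continuous_intros c\<eta> continuous_r cW simp: R nz)
    then show ?thesis unfolding E_def by (simp add: Y_def power_divide power_mult_distrib mult_ac)
  qed
  have iJ: "integrable lborel (\<lambda>x. \<eta> x ^ ?N * J x)"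
    using R n by (intro integrable_J[where R=R] continuous_intros c\<eta>) auto
  define A where "A = C / L ^ (?N - 1)"
  define U where "U x = A * (\<eta> x ^ ?N * J x) + C * E x - c / ?N * X x" for x
  have iU: "integrable lborel U"
    unfolding U_def by (intro Bochner_Integration.integrable_add Bochner_Integration.integrable_diff integrable_mult_right iX iE iJ)
  have lo: "0 \<le> (\<eta> x * (Y x / W x)) ^ ?N" for x
    using \<eta>(2) Y_nonneg W(3) by (intro zero_le_power mult_nonneg_nonneg divide_nonneg_pos) auto
  have up: "AE x in lborel. (\<eta> x * (Y x / W x)) ^ ?N \<le> U x"
      using comparability
    proof eventually_elim
      case (elim x)
      define P where "P = \<eta> x ^ ?N"
      have P0: "0 \<le> P" using \<eta>(2) by (simp add: P_def)
      have d0: "0 \<le> d x" using elim by simp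
      define f where "f = \<alpha> x * flux (Dg x) (g x) (D x)"
      have fE: "f \<le> ?N * ((fact ?N * ?N) * E x)"
      proof -
        have "f \<le> (\<bar>flux (Dg x) (g x) (D x)\<bar> / (1 + \<tau> x)) / W x ^ Suc k"
          unfolding f_def \<alpha>_def using p[of x] W(3)[of x] by (simp add: divide_right_mono)
        also have "\<dots> \<le> ((fact ?N * ?N) * (norm (D x) * Y x ^ (?N - 1))) / W x ^ Suc k"
          using W(3)[of x] by (intro divide_right_mono flux_bound) auto
        also have "\<dots> = ?N * ((fact ?N * ?N) * E x)"
          using \<eta>(2)[of x] by (simp add: D_def E_def k1 power_mult_distrib power_divide mult_ac del: power_Suc)
        finally show ?thesis .
      qed
      have Xx: "X x = f + ?N * (P * (\<beta> x * d x))" by (simp add: X_def f_def d_def P_def)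
      have "(\<eta> x * (Y x / W x)) ^ ?N = P * (Y x ^ ?N / W x ^ ?N)" by (simp add: P_def power_mult_distrib power_divide)
      also have "\<dots> \<le> P * (c * ((1 + \<tau> x) * d x) / W x ^ ?N)"
        using elim P0 W(3)[of x] by (intro mult_left_mono divide_right_mono) auto
      also have "\<dots> = c * (P * (d x / W x ^ ?N)) + c * (P * (\<tau> x * d x / W x ^ ?N))"
        by (simp add: algebra_simps add_divide_distrib)
      \<comment> \<open>The factor \<open>Suc k\<close>, at least 1, is inserted to complete the
        second part of \<beta>.\<close>
      also have "\<dots> \<le> c * (P * (d x / L ^ Suc k)) + c * (P * (Suc k * \<tau> x * d x / W x ^ ?N))"
      proof (intro add_mono mult_left_mono P0 divide_right_mono)
        have "L ^ Suc k \<le> W x ^ Suc k" using L W(2) by (intro power_mono) auto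
        also have "\<dots> \<le> W x ^ ?N" unfolding k using W(1) by (intro power_increasing) auto
        finally show "d x / W x ^ ?N \<le> d x / L ^ Suc k" using L d0 W(3)[of x] by (intro divide_left_mono) auto
        show "\<tau> x * d x \<le> Suc k * \<tau> x * d x" using \<tau>_nonneg[of x] d0 by (intro mult_right_mono) (auto simp: mult_le_cancel_right1)
      qed (use c W(3)[of x] in auto)
      also have "c * (P * (Suc k * \<tau> x * d x / W x ^ ?N)) = c * (P * (d x / W x ^ Suc k)) - c * (P * (\<beta> x * d x))"
        by (simp add: \<beta>_def algebra_simps del: power_Suc)
      also have "c * (P * (d x / W x ^ Suc k)) \<le> c * (P * (d x / L ^ Suc k))"
        using L W(2)[of x] d0 P0 c W(3)[of x] by (intro mult_left_mono divide_left_mono power_mono) auto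
      also have "c * (P * (\<beta> x * d x)) = c / ?N * X x - c / ?N * f" using n unfolding Xx by (simp add: distrib_left)
      also have "c / ?N * f \<le> c / ?N * (?N * ((fact ?N * ?N) * E x))" using c by (intro mult_left_mono fE) auto
      also have "c / ?N * (?N * ((fact ?N * ?N) * E x)) = (c * (fact ?N * ?N)) * E x" using n by simp
      also have "(c * (fact ?N * ?N)) * E x \<le> C * E x" by (intro mult_right_mono C_bounds E0)
      also have "P * (d x / L ^ Suc k) \<le> P * (J x / L ^ Suc k)" using elim L P0 by (intro mult_left_mono divide_right_mono) auto
      also have "c * (P * (J x / L ^ Suc k)) + (c * (P * (J x / L ^ Suc k)) - (c / ?N * X x - C * E x)) = (2 * c) * (P * (J x / L ^ Suc k)) + C * E x - c / ?N * X x" by simp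
      also have "(2 * c) * (P * (J x / L ^ Suc k)) \<le> C * (P * (J x / L ^ Suc k))"
        using P0 J(2)[of x] L by (intro mult_right_mono C_bounds) auto
      also have "C * (P * (J x / L ^ Suc k)) + C * E x - c / ?N * X x = U x" by (simp add: U_def A_def P_def k1)
      finally show ?case using c by simp
    qed
  have "(LINT x|lborel. (\<eta> x * (Y x / W x)) ^ ?N) \<le> (LINT x|lborel. U x)"
    using up by (intro integral_mono_AE'[OF iU up]) (auto elim!: eventually_mono intro: order_trans[OF lo])
  also have "\<dots> = A * (LINT x|lborel. \<eta> x ^ ?N * J x) + C * (LINT x|lborel. E x)"
    unfolding U_def using iX iE iJ by (simp add: X0)
  finally show ?thesis by (simp add: A_def E_def W_def)
qed

lemma variation:
  assumes F: "\<And>t. (F has_real_derivative F' t) (at t)" "continuous_on UNIV F'" "\<And>t. 0 \<le> F' t"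
    and A: "A \<in> sets borel" "A' \<in> sets borel" "bounded A'" "\<And>x t. x \<in> A \<Longrightarrow> 0 \<le> t \<Longrightarrow> t \<le> 1 \<Longrightarrow> x + t *\<^sub>R z \<in> A'"
  shows "(\<integral>\<^sup>+x\<in>A. ennreal \<bar>F (u (x + z)) - F (u x)\<bar> \<partial>lborel) \<le> ennreal (norm z * C) * (\<integral>\<^sup>+x\<in>A'. ennreal (F' (u x) * Y x) \<partial>lborel)"
proof -
  let ?N = "CARD('n)"
  obtain k where k: "?N = Suc (Suc k)" using n by (cases "CARD('n)"; cases "CARD('n) - 1") auto
  \<comment> \<open>As a function on the target, F(u) is C^1 also at the origin, because |y|^n is so
    for n at least 2; the variation estimate for composed maps therefore applies.\<close>
  define h where "h y = F (ln (1 + norm y ^ ?N))" for y :: "real^'n"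
  define Dh where "Dh y = (F' (ln (1 + norm y ^ ?N)) * (?N * norm y ^ (?N - 2) / (1 + norm y ^ ?N))) *\<^sub>R y" for y :: "real^'n"
  have p: "0 < 1 + norm y ^ ?N" for y :: "real^'n" by (rule add_pos_nonneg) auto
  have h: "(h has_derivative (\<lambda>v. Dh y \<bullet> v)) (at y)" for y
  proof -
    have "((\<lambda>y::real^'n. 1 + norm y ^ ?N) has_derivative (\<lambda>h. ?N * norm y ^ (?N - 2) * (y \<bullet> h))) (at y)"
      using has_derivative_add[OF has_derivative_const has_derivative_norm_power[OF n]] by simp
    from has_derivative_ln[OF p this]
    have "((\<lambda>y::real^'n. ln (1 + norm y ^ ?N)) has_derivative (\<lambda>h. (?N * norm y ^ (?N - 2) * (y \<bullet> h)) * inverse (1 + norm y ^ ?N))) (at y)"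
      by (simp add: mult_ac)
    moreover have "(F has_derivative (\<lambda>h. F' t * h)) (at t)" for t
      using F(1) by (simp add: has_field_derivative_def)
    ultimately have "((\<lambda>y::real^'n. F (ln (1 + norm y ^ ?N))) has_derivative
        (\<lambda>h. F' (ln (1 + norm y ^ ?N)) * ((?N * norm y ^ (?N - 2) * (y \<bullet> h)) * inverse (1 + norm y ^ ?N)))) (at y)"
      by (rule has_derivative_compose)
    then show ?thesis unfolding h_def[abs_def] Dh_def by (simp add: inverse_eq_divide mult_ac)
  qed
  have cl: "continuous_on UNIV (\<lambda>y::real^'n. ln (1 + norm y ^ ?N))"
    by (intro continuous_intros) (use p in \<open>auto simp: less_imp_neq[OF p, symmetric]\<close>)
  have cDh: "continuous_on UNIV Dh"
    unfolding Dh_def[abs_def]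
    by (intro continuous_intros continuous_on_compose2[OF F(2) cl]) (use less_imp_neq[OF p, symmetric] in auto)
  have "(\<integral>\<^sup>+x\<in>A. ennreal \<bar>h (g (x + z)) - h (g x)\<bar> \<partial>lborel) \<le> ennreal (norm z) * (\<integral>\<^sup>+x\<in>A'. ennreal (norm (Dh (g x)) * norm (Dg x)) \<partial>lborel)"
    by (rule locally_approximable_variation[OF g _ h cDh A]) (use n in auto)
  also have "\<dots> \<le> ennreal (norm z) * (\<integral>\<^sup>+x\<in>A'. ennreal (C * (F' (u x) * Y x)) \<partial>lborel)"
  proof (intro mult_left_mono nn_integral_mono mult_right_mono ennreal_leI)
    fix x
    have "norm (Dg x) = Y x * r x" using r_pos[of x] by (simp add: Y_def)
    then have "norm (Dh (g x)) * norm (Dg x) = F' (u x) * (?N * (norm (g x) ^ (?N - 2) * norm (g x)) / (1 + \<tau> x)) * (Y x * r x)"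
      using F(3) \<tau>_nonneg[of x] by (simp add: Dh_def \<tau>_def u_def abs_mult)
    also have "norm (g x) ^ (?N - 2) * norm (g x) = norm (g x) ^ (?N - 1)" by (simp add: k)
    also have "F' (u x) * (?N * norm (g x) ^ (?N - 1) / (1 + \<tau> x)) * (Y x * r x) \<le> F' (u x) * (?N * r x ^ (?N - 1) / (1 + \<tau> x)) * (Y x * r x)"
      using F(3) \<tau>_nonneg[of x] Y_nonneg r_pos[of x]
      by (intro mult_right_mono mult_left_mono divide_right_mono power_mono norm_g_le_r mult_nonneg_nonneg) auto
    also have "\<dots> = ?N * (F' (u x) * Y x) * ((r x ^ (?N - 1) * r x) / (1 + \<tau> x))" by (simp add: mult_ac)
    also have "\<dots> = ?N * (F' (u x) * Y x)" unfolding r_power_pred using \<tau>_nonneg[of x] by simp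
    also have "\<dots> \<le> C * (F' (u x) * Y x)" using F(3) Y_nonneg by (intro mult_right_mono C_bounds) auto
    finally show "norm (Dh (g x)) * norm (Dg x) \<le> C * (F' (u x) * Y x)" .
  qed auto
  also have "(\<integral>\<^sup>+x\<in>A'. ennreal (C * (F' (u x) * Y x)) \<partial>lborel) = ennreal C * (\<integral>\<^sup>+x\<in>A'. ennreal (F' (u x) * Y x) \<partial>lborel)"
  proof -
    have [measurable]: "Y \<in> borel_measurable borel" "(\<lambda>x. F' (u x)) \<in> borel_measurable borel" "A' \<in> sets borel"
      using measurable_Y A(2) by (auto intro!: borel_measurable_continuous_onI continuous_on_compose2[OF F(2) continuous_u])
    have "ennreal (C * (F' (u x) * Y x)) * indicator A' x = ennreal C * (ennreal (F' (u x) * Y x) * indicator A' x)" for x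
      using C_bounds(1) F(3) Y_nonneg by (subst ennreal_mult) (auto simp: mult.assoc)
    then show ?thesis by (simp add: nn_integral_cmult)
  qed
  also have "ennreal (norm z) * (ennreal C * (\<integral>\<^sup>+x\<in>A'. ennreal (F' (u x) * Y x) \<partial>lborel)) = ennreal (norm z * C) * (\<integral>\<^sup>+x\<in>A'. ennreal (F' (u x) * Y x) \<partial>lborel)"
    using C_bounds(1) by (simp add: ennreal_mult mult.assoc)
  finally show ?thesis by (simp add: h_def u_def \<tau>_def)
qed

theorem growth_data: "growth_data C J u Y"
proof -
  have dim: "DIM(real^'n) = CARD('n)" by simp
  have upper: "AE x in lborel. Y x ^ CARD('n) \<le> C * exp (u x) * J x"
    using comparability
  proof eventually_elim
    case (elim x)
    have "c * ((1 + \<tau> x) * d x) \<le> C * ((1 + \<tau> x) * J x)"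
      using elim c C_bounds(1,3) \<tau>_nonneg[of x] by (intro mult_mono) auto
    then show ?case using elim by (simp add: exp_u mult.assoc)
  qed
  have Y_int: "set_integrable lborel (cball 0 R) (\<lambda>x. Y x ^ CARD('n))" for R
    using locally_approximable_norm_power_integrable[OF g, of R] unfolding set_integrable_def
  proof (rule Bochner_Integration.integrable_bound)
    show "(\<lambda>x. indicat_real (cball 0 R) x *\<^sub>R Y x ^ CARD('n)) \<in> borel_measurable lborel"
      using measurable_Y by (intro borel_measurable_scaleR borel_measurable_indicator) auto
    show "AE x in lborel. norm (indicat_real (cball 0 R) x *\<^sub>R Y x ^ CARD('n)) \<le> norm (indicat_real (cball 0 R) x *\<^sub>R norm (Dg x) ^ CARD('n))"
      using power_mono[OF Y_le Y_nonneg] Y_nonneg by (intro AE_I2) (auto simp: indicator_def)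
  qed
  show ?thesis
    by (rule growth_data.intro; (unfold dim)?)
      (fact C_bounds(1) n J locally_integrable_J continuous_u u_nonneg measurable_Y Y_nonneg Y_int mass log_energy variation upper)+
qed

end

section \<open>Stereographic projection\<close>

lemma sum_UNIV_option: "(\<Sum>a\<in>UNIV. F a) = F None + (\<Sum>k\<in>(UNIV::'n::finite set). F (Some k))"
  by (simp add: UNIV_option_conv sum.reindex o_def)

text \<open>The matrix defining the volume form is multiplied by \<open>transpose Q\<close>; this
  allows any omitted point to be rotated to the pole.\<close>

lemma sphere_det_orthogonal:
  fixes Q :: "real^('n::finite option)^('n option)" and A :: "real^'n^('n option)"
  assumes "det Q = 1" shows "sphere_det (Q *v y) (Q ** A) = sphere_det y A"
proof -
  define M where "M = (\<chi> a. case a of None \<Rightarrow> y | Some j \<Rightarrow> A *v axis j 1)"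
  have "(\<chi> a. case a of None \<Rightarrow> Q *v y | Some j \<Rightarrow> (Q ** A) *v axis j 1) = M ** transpose Q"
    by (simp add: vec_eq_iff M_def matrix_matrix_mult_def transpose_def matrix_vector_mult_basis column_def
        matrix_vector_mul_component inner_vec_def mult.commute split: option.split)
  then have "sphere_det (Q *v y) (Q ** A) = det (M ** transpose Q)"
    by (simp add: sphere_det_def sphere_volume_form_def)
  then show ?thesis using assms by (simp add: det_mul sphere_det_def sphere_volume_form_def M_def)
qed

text \<open>Projection from the pole \<open>- axis None 1\<close>. With this pole the orientation
  given by the outward normal is preserved, so no sign appears in
  \<open>sphere_det_stereographic\<close>.\<close>

definition stereographic :: "real^('n::finite option) \<Rightarrow> real^'n" where
  "stereographic y = (\<chi> k. y $ Some k / (1 + y $ None))"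

definition stereographic_deriv :: "real^('n::finite option) \<Rightarrow> real^('n option)^'n" where
  "stereographic_deriv y = (\<chi> k a. case a of None \<Rightarrow> - (y $ Some k / (1 + y $ None) ^ 2)
     | Some l \<Rightarrow> if l = k then 1 / (1 + y $ None) else 0)"

lemma stereographic_deriv_mult_component:
  "(stereographic_deriv y *v w) $ k = w $ Some k / (1 + y $ None) - y $ Some k * w $ None / (1 + y $ None) ^ 2"
proof -
  have "(\<Sum>l\<in>UNIV. (if l = k then 1 / (1 + y $ None) else 0) * w $ Some l) = w $ Some k / (1 + y $ None)"
    by (simp add: if_distrib[of "\<lambda>x. x * _"] cong: if_cong)
  then show ?thesis
    by (simp add: stereographic_deriv_def matrix_vector_mult_def sum_UNIV_option)
qed

locale sphere_point =
  fixes y :: "real^('n::finite option)"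
  assumes norm_y: "norm y = 1" and not_pole: "y $ None \<noteq> -1"
begin

abbreviation t where "t \<equiv> y $ None"

lemma sum_squares: "(\<Sum>k\<in>UNIV. (y $ Some k) ^ 2) = 1 - t ^ 2"
proof -
  have "1 = y \<bullet> y" using norm_y by (simp add: dot_square_norm)
  then show ?thesis by (simp add: inner_vec_def sum_UNIV_option power2_eq_square)
qed

lemma t_gt: "0 < 1 + t"
proof -
  have "\<bar>t\<bar> \<le> 1" using component_le_norm_cart[of y None] norm_y by simp
  then show ?thesis using not_pole by linarith
qed

lemma norm_stereographic: "1 + norm (stereographic y) ^ 2 = 2 / (1 + t)"
proof -
  have "norm (stereographic y) ^ 2 = (\<Sum>k\<in>UNIV. (y $ Some k) ^ 2) / (1 + t) ^ 2"
    by (simp add: norm_vec_def L2_set_def sum_nonneg stereographic_def power_divide sum_divide_distrib)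
  moreover have "1 + (1 - (q - 1) ^ 2) / q ^ 2 = 2 / q" if "0 < q" for q :: real
    using that by (simp add: field_simps power2_eq_square)
  from this[OF t_gt] have "1 + (1 - t ^ 2) / (1 + t) ^ 2 = 2 / (1 + t)" by simp
  ultimately show ?thesis by (simp add: sum_squares)
qed

lemma sum_tangent:
  assumes "y \<bullet> w = 0" shows "(\<Sum>k\<in>UNIV. y $ Some k * w $ Some k) = - t * w $ None"
  using assms by (simp add: inner_vec_def sum_UNIV_option)

text \<open>Expanding the square and eliminating the sums by |y| = 1 and by tangency leaves a
  rational identity in q = 1 + t. That the factor is the same in all directions is what transfers
  the distortion inequality to the chart.\<close>

lemma conformal:
  assumes w: "y \<bullet> w = 0" shows "norm (stereographic_deriv y *v w) = norm w / (1 + t)"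
proof -
  define q where "q = 1 + t"
  have q: "0 < q" using t_gt by (simp add: q_def)
  have "norm (stereographic_deriv y *v w) ^ 2 = (\<Sum>k\<in>UNIV. (w $ Some k / q - y $ Some k * w $ None / q ^ 2) ^ 2)"
    by (simp add: norm_vec_def L2_set_def sum_nonneg stereographic_deriv_mult_component q_def)
  also have "\<dots> = (\<Sum>k\<in>UNIV. (w $ Some k) ^ 2 / q ^ 2 - 2 * w $ None / q ^ 3 * (y $ Some k * w $ Some k) + (w $ None) ^ 2 / q ^ 4 * (y $ Some k) ^ 2)"
    using q by (intro sum.cong refl) (simp add: field_simps eval_nat_numeral)
  also have "\<dots> = (\<Sum>k\<in>UNIV. (w $ Some k) ^ 2) / q ^ 2 - 2 * w $ None / q ^ 3 * (- t * w $ None) + (w $ None) ^ 2 / q ^ 4 * (1 - t ^ 2)"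
    unfolding sum.distrib sum_subtractf sum_divide_distrib[symmetric] sum_distrib_left[symmetric] sum_squares sum_tangent[OF w] ..
  also have "\<dots> = ((w $ None) ^ 2 + (\<Sum>k\<in>UNIV. (w $ Some k) ^ 2)) / q ^ 2"
  proof -
    have t: "t = q - 1" by (simp add: q_def)
    have "S / q ^ 2 - 2 * a / q ^ 3 * (- (q - 1) * a) + a ^ 2 / q ^ 4 * (1 - (q - 1) ^ 2) = (a ^ 2 + S) / q ^ 2" for S a
      using q by (simp add: field_simps eval_nat_numeral)
    then show ?thesis unfolding t .
  qed
  also have "(w $ None) ^ 2 + (\<Sum>k\<in>UNIV. (w $ Some k) ^ 2) = norm w ^ 2"
    by (simp add: norm_vec_def L2_set_def sum_nonneg sum_UNIV_option)
  finally have "norm (stereographic_deriv y *v w) ^ 2 = (norm w / q) ^ 2" by (simp add: power_divide)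
  then show ?thesis using q by (simp add: power2_eq_iff_nonneg q_def)
qed

text \<open>Row operations turn the matrix with columns \<open>y, A e\<^sub>1, \<dots>, A e\<^sub>n\<close> into a block matrix with the
  single entry \<open>1\<close> in its first row.\<close>

lemma sphere_det_stereographic:
  fixes A :: "real^'n^('n option)"
  assumes tangent: "\<And>v. y \<bullet> (A *v v) = 0"
  shows "sphere_det y A = (1 + t) ^ CARD('n) * det (stereographic_deriv y ** A)"
proof -
  define q where "q = 1 + t"
  have q: "0 < q" using t_gt by (simp add: q_def)
  define M where "M = (\<chi> a. case a of None \<Rightarrow> y | Some j \<Rightarrow> A *v axis j 1)"
  define Mt where "Mt = transpose M"
  have Mt: "Mt $ b $ None = y $ b" "Mt $ b $ Some j = A $ b $ j" for b j
    by (simp_all add: Mt_def M_def transpose_def matrix_vector_mult_basis column_def)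
  \<comment> \<open>\<open>E\<close> subtracts y_k / q times the first row from row k;
    \<open>F\<close> then adds y_l times row l to the first row, which by |y| = 1 and tangency
    becomes (1, 0, ..., 0).\<close>
  define E :: "real^('n option)^('n option)" where "E = (\<chi> a b. case a of None \<Rightarrow> (case b of None \<Rightarrow> 1 | Some l \<Rightarrow> 0)
    | Some k \<Rightarrow> (case b of None \<Rightarrow> - y $ Some k / q | Some l \<Rightarrow> if l = k then 1 else 0))"
  define F :: "real^('n option)^('n option)" where "F = (\<chi> a b. case a of None \<Rightarrow> (case b of None \<Rightarrow> 1 | Some l \<Rightarrow> y $ Some l)
    | Some k \<Rightarrow> (case b of None \<Rightarrow> 0 | Some l \<Rightarrow> if l = k then 1 else 0))"
  have id: "(\<chi> i j. if j = i then 1 else 0) = (mat 1 :: real^'n^'n)" by (simp add: mat_def vec_eq_iff eq_commute)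
  have detE: "det E = 1" by (subst det_option_block) (simp_all add: E_def id)
  have "det (transpose F) = 1"
    by (subst det_option_block) (simp_all add: F_def transpose_def id[unfolded vec_eq_iff] mat_def[symmetric] eq_commute)
  then have detF: "det F = 1" by (simp add: det_transpose)
  define P where "P = F ** (E ** Mt)"
  have pick: "(\<Sum>l\<in>UNIV. (if l = k then 1 else 0) * X l) = X k" for k :: 'n and X :: "'n \<Rightarrow> real"
    by (simp add: if_distrib[of "\<lambda>x. x * _"] cong: if_cong)
  have E1: "(E ** Mt) $ None $ b = Mt $ None $ b" for b
    by (simp add: matrix_matrix_mult_def sum_UNIV_option E_def)
  have E2: "(E ** Mt) $ Some k $ b = Mt $ Some k $ b - y $ Some k / q * Mt $ None $ b" for k b
    by (simp add: matrix_matrix_mult_def sum_UNIV_option E_def pick)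
  have P2: "P $ Some k $ b = Mt $ Some k $ b - y $ Some k / q * Mt $ None $ b" for k b
    unfolding P_def by (subst matrix_matrix_mult_def) (simp add: sum_UNIV_option F_def pick E2)
  have P1: "P $ None $ b = Mt $ None $ b + ((\<Sum>k\<in>UNIV. y $ Some k * Mt $ Some k $ b) - (1 - t ^ 2) / q * Mt $ None $ b)" for b
  proof -
    have "P $ None $ b = Mt $ None $ b + (\<Sum>k\<in>UNIV. y $ Some k * (Mt $ Some k $ b - y $ Some k / q * Mt $ None $ b))"
      unfolding P_def by (subst matrix_matrix_mult_def) (simp add: sum_UNIV_option F_def E1 E2)
    also have "(\<Sum>k\<in>UNIV. y $ Some k * (Mt $ Some k $ b - y $ Some k / q * Mt $ None $ b))
        = (\<Sum>k\<in>UNIV. y $ Some k * Mt $ Some k $ b) - (\<Sum>k\<in>UNIV. (y $ Some k) ^ 2) / q * Mt $ None $ b"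
      by (simp add: right_diff_distrib sum_subtractf sum_distrib_right sum_divide_distrib power2_eq_square mult.assoc)
    finally show ?thesis unfolding sum_squares .
  qed
  have t: "t = q - 1" by (simp add: q_def)
  have fac: "1 - t ^ 2 = (2 - q) * q" unfolding t by (simp add: power2_eq_square algebra_simps)
  have fac': "(1 - t ^ 2) / q = 2 - q" unfolding fac using q by simp
  have "P $ None $ None = 1"
  proof -
    have "(\<Sum>k\<in>UNIV. y $ Some k * y $ Some k) = (2 - q) * q" using sum_squares fac by (simp add: power2_eq_square)
    then show ?thesis unfolding P1 Mt fac' by (simp add: t algebra_simps)
  qed
  moreover have "P $ None $ Some j = 0" for j
  proof -
    have "(\<Sum>k\<in>UNIV. y $ Some k * A $ Some k $ j) = - t * A $ None $ j"
      using sum_tangent[OF tangent[of "axis j 1"]] by (simp add: matrix_vector_mult_basis column_def)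
    then show ?thesis unfolding P1 Mt fac' by (simp add: t algebra_simps)
  qed
  ultimately have "det P = det (\<chi> i j. P $ Some i $ Some j)" by (intro det_option_block) auto
  also have "(\<chi> i j. P $ Some i $ Some j) = (\<chi> i. q *s (stereographic_deriv y ** A) $ i)"
  proof -
    have "(stereographic_deriv y ** A) $ i $ j = A $ Some i $ j / q - y $ Some i * A $ None $ j / q ^ 2" for i j
      using stereographic_deriv_mult_component[of y "\<chi> a. A $ a $ j" i]
      by (simp add: matrix_matrix_mult_def matrix_vector_mult_def q_def)
    then show ?thesis using q by (simp add: vec_eq_iff P2 Mt field_simps power2_eq_square)
  qed
  also have "det \<dots> = q ^ CARD('n) * det (stereographic_deriv y ** A)" by (subst det_rows_mul) simp
  also have "det P = sphere_det y A"
    by (simp add: P_def det_mul detE detF Mt_def det_transpose M_def sphere_det_def sphere_volume_form_def)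
  finally show ?thesis by (simp add: q_def)
qed

text \<open>The norm of a matrix is here the Euclidean norm of its entries, bounded by the sum of
  their n^2 absolute values; this is the origin of the factor (n^2)^n in the distortion of a
  chart.\<close>

lemma norm_stereographic_deriv_le:
  fixes A :: "real^'n^('n option)"
  assumes tangent: "\<And>v. y \<bullet> (A *v v) = 0"
  shows "norm (stereographic_deriv y ** A) \<le> CARD('n) ^ 2 * (onorm ((*v) A) / (1 + t))"
proof -
  let ?B = "stereographic_deriv y ** A"
  have "\<bar>?B $ k $ j\<bar> \<le> onorm ((*v) A) / (1 + t)" for k j
  proof -
    have "?B $ k $ j = (?B *v axis j 1) $ k" by (simp add: matrix_vector_mult_basis column_def)
    then have "\<bar>?B $ k $ j\<bar> \<le> norm (?B *v axis j 1)" by (simp add: component_le_norm_cart)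
    also have "?B *v axis j 1 = stereographic_deriv y *v (A *v axis j 1)" by (simp add: matrix_vector_mul_assoc)
    also have "norm \<dots> = norm (A *v axis j 1) / (1 + t)" by (rule conformal[OF tangent])
    also have "\<dots> \<le> onorm ((*v) A) / (1 + t)"
      using onorm[OF matrix_vector_mul_bounded_linear, of A "axis j 1"] t_gt by (intro divide_right_mono) auto
    finally show ?thesis .
  qed
  then have "(\<Sum>k\<in>UNIV. \<Sum>j\<in>UNIV. \<bar>?B $ k $ j\<bar>) \<le> (\<Sum>k\<in>(UNIV::'n set). \<Sum>j\<in>(UNIV::'n set). onorm ((*v) A) / (1 + t))"
    by (intro sum_mono)
  then show ?thesis using norm_matrix_le_sum[of ?B] by (simp add: power2_eq_square)
qed

lemma distortion_stereographic:
  fixes A :: "real^'n^('n option)" and K :: real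
  assumes tangent: "\<And>v. y \<bullet> (A *v v) = 0" and K: "onorm ((*v) A) ^ CARD('n) \<le> K * sphere_det y A"
  shows "norm (stereographic_deriv y ** A) ^ CARD('n) \<le> real ((CARD('n) ^ 2) ^ CARD('n)) * K * det (stereographic_deriv y ** A)"
proof -
  let ?B = "stereographic_deriv y ** A"
  have "norm ?B ^ CARD('n) \<le> (CARD('n) ^ 2 * (onorm ((*v) A) / (1 + t))) ^ CARD('n)"
    by (intro power_mono norm_stereographic_deriv_le tangent) simp
  also have "\<dots> = real ((CARD('n) ^ 2) ^ CARD('n)) * (onorm ((*v) A) ^ CARD('n) / (1 + t) ^ CARD('n))"
    by (simp add: power_mult_distrib power_divide)
  also have "\<dots> \<le> real ((CARD('n) ^ 2) ^ CARD('n)) * (K * ((1 + t) ^ CARD('n) * det ?B) / (1 + t) ^ CARD('n))"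
    using K t_gt unfolding sphere_det_stereographic[OF tangent] by (intro mult_left_mono divide_right_mono) auto
  also have "\<dots> = real ((CARD('n) ^ 2) ^ CARD('n)) * K * det ?B" using t_gt by simp
  finally show ?thesis .
qed

end

text \<open>Makes stereographic projection globally \<open>C\<^sup>1\<close> without changing it on a compact subset of its domain.\<close>

lemma C1_reciprocal_extension:
  fixes \<delta> :: real assumes \<delta>: "0 < \<delta>"
  obtains \<rho> \<rho>' where "\<And>s. (\<rho> has_real_derivative \<rho>' s) (at s)" "continuous_on UNIV \<rho>'"
    "\<And>s. \<delta> \<le> 1 + s \<Longrightarrow> \<rho> s = 1 / (1 + s)" "\<And>s. \<delta> \<le> 1 + s \<Longrightarrow> \<rho>' s = - (1 / (1 + s) ^ 2)"
proof -
  \<comment> \<open>A positive C^1 function replacing 1 + s where this is below \<delta>: with w = 1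
    + s, the product \<delta> \<phi> equals (w - \<delta>/2)^2 + 3 \<delta>^2 / 4 there.\<close>
  define \<phi> where "\<phi> s = 1 + s + (max 0 (\<delta> - (1 + s))) ^ 2 / \<delta>" for s :: real
  define \<phi>' where "\<phi>' s = 1 - 2 * max 0 (\<delta> - (1 + s)) / \<delta>" for s :: real
  have d: "(\<phi> has_real_derivative \<phi>' s) (at s)" for s
  proof -
    have "((\<lambda>s. \<delta> - (1 + s)) has_real_derivative - 1) (at s)" by (auto intro!: derivative_eq_intros)
    from DERIV_chain2[OF has_real_derivative_max_0_squared this]
    have m: "((\<lambda>s. (max 0 (\<delta> - (1 + s))) ^ 2) has_real_derivative 2 * max 0 (\<delta> - (1 + s)) * - 1) (at s)" .
    have "((\<lambda>s. 1 + s) has_real_derivative 1) (at s)" by (auto intro!: derivative_eq_intros)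
    from DERIV_add[OF this DERIV_cdivide[OF m, of \<delta>]]
    show ?thesis unfolding \<phi>_def[abs_def] \<phi>'_def by simp
  qed
  have p: "0 < \<phi> s" for s
  proof (cases "\<delta> \<le> 1 + s")
    case True
    then show ?thesis using \<delta> by (simp add: \<phi>_def)
  next
    case False
    define w where "w = 1 + s"
    have "\<phi> s * \<delta> = w * \<delta> + (\<delta> - w) ^ 2" using False \<delta> by (simp add: \<phi>_def w_def field_simps)
    also have "\<dots> = (w - \<delta> / 2) ^ 2 + 3 / 4 * \<delta> ^ 2" by (simp add: power2_eq_square algebra_simps)
    also have "\<dots> > 0" using \<delta> by (intro add_nonneg_pos) auto
    finally show ?thesis using \<delta> by (simp add: zero_less_mult_iff)
  qed
  have c\<phi>: "continuous_on UNIV \<phi>" "continuous_on UNIV \<phi>'"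
    unfolding \<phi>_def[abs_def] \<phi>'_def[abs_def] using \<delta> by (intro continuous_intros; simp)+
  show ?thesis
  proof
    show "((\<lambda>s. 1 / \<phi> s) has_real_derivative - (\<phi>' s / \<phi> s ^ 2)) (at s)" for s
    proof -
      have "\<phi> s \<noteq> 0" using p[of s] by simp
      from DERIV_inverse'[OF d this] show ?thesis
        unfolding inverse_eq_divide by (rule DERIV_cong) (simp add: power2_eq_square)
    qed
    show "continuous_on UNIV (\<lambda>s. - (\<phi>' s / \<phi> s ^ 2))"
      by (intro continuous_intros c\<phi>) (use less_imp_neq[OF p, symmetric] in auto)
  qed (simp_all add: \<phi>_def \<phi>'_def)
qed

lemma locally_approximable_stereographic:
  fixes f :: "real^'n \<Rightarrow> real^('n option)"
  assumes f: "locally_approximable p f Df" and p: "1 \<le> p" and pole: "\<And>x. 0 < 1 + f x $ None"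
  shows "locally_approximable p (\<lambda>x. stereographic (f x)) (\<lambda>x. stereographic_deriv (f x) ** Df x)"
proof (rule locally_approximable_local)
  have cf: "continuous_on UNIV f" and mDf: "Df \<in> borel_measurable borel"
    using f by (auto simp: locally_approximable_def)
  have cfk: "continuous_on S (\<lambda>x. f x $ a)" for a S by (intro continuous_intros continuous_on_subset[OF cf]) auto
  have nz: "1 + f x $ None \<noteq> 0" for x using pole[of x] by simp
  show "continuous_on UNIV (\<lambda>x. stereographic (f x))"
    unfolding stereographic_def by (intro continuous_on_vec_lambda continuous_intros cfk) (simp add: nz)
  show "(\<lambda>x. stereographic_deriv (f x) ** Df x) \<in> borel_measurable borel"
  proof (rule borel_measurable_matrixI)
    fix k j
    have entry: "(stereographic_deriv (f x) ** Df x) $ k $ j = Df x $ Some k $ j / (1 + f x $ None) - f x $ Some k * Df x $ None $ j / (1 + f x $ None) ^ 2" for x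
      using stereographic_deriv_mult_component[of "f x" "\<chi> a. Df x $ a $ j" k]
      by (simp add: matrix_matrix_mult_def matrix_vector_mult_def)
    have [measurable]: "(\<lambda>x. Df x $ a $ j) \<in> borel_measurable borel" for a
      by (rule borel_measurable_continuous_on[OF _ mDf]) (intro continuous_intros)
    have [measurable]: "(\<lambda>x. f x $ a) \<in> borel_measurable borel" for a
      by (rule borel_measurable_continuous_onI[OF cfk])
    show "(\<lambda>x. (stereographic_deriv (f x) ** Df x) $ k $ j) \<in> borel_measurable borel" unfolding entry by measurable
  qed
  fix R :: real
  \<comment> \<open>By compactness the image of the ball stays at a positive distance from the pole;
    for negative R the ball is empty.\<close>
  obtain \<delta> where \<delta>: "0 < \<delta>" "\<And>x. x \<in> cball 0 R \<Longrightarrow> \<delta> \<le> 1 + f x $ None"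
  proof (cases "0 \<le> R")
    case True
    then have "\<exists>x\<in>cball 0 R. \<forall>y\<in>cball 0 R. 1 + f x $ None \<le> 1 + f y $ None"
      by (intro continuous_attains_inf continuous_intros cfk) auto
    then show ?thesis using that pole by blast
  next
    case False
    then show ?thesis using that[of 1] by auto
  qed
  obtain \<rho> \<rho>' where \<rho>: "\<And>s. (\<rho> has_real_derivative \<rho>' s) (at s)" "continuous_on UNIV \<rho>'"
    "\<And>s. \<delta> \<le> 1 + s \<Longrightarrow> \<rho> s = 1 / (1 + s)" "\<And>s. \<delta> \<le> 1 + s \<Longrightarrow> \<rho>' s = - (1 / (1 + s) ^ 2)"
    by (rule C1_reciprocal_extension[OF \<delta>(1)]) (rule that)
  define h where "h y = (\<chi> k. y $ Some k * \<rho> (y $ None))" for y :: "real^('n option)"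
  define Dh :: "real^('n option) \<Rightarrow> real^('n option)^'n" where "Dh y = (\<chi> k a. case a of None \<Rightarrow> y $ Some k * \<rho>' (y $ None)
     | Some l \<Rightarrow> if l = k then \<rho> (y $ None) else 0)" for y
  have dh: "(h has_derivative (\<lambda>v. Dh y *v v)) (at y)" for y
  proof (rule has_derivative_vec_componentwise)
    fix k
    have nth: "((\<lambda>y::real^('n option). y $ a) has_derivative (\<lambda>v. v $ a)) (at y)" for a
      by (rule bounded_linear_imp_has_derivative[OF bounded_linear_vec_nth])
    have "(\<rho> has_derivative (\<lambda>h. \<rho>' s * h)) (at s)" for s using \<rho>(1) by (simp add: has_field_derivative_def)
    from has_derivative_mult[OF nth[of "Some k"] has_derivative_compose[OF nth[of None] this]]
    have "((\<lambda>y. y $ Some k * \<rho> (y $ None)) has_derivative (\<lambda>v. y $ Some k * (\<rho>' (y $ None) * v $ None) + v $ Some k * \<rho> (y $ None))) (at y)" .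
    moreover have "(Dh y *v v) $ k = y $ Some k * (\<rho>' (y $ None) * v $ None) + v $ Some k * \<rho> (y $ None)" for v
    proof -
      have "(\<Sum>l\<in>UNIV. (if l = k then \<rho> (y $ None) else 0) * v $ Some l) = \<rho> (y $ None) * v $ Some k"
        by (simp add: if_distrib[of "\<lambda>x. x * _"] cong: if_cong)
      then show ?thesis by (simp add: Dh_def matrix_vector_mult_def sum_UNIV_option mult.assoc)
    qed
    ultimately show "((\<lambda>x. h x $ k) has_derivative (\<lambda>v. (Dh y *v v) $ k)) (at y)" by (simp add: h_def)
  qed
  have c\<rho>: "continuous_on UNIV \<rho>" using \<rho>(1) by (auto intro!: continuous_at_imp_continuous_on DERIV_isCont)
  have cDh: "continuous_on UNIV Dh"
  proof -
    have "continuous_on UNIV (\<lambda>y. case a of None \<Rightarrow> y $ Some k * \<rho>' (y $ None) | Some l \<Rightarrow> if l = k then \<rho> (y $ None) else 0)"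
      for k :: 'n and a :: "'n option"
      by (cases a; cases "a = Some k") (auto intro!: continuous_intros continuous_on_compose2[OF c\<rho>] continuous_on_compose2[OF \<rho>(2)])
    then show ?thesis unfolding Dh_def[abs_def] by (intro continuous_on_vec_lambda)
  qed
  have "h (f x) = stereographic (f x) \<and> Dh (f x) ** Df x = stereographic_deriv (f x) ** Df x" if "x \<in> cball 0 R" for x
  proof
    show "h (f x) = stereographic (f x)" using \<rho>(3)[OF \<delta>(2)[OF that]] by (simp add: h_def stereographic_def vec_eq_iff)
    have "Dh (f x) = stereographic_deriv (f x)"
      using \<rho>(3,4)[OF \<delta>(2)[OF that]] by (simp add: Dh_def stereographic_deriv_def vec_eq_iff split: option.split)
    then show "Dh (f x) ** Df x = stereographic_deriv (f x) ** Df x" by simp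
  qed
  then show "\<exists>g' Dg'. locally_approximable p g' Dg' \<and> (\<forall>x\<in>cball 0 R. g' x = stereographic (f x) \<and> Dg' x = stereographic_deriv (f x) ** Df x)"
    using locally_approximable_compose_C1[OF f p dh cDh] by blast
qed

lemma borel_measurable_sphere_det:
  fixes f :: "real^'n \<Rightarrow> real^('n option)"
  assumes f: "continuous_on UNIV f" and Df: "Df \<in> borel_measurable borel"
  shows "(\<lambda>x. sphere_det (f x) (Df x)) \<in> borel_measurable borel"
proof -
  have 1: "(\<lambda>x. Df x $ a $ j) \<in> borel_measurable borel" for a j
    by (rule borel_measurable_continuous_on[OF _ Df]) (intro continuous_intros)
  have 2: "(\<lambda>x. f x $ a) \<in> borel_measurable borel" for a
    by (rule borel_measurable_continuous_onI) (intro continuous_intros f)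
  have "(\<lambda>x. (\<chi> a. case a of None \<Rightarrow> f x | Some j \<Rightarrow> Df x *v axis j 1) $ a $ b) \<in> borel_measurable borel" for a b :: "'n option"
    using 1 2 by (cases a) (simp_all add: matrix_vector_mult_basis column_def)
  then show ?thesis
    unfolding sphere_det_def sphere_volume_form_def det_def
    by (intro borel_measurable_sum borel_measurable_times borel_measurable_prod) auto
qed

text \<open>A rotation of determinant 1 moves the omitted point to the pole and changes neither
  operator norms nor \<open>sphere_det\<close>. The maximum with 0 alters the Jacobian on a null set
  only and makes it nonnegative everywhere. The last claim turns the size of g into the distance to
  the omitted point.\<close>

lemma stereographic_chart_bounded_distortion:
  fixes f :: "real^'n \<Rightarrow> real^('n option)"
  assumes n: "2 \<le> CARD('n)" and K: "0 < K"
    and f: "locally_approximable CARD('n) f Df" and sph: "\<And>x. norm (f x) = 1"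
    and qr: "AE x in lborel. onorm ((*v) (Df x)) ^ CARD('n) \<le> K * sphere_det (f x) (Df x)"
    and a: "norm a = 1" "\<And>x. f x \<noteq> a"
  shows "\<exists>g Dg. bounded_distortion (real ((CARD('n) ^ 2) ^ CARD('n)) * K) g Dg (\<lambda>x. max 0 (sphere_det (f x) (Df x)))
      (growth_constant CARD('n) (real ((CARD('n) ^ 2) ^ CARD('n)) * K))
    \<and> (\<forall>x. (1 + norm (g x) ^ 2) * norm (f x - a) ^ 2 = 4)"
proof -
  let ?N = "CARD('n)"
  have p: "1 \<le> ?N" using n by simp
  have N': "2 \<le> CARD('n option)" using n by (simp add: card_option)
  obtain \<Theta> where \<Theta>: "orthogonal_transformation \<Theta>" "det (matrix \<Theta>) = 1" "\<Theta> a = - axis None 1"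
    using rotation_exists_1[OF N' a(1), of "- axis None 1"] by auto
  define Q where "Q = matrix \<Theta>"
  have Q: "Q *v v = \<Theta> v" for v
    unfolding Q_def using \<Theta>(1) by (simp add: matrix_works orthogonal_transformation_linear)
  have nQ: "norm (Q *v v) = norm v" for v using \<Theta>(1) by (simp add: Q orthogonal_transformation_norm)
  define F where "F x = Q *v f x" for x
  define DF where "DF x = Q ** Df x" for x
  have F: "locally_approximable ?N F DF"
    unfolding F_def[abs_def] DF_def[abs_def]
    by (rule locally_approximable_compose_C1[OF f p]) (auto intro!: bounded_linear_imp_has_derivative)
  have sphF: "norm (F x) = 1" for x by (simp add: F_def nQ sph)
  have None: "F x $ None = - (f x \<bullet> a)" for x
  proof -
    have "f x \<bullet> a = \<Theta> (f x) \<bullet> \<Theta> a" using \<Theta>(1) by (simp add: orthogonal_transformation_def)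
    then show ?thesis by (simp add: \<Theta>(3) F_def Q inner_axis)
  qed
  have dist: "norm (f x - a) ^ 2 = 2 * (1 + F x $ None)" for x
  proof -
    have "f x \<bullet> f x = 1" "a \<bullet> a = 1" using sph[of x] a(1) by (simp_all add: dot_square_norm)
    then show ?thesis by (simp add: None power2_norm_eq_inner inner_diff_left inner_diff_right inner_commute)
  qed
  have pole: "0 < 1 + F x $ None" for x
  proof -
    have "0 < norm (f x - a) ^ 2" using a(2)[of x] by simp
    then show ?thesis unfolding dist by simp
  qed
  have pt: "sphere_point (F x)" for x
    using pole[of x] by unfold_locales (auto simp: sphF)
  have tang: "AE x in lborel. \<forall>v. F x \<bullet> (DF x *v v) = 0" by (rule sphere_valued_tangential[OF F p sphF])
  define g where "g x = stereographic (F x)" for x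
  define Dg where "Dg x = stereographic_deriv (F x) ** DF x" for x
  have g: "locally_approximable ?N g Dg"
    unfolding g_def[abs_def] Dg_def[abs_def] by (rule locally_approximable_stereographic[OF F p pole])
  have sd: "sphere_det (F x) (DF x) = sphere_det (f x) (Df x)" for x
    unfolding F_def DF_def by (rule sphere_det_orthogonal) (simp add: Q_def \<Theta>)
  have on: "onorm ((*v) (DF x)) = onorm ((*v) (Df x))" for x
    unfolding onorm_def DF_def matrix_vector_mul_assoc[symmetric] nQ ..
  have gn: "1 + norm (g x) ^ 2 = 2 / (1 + F x $ None)" for x
    unfolding g_def by (rule sphere_point.norm_stereographic[OF pt])
  have "bounded_distortion (real ((?N ^ 2) ^ ?N) * K) g Dg (\<lambda>x. max 0 (sphere_det (f x) (Df x)))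
      (growth_constant ?N (real ((?N ^ 2) ^ ?N) * K))"
  proof
    show "0 < real ((?N ^ 2) ^ ?N) * K" using K by simp
    show "2 \<le> ?N" by (rule n)
    show "locally_approximable ?N g Dg" by (rule g)
    show "AE x in lborel. norm (Dg x) ^ ?N \<le> real ((?N ^ 2) ^ ?N) * K * det (Dg x)"
      using tang qr
    proof eventually_elim
      case (elim x)
      have "onorm ((*v) (DF x)) ^ ?N \<le> K * sphere_det (F x) (DF x)" using elim by (simp add: on sd)
      from sphere_point.distortion_stereographic[OF pt _ this] show ?case using elim by (simp add: Dg_def)
    qed
    have "continuous_on UNIV f" "Df \<in> borel_measurable borel" using f by (auto simp: locally_approximable_def)
    from borel_measurable_sphere_det[OF this]
    show "(\<lambda>x. max 0 (sphere_det (f x) (Df x))) \<in> borel_measurable borel" by simp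
    show "0 \<le> max 0 (sphere_det (f x) (Df x))" for x by simp
    show "AE x in lborel. max 0 (sphere_det (f x) (Df x)) * (1 + norm (g x) ^ 2) ^ ?N = 2 ^ ?N * det (Dg x)"
      using tang qr
    proof eventually_elim
      case (elim x)
      have "0 \<le> onorm ((*v) (Df x)) ^ ?N" by (intro zero_le_power onorm_pos_le matrix_vector_mul_bounded_linear)
      then have "0 \<le> sphere_det (f x) (Df x)" using elim K by (meson order_trans zero_le_mult_iff less_le_not_le)
      moreover have "sphere_det (f x) (Df x) = (1 + F x $ None) ^ ?N * det (Dg x)"
        unfolding sd[symmetric] Dg_def by (rule sphere_point.sphere_det_stereographic[OF pt]) (use elim in auto)
      ultimately have "max 0 (sphere_det (f x) (Df x)) = (1 + F x $ None) ^ ?N * det (Dg x)" by simp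
      then show ?case using pole[of x] by (simp add: gn power_divide)
    qed
  qed simp
  moreover have "(1 + norm (g x) ^ 2) * norm (f x - a) ^ 2 = 4" for x
  proof -
    have "2 / q * (2 * q) = 4" if "0 < q" for q :: real using that by simp
    from this[OF pole[of x]] show ?thesis unfolding gn dist .
  qed
  ultimately show ?thesis by blast
qed

section \<open>Omitted points\<close>

lemma finite_separated:
  fixes I :: "'a::metric_space set"
  assumes "finite I"
  obtains \<epsilon> where "0 < \<epsilon>" "\<And>a b. a \<in> I \<Longrightarrow> b \<in> I \<Longrightarrow> a \<noteq> b \<Longrightarrow> 2 * \<epsilon> \<le> dist a b"
proof
  define D where "D = insert 1 ((\<lambda>(a, b). dist a b) ` {(a, b). a \<in> I \<and> b \<in> I \<and> a \<noteq> b})"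
  have "finite {(a, b). a \<in> I \<and> b \<in> I \<and> a \<noteq> b}"
    by (rule finite_subset[of _ "I \<times> I"]) (use assms in auto)
  then have D: "finite D" "D \<noteq> {}" by (auto simp: D_def)
  have "0 < Min D" using D by (subst Min_gr_iff) (auto simp: D_def)
  then show "0 < Min D / 2" by simp
  show "2 * (Min D / 2) \<le> dist a b" if "a \<in> I" "b \<in> I" "a \<noteq> b" for a b
  proof -
    have "dist a b \<in> D" using that by (force simp: D_def)
    then show ?thesis using Min_le[OF D(1)] by simp
  qed
qed

theorem theorem1p1:
  fixes K :: real
  assumes "CARD('n::finite) \<ge> 2" and "K \<ge> 1"
  shows "\<exists>q\<^sub>0::nat. \<forall>f :: real^'n \<Rightarrow> real^('n option).
           quasiregular_to_sphere K f \<longrightarrow>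
             finite (sphere 0 1 - range f) \<and> card (sphere 0 1 - range f) \<le> q\<^sub>0"
proof -
  let ?N = "CARD('n)"
  define c where "c = real ((?N ^ 2) ^ ?N) * K"
  define C where "C = growth_constant ?N c"
  obtain q\<^sub>0 :: nat where q\<^sub>0: "\<And>(J :: real^'n \<Rightarrow> real) (u :: real^('n option) \<Rightarrow> real^'n \<Rightarrow> real) Y I b.
    finite I \<Longrightarrow> q\<^sub>0 \<le> card I \<Longrightarrow> (\<And>i. i \<in> I \<Longrightarrow> growth_data C J (u i) (Y i)) \<Longrightarrow>
    disjoint_family_on (\<lambda>i. {x. b < u i x}) I \<Longrightarrow> (AE x in lborel. J x = 0)"
    using growth_family_bound[where 'a="real^'n" and 'i="real^('n option)" and C=C] by metis
  show ?thesis
  proof (intro exI[of _ q\<^sub>0] allI impI, rule ccontr)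
    fix f :: "real^'n \<Rightarrow> real^('n option)"
    let ?S = "sphere 0 1 - range f"
    assume f: "quasiregular_to_sphere K f" and many: "\<not> (finite ?S \<and> card ?S \<le> q\<^sub>0)"
    obtain Df where Df: "has_W1p_loc_differential ?N f Df"
      "AE x in lebesgue. onorm ((*v) (Df x)) ^ ?N \<le> K * sphere_det (f x) (Df x)"
      and cf: "continuous_on UNIV f" and sph: "\<And>x. norm (f x) = 1" and nc: "\<not> f constant_on UNIV"
      using f unfolding quasiregular_to_sphere_def by (auto simp: image_subset_iff)
    have p: "1 \<le> ?N" using assms(1) by simp
    obtain D where D: "locally_approximable ?N f D" "AE x in lborel. Df x = D x"
      by (rule sobolev_borel_representative[OF cf Df(1) p])
    have qr: "AE x in lborel. onorm ((*v) (D x)) ^ ?N \<le> K * sphere_det (f x) (D x)"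
      using Df(2) D(2) unfolding AE_completion_iff by eventually_elim simp
    \<comment> \<open>A finite subfamily of omitted points is kept, since the set of all of them may
      be infinite.\<close>
    obtain I where I: "I \<subseteq> ?S" "finite I" "card I = q\<^sub>0"
    proof (cases "finite ?S")
      case True
      then have "q\<^sub>0 \<le> card ?S" using many by simp
      then show ?thesis using obtain_subset_with_card_n[of q\<^sub>0 ?S] that by metis
    next
      case False
      then show ?thesis using infinite_arbitrarily_large[of ?S q\<^sub>0] that by metis
    qed
    define J where "J x = max 0 (sphere_det (f x) (D x))" for x
    have "\<forall>a\<in>I. \<exists>g Dg. bounded_distortion c g Dg J C \<and> (\<forall>x. (1 + norm (g x) ^ 2) * norm (f x - a) ^ 2 = 4)"
    proof
      fix a assume "a \<in> I"
      then have "norm a = 1" "\<And>x. f x \<noteq> a" using I(1) by auto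
      then show "\<exists>g Dg. bounded_distortion c g Dg J C \<and> (\<forall>x. (1 + norm (g x) ^ 2) * norm (f x - a) ^ 2 = 4)"
        unfolding c_def C_def J_def[abs_def] using assms
        by (intro stereographic_chart_bounded_distortion D(1) sph qr) auto
    qed
    then obtain g Dg where g: "\<And>a. a \<in> I \<Longrightarrow> bounded_distortion c (g a) (Dg a) J C"
      "\<And>a x. a \<in> I \<Longrightarrow> (1 + norm (g a x) ^ 2) * norm (f x - a) ^ 2 = 4"
      by metis
    obtain \<epsilon> where \<epsilon>: "0 < \<epsilon>" "\<And>a b. a \<in> I \<Longrightarrow> b \<in> I \<Longrightarrow> a \<noteq> b \<Longrightarrow> 2 * \<epsilon> \<le> dist a b"
      using finite_separated[OF I(2)] by metis
    \<comment> \<open>By (1 + |g|^2) |f - a|^2 = 4, the inequality |g| > 2 / \<epsilon> places f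
      within \<epsilon> of a, and the balls of radius \<epsilon> about the chosen points are
      disjoint.\<close>
    define M where "M = 2 / \<epsilon>"
    have M: "0 < M" using \<epsilon> by (simp add: M_def)
    have near: "norm (f x - a) < \<epsilon>" if a: "a \<in> I" and x: "ln (1 + M ^ ?N) < bounded_distortion.u (g a) x" for a x
    proof -
      have "ln (1 + M ^ ?N) < ln (1 + norm (g a x) ^ ?N)"
        using x unfolding bounded_distortion.u_def[OF g(1)[OF a]] bounded_distortion.\<tau>_def[OF g(1)[OF a]] .
      then have "M ^ ?N < norm (g a x) ^ ?N" using M by (subst (asm) ln_less_cancel_iff) (auto intro: add_pos_nonneg)
      then have "M < norm (g a x)" by (rule power_less_imp_less_base) simp
      then have "M ^ 2 < 1 + norm (g a x) ^ 2" using M power_strict_mono[of M "norm (g a x)" 2] by simp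
      moreover have "0 < norm (f x - a)" using g(2)[OF a, of x] by fastforce
      ultimately have "M ^ 2 * norm (f x - a) ^ 2 < (1 + norm (g a x) ^ 2) * norm (f x - a) ^ 2"
        by (intro mult_strict_right_mono) auto
      then have "(norm (f x - a)) ^ 2 < \<epsilon> ^ 2" unfolding g(2)[OF a] using \<epsilon>(1) by (simp add: M_def power_divide field_simps)
      then show ?thesis using \<epsilon>(1) by (simp add: power2_less_imp_less)
    qed
    have "disjoint_family_on (\<lambda>a. {x. ln (1 + M ^ ?N) < bounded_distortion.u (g a) x}) I"
      unfolding disjoint_family_on_def
    proof (intro ballI impI equals0I)
      fix a b x assume ab: "a \<in> I" "b \<in> I" "a \<noteq> b"
        and x: "x \<in> {x. ln (1 + M ^ ?N) < bounded_distortion.u (g a) x} \<inter> {x. ln (1 + M ^ ?N) < bounded_distortion.u (g b) x}"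
      have "dist a b \<le> norm (f x - a) + norm (f x - b)"
        using dist_triangle3[of a b "f x"] by (simp add: dist_norm)
      also have "\<dots> < 2 * \<epsilon>" using near[OF ab(1), of x] near[OF ab(2), of x] x by simp
      finally show False using \<epsilon>(2)[OF ab] by simp
    qed
    then have "AE x in lborel. J x = 0"
      using I by (intro q\<^sub>0[where I=I and u="\<lambda>a. bounded_distortion.u (g a)" and Y="\<lambda>a. bounded_distortion.Y (g a) (Dg a)"]
          bounded_distortion.growth_data[OF g(1)]) auto
    \<comment> \<open>The distortion inequality forces the differential to vanish together with the
      Jacobian.\<close>
    then have "AE x in lborel. D x = 0"
      using qr
    proof eventually_elim
      case (elim x)
      have "0 \<le> onorm ((*v) (D x))" by (intro onorm_pos_le matrix_vector_mul_bounded_linear)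
      moreover have "onorm ((*v) (D x)) ^ ?N \<le> 0"
        using elim assms(2) mult_nonneg_nonpos[of K "sphere_det (f x) (D x)"] by (simp add: J_def max_def split: if_splits)
      ultimately have "onorm ((*v) (D x)) = 0" by (metis power_eq_0_iff zero_le_power order_antisym)
      then have "D x *v v = 0" for v
        using onorm_eq_0[OF matrix_vector_mul_bounded_linear[of "D x"]] by simp
      then show ?case by (simp add: matrix_eq)
    qed
    then have "f constant_on UNIV" by (rule zero_differential_imp_constant[OF D(1) p])
    with nc show False ..
  qed
qed

end
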